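(* Let $p,s,\alpha$ be in the admissible range with $\alpha>0$, and let $(\varphi_t)_{t\ge0}$ be a non-trivial semigroup of holomorphic self-maps of $\mathbb D$ with infinitesimal generator $G$. The following are equivalent: (i) $[\varphi_t,M_\alpha(D^p_s)]=m_\alpha(D^p_s)$; (ii) $G$ satisfies the vanishing Bloch condition $$\lim_{|z|\to1^-}\frac{1-|z|^2}{|G(z)|}=0.$$
   Context: $\mathbb D$ is the open unit disk of $\mathbb C$, $\mathcal H(\mathbb D)$ the space of analytic functions on $\mathbb D$, $dA$ Lebesgue area measure. For $1<p<\infty$ and $-1<s<\infty$, $D^p_s$ is the Banach space of $f\in\mathcal H(\mathbb D)$ with $\|f\|_{D^p_s}=|f(0)|+\left(\int_{\mathbb D}|f'(z)|^p(1-|z|^2)^s\,dA(z)\right)^{1/p}<\infty$. For $a\in\mathbb D$ put $\sigma_a(z)=\frac{a-z}{1-\overline a z}$. For $1<p<\infty$, $p-2\le s<\infty$, $0\le\alpha<\infty$, $M_\alpha(D^p_s)$ is the space of $f\in D^p_s$ with $\rho_{\alpha,p,s}(f)=\sup_{a\in\mathbb D}(1-|a|^2)^\alpha\|f\circ\sigma_a-f(a)\|_{D^p_s}<\infty$, normed by $|f(0)|+\rho_{\alpha,p,s}(f)$, and $m_\alpha(D^p_s)$ is the subspace of those $f$ with $\lim_{|a|\to1^-}(1-|a|^2)^\alpha\|f\circ\sigma_a-f(a)\|_{D^p_s}=0$. The parameters $p,s,\alpha$ are in the admissible range if $1<p<\infty$, $0\le\alpha<\frac{s-(p-2)}{p}$,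 and either ($p\ge2$ and $s>p-2$) or ($1<p<2$ and $s\ge0$). A semigroup of holomorphic self-maps of $\mathbb D$ is a family $(\varphi_t)_{t\ge0}$ of analytic maps $\varphi_t:\mathbb D\to\mathbb D$ with $\varphi_0(z)=z$, $\varphi_t\circ\varphi_s=\varphi_{t+s}$ for $t,s\ge0$, and $\varphi_t(z)\to z$ uniformly on compact subsets of $\mathbb D$ as $t\to0^+$; it is non-trivial if not every $\varphi_t$ is the identity. Its infinitesimal generator is $G(z)=\lim_{t\to0^+}\frac{\varphi_t(z)-z}{t}$, $z\in\mathbb D$ (the limit exists uniformly on compact subsets, and $G$ is holomorphic). For a Banach space $X\subset\mathcal H(\mathbb D)$ (continuously embedded), $[\varphi_t,X]=\{f\in X:\lim_{t\to0^+}\|f\circ\varphi_t-f\|_X=0\}$. *)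

theory Defs
  imports "HOL-Complex_Analysis.Complex_Analysis"
begin

text \<open>Elements of $\mathcal{H}(\mathbb{D})$ are represented by functions
  \<^typ>\<open>complex \<Rightarrow> complex\<close> that are holomorphic on the disk; their values off the disk are
  irrelevant, and every definition below depends only on the values on the disk. In particular
  the sets of functions below are closed under changing values off the disk, so an equality
  between them is the equality of the corresponding subspaces of $\mathcal{H}(\mathbb{D})$.

  The norms take values in \<^typ>\<open>ennreal\<close> and are \<open>\<infinity>\<close> for a holomorphic function outside the
  space, so that a supremum being finite, or a limit being 0, has its usual meaning.\<close>

abbreviation unit_disk :: "complex set" where
  "unit_disk \<equiv> ball 0 1"

definition ennreal_powr :: "ennreal \<Rightarrow> real \<Rightarrow> ennreal" where
  "ennreal_powr x r = (if x = \<infinity> then \<infinity> else ennreal (enn2real x powr r))"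
  \<comment> \<open>only used with \<open>r > 0\<close>\<close>

definition disk_aut :: "complex \<Rightarrow> complex \<Rightarrow> complex" where
  "disk_aut a z = (a - z) / (1 - cnj a * z)"

definition D_norm :: "real \<Rightarrow> real \<Rightarrow> (complex \<Rightarrow> complex) \<Rightarrow> ennreal" where
  "D_norm p s f =
     ennreal (cmod (f 0)) +
     ennreal_powr
       (\<integral>\<^sup>+z\<in>unit_disk. ennreal (cmod (deriv f z) powr p * (1 - (cmod z)\<^sup>2) powr s) \<partial>lborel)
       (1 / p)"

definition D_space :: "real \<Rightarrow> real \<Rightarrow> (complex \<Rightarrow> complex) set" where
  "D_space p s = {f. f holomorphic_on unit_disk \<and> D_norm p s f < \<infinity>}"

definition M_weight :: "real \<Rightarrow> real \<Rightarrow> real \<Rightarrow> (complex \<Rightarrow> complex) \<Rightarrow> complex \<Rightarrow> ennreal" where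
  "M_weight \<alpha> p s f a =
     ennreal ((1 - (cmod a)\<^sup>2) powr \<alpha>) * D_norm p s (\<lambda>z. f (disk_aut a z) - f a)"

definition M_rho :: "real \<Rightarrow> real \<Rightarrow> real \<Rightarrow> (complex \<Rightarrow> complex) \<Rightarrow> ennreal" where
  "M_rho \<alpha> p s f = (SUP a\<in>unit_disk. M_weight \<alpha> p s f a)"

definition M_space :: "real \<Rightarrow> real \<Rightarrow> real \<Rightarrow> (complex \<Rightarrow> complex) set" where
  "M_space \<alpha> p s = {f \<in> D_space p s. M_rho \<alpha> p s f < \<infinity>}"

text \<open>For \<open>a = 0\<close> the quantity \<^const>\<open>M_weight\<close> is the \<open>D\<close>-norm of \<open>z \<mapsto> f (- z) - f 0\<close>; hence a
  holomorphic function with finite \<open>M_norm\<close> automatically lies in \<^const>\<open>D_space\<close>.\<close>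

definition M_norm :: "real \<Rightarrow> real \<Rightarrow> real \<Rightarrow> (complex \<Rightarrow> complex) \<Rightarrow> ennreal" where
  "M_norm \<alpha> p s f = ennreal (cmod (f 0)) + M_rho \<alpha> p s f"

definition to_unit_circle :: "complex filter" where
  "to_unit_circle = filtercomap cmod (at_left 1)"
  \<comment> \<open>the limit process \<open>|z| \<rightarrow> 1-\<close>\<close>

definition little_m_space :: "real \<Rightarrow> real \<Rightarrow> real \<Rightarrow> (complex \<Rightarrow> complex) set" where
  "little_m_space \<alpha> p s = {f \<in> M_space \<alpha> p s. (M_weight \<alpha> p s f \<longlongrightarrow> 0) to_unit_circle}"

definition admissible :: "real \<Rightarrow> real \<Rightarrow> real \<Rightarrow> bool" where
  "admissible p s \<alpha> \<longleftrightarrow>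
     1 < p \<and> 0 \<le> \<alpha> \<and> \<alpha> < (s - (p - 2)) / p \<and>
     (p \<ge> 2 \<and> s > p - 2 \<or> p < 2 \<and> s \<ge> 0)"

definition holo_semigroup :: "(real \<Rightarrow> complex \<Rightarrow> complex) \<Rightarrow> bool" where
  "holo_semigroup \<phi> \<longleftrightarrow>
     (\<forall>t\<ge>0. \<phi> t holomorphic_on unit_disk \<and> \<phi> t ` unit_disk \<subseteq> unit_disk) \<and>
     (\<forall>z\<in>unit_disk. \<phi> 0 z = z) \<and>
     (\<forall>t\<ge>0. \<forall>u\<ge>0. \<forall>z\<in>unit_disk. \<phi> (t + u) z = \<phi> t (\<phi> u z)) \<and>
     (\<forall>K. compact K \<and> K \<subseteq> unit_disk \<longrightarrow> uniform_limit K \<phi> (\<lambda>z. z) (at_right 0))"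

definition nontrivial_semigroup :: "(real \<Rightarrow> complex \<Rightarrow> complex) \<Rightarrow> bool" where
  "nontrivial_semigroup \<phi> \<longleftrightarrow> \<not> (\<forall>t\<ge>0. \<forall>z\<in>unit_disk. \<phi> t z = z)"

definition is_generator :: "(real \<Rightarrow> complex \<Rightarrow> complex) \<Rightarrow> (complex \<Rightarrow> complex) \<Rightarrow> bool" where
  "is_generator \<phi> G \<longleftrightarrow>
     (\<forall>z\<in>unit_disk. ((\<lambda>t. (\<phi> t z - z) / complex_of_real t) \<longlongrightarrow> G z) (at_right 0))"

text \<open>\<open>[\<phi>\<^sub>t, X]\<close> for a space \<open>X\<close> with norm \<open>N\<close>\<close>

definition strong_cont_part ::
    "(real \<Rightarrow> complex \<Rightarrow> complex) \<Rightarrow> (complex \<Rightarrow> complex) set \<Rightarrow>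
     ((complex \<Rightarrow> complex) \<Rightarrow> ennreal) \<Rightarrow> (complex \<Rightarrow> complex) set" where
  "strong_cont_part \<phi> X N =
     {f \<in> X. ((\<lambda>t. N (\<lambda>z. f (\<phi> t z) - f z)) \<longlongrightarrow> 0) (at_right 0)}"

text \<open>The quotient is formed in \<^typ>\<open>ennreal\<close>, where it is \<open>\<infinity>\<close> (and not 0, as in \<^typ>\<open>real\<close>)
  at the zeros of \<open>G\<close> in the disk.\<close>

definition vanishing_Bloch_condition :: "(complex \<Rightarrow> complex) \<Rightarrow> bool" where
  "vanishing_Bloch_condition G \<longleftrightarrow>
     ((\<lambda>z. ennreal (1 - (cmod z)\<^sup>2) / ennreal (cmod (G z))) \<longlongrightarrow> 0) to_unit_circle"

end

theory Submission
  imports Defs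
begin

text \<open>Write \<open>W f a\<close> for the \<open>p\<close>-th power of the weighted norm at \<open>a\<close>. Littlewood subordination together with the area
  formula gives \<open>W (f \<circ> \<phi>) a \<le> ((1 - |a|\<^sup>2) / (1 - |\<phi> a|\<^sup>2)) powr (\<alpha> p) * W f (\<phi> a)\<close> for injective self-maps; this makes the composition
  semigroup bounded, and strongly continuous on the little space.

  For the converse inclusion one uses the averages \<open>A\<^sub>T f = (1/T) \<integral>\<^sub>0\<^sup>T f \<circ> \<phi>\<^sub>u du\<close>, which satisfy
  \<open>G \<cdot> (A\<^sub>T f)' = (f \<circ> \<phi>\<^sub>T - f) / T\<close>. A function in the continuity part is the limit of its averages. By Berkson--Porta
  \<open>1 / G\<close> is, up to an explicit factor, a function with nonnegative real part, whose powers below one are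
  integrable on circles (Kolmogorov); with the vanishing Bloch condition this puts every \<open>A\<^sub>T f\<close> in the little space.

  If the Bloch condition fails along points tending to the circle, a gliding hump of peak functions at
  such points gives \<open>f\<close> in the big space with \<open>|f'(z)| (1 - |z|\<^sup>2) powr (1 + \<alpha>)\<close> bounded below along them. There \<open>G\<close> is
  so small, also on hyperbolic discs by Harnack, that \<open>\<phi>\<^sub>u\<close> hardly moves, so that for small \<open>T\<close>
  the average \<open>A\<^sub>T f\<close> still peaks there: it lies in the continuity part but not in the little space.\<close>

subsection \<open>Automorphisms and self-maps of the disk\<close>

text \<open>The obstacle is the decay of the averages at the circle. Put \<kappa> = s - p + 2 -
  \<alpha> * p, which admissibility makes positive. Up to harmless terms, the energy of an average
  at a is bounded by the integral of (1 - |z|^2)^(\<kappa> - 2) * L(sigma_a z)^p, where L is a form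
  of the Bloch quotient compatible with automorphisms. L is bounded, and sigma_a pushes compact sets
  towards the circle as |a| tends to 1. For \<kappa> \<le> 1, however, the weight alone is not
  integrable, so dominated convergence fails. The missing factor is a gain of (1 - |z|^2)^\<delta>,
  with \<delta> close to 1, from circle means of L^\<delta>. These must be bounded uniformly in a
  although the pole b of L moves to sigma_a b; hence the Kolmogorov estimate for an arbitrary pole
  in the closed disk, with a constant that depends on \<delta> alone. The condition \<alpha> > 0
  enters through growth: members of the space grow at most like (1 - |z|^2)^(-\<alpha>), without a
  logarithm, and functions with bounded derivative lie in the little space. Estimates are made for
  p-th powers in \<open>ennreal\<close>, with a quasi-triangle inequality of constant 2 powr
  p.\<close>

definition dirichlet_energy :: "real \<Rightarrow> real \<Rightarrow> (complex \<Rightarrow> complex) \<Rightarrow> ennreal" where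
  "dirichlet_energy p s g =
     (\<integral>\<^sup>+z\<in>unit_disk. ennreal (cmod (deriv g z) powr p * (1 - (cmod z)\<^sup>2) powr s) \<partial>lborel)"

lemma in_disk_iff: "z \<in> unit_disk \<longleftrightarrow> cmod z < 1"
  by (simp add: dist_norm)

lemma norm_cnj_mult_less_1: "cmod a \<le> 1 \<Longrightarrow> cmod z < 1 \<Longrightarrow> cmod (cnj a * z) < 1"
  by (metis complex_mod_cnj mult_left_le_one_le norm_ge_zero norm_mult order_le_less_trans)

lemma one_minus_cnj_mult_neq_0: "cmod a \<le> 1 \<Longrightarrow> cmod z < 1 \<Longrightarrow> 1 - cnj a * z \<noteq> 0"
  using norm_cnj_mult_less_1[of a z] by auto

lemma norm_one_minus_cnj_mult_ge: "cmod a \<le> 1 \<Longrightarrow> 1 - cmod z \<le> cmod (1 - cnj a * z)"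
  using norm_triangle_ineq2[of 1 "cnj a * z"] mult_left_le_one_le[of "cmod z" "cmod a"]
  by (simp add: norm_mult)

lemma norm_one_minus_cnj_mult_ge': "cmod z \<le> 1 \<Longrightarrow> 1 - cmod a \<le> cmod (1 - cnj a * z)"
  using norm_one_minus_cnj_mult_ge[of z a] complex_mod_cnj[of "1 - cnj a * z"]
  by (simp add: mult.commute del: complex_mod_cnj)

lemma norm_one_minus_cnj_mult_le: "cmod a \<le> 1 \<Longrightarrow> cmod z \<le> 1 \<Longrightarrow> cmod (1 - cnj a * z) \<le> 2"
  using norm_triangle_ineq4[of 1 "cnj a * z"] mult_le_one[of "cmod a" "cmod z"]
  by (simp add: norm_mult)

text \<open>A polynomial identity in real and imaginary parts, hence valid for all complex
  arguments. Points of the closed disk matter: for a Denjoy--Wolff point b on the circle it compares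
  |w - b| with |1 - cnj b * w|.\<close>

lemma norm_sq_diff_identity:
  "(cmod (1 - cnj a * z))\<^sup>2 - (cmod (a - z))\<^sup>2 = (1 - (cmod a)\<^sup>2) * (1 - (cmod z)\<^sup>2)"
proof -
  have "of_real ((cmod (1 - cnj a * z))\<^sup>2 - (cmod (a - z))\<^sup>2) = (of_real ((1 - (cmod a)\<^sup>2) * (1 - (cmod z)\<^sup>2)) :: complex)"
    by (simp only: of_real_diff of_real_mult complex_norm_square of_real_1) (simp add: algebra_simps)
  then show ?thesis by (simp only: of_real_eq_iff)
qed

lemma one_minus_norm_disk_aut:
  assumes "cmod a < 1" "cmod z < 1"
  shows "1 - (cmod (disk_aut a z))\<^sup>2 = (1 - (cmod a)\<^sup>2) * (1 - (cmod z)\<^sup>2) / (cmod (1 - cnj a * z))\<^sup>2"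
  using norm_sq_diff_identity[of a z] one_minus_cnj_mult_neq_0[of a z] assms
  by (simp add: disk_aut_def norm_divide field_simps)

lemma one_minus_norm_sq_pos: "cmod z < 1 \<Longrightarrow> 0 < 1 - (cmod z)\<^sup>2"
  by (simp add: abs_square_less_1)

lemma norm_disk_aut_less_1:
  assumes "cmod a < 1" "cmod z < 1"
  shows "cmod (disk_aut a z) < 1"
proof -
  have "0 < 1 - (cmod (disk_aut a z))\<^sup>2"
    unfolding one_minus_norm_disk_aut[OF assms]
    using assms one_minus_norm_sq_pos one_minus_cnj_mult_neq_0[of a z] by simp
  then show ?thesis by (simp add: abs_square_less_1)
qed

lemma disk_aut_disk_aut:
  assumes "cmod a < 1" "cmod z < 1"
  shows "disk_aut a (disk_aut a z) = z"
proof -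
  have nz: "1 - cnj a * z \<noteq> 0" "1 - cnj a * a \<noteq> 0"
    using one_minus_cnj_mult_neq_0[of a z] one_minus_cnj_mult_neq_0[of a a] assms by auto
  have "a - disk_aut a z = (1 - cnj a * a) * z / (1 - cnj a * z)"
    using nz by (simp add: disk_aut_def field_simps)
  moreover have "1 - cnj a * disk_aut a z = (1 - cnj a * a) / (1 - cnj a * z)"
    using nz by (simp add: disk_aut_def field_simps)
  ultimately show ?thesis
    using nz by (simp add: disk_aut_def[of a "disk_aut a z"])
qed

lemma disk_aut_0 [simp]: "disk_aut a 0 = a" and disk_aut_self [simp]: "disk_aut a a = 0"
  by (simp_all add: disk_aut_def)

lemma disk_aut_0_left [simp]: "disk_aut 0 z = - z"
  by (simp add: disk_aut_def)

lemma has_field_derivative_disk_aut: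
  assumes "cmod a < 1" "cmod z < 1"
  shows "(disk_aut a has_field_derivative - (1 - (cmod a)\<^sup>2) / (1 - cnj a * z)\<^sup>2) (at z)"
proof -
  have nz: "1 - cnj a * z \<noteq> 0"
    using one_minus_cnj_mult_neq_0[of a z] assms by auto
  have e: "of_real ((cmod a)\<^sup>2) = a * cnj a" by (simp only: complex_norm_square)
  show ?thesis
    unfolding disk_aut_def[abs_def]
    by (rule derivative_eq_intros refl nz)+ (use nz e in \<open>simp add: field_simps power2_eq_square\<close>)
qed

lemma holomorphic_disk_aut [holomorphic_intros]:
  assumes "cmod a < 1" shows "disk_aut a holomorphic_on unit_disk"
  by (rule holomorphic_onI)
     (use has_field_derivative_disk_aut[OF assms] in
      \<open>auto simp: in_disk_iff field_differentiable_def intro: has_field_derivative_at_within\<close>)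

lemma disk_aut_image: "cmod a < 1 \<Longrightarrow> disk_aut a ` unit_disk = unit_disk"
proof (intro equalityI subsetI)
  fix z assume a: "cmod a < 1" and "z \<in> unit_disk"
  then have "z = disk_aut a (disk_aut a z)" "disk_aut a z \<in> unit_disk"
    by (auto simp: in_disk_iff disk_aut_disk_aut norm_disk_aut_less_1)
  then show "z \<in> disk_aut a ` unit_disk" by blast
qed (auto simp: in_disk_iff norm_disk_aut_less_1)

lemma inj_on_disk_aut: "cmod a < 1 \<Longrightarrow> inj_on (disk_aut a) unit_disk"
  by (rule inj_on_inverseI[of _ "disk_aut a"]) (simp add: in_disk_iff disk_aut_disk_aut)

lemma norm_deriv_disk_aut:
  assumes "cmod a < 1" "cmod z < 1"
  shows "cmod (deriv (disk_aut a) z) = (1 - (cmod a)\<^sup>2) / (cmod (1 - cnj a * z))\<^sup>2"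
  unfolding DERIV_imp_deriv[OF has_field_derivative_disk_aut[OF assms]]
  using one_minus_norm_sq_pos[OF assms(1)] by (simp only: norm_divide norm_of_real norm_power abs_minus_cancel abs_of_pos)

text \<open>The equality case of Schwarz--Pick. In this form powers of 1 - |z|^2 turn into powers of
  the Jacobian under substitution by an automorphism.\<close>

lemma norm_deriv_disk_aut':
  assumes "cmod a < 1" "cmod z < 1"
  shows "cmod (deriv (disk_aut a) z) = (1 - (cmod (disk_aut a z))\<^sup>2) / (1 - (cmod z)\<^sup>2)"
  using one_minus_norm_sq_pos[OF assms(2)]
  by (simp add: norm_deriv_disk_aut[OF assms] one_minus_norm_disk_aut[OF assms])

section \<open>Holomorphic self-maps and the Schwarz--Pick inequality\<close>

definition disk_self_map :: "(complex \<Rightarrow> complex) \<Rightarrow> bool" where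
  "disk_self_map \<psi> \<longleftrightarrow> \<psi> holomorphic_on unit_disk \<and> \<psi> ` unit_disk \<subseteq> unit_disk"

lemma disk_self_mapD:
  assumes "disk_self_map \<psi>"
  shows "\<psi> holomorphic_on unit_disk" "cmod z < 1 \<Longrightarrow> cmod (\<psi> z) < 1"
  using assms by (auto simp: disk_self_map_def image_subset_iff)

lemma disk_self_map_disk_aut: "cmod a < 1 \<Longrightarrow> disk_self_map (disk_aut a)"
  by (simp add: disk_self_map_def holomorphic_disk_aut disk_aut_image)

lemma disk_self_map_compose:
  "disk_self_map \<psi> \<Longrightarrow> disk_self_map \<phi> \<Longrightarrow> disk_self_map (\<lambda>z. \<psi> (\<phi> z))"
  using holomorphic_on_compose_gen[of \<phi> unit_disk \<psi> unit_disk]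
  unfolding disk_self_map_def comp_def by blast

text \<open>The conjugated map sends 0 to 0, because \<open>disk_aut w 0 = w\<close> and
  \<open>disk_aut (\<psi> w) (\<psi> w) = 0\<close>. This reduces Schwarz--Pick to the Schwarz
  lemma.\<close>

lemma disk_self_map_normalise:
  assumes "disk_self_map \<psi>" "cmod w < 1"
  shows "disk_self_map (\<lambda>z. disk_aut (\<psi> w) (\<psi> (disk_aut w z)))"
  by (rule disk_self_map_compose[OF disk_self_map_disk_aut
        disk_self_map_compose[OF assms(1) disk_self_map_disk_aut]])
     (use assms disk_self_mapD(2)[OF assms] in simp_all)

lemma Schwarz_lemma_disk:
  assumes "disk_self_map \<psi>" "\<psi> 0 = 0" "cmod z < 1"
  shows "cmod (\<psi> z) \<le> cmod z"
  using Schwarz_Lemma(1)[OF disk_self_mapD(1)[OF assms(1)] assms(2) disk_self_mapD(2)[OF assms(1)] assms(3)] .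

lemma Schwarz_Pick:
  assumes "disk_self_map \<psi>" "cmod z < 1" "cmod w < 1"
  shows "cmod (disk_aut (\<psi> w) (\<psi> z)) \<le> cmod (disk_aut w z)"
proof -
  have "cmod (disk_aut (\<psi> w) (\<psi> (disk_aut w (disk_aut w z)))) \<le> cmod (disk_aut w z)"
    by (rule Schwarz_lemma_disk[OF disk_self_map_normalise]) (use assms norm_disk_aut_less_1 in auto)
  then show ?thesis using assms by (simp add: disk_aut_disk_aut)
qed

text \<open>The normalised map fixes 0, so its derivative there has modulus at most 1; the chain
  rule expresses that derivative through the one of \<open>\<psi>\<close> at
  \<open>w\<close>.\<close>

lemma Schwarz_Pick_deriv:
  assumes "disk_self_map \<psi>" "cmod w < 1"
  shows "cmod (deriv \<psi> w) * (1 - (cmod w)\<^sup>2) \<le> 1 - (cmod (\<psi> w))\<^sup>2"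
proof -
  let ?f = "\<lambda>z. disk_aut (\<psi> w) (\<psi> (disk_aut w z))"
  have psi: "cmod (\<psi> w) < 1" "cmod (\<psi> (disk_aut w 0)) < 1" using disk_self_mapD[OF assms(1)] assms by auto
  have d1: "(disk_aut w has_field_derivative - (1 - (cmod w)\<^sup>2)) (at 0)"
    using has_field_derivative_disk_aut[OF assms(2), of 0] by simp
  have d2: "(\<psi> has_field_derivative deriv \<psi> w) (at w)"
    using disk_self_mapD(1)[OF assms(1)] assms(2) by (intro holomorphic_derivI) (auto simp: in_disk_iff)
  have d3: "(disk_aut (\<psi> w) has_field_derivative - (1 - (cmod (\<psi> w))\<^sup>2) / (1 - cnj (\<psi> w) * \<psi> w)\<^sup>2) (at (\<psi> w))"
    using has_field_derivative_disk_aut[OF psi(1) psi(1)] .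
  have "(?f has_field_derivative
     - (1 - (cmod (\<psi> w))\<^sup>2) / (1 - cnj (\<psi> w) * \<psi> w)\<^sup>2 * (deriv \<psi> w * - (1 - (cmod w)\<^sup>2))) (at 0)"
    by (intro DERIV_chain2[of "disk_aut (\<psi> w)" _ "\<lambda>z. \<psi> (disk_aut w z)" 0] DERIV_chain2[of \<psi> _ "disk_aut w" 0] d1)
       (use d2 d3 in simp_all)
  then have "deriv ?f 0 = - (1 - (cmod (\<psi> w))\<^sup>2) / (1 - cnj (\<psi> w) * \<psi> w)\<^sup>2 * (deriv \<psi> w * - (1 - (cmod w)\<^sup>2))"
    by (rule DERIV_imp_deriv)
  moreover have "cmod (deriv ?f 0) \<le> 1"
    by (rule Schwarz_Lemma(2)[of ?f 0])
       (use disk_self_mapD[OF disk_self_map_normalise[OF assms]] in auto)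
  moreover have e: "1 - cnj (\<psi> w) * \<psi> w = of_real (1 - (cmod (\<psi> w))\<^sup>2)"
    using complex_norm_square[of "\<psi> w"] by (simp add: mult.commute)
  moreover have pos: "1 - (cmod (\<psi> w))\<^sup>2 > 0" "1 - (cmod w)\<^sup>2 > 0"
    using one_minus_norm_sq_pos psi assms by auto
  moreover have "cmod (deriv ?f 0) = cmod (deriv \<psi> w) * (1 - (cmod w)\<^sup>2) / (1 - (cmod (\<psi> w))\<^sup>2)"
  proof -
    have "deriv ?f 0 = deriv \<psi> w * of_real (1 - (cmod w)\<^sup>2) / of_real (1 - (cmod (\<psi> w))\<^sup>2)"
    proof -
      define x y where "x = complex_of_real (1 - (cmod w)\<^sup>2)" and "y = complex_of_real (1 - (cmod (\<psi> w))\<^sup>2)"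
      have "y \<noteq> 0" using pos by (simp only: y_def of_real_eq_0_iff)
      then have "- y / y\<^sup>2 * (deriv \<psi> w * - x) = deriv \<psi> w * x / y"
        by (simp add: power2_eq_square)
      then show ?thesis
        unfolding calculation(1) e by (simp only: x_def y_def of_real_minus)
    qed
    then show ?thesis
      using pos by (simp add: norm_mult norm_divide del: of_real_diff of_real_power)
  qed
  ultimately have "cmod (deriv \<psi> w) * (1 - (cmod w)\<^sup>2) / (1 - (cmod (\<psi> w))\<^sup>2) \<le> 1" by metis
  then show ?thesis using pos by (simp add: pos_divide_le_eq)
qed

subsection \<open>Area integrals over the disk\<close>

abbreviation vec2_to_complex :: "real^2 \<Rightarrow> complex" where
  "vec2_to_complex v \<equiv> Complex (v $ 1) (v $ 2)"

abbreviation complex_to_vec2 :: "complex \<Rightarrow> real^2" where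
  "complex_to_vec2 z \<equiv> vector [Re z, Im z]"

lemma vector_2_eta [simp]: "vector [v $ 1, v $ 2] = (v :: real^2)"
  by (simp add: vec_eq_iff forall_2)

lemma bounded_linear_vec2_to_complex: "bounded_linear vec2_to_complex"
  unfolding linear_conv_bounded_linear[symmetric] by (auto intro!: linearI simp: complex_eq_iff)

lemma bounded_linear_complex_to_vec2: "bounded_linear complex_to_vec2"
  unfolding linear_conv_bounded_linear[symmetric] by (auto intro!: linearI simp: vec_eq_iff forall_2)

text \<open>The change-of-variables theorem speaks about \<open>real^'n\<close>, so Lebesgue measure
  on the complex plane is transported to \<open>real^2\<close>. It suffices to compare the measures
  of boxes.\<close>

lemma lborel_complex_eq_distr: "(lborel :: complex measure) = distr lborel borel vec2_to_complex"
proof (rule lborel_eqI)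
  have meas: "vec2_to_complex \<in> borel_measurable borel"
    by (intro borel_measurable_continuous_onI linear_continuous_on bounded_linear_vec2_to_complex)
  fix l u :: complex assume le: "\<And>b. b \<in> Basis \<Longrightarrow> l \<bullet> b \<le> u \<bullet> b"
  have "vec2_to_complex -` box l u = box (complex_to_vec2 l) (complex_to_vec2 u)"
    by (auto simp: box_def Basis_complex_def mem_box_cart forall_2 interval_cbox_cart inner_complex_def
        Basis_vec_def axis_eq_axis inner_axis)
  moreover have "emeasure lborel (box (complex_to_vec2 l) (complex_to_vec2 u))
      = ennreal ((Re u - Re l) * (Im u - Im l))"
    using le[of 1] le[of \<i>]
    by (subst emeasure_lborel_box)
       (auto simp: Basis_vec_def prod.UNION_disjoint inner_axis axis_eq_axis UNIV_2 cart_eq_inner_axis[symmetric]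
          Basis_complex_def inner_complex_def)
  ultimately show "emeasure (distr lborel borel vec2_to_complex) (box l u) = ennreal (\<Prod>b\<in>Basis. (u - l) \<bullet> b)"
    using meas by (simp add: emeasure_distr Basis_complex_def inner_complex_def)
qed simp

lemma nn_integral_lborel_vec2:
  assumes "f \<in> borel_measurable borel"
  shows "(\<integral>\<^sup>+z. f z \<partial>(lborel :: complex measure)) = (\<integral>\<^sup>+v. f (vec2_to_complex v) \<partial>lborel)"
  unfolding lborel_complex_eq_distr
  by (rule nn_integral_distr)
     (use assms bounded_linear_vec2_to_complex in \<open>auto intro!: borel_measurable_continuous_onI linear_continuous_on\<close>)

text \<open>For a nonnegative integrand integrability is absolute integrability, and
  \<open>vec\<close> embeds the values in \<open>real^1\<close>, where the vector-valued change of
  variables applies.\<close>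

lemma has_integral_change_of_variables_nonneg:
  fixes F :: "real^'m::{finite,wellorder} \<Rightarrow> real" and g :: "real^'m::_ \<Rightarrow> real^'m::_"
  assumes S: "S \<in> sets lebesgue"
    and der: "\<And>x. x \<in> S \<Longrightarrow> (g has_derivative g' x) (at x within S)"
    and inj: "inj_on g S"
    and F: "(F has_integral c) (g ` S)" "\<And>y. y \<in> g ` S \<Longrightarrow> 0 \<le> F y"
  shows "((\<lambda>x. \<bar>det (matrix (g' x))\<bar> * F (g x)) has_integral c) S"
proof -
  have "F absolutely_integrable_on (g ` S)" "integral (g ` S) F = c"
    using F by (auto simp: has_integral_iff absolutely_integrable_on_iff_nonneg)
  then have "(\<lambda>x. vec (F x) :: real^1) absolutely_integrable_on (g ` S) \<and>
      integral (g ` S) (\<lambda>x. vec (F x)) = (vec c :: real^1)"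
    by (simp add: absolutely_integrable_on_1_iff integral_on_1_eq)
  then have "(\<lambda>x. \<bar>det (matrix (g' x))\<bar> *\<^sub>R vec (F (g x)) :: real^1) absolutely_integrable_on S \<and>
      integral S (\<lambda>x. \<bar>det (matrix (g' x))\<bar> *\<^sub>R vec (F (g x))) = (vec c :: real^1)"
    using has_absolute_integral_change_of_variables[OF S der inj, of "\<lambda>x. vec (F x) :: real^1" "vec c"] by blast
  then show ?thesis
    by (auto simp: absolutely_integrable_on_1_iff integral_on_1_eq has_integral_iff
        dest: set_lebesgue_integral_eq_integral(1))
qed

text \<open>The area formula for a univalent map. As an inequality it is trivial when the right side
  is infinite, and otherwise the integrand on the image is integrable. For automorphisms and
  rotations, applying it also to the inverse map gives equality.\<close>

lemma nn_integral_conformal_image: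
  fixes \<psi> :: "complex \<Rightarrow> complex" and F :: "complex \<Rightarrow> real"
  assumes S: "open S" and psi: "\<psi> holomorphic_on S" "inj_on \<psi> S"
    and F: "continuous_on (\<psi> ` S) F" "\<And>w. w \<in> \<psi> ` S \<Longrightarrow> 0 \<le> F w"
  shows "(\<integral>\<^sup>+z\<in>S. ennreal (F (\<psi> z) * (cmod (deriv \<psi> z))\<^sup>2) \<partial>lborel) \<le> (\<integral>\<^sup>+w\<in>\<psi> ` S. ennreal (F w) \<partial>lborel)"
proof (cases "(\<integral>\<^sup>+w\<in>\<psi> ` S. ennreal (F w) \<partial>lborel) = \<infinity>")
  case False
  let ?T = "complex_to_vec2" and ?U = "vec2_to_complex"
  define g where "g = (\<lambda>v. ?T (\<psi> (?U v)))"
  define g' where "g' = (\<lambda>v h. ?T (deriv \<psi> (?U v) * ?U h))"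
  define A where "A = ?U -` S"
  note contU = linear_continuous_on[OF bounded_linear_vec2_to_complex]
  have opA: "open A" unfolding A_def using contU[of UNIV] S by (simp add: continuous_on_open_vimage)
  have opI: "open (\<psi> ` S)" by (rule open_mapping_thm3[OF psi(1) S psi(2)])
  have gA: "g ` A = ?U -` (\<psi> ` S)"
  proof -
    have "v \<in> g ` A" if "?U v = \<psi> z" "z \<in> S" for v z
      using that by (intro image_eqI[of _ _ "?T z"])
       (auto simp: g_def A_def that(1)[symmetric])
    then show ?thesis by (auto simp: g_def A_def)
  qed
  have opgA: "open (g ` A)" unfolding gA using contU[of UNIV] opI by (simp add: continuous_on_open_vimage)
  have der: "(g has_derivative g' v) (at v within A)" if "v \<in> A" for v
  proof -
    have "(\<psi> has_field_derivative deriv \<psi> (?U v)) (at (?U v))"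
      using that psi S by (intro holomorphic_derivI) (auto simp: A_def)
    then have d: "(\<psi> has_derivative (*) (deriv \<psi> (?U v))) (at (?U v))"
      by (simp add: has_field_derivative_def)
    have dU: "(?U has_derivative ?U) (at v)"
      by (rule bounded_linear_imp_has_derivative[OF bounded_linear_vec2_to_complex])
    have "((\<lambda>v. \<psi> (?U v)) has_derivative (\<lambda>h. deriv \<psi> (?U v) * ?U h)) (at v)"
      using has_derivative_compose[OF dU d] .
    from bounded_linear.has_derivative[OF bounded_linear_complex_to_vec2 this]
    show ?thesis unfolding g_def g'_def by (rule has_derivative_at_withinI)
  qed
  \<comment> \<open>Cauchy--Riemann: the real matrix of multiplication by c has determinant
    |c|^2.\<close>
  have det: "det (matrix (g' v)) = (cmod (deriv \<psi> (?U v)))\<^sup>2" for v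
    unfolding cmod_power2 by (simp add: det_2 matrix_def g'_def axis_def power2_eq_square)
  have inj: "inj_on g A"
  proof (rule inj_onI)
    fix v w assume vw: "v \<in> A" "w \<in> A" "g v = g w"
    from vw(3) have "\<psi> (?U v) = \<psi> (?U w)"
      unfolding g_def by (auto simp: vec_eq_iff forall_2 complex_eq_iff)
    with vw have "?U v = ?U w" using psi(2) by (auto simp: A_def dest: inj_onD)
    then show "v = w" by (auto simp: vec_eq_iff forall_2)
  qed
  have measF: "(\<lambda>w. ennreal (F w) * indicator (\<psi> ` S) w) \<in> borel_measurable borel"
  proof -
    have "(\<lambda>w. indicator (\<psi> ` S) w *\<^sub>R F w) \<in> borel_measurable borel"
      using opI by (intro borel_measurable_continuous_on_indicator F) auto
    then have "(\<lambda>w. ennreal (indicator (\<psi> ` S) w *\<^sub>R F w)) \<in> borel_measurable borel" by measurable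
    then show ?thesis by (rule measurable_cong[THEN iffD1, rotated]) (auto simp: indicator_def)
  qed
  have eq1: "(\<integral>\<^sup>+w\<in>\<psi> ` S. ennreal (F w) \<partial>lborel) = (\<integral>\<^sup>+v\<in>g ` A. ennreal (F (?U v)) \<partial>lborel)"
    unfolding nn_integral_lborel_vec2[OF measF]
    by (intro nn_integral_cong) (auto simp: gA indicator_def)
  have contFU: "continuous_on (g ` A) (\<lambda>v. F (?U v))"
    by (intro continuous_on_compose2[OF F(1) contU]) (auto simp: gA)
  have fin: "(\<integral>\<^sup>+v\<in>g ` A. ennreal (F (?U v)) \<partial>lborel) < \<infinity>" using False eq1 by (simp add: less_top)
  have sm: "set_borel_measurable borel (g ` A) (\<lambda>v. F (?U v))"
    unfolding set_borel_measurable_def using opgA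
    by (intro borel_measurable_continuous_on_indicator contFU) auto
  have nn: "0 \<le> F (?U v)" if "v \<in> g ` A" for v using F(2) that unfolding gA by auto
  define c where "c = integral (g ` A) (\<lambda>v. F (?U v))"
  have eq2: "(\<integral>\<^sup>+v\<in>g ` A. ennreal (F (?U v)) \<partial>lborel) = ennreal c"
    unfolding c_def by (rule set_nn_integral_lborel_eq_integral[OF sm nn fin])
  have "((\<lambda>v. F (?U v)) has_integral c) (g ` A)"
  proof -
    have "(\<lambda>v. F (?U v)) integrable_on (g ` A)"
    proof -
      have "set_integrable lborel (g ` A) (\<lambda>v. F (?U v))"
        unfolding set_integrable_def
      proof (rule integrableI_nonneg)
        show "(\<lambda>x. indicator (g ` A) x *\<^sub>R F (?U x)) \<in> borel_measurable lborel"
          using sm unfolding set_borel_measurable_def by simp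
        show "AE x in lborel. 0 \<le> indicat_real (g ` A) x *\<^sub>R F (?U x)"
          using nn by (auto simp: indicator_def)
        have "(\<integral>\<^sup>+x. ennreal (indicat_real (g ` A) x *\<^sub>R F (?U x)) \<partial>lborel) = (\<integral>\<^sup>+v\<in>g ` A. ennreal (F (?U v)) \<partial>lborel)"
          by (intro nn_integral_cong) (auto simp: indicator_def)
        then show "(\<integral>\<^sup>+x. ennreal (indicat_real (g ` A) x *\<^sub>R F (?U x)) \<partial>lborel) < \<infinity>" using fin by simp
      qed
      then show ?thesis by (rule set_borel_integral_eq_integral)
    qed
    then show ?thesis unfolding c_def by (rule integrable_integral)
  qed
  from has_integral_change_of_variables_nonneg[OF _ der inj this nn] opA
  have hi: "((\<lambda>v. (cmod (deriv \<psi> (?U v)))\<^sup>2 * F (\<psi> (?U v))) has_integral c) A"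
    by (simp add: det g_def)
  have measL: "(\<lambda>z. ennreal (F (\<psi> z) * (cmod (deriv \<psi> z))\<^sup>2) * indicator S z) \<in> borel_measurable borel"
  proof -
    have "continuous_on S (\<lambda>z. F (\<psi> z))"
      by (intro continuous_on_compose2[OF F(1)] holomorphic_on_imp_continuous_on psi) auto
    moreover have "continuous_on S (deriv \<psi>)"
      by (intro holomorphic_on_imp_continuous_on holomorphic_deriv psi S)
    ultimately have "(\<lambda>z. indicator S z *\<^sub>R (F (\<psi> z) * (cmod (deriv \<psi> z))\<^sup>2)) \<in> borel_measurable borel"
      using S by (intro borel_measurable_continuous_on_indicator continuous_intros) auto
    then have "(\<lambda>z. ennreal (indicator S z *\<^sub>R (F (\<psi> z) * (cmod (deriv \<psi> z))\<^sup>2))) \<in> borel_measurable borel" by measurable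
    then show ?thesis by (rule measurable_cong[THEN iffD1, rotated]) (auto simp: indicator_def)
  qed
  have "(\<integral>\<^sup>+z\<in>S. ennreal (F (\<psi> z) * (cmod (deriv \<psi> z))\<^sup>2) \<partial>lborel)
      = (\<integral>\<^sup>+v\<in>A. ennreal ((cmod (deriv \<psi> (?U v)))\<^sup>2 * F (\<psi> (?U v))) \<partial>lborel)"
    unfolding nn_integral_lborel_vec2[OF measL]
    by (intro nn_integral_cong) (auto simp: A_def indicator_def mult.commute)
  also have "\<dots> = ennreal c"
    using nn_integral_has_integral_lebesgue'[OF _ hi] F(2)
    by (auto simp: A_def mult.commute)
  finally show ?thesis using eq1 eq2 by simp
qed simp

lemma nn_integral_disk_cong:
  "(\<And>z. cmod z < 1 \<Longrightarrow> f z = g z) \<Longrightarrow> (\<integral>\<^sup>+z\<in>unit_disk. f z \<partial>lborel) = (\<integral>\<^sup>+z\<in>unit_disk. g z \<partial>lborel)"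
  by (intro nn_integral_cong) (auto simp: indicator_def)

lemma nn_integral_disk_mono:
  "(\<And>z. cmod z < 1 \<Longrightarrow> f z \<le> g z) \<Longrightarrow> (\<integral>\<^sup>+z\<in>unit_disk. f z \<partial>lborel) \<le> (\<integral>\<^sup>+z\<in>unit_disk. g z \<partial>lborel)"
  by (intro nn_integral_mono) (auto simp: indicator_def)

text \<open>The reverse inequality is the area formula for the integrand already pulled back once:
  \<open>disk_aut a\<close> is an involution, so pulling back twice restores \<open>F\<close> and
  the two Jacobians cancel.\<close>

lemma nn_integral_disk_aut:
  fixes F :: "complex \<Rightarrow> real"
  assumes a: "cmod a < 1" and F: "continuous_on unit_disk F" "\<And>w. cmod w < 1 \<Longrightarrow> 0 \<le> F w"
  shows "(\<integral>\<^sup>+z\<in>unit_disk. ennreal (F (disk_aut a z) * (cmod (deriv (disk_aut a) z))\<^sup>2) \<partial>lborel)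
    = (\<integral>\<^sup>+w\<in>unit_disk. ennreal (F w) \<partial>lborel)"
proof (rule antisym)
  show "(\<integral>\<^sup>+z\<in>unit_disk. ennreal (F (disk_aut a z) * (cmod (deriv (disk_aut a) z))\<^sup>2) \<partial>lborel)
    \<le> (\<integral>\<^sup>+w\<in>unit_disk. ennreal (F w) \<partial>lborel)"
    using nn_integral_conformal_image[OF open_ball holomorphic_disk_aut[OF a] inj_on_disk_aut[OF a], of F] F
    by (simp add: disk_aut_image[OF a] in_disk_iff del: mem_ball_0)
next
  let ?F = "\<lambda>z. F (disk_aut a z) * (cmod (deriv (disk_aut a) z))\<^sup>2"
  have cont: "continuous_on unit_disk ?F"
    using disk_aut_image[OF a] holomorphic_disk_aut[OF a]
    by (intro continuous_intros continuous_on_compose2[OF F(1)] holomorphic_on_imp_continuous_on holomorphic_deriv) auto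
  have "(\<integral>\<^sup>+w\<in>unit_disk. ennreal (F w) \<partial>lborel) =
     (\<integral>\<^sup>+z\<in>unit_disk. ennreal (?F (disk_aut a z) * (cmod (deriv (disk_aut a) z))\<^sup>2) \<partial>lborel)"
  proof (rule nn_integral_disk_cong)
    fix z :: complex assume z: "cmod z < 1"
    have "cmod (deriv (disk_aut a) (disk_aut a z)) * cmod (deriv (disk_aut a) z) = 1"
      using one_minus_norm_sq_pos[OF z] one_minus_norm_sq_pos[OF norm_disk_aut_less_1[OF a z]]
      by (simp add: norm_deriv_disk_aut'[OF a] norm_disk_aut_less_1[OF a z] disk_aut_disk_aut[OF a] z)
    then have "(cmod (deriv (disk_aut a) (disk_aut a z)))\<^sup>2 * (cmod (deriv (disk_aut a) z))\<^sup>2 = 1"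
      by (metis power_mult_distrib power_one)
    then show "ennreal (F z) = ennreal (?F (disk_aut a z) * (cmod (deriv (disk_aut a) z))\<^sup>2)"
      by (simp add: disk_aut_disk_aut[OF a z] mult.assoc)
  qed
  also have "\<dots> \<le> (\<integral>\<^sup>+w\<in>unit_disk. ennreal (?F w) \<partial>lborel)"
    using nn_integral_conformal_image[OF open_ball holomorphic_disk_aut[OF a] inj_on_disk_aut[OF a], of ?F] F cont
    by (simp add: disk_aut_image[OF a] in_disk_iff norm_disk_aut_less_1[OF a] del: mem_ball_0)
  finally show "(\<integral>\<^sup>+w\<in>unit_disk. ennreal (F w) \<partial>lborel) \<le> (\<integral>\<^sup>+w\<in>unit_disk. ennreal (?F w) \<partial>lborel)" .
qed

text \<open>As for automorphisms, the reverse inequality comes from the inverse rotation.\<close>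

lemma nn_integral_rotate:
  fixes F :: "complex \<Rightarrow> real"
  assumes e: "cmod e = 1" and F: "continuous_on unit_disk F" "\<And>w. cmod w < 1 \<Longrightarrow> 0 \<le> F w"
  shows "(\<integral>\<^sup>+z\<in>unit_disk. ennreal (F (e * z)) \<partial>lborel) = (\<integral>\<^sup>+w\<in>unit_disk. ennreal (F w) \<partial>lborel)"
proof -
  have img: "(*) c ` unit_disk = unit_disk" if "cmod c = 1" for c :: complex
  proof -
    have "z \<in> (*) c ` unit_disk" if z: "z \<in> unit_disk" for z
      using \<open>cmod c = 1\<close> z by (intro image_eqI[of _ _ "z / c"]) (auto simp: norm_divide)
    then show ?thesis using that by (auto simp: norm_mult)
  qed
  have le: "(\<integral>\<^sup>+z\<in>unit_disk. ennreal (F (c * z)) \<partial>lborel) \<le> (\<integral>\<^sup>+w\<in>unit_disk. ennreal (F w) \<partial>lborel)"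
    if c: "cmod c = 1" and F: "continuous_on unit_disk F" "\<And>w. cmod w < 1 \<Longrightarrow> 0 \<le> F w" for c F
  proof -
    have "inj_on ((*) c) unit_disk" using c by (auto intro!: inj_onI)
    from nn_integral_conformal_image[of unit_disk "(*) c" F, OF _ _ this] F c show ?thesis
      by (simp add: img in_disk_iff norm_mult holomorphic_intros del: mem_ball_0)
  qed
  have contr: "continuous_on unit_disk (\<lambda>z. F (e * z))"
    using img[OF e] by (intro continuous_on_compose2[OF F(1)] continuous_intros) auto
  have "(\<integral>\<^sup>+w\<in>unit_disk. ennreal (F w) \<partial>lborel) = (\<integral>\<^sup>+w\<in>unit_disk. ennreal (F (e * (inverse e * w))) \<partial>lborel)"
    using e by (intro nn_integral_cong) (auto simp: field_simps)
  also have "\<dots> \<le> (\<integral>\<^sup>+w\<in>unit_disk. ennreal (F (e * w)) \<partial>lborel)"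
    using e by (intro le[of "inverse e" "\<lambda>z. F (e * z)"] contr) (auto simp: norm_inverse norm_mult intro!: F)
  finally show ?thesis using le[OF e F] by simp
qed

lemma continuous_on_norm_powr_weight:
  assumes "continuous_on unit_disk g" "0 < p"
  shows "continuous_on unit_disk (\<lambda>z. cmod (g z) powr p * (1 - (cmod z)\<^sup>2) powr s)"
  using assms by (intro continuous_intros continuous_on_powr') (auto simp: abs_square_less_1 abs_square_eq_1)

text \<open>Of the p powers of |sigma_a'| two serve as Jacobian of the substitution; the other p - 2
  merge with the weight. Afterwards \<open>a\<close> occurs only in the last factor, whose exponent
  s - p + 2 is positive for admissible parameters.\<close>

lemma dirichlet_energy_disk_aut:
  assumes a: "cmod a < 1" and f: "f holomorphic_on unit_disk" and p: "0 < p"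
  shows "dirichlet_energy p s (\<lambda>z. f (disk_aut a z)) =
    (\<integral>\<^sup>+w\<in>unit_disk. ennreal (cmod (deriv f w) powr p * (1 - (cmod w)\<^sup>2) powr (p - 2) *
        (1 - (cmod (disk_aut a w))\<^sup>2) powr (s - p + 2)) \<partial>lborel)"
proof -
  let ?F = "\<lambda>w. cmod (deriv f w) powr p * (1 - (cmod w)\<^sup>2) powr (p - 2) *
        (1 - (cmod (disk_aut a w))\<^sup>2) powr (s - p + 2)"
  have contF: "continuous_on unit_disk ?F"
  proof (rule continuous_on_mult[OF continuous_on_norm_powr_weight[OF _ p]])
    show "continuous_on unit_disk (deriv f)"
      by (intro holomorphic_on_imp_continuous_on holomorphic_deriv f) auto
    have "continuous_on unit_disk (disk_aut a)"
      by (intro holomorphic_on_imp_continuous_on holomorphic_disk_aut a)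
    then show "continuous_on unit_disk (\<lambda>x. (1 - (cmod (disk_aut a x))\<^sup>2) powr (s - p + 2))"
      using one_minus_norm_sq_pos norm_disk_aut_less_1[OF a]
      by (intro continuous_on_powr continuous_intros) (fastforce simp: in_disk_iff)+
  qed
  have "dirichlet_energy p s (\<lambda>z. f (disk_aut a z)) =
      (\<integral>\<^sup>+z\<in>unit_disk. ennreal (?F (disk_aut a z) * (cmod (deriv (disk_aut a) z))\<^sup>2) \<partial>lborel)"
    unfolding dirichlet_energy_def
  proof (rule nn_integral_disk_cong)
    fix z :: complex assume z: "cmod z < 1"
    let ?d = "cmod (deriv (disk_aut a) z)" and ?w = "disk_aut a z"
    have w: "cmod ?w < 1" by (rule norm_disk_aut_less_1[OF a z])
    have "(f has_field_derivative deriv f ?w) (at ?w)"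
      using w f by (intro holomorphic_derivI) (auto simp: in_disk_iff)
    moreover have "(disk_aut a has_field_derivative deriv (disk_aut a) z) (at z)"
      using has_field_derivative_disk_aut[OF a z] by (simp add: DERIV_imp_deriv)
    ultimately have "deriv (\<lambda>z. f (disk_aut a z)) z = deriv f ?w * deriv (disk_aut a) z"
      by (intro DERIV_imp_deriv DERIV_chain2)
    moreover have d: "0 < ?d" "1 - (cmod ?w)\<^sup>2 = ?d * (1 - (cmod z)\<^sup>2)"
      using one_minus_norm_sq_pos[OF z] one_minus_norm_sq_pos[OF w] by (simp_all add: norm_deriv_disk_aut'[OF a z])
    moreover have "?d powr p = ?d powr (p - 2) * ?d\<^sup>2"
      using d by (simp add: powr_diff)
    moreover have "(1 - (cmod z)\<^sup>2) powr s = (1 - (cmod z)\<^sup>2) powr (p - 2) * (1 - (cmod z)\<^sup>2) powr (s - p + 2)"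
      by (simp add: powr_add[symmetric])
    ultimately show "ennreal (cmod (deriv (\<lambda>z. f (disk_aut a z)) z) powr p * (1 - (cmod z)\<^sup>2) powr s) =
         ennreal (?F ?w * ?d\<^sup>2)"
      using one_minus_norm_sq_pos[OF z]
      by (simp add: disk_aut_disk_aut[OF a z] norm_mult powr_mult mult_ac)
  qed
  also have "\<dots> = (\<integral>\<^sup>+w\<in>unit_disk. ennreal (?F w) \<partial>lborel)"
    by (rule nn_integral_disk_aut[OF a contF]) auto
  finally show ?thesis .
qed

text \<open>Dyadic annuli take the place of polar coordinates: on \<open>A k\<close> the weight is
  comparable to (1/2)^(b * k), the area is of order (1/2)^k, and a geometric series remains.\<close>

lemma nn_integral_one_minus_norm_powr_finite:
  assumes "- 1 < b"
  shows "(\<integral>\<^sup>+z\<in>unit_disk. ennreal ((1 - (cmod z)\<^sup>2) powr b) \<partial>lborel) < \<infinity>"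
proof -
  define A where "A = (\<lambda>k::nat. {z::complex. (1/2)^Suc k < 1 - (cmod z)\<^sup>2 \<and> 1 - (cmod z)\<^sup>2 \<le> (1/2)^k})"
  \<comment> \<open>On \<open>A k\<close> the weight is largest at the inner edge for b \<ge> 0 and
    towards the outer edge for b < 0. The second case costs a factor (1/2) powr b, and
    \<open>K\<close> covers both.\<close>
  define K where "K = max 1 ((1/2::real) powr b)"
  have A_ball: "A k \<subseteq> ball 0 (sqrt (1 - (1/2)^Suc k)) - ball 0 (sqrt (1 - (1/2)^k))" for k
  proof
    fix z assume "z \<in> A k"
    then have z: "(1/2)^Suc k < 1 - (cmod z)\<^sup>2" "1 - (cmod z)\<^sup>2 \<le> (1/2)^k" by (auto simp: A_def)
    have "cmod z < sqrt (1 - (1/2)^Suc k)" by (rule real_less_rsqrt) (use z in linarith)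
    moreover have "sqrt (1 - (1/2)^k) \<le> cmod z" by (rule real_le_lsqrt) (use z in auto)
    ultimately show "z \<in> ball 0 (sqrt (1 - (1/2)^Suc k)) - ball 0 (sqrt (1 - (1/2)^k))" by simp
  qed
  have measA: "A k \<in> sets borel" for k
    unfolding A_def by measurable
  have emA: "emeasure lborel (A k) \<le> ennreal (pi * (1/2)^Suc k)" for k
  proof -
    have le1: "(1/2::real)^k \<le> 1" "(1/2::real)^Suc k \<le> 1" by (rule power_le_one; simp)+
    have "emeasure lborel (A k) \<le> emeasure lborel (ball (0::complex) (sqrt (1 - (1/2)^Suc k)) - ball 0 (sqrt (1 - (1/2)^k)))"
      by (intro emeasure_mono A_ball) auto
    also have "\<dots> = emeasure lborel (ball (0::complex) (sqrt (1 - (1/2)^Suc k))) - emeasure lborel (ball (0::complex) (sqrt (1 - (1/2)^k)))"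
      by (rule emeasure_Diff) (use emeasure_lborel_ball_finite[of "0::complex"] in \<open>auto simp: less_top intro!: subset_ball\<close>)
    also have "\<dots> = ennreal (pi * (1 - (1/2)^Suc k)) - ennreal (pi * (1 - (1/2)^k))"
      using le1 by (subst (1 2) emeasure_ball) (simp_all add: unit_ball_vol_2)
    also have "\<dots> = ennreal (pi * (1/2)^Suc k)"
      using le1 by (subst ennreal_minus) (simp_all add: field_simps)
    finally show ?thesis .
  qed
  have cover: "unit_disk \<subseteq> (\<Union>k. A k)"
  proof
    fix z :: complex assume "z \<in> unit_disk"
    then have pos: "0 < 1 - (cmod z)\<^sup>2" using one_minus_norm_sq_pos by (simp add: in_disk_iff)
    obtain n where n: "(1/2::real)^n < 1 - (cmod z)\<^sup>2" using real_arch_pow_inv[OF pos, of "1/2"] by auto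
    define m where "m = (LEAST n. (1/2::real)^n < 1 - (cmod z)\<^sup>2)"
    have m: "(1/2::real)^m < 1 - (cmod z)\<^sup>2" unfolding m_def by (rule LeastI[of _ n]) (rule n)
    then have "m \<noteq> 0" by (cases m) auto
    then obtain k where k: "m = Suc k" by (cases m) auto
    have "\<not> (1/2::real)^k < 1 - (cmod z)\<^sup>2" using not_less_Least[of k "\<lambda>n. (1/2::real)^n < 1 - (cmod z)\<^sup>2"] k unfolding m_def by auto
    then show "z \<in> (\<Union>k. A k)" using m k by (auto simp: A_def)
  qed
  have bound: "(1 - (cmod z)\<^sup>2) powr b \<le> K * (1/2) powr (b * k)" if "z \<in> A k" for z k
  proof -
    let ?x = "1 - (cmod z)\<^sup>2"
    have x: "(1/2)^Suc k < ?x" "?x \<le> (1/2)^k" "0 < ?x" using that unfolding A_def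
      by (auto intro: less_trans[of 0 "(1/2)^Suc k"])
    have pw: "(1/2::real)^j = (1/2) powr (real j)" for j by (simp add: powr_realpow)
    show ?thesis
    proof (cases "0 \<le> b")
      case True
      have "?x powr b \<le> ((1/2)^k) powr b" using x True by (intro powr_mono2) auto
      also have "\<dots> = 1 * (1/2) powr (b * k)" by (simp add: pw powr_powr mult.commute)
      also have "\<dots> \<le> K * (1/2) powr (b * k)" by (intro mult_right_mono) (auto simp: K_def)
      finally show ?thesis .
    next
      case False
      have "?x powr b \<le> ((1/2)^Suc k) powr b" using x False by (intro powr_mono2') auto
      also have "\<dots> = (1/2) powr b * (1/2) powr (b * k)"
        unfolding pw by (simp add: powr_powr powr_add[symmetric] algebra_simps)
      also have "\<dots> \<le> K * (1/2) powr (b * k)" by (intro mult_right_mono) (auto simp: K_def)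
      finally show ?thesis .
    qed
  qed
  \<comment> \<open>The ratio of the series, combining area and weight. It is below 1 exactly
    because b > -1.\<close>
  let ?r = "(1/2::real) powr (1 + b)"
  have r: "0 < ?r" "?r < 1" using assms powr_less_mono'[of "1/2" 0 "1 + b"] by auto
  have "(\<integral>\<^sup>+z\<in>unit_disk. ennreal ((1 - (cmod z)\<^sup>2) powr b) \<partial>lborel)
     \<le> (\<integral>\<^sup>+z. (\<Sum>k. ennreal (K * (1/2) powr (b * k)) * indicator (A k) z) \<partial>lborel)"
  proof (rule nn_integral_mono)
    fix z :: complex
    show "ennreal ((1 - (cmod z)\<^sup>2) powr b) * indicator unit_disk z \<le> (\<Sum>k. ennreal (K * (1/2) powr (b * k)) * indicator (A k) z)"
    proof (cases "z \<in> unit_disk")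
      case True
      then obtain k where k: "z \<in> A k" using cover by auto
      have "ennreal ((1 - (cmod z)\<^sup>2) powr b) \<le> ennreal (K * (1/2) powr (b * k)) * indicator (A k) z"
        using bound[OF k] k by (simp add: ennreal_leI)
      also have "\<dots> \<le> (\<Sum>k. ennreal (K * (1/2) powr (b * k)) * indicator (A k) z)"
        using sum_le_suminf[of "\<lambda>k. ennreal (K * (1/2) powr (b * k)) * indicator (A k) z" "{k}"]
        by (simp del: sum_mult_indicator)
      finally show ?thesis using True by simp
    qed simp
  qed
  also have "\<dots> = (\<Sum>k. ennreal (K * (1/2) powr (b * k)) * emeasure lborel (A k))"
    using measA by (subst nn_integral_suminf) (auto simp: nn_integral_cmult_indicator)
  also have "\<dots> \<le> (\<Sum>k. ennreal (K * pi / 2 * ?r ^ k))"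
  proof (rule suminf_le)
    fix k
    have "ennreal (K * (1/2) powr (b * k)) * emeasure lborel (A k) \<le> ennreal (K * (1/2) powr (b * k)) * ennreal (pi * (1/2)^Suc k)"
      by (intro mult_left_mono emA) auto
    also have "\<dots> = ennreal (K * (1/2) powr (b * k) * (pi * (1/2)^Suc k))"
      by (rule ennreal_mult[symmetric]) (auto simp: K_def)
    also have "K * (1/2) powr (b * k) * (pi * (1/2)^Suc k) = K * pi / 2 * ?r ^ k"
    proof -
      have "?r ^ k = (1/2) powr (k + b * k)"
        by (simp add: powr_realpow[symmetric] powr_powr algebra_simps)
      then show ?thesis by (simp add: powr_add powr_realpow)
    qed
    finally show "ennreal (K * (1/2) powr (b * k)) * emeasure lborel (A k) \<le> ennreal (K * pi / 2 * ?r ^ k)" .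
  qed auto
  also have "\<dots> < \<infinity>"
  proof -
    have "summable (\<lambda>k. K * pi / 2 * ?r ^ k)" using r by (intro summable_mult summable_geometric) auto
    then show ?thesis by (subst suminf_ennreal2) (auto simp: K_def)
  qed
  finally show ?thesis .
qed

subsection \<open>Poisson integrals and Littlewood subordination\<close>

text \<open>The graph of the convex function x powr p lies above its tangent at m. For positive x
  and m and p > 1 this is Young's inequality with the exponents 1/p and 1 - 1/p.\<close>

lemma powr_ge_tangent:
  fixes x m p :: real
  assumes "0 \<le> x" "0 \<le> m" "1 \<le> p"
  shows "m powr p + p * m powr (p - 1) * (x - m) \<le> x powr p"
proof (cases "m = 0 \<or> p = 1 \<or> x = 0")
  case True
  have "m powr (p - 1) * m = m powr p" if "0 < m" using that by (simp add: powr_diff)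
  then have "m powr p + p * m powr (p - 1) * (0 - m) \<le> 0" if "0 < m"
    using that assms by (simp add: mult.assoc mult_le_cancel_right1)
  with True show ?thesis using assms by (cases "m = 0") auto
next
  case False
  then have m: "0 < m" "1 < p" "0 < x" using assms by auto
  have "x * m powr (p - 1) = (x powr p) powr (1/p) * (m powr p) powr (1 - 1/p)"
    using assms m by (simp add: powr_powr right_diff_distrib)
  also have "\<dots> \<le> (1/p) * x powr p + (1 - 1/p) * m powr p"
    using m by (intro Youngs_inequality_0) auto
  finally have "p * (x * m powr (p - 1)) \<le> p * ((1/p) * x powr p + (1 - 1/p) * m powr p)"
    using m by (intro mult_left_mono) auto
  also have "\<dots> = x powr p + (p - 1) * m powr p"
    using m by (simp add: field_simps)
  finally have "p * (x * m powr (p - 1)) \<le> x powr p + (p - 1) * m powr p" .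
  moreover have "m powr (p - 1) * m = m powr p"
    using m by (simp add: powr_diff)
  ultimately show ?thesis by (simp add: algebra_simps)
qed

text \<open>Jensen's inequality for the probability density \<open>w\<close>: integrate the tangent
  inequality taken at the mean \<open>m\<close> of \<open>cmod (h t)\<close>.\<close>

lemma powr_norm_integral_le:
  fixes h :: "real \<Rightarrow> complex" and w :: "real \<Rightarrow> real"
  assumes h: "continuous_on {a..b} h" and w: "continuous_on {a..b} w" "\<And>t. t \<in> {a..b} \<Longrightarrow> 0 \<le> w t"
    and w1: "integral {a..b} w = 1" and p: "1 \<le> p"
  shows "cmod (integral {a..b} (\<lambda>t. w t *\<^sub>R h t)) powr p \<le> integral {a..b} (\<lambda>t. w t * cmod (h t) powr p)"
proof -
  define m where "m = integral {a..b} (\<lambda>t. w t * cmod (h t))"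
  have int: "(\<lambda>t. w t *\<^sub>R h t) integrable_on {a..b}" "(\<lambda>t. w t * cmod (h t)) integrable_on {a..b}"
     "w integrable_on {a..b}" "(\<lambda>t. w t * cmod (h t) powr p) integrable_on {a..b}"
    using h w p by (intro integrable_continuous_real continuous_intros continuous_on_powr'; auto)+
  have int': "(\<lambda>t. c * w t) integrable_on {a..b}" "(\<lambda>t. c * (w t * cmod (h t))) integrable_on {a..b}" for c
    using h w by (intro integrable_continuous_real continuous_intros; auto)+
  have m0: "0 \<le> m" unfolding m_def using w by (intro integral_nonneg int) auto
  have le: "cmod (integral {a..b} (\<lambda>t. w t *\<^sub>R h t)) \<le> m"
    unfolding m_def using w by (intro integral_norm_bound_integral int) auto
  have "m powr p = integral {a..b} (\<lambda>t. (m powr p - p * m powr (p - 1) * m) * w t + p * m powr (p - 1) * (w t * cmod (h t)))"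
    using int w1 by (subst integral_add) (auto intro!: int' simp: m_def[symmetric])
  also have "\<dots> \<le> integral {a..b} (\<lambda>t. w t * cmod (h t) powr p)"
  proof (intro integral_le int integrable_add int')
    fix t assume t: "t \<in> {a..b}"
    have "w t * (m powr p + p * m powr (p - 1) * (cmod (h t) - m)) \<le> w t * cmod (h t) powr p"
      using powr_ge_tangent[of "cmod (h t)" m p] m0 p w(2)[OF t] by (intro mult_left_mono) auto
    then show "(m powr p - p * m powr (p - 1) * m) * w t + p * m powr (p - 1) * (w t * cmod (h t)) \<le> w t * cmod (h t) powr p"
      by (simp add: algebra_simps)
  qed
  finally show ?thesis using powr_mono2[OF _ _ le, of p] p by simp
qed

text \<open>Period 1 instead of 2 pi: circle means are then integrals over \<open>{0..1}\<close>
  without a factor, and \<open>circlepath\<close> has the same parametrisation.\<close>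

definition unit_circ :: "real \<Rightarrow> complex" where
  "unit_circ t = exp (2 * of_real pi * \<i> * of_real t)"

lemma norm_unit_circ [simp]: "cmod (unit_circ t) = 1"
  by (simp add: unit_circ_def)

lemma continuous_on_unit_circ [continuous_intros]: "continuous_on S unit_circ"
  unfolding unit_circ_def by (intro continuous_intros)

lemma unit_circ_nonzero [simp]: "unit_circ t \<noteq> 0"
  by (simp add: unit_circ_def)

lemma continuous_on_unit_circ' [continuous_intros]:
  "continuous_on S f \<Longrightarrow> continuous_on S (\<lambda>x. unit_circ (f x))"
  unfolding unit_circ_def by (intro continuous_intros)

text \<open>The Poisson kernel of the disk of radius \<open>R\<close>, normalised to integral 1 in
  the parameter of \<open>unit_circ\<close>.\<close>

definition poisson :: "real \<Rightarrow> complex \<Rightarrow> real \<Rightarrow> real" where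
  "poisson R w t = (R\<^sup>2 - (cmod w)\<^sup>2) / (cmod (R * unit_circ t - w))\<^sup>2"

lemma poisson_nonneg: "cmod w \<le> R \<Longrightarrow> 0 \<le> poisson R w t"
  by (simp add: poisson_def power_mono)

lemma poisson_denominator: "cmod w < R \<Longrightarrow> R * unit_circ t - w \<noteq> 0"
  by (metis abs_of_nonneg eq_iff_diff_eq_0 less_eq_real_def linorder_not_le mult.right_neutral norm_ge_zero norm_mult norm_of_real norm_unit_circ order_trans)

lemma continuous_on_poisson: "cmod w < R \<Longrightarrow> continuous_on S (poisson R w)"
  unfolding poisson_def[abs_def] by (intro continuous_intros) (auto dest: poisson_denominator)

text \<open>Cauchy's formula for \<open>H\<close>, which is \<open>F\<close> times a factor
  holomorphic near the closed disk and equal to 1 at \<open>w\<close>. On the circle R^2 = z * cnj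
  z, so this factor turns the Cauchy kernel into the Poisson kernel.\<close>

lemma Poisson_integral_formula:
  assumes F: "F holomorphic_on cball 0 R" and w: "cmod w < R"
  shows "((\<lambda>t. poisson R w t *\<^sub>R F (R * unit_circ t)) has_integral F w) {0..1}"
proof -
  have R: "0 < R" using w norm_ge_zero[of w] by linarith
  define H where "H = (\<lambda>z. F z * of_real (R\<^sup>2 - (cmod w)\<^sup>2) / (of_real (R\<^sup>2) - cnj w * z))"
  have nz: "of_real (R\<^sup>2) - cnj w * z \<noteq> 0" if "cmod z \<le> R" for z
  proof -
    have "cmod (cnj w * z) < R * R"
      using order_le_less_trans[OF mult_left_mono[OF that norm_ge_zero[of w]] mult_strict_right_mono[OF w R]]
      by (simp only: norm_mult complex_mod_cnj)
    then have "cmod (cnj w * z) < cmod (of_real (R\<^sup>2))" by (simp add: power2_eq_square norm_mult)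
    then show ?thesis by auto
  qed
  have "H holomorphic_on cball 0 R" unfolding H_def using nz by (intro holomorphic_intros F) auto
  from Cauchy_integral_circlepath_simple[OF this, of w] w
  have "((\<lambda>u. H u / (u - w)) has_contour_integral (2 * of_real pi * \<i> * H w)) (circlepath 0 R)" by simp
  then have "((\<lambda>t. H (circlepath 0 R t) / (circlepath 0 R t - w) * (2 * of_real pi * \<i> * of_real R * unit_circ t)) has_integral (2 * of_real pi * \<i> * H w)) {0..1}"
    unfolding has_contour_integral vector_derivative_circlepath unit_circ_def by simp
  from has_integral_mult_right[OF this, of "1 / (2 * of_real pi * \<i>)"]
  have "((\<lambda>t. 1 / (2 * of_real pi * \<i>) * (H (circlepath 0 R t) / (circlepath 0 R t - w) * (2 * of_real pi * \<i> * of_real R * unit_circ t))) has_integral H w) {0..1}"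
    by simp
  moreover have "H w = F w"
  proof -
    have "of_real (R\<^sup>2 - (cmod w)\<^sup>2) = of_real (R\<^sup>2) - cnj w * w"
      by (simp only: of_real_diff complex_norm_square mult.commute)
    then show ?thesis using nz[of w] w by (simp add: H_def)
  qed
  moreover have "1 / (2 * of_real pi * \<i>) * (H (circlepath 0 R t) / (circlepath 0 R t - w) * (2 * of_real pi * \<i> * of_real R * unit_circ t)) = poisson R w t *\<^sub>R F (R * unit_circ t)" for t
  proof -
    define z where "z = R * unit_circ t"
    have cz: "circlepath 0 R t = z" by (simp add: circlepath z_def unit_circ_def)
    have nzw: "z - w \<noteq> 0" unfolding z_def using poisson_denominator[OF w] .
    have nz0: "z \<noteq> 0" using R by (simp add: z_def)
    have zR: "cmod z = R" using R by (simp add: z_def norm_mult)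
    have "of_real (R\<^sup>2) - cnj w * z = z * cnj (z - w)"
      using complex_norm_square[of z] by (simp add: zR algebra_simps)
    then have e: "z / (of_real (R\<^sup>2) - cnj w * z) / (z - w) = 1 / of_real ((cmod (z - w))\<^sup>2)"
      using nz0 nzw unfolding complex_norm_square by simp
    have "1 / (2 * of_real pi * \<i>) * (H z / (z - w) * (2 * of_real pi * \<i> * of_real R * unit_circ t)) = H z / (z - w) * z"
    proof -
      have "1 / c * (x * (c * y)) = x * y" if "c \<noteq> 0" for c x y :: complex using that by simp
      from this[of "2 * of_real pi * \<i>" "H z / (z - w)" z] show ?thesis by (simp add: z_def mult.assoc)
    qed
    also have "\<dots> = F z * of_real (R\<^sup>2 - (cmod w)\<^sup>2) * (z / (of_real (R\<^sup>2) - cnj w * z) / (z - w))"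
      by (simp add: H_def)
    also have "\<dots> = poisson R w t *\<^sub>R F z"
      unfolding e poisson_def z_def[symmetric] by (simp add: scaleR_conv_of_real)
    finally show ?thesis by (simp add: cz z_def)
  qed
  ultimately show ?thesis by simp
qed

lemma integral_poisson:
  assumes "cmod w < R" shows "integral {0..1} (poisson R w) = 1"
proof -
  have "((\<lambda>t. Re (poisson R w t *\<^sub>R 1)) has_integral Re 1) {0..1}"
    by (rule has_integral_Re[OF Poisson_integral_formula[of "\<lambda>_. 1" R w]]) (use assms in auto)
  then show ?thesis by (simp add: integral_unique)
qed

lemma powr_norm_le_poisson:
  assumes F: "F holomorphic_on cball 0 R" and w: "cmod w < R" and p: "1 \<le> p"
  shows "cmod (F w) powr p \<le> integral {0..1} (\<lambda>t. poisson R w t * cmod (F (R * unit_circ t)) powr p)"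
proof -
  have R: "0 < R" using w norm_ge_zero[of w] by linarith
  have "F w = integral {0..1} (\<lambda>t. poisson R w t *\<^sub>R F (R * unit_circ t))"
    using Poisson_integral_formula[OF F w] by (simp add: integral_unique)
  moreover have "continuous_on {0..1} (\<lambda>t. F (R * unit_circ t))"
    using R by (intro continuous_on_compose2[OF holomorphic_on_imp_continuous_on[OF F]] continuous_intros)
      (auto simp: norm_mult)
  ultimately show ?thesis
    using powr_norm_integral_le[of 0 1 "\<lambda>t. F (R * unit_circ t)" "poisson R w" p] w p integral_poisson[OF w]
      poisson_nonneg[of w R] continuous_on_poisson[OF w] by simp
qed

text \<open>Subharmonicity of |g|^p at the centre, obtained from the dilation w \<mapsto> g (w * z),
  which is holomorphic on the closed unit disk, and the Poisson formula at 0.\<close>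

lemma powr_norm_le_circle_mean:
  assumes g: "g holomorphic_on unit_disk" and z: "cmod z < 1" and p: "1 \<le> p"
  shows "cmod (g 0) powr p \<le> integral {0..1} (\<lambda>t. cmod (g (unit_circ t * z)) powr p)"
proof -
  have "(\<lambda>w. g (w * z)) holomorphic_on cball 0 1"
  proof -
    have "(\<lambda>w. w * z) ` cball 0 1 \<subseteq> unit_disk"
    proof clarify
      fix w assume "w \<in> cball (0::complex) 1"
      then have "cmod w * cmod z \<le> cmod z" by (intro mult_left_le_one_le) auto
      then show "w * z \<in> unit_disk" using z by (simp add: norm_mult)
    qed
    then show ?thesis
      using holomorphic_on_compose_gen[of "\<lambda>w. w * z" "cball 0 1" g unit_disk, OF _ g]
      by (simp add: comp_def holomorphic_intros)
  qed
  from powr_norm_le_poisson[OF this, of 0 p] p show ?thesis by (simp add: poisson_def)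
qed

lemma borel_measurable_indicator_ennreal:
  fixes f :: "complex \<Rightarrow> real"
  assumes "continuous_on unit_disk f"
  shows "(\<lambda>z. ennreal (f z) * indicator unit_disk z) \<in> borel_measurable borel"
proof -
  have "(\<lambda>z. indicator unit_disk z *\<^sub>R f z) \<in> borel_measurable borel"
    by (intro borel_measurable_continuous_on_indicator assms) auto
  then have "(\<lambda>z. ennreal (indicator unit_disk z *\<^sub>R f z)) \<in> borel_measurable borel" by measurable
  then show ?thesis by (rule measurable_cong[THEN iffD1, rotated]) (auto simp: indicator_def)
qed

text \<open>The integral is invariant under rotating \<open>K\<close>, since \<open>W\<close> is
  radial. Averaging over all rotations and exchanging the integrals replaces \<open>K\<close> by its
  circle means. This does the work of polar coordinates.\<close>

lemma nn_integral_circle_mean: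
  fixes K W :: "complex \<Rightarrow> real"
  assumes K: "continuous_on unit_disk K" "\<And>w. cmod w < 1 \<Longrightarrow> 0 \<le> K w"
    and W: "continuous_on unit_disk W" "\<And>w. cmod w < 1 \<Longrightarrow> 0 \<le> W w" "\<And>e w. cmod e = 1 \<Longrightarrow> cmod w < 1 \<Longrightarrow> W (e * w) = W w"
  shows "(\<integral>\<^sup>+z\<in>unit_disk. ennreal (K z * W z) \<partial>lborel) =
    (\<integral>\<^sup>+z\<in>unit_disk. ennreal (integral {0..1} (\<lambda>t. K (unit_circ t * z)) * W z) \<partial>lborel)"
proof -
  let ?f = "\<lambda>t z. ennreal (indicator ({0..1} \<times> unit_disk) (t, z) *\<^sub>R (K (unit_circ t * z) * W z))"
  have contK: "continuous_on ({0..1} \<times> unit_disk) (\<lambda>x. K (unit_circ (fst x) * snd x))"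
    by (intro continuous_on_compose2[OF K(1)] continuous_intros) (auto simp: norm_mult)
  have contKW: "continuous_on ({0..1} \<times> unit_disk) (\<lambda>x. K (unit_circ (fst x) * snd x) * W (snd x))"
    by (intro continuous_intros contK continuous_on_compose2[OF W(1)]) auto
  have "(\<lambda>x. indicator ({0..1} \<times> unit_disk) x *\<^sub>R (K (unit_circ (fst x) * snd x) * W (snd x))) \<in> borel_measurable borel"
    by (rule borel_measurable_continuous_on_indicator[OF _ contKW]) (auto simp: borel_Times)
  then have meas: "(\<lambda>(t, z). ?f t z) \<in> borel_measurable (lborel \<Otimes>\<^sub>M lborel)"
    by (simp add: lborel_prod split_beta')
  have "(\<integral>\<^sup>+z\<in>unit_disk. ennreal (K z * W z) \<partial>lborel)
     = (\<integral>\<^sup>+t\<in>{0..1::real}. (\<integral>\<^sup>+z\<in>unit_disk. ennreal (K z * W z) \<partial>lborel) \<partial>lborel)"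
    by (simp add: nn_integral_cmult_indicator)
  also have "\<dots> = (\<integral>\<^sup>+t. (\<integral>\<^sup>+z. ?f t z \<partial>lborel) \<partial>lborel)"
  proof (intro nn_integral_cong)
    fix t :: real
    have "(\<integral>\<^sup>+z\<in>unit_disk. ennreal (K z * W z) \<partial>lborel) = (\<integral>\<^sup>+z\<in>unit_disk. ennreal (K (unit_circ t * z) * W (unit_circ t * z)) \<partial>lborel)"
      by (rule nn_integral_rotate[symmetric, where F = "\<lambda>z. K z * W z"]) (auto intro!: continuous_intros mult_nonneg_nonneg K W)
    also have "\<dots> = (\<integral>\<^sup>+z\<in>unit_disk. ennreal (K (unit_circ t * z) * W z) \<partial>lborel)"
      by (rule nn_integral_disk_cong) (simp add: W)
    finally have e: "(\<integral>\<^sup>+z\<in>unit_disk. ennreal (K z * W z) \<partial>lborel) = (\<integral>\<^sup>+z\<in>unit_disk. ennreal (K (unit_circ t * z) * W z) \<partial>lborel)" .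
    show "(\<integral>\<^sup>+z\<in>unit_disk. ennreal (K z * W z) \<partial>lborel) * indicator {0..1} t = (\<integral>\<^sup>+z. ?f t z \<partial>lborel)"
      unfolding e by (cases "t \<in> {0..1}") (auto intro!: nn_integral_cong simp: indicator_def)
  qed
  also have "\<dots> = (\<integral>\<^sup>+z. (\<integral>\<^sup>+t. ?f t z \<partial>lborel) \<partial>lborel)"
    by (rule lborel_pair.Fubini'[OF meas, symmetric])
  also have "\<dots> = (\<integral>\<^sup>+z\<in>unit_disk. ennreal (integral {0..1} (\<lambda>t. K (unit_circ t * z)) * W z) \<partial>lborel)"
  proof (rule nn_integral_cong)
    fix z :: complex
    show "(\<integral>\<^sup>+t. ?f t z \<partial>lborel) = ennreal (integral {0..1} (\<lambda>t. K (unit_circ t * z)) * W z) * indicator unit_disk z"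
    proof (cases "z \<in> unit_disk")
      case True
      have "continuous_on {0..1} (\<lambda>t. K (unit_circ t * z))"
        using True by (intro continuous_on_compose2[OF K(1)] continuous_intros) (auto simp: norm_mult)
      then have "(\<lambda>t. K (unit_circ t * z)) integrable_on {0..1}" by (rule integrable_continuous_real)
      then have "((\<lambda>t. K (unit_circ t * z) * W z) has_integral integral {0..1} (\<lambda>t. K (unit_circ t * z)) * W z) {0..1}"
        by (intro has_integral_mult_left integrable_integral)
      moreover have "0 \<le> K (unit_circ t * z) * W z" for t
        using True by (intro mult_nonneg_nonneg K W) (auto simp: norm_mult)
      ultimately have "(\<integral>\<^sup>+t. ennreal (K (unit_circ t * z) * W z) * indicator {0..1} t \<partial>lborel) = ennreal (integral {0..1} (\<lambda>t. K (unit_circ t * z)) * W z)"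
        by (intro nn_integral_has_integral_lebesgue')
      moreover have "(\<integral>\<^sup>+t. ?f t z \<partial>lborel) = (\<integral>\<^sup>+t. ennreal (K (unit_circ t * z) * W z) * indicator {0..1} t \<partial>lborel)"
        using True by (intro nn_integral_cong) (auto simp: indicator_def)
      ultimately show ?thesis using True by simp
    qed simp
  qed
  finally show ?thesis .
qed

lemma Re_Cayley_quotient: "a \<noteq> b \<Longrightarrow> Re ((a + b) / (a - b)) = ((cmod a)\<^sup>2 - (cmod b)\<^sup>2) / (cmod (a - b))\<^sup>2"
  unfolding cmod_power2 by (simp add: Re_divide power2_eq_square) (simp add: algebra_simps)

text \<open>The strict contraction c < 1 keeps \<psi> of the circle of radius \<open>R\<close>
  strictly inside that circle. There |F|^p is dominated by its Poisson integral over the same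
  circle; after exchanging the integrals, the inner one over t is 1.\<close>

lemma Littlewood_circle_aux:
  fixes R :: real
  assumes F: "F holomorphic_on unit_disk" and psi: "\<psi> holomorphic_on unit_disk"
    and le: "\<And>z. cmod z < 1 \<Longrightarrow> cmod (\<psi> z) \<le> c * cmod z" and c: "c < 1"
    and R: "0 < R" "R < 1" and p: "1 \<le> p"
  shows "integral {0..1} (\<lambda>t. cmod (F (\<psi> (R * unit_circ t))) powr p) \<le> integral {0..1} (\<lambda>t. cmod (F (R * unit_circ t)) powr p)"
proof -
  define v where "v = (\<lambda>t. \<psi> (R * unit_circ t))"
  have nR: "cmod (R * unit_circ t) = R" for t using R by (simp add: norm_mult)
  have vR: "cmod (v t) < R" for t
  proof -
    have "cmod (v t) \<le> c * R" using le[of "R * unit_circ t"] R by (simp add: nR v_def)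
    also have "\<dots> < 1 * R" using c R by (intro mult_strict_right_mono) auto
    finally show ?thesis by simp
  qed
  have sub: "cball 0 R \<subseteq> unit_disk" using R by auto
  have contv: "continuous_on {0..1} v"
    unfolding v_def by (intro continuous_on_compose2[OF holomorphic_on_imp_continuous_on[OF psi]] continuous_intros)
      (use R in \<open>auto simp: norm_mult\<close>)
  have contF: "continuous_on {0..1} (\<lambda>t. F (R * unit_circ t))"
    by (intro continuous_on_compose2[OF holomorphic_on_imp_continuous_on[OF F]] continuous_intros)
      (use R in \<open>auto simp: norm_mult\<close>)
  have contFp: "continuous_on {0..1} (\<lambda>t. cmod (F (R * unit_circ t)) powr p)"
    using contF p by (intro continuous_on_powr' continuous_intros) auto
  have contFv: "continuous_on {0..1} (\<lambda>t. cmod (F (v t)) powr p)"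
  proof (intro continuous_on_powr' continuous_intros)
    show "continuous_on {0..1} (\<lambda>t. F (v t))"
      using less_trans[OF vR R(2)] by (intro continuous_on_compose2[OF holomorphic_on_imp_continuous_on[OF F] contv]) auto
  qed (use p in auto)
  let ?h = "\<lambda>t u. poisson R (v t) u * cmod (F (R * unit_circ u)) powr p"
  have conth: "continuous_on (cbox (0,0) (1,1)) (\<lambda>(t,u). ?h t u)"
    unfolding poisson_def split_beta'
    by (intro continuous_intros continuous_on_compose2[OF contFp] continuous_on_compose2[OF contv])
       (use poisson_denominator[OF vR] in \<open>auto simp: cbox_Pair_eq\<close>)
  \<comment> \<open>As a function of z, the kernel at \<psi> z is the real part of the Cayley
    quotient \<Phi>. Its mean over the circle is the value at the centre, and \<Phi> 0 = 1 because
    \<psi> 0 = 0.\<close>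
  have mean: "integral {0..1} (\<lambda>t. poisson R (v t) u) = 1" for u
  proof -
    define \<Phi> where "\<Phi> = (\<lambda>z. (R * unit_circ u + \<psi> z) / (R * unit_circ u - \<psi> z))"
    have nz: "R * unit_circ u - \<psi> z \<noteq> 0" if "cmod z \<le> R" for z
    proof -
      have "cmod (\<psi> z) \<le> c * cmod z" using le that R by simp
      moreover have "c * cmod z < R"
      proof (cases "c \<le> 0")
        case True then show ?thesis using mult_nonpos_nonneg[OF True norm_ge_zero[of z]] R by linarith
      next
        case False
        have "c * cmod z \<le> c * R" using False that by (intro mult_left_mono) auto
        also have "\<dots> < 1 * R" using c R by (intro mult_strict_right_mono) auto
        finally show ?thesis by simp
      qed
      ultimately show ?thesis by (intro poisson_denominator) auto
    qed
    have "\<Phi> holomorphic_on cball 0 R"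
      unfolding \<Phi>_def using nz by (intro holomorphic_intros holomorphic_on_subset[OF psi sub]) auto
    from has_integral_Re[OF Poisson_integral_formula[OF this, of 0]] R
    have "((\<lambda>t. Re (\<Phi> (R * unit_circ t))) has_integral Re (\<Phi> 0)) {0..1}" by (simp add: poisson_def norm_mult)
    moreover have "\<Phi> 0 = 1" using le[of 0] R by (simp add: \<Phi>_def)
    moreover have "Re (\<Phi> (R * unit_circ t)) = poisson R (v t) u" for t
      unfolding \<Phi>_def poisson_def using poisson_denominator[OF vR[of t], of u]
      by (subst Re_Cayley_quotient) (use R in \<open>auto simp: v_def norm_mult\<close>)
    ultimately show ?thesis by (simp add: integral_unique)
  qed
  have "integral {0..1} (\<lambda>t. cmod (F (v t)) powr p) \<le> integral {0..1} (\<lambda>t. integral {0..1} (?h t))"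
  proof (rule integral_le)
    show "(\<lambda>t. cmod (F (v t)) powr p) integrable_on {0..1}" by (rule integrable_continuous_real[OF contFv])
    show "(\<lambda>t. integral {0..1} (?h t)) integrable_on {0..1}"
      using integral_integrable_2dim[OF conth] by simp
    show "cmod (F (v t)) powr p \<le> integral {0..1} (?h t)" for t
      using powr_norm_le_poisson[OF holomorphic_on_subset[OF F sub] vR p] .
  qed
  also have "\<dots> = integral {0..1} (\<lambda>u. integral {0..1} (\<lambda>t. ?h t u))"
    using integral_swap_continuous[OF conth] by simp
  also have "\<dots> = integral {0..1} (\<lambda>u. cmod (F (R * unit_circ u)) powr p)"
    by (simp add: mean)
  finally show ?thesis by (simp add: v_def)
qed

text \<open>Conjugating \<psi> by the rotation that takes |z| to z reduces an arbitrary circle point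
  to a positive radius.\<close>

lemma Littlewood_circle:
  assumes F: "F holomorphic_on unit_disk" and psi: "\<psi> holomorphic_on unit_disk"
    and le: "\<And>z. cmod z < 1 \<Longrightarrow> cmod (\<psi> z) \<le> c * cmod z" and c: "c < 1"
    and z: "cmod z < 1" and p: "1 \<le> p"
  shows "integral {0..1} (\<lambda>t. cmod (F (\<psi> (unit_circ t * z))) powr p) \<le> integral {0..1} (\<lambda>t. cmod (F (unit_circ t * z)) powr p)"
proof (cases "z = 0")
  case True
  then show ?thesis using le[of 0] by simp
next
  case False
  define e where "e = z / cmod z"
  have e: "cmod e = 1" "z = e * cmod z" using False by (auto simp: e_def norm_divide)
  have "(*) e ` unit_disk \<subseteq> unit_disk" using e by (auto simp: norm_mult)
  from holomorphic_on_compose_gen[OF _ F this] holomorphic_on_compose_gen[OF _ psi this]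
  have hol: "(\<lambda>w. F (e * w)) holomorphic_on unit_disk" "(\<lambda>w. \<psi> (e * w) / e) holomorphic_on unit_disk"
    using e by (auto simp: comp_def intro!: holomorphic_intros)
  have "cmod (\<psi> (e * w) / e) \<le> c * cmod w" if "cmod w < 1" for w
    using le[of "e * w"] that e by (simp add: norm_mult norm_divide)
  moreover have "e \<noteq> 0" using e(1) by auto
  ultimately
  have "integral {0..1} (\<lambda>t. cmod (F (\<psi> (e * (of_real (cmod z) * unit_circ t)))) powr p)
    \<le> integral {0..1} (\<lambda>t. cmod (F (e * (of_real (cmod z) * unit_circ t))) powr p)"
    using Littlewood_circle_aux[OF hol _ c _ z p] False by auto
  moreover have "e * (of_real (cmod z) * unit_circ t) = unit_circ t * z" for t
    by (subst e(2)) (simp add: mult_ac)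
  ultimately show ?thesis by simp
qed

lemma continuous_on_radial_powr: "continuous_on unit_disk (\<lambda>z. (1 - (cmod z)\<^sup>2) powr s)"
  by (intro continuous_on_powr continuous_intros) (auto simp: abs_square_eq_1)

text \<open>By the Schwarz lemma c * \<psi> with c < 1 is a strict contraction in the sense of the
  circle estimate. Integrate that estimate against the radial weight, then let c tend to 1 and use
  Fatou's lemma.\<close>

lemma Littlewood_subordination:
  assumes F: "F holomorphic_on unit_disk" and psi: "disk_self_map \<psi>" "\<psi> 0 = 0" and p: "1 \<le> p"
  shows "(\<integral>\<^sup>+z\<in>unit_disk. ennreal (cmod (F (\<psi> z)) powr p * (1 - (cmod z)\<^sup>2) powr s) \<partial>lborel)
    \<le> (\<integral>\<^sup>+z\<in>unit_disk. ennreal (cmod (F z) powr p * (1 - (cmod z)\<^sup>2) powr s) \<partial>lborel)"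
proof -
  define c where "c = (\<lambda>n::nat. 1 - 1 / (real n + 1))"
  have c: "0 \<le> c n" "c n < 1" for n by (auto simp: c_def field_simps)
  have clim: "c \<longlonglongrightarrow> 1" unfolding c_def by real_asymp
  have W: "continuous_on unit_disk (\<lambda>z. (1 - (cmod z)\<^sup>2) powr s)" by (rule continuous_on_radial_powr)
  have contF: "continuous_on unit_disk F" by (rule holomorphic_on_imp_continuous_on[OF F])
  have contpsi: "continuous_on unit_disk \<psi>" by (rule holomorphic_on_imp_continuous_on[OF disk_self_mapD(1)[OF psi(1)]])
  have psin: "cmod (c n * \<psi> z) \<le> c n * cmod z" if "cmod z < 1" for n z
    using Schwarz_lemma_disk[OF psi that] c[of n] by (simp add: norm_mult mult_left_mono)
  have psiless: "cmod (c n * \<psi> z) < 1" if "cmod z < 1" for n z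
    using disk_self_mapD(2)[OF psi(1) that] c[of n]
    by (simp add: norm_mult) (metis less_eq_real_def mult_left_le_one_le norm_ge_zero order_le_less_trans)
  have contn: "continuous_on unit_disk (\<lambda>z. F (c n * \<psi> z))" for n
    by (intro continuous_on_compose2[OF contF] continuous_intros contpsi) (use psiless in \<open>auto simp: in_disk_iff\<close>)
  have powc: "continuous_on unit_disk (\<lambda>z. cmod (g z) powr p)" if "continuous_on unit_disk g" for g
    using that p by (intro continuous_on_powr' continuous_intros) auto
  have step: "(\<integral>\<^sup>+z\<in>unit_disk. ennreal (cmod (F (c n * \<psi> z)) powr p * (1 - (cmod z)\<^sup>2) powr s) \<partial>lborel)
    \<le> (\<integral>\<^sup>+z\<in>unit_disk. ennreal (cmod (F z) powr p * (1 - (cmod z)\<^sup>2) powr s) \<partial>lborel)" for n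
  proof -
    have "(\<integral>\<^sup>+z\<in>unit_disk. ennreal (cmod (F (c n * \<psi> z)) powr p * (1 - (cmod z)\<^sup>2) powr s) \<partial>lborel)
      = (\<integral>\<^sup>+z\<in>unit_disk. ennreal (integral {0..1} (\<lambda>t. cmod (F (c n * \<psi> (unit_circ t * z))) powr p) * (1 - (cmod z)\<^sup>2) powr s) \<partial>lborel)"
      by (rule nn_integral_circle_mean[OF powc[OF contn] _ W]) (auto simp: norm_mult)
    also have "\<dots> \<le> (\<integral>\<^sup>+z\<in>unit_disk. ennreal (integral {0..1} (\<lambda>t. cmod (F (unit_circ t * z)) powr p) * (1 - (cmod z)\<^sup>2) powr s) \<partial>lborel)"
    proof (rule nn_integral_disk_mono)
      fix z :: complex assume z: "cmod z < 1"
      have "(\<lambda>z. c n * \<psi> z) holomorphic_on unit_disk" by (intro holomorphic_intros disk_self_mapD(1) psi)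
      from Littlewood_circle[OF F this psin c(2) z p]
      show "ennreal (integral {0..1} (\<lambda>t. cmod (F (c n * \<psi> (unit_circ t * z))) powr p) * (1 - (cmod z)\<^sup>2) powr s)
         \<le> ennreal (integral {0..1} (\<lambda>t. cmod (F (unit_circ t * z)) powr p) * (1 - (cmod z)\<^sup>2) powr s)"
        by (intro ennreal_leI mult_right_mono) auto
    qed
    also have "\<dots> = (\<integral>\<^sup>+z\<in>unit_disk. ennreal (cmod (F z) powr p * (1 - (cmod z)\<^sup>2) powr s) \<partial>lborel)"
      by (rule nn_integral_circle_mean[OF powc[OF contF] _ W, symmetric]) (auto simp: norm_mult)
    finally show ?thesis .
  qed
  have "(\<integral>\<^sup>+z\<in>unit_disk. ennreal (cmod (F (\<psi> z)) powr p * (1 - (cmod z)\<^sup>2) powr s) \<partial>lborel)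
    = (\<integral>\<^sup>+z. liminf (\<lambda>n. ennreal (cmod (F (c n * \<psi> z)) powr p * (1 - (cmod z)\<^sup>2) powr s) * indicator unit_disk z) \<partial>lborel)"
  proof (rule nn_integral_cong)
    fix z :: complex
    show "ennreal (cmod (F (\<psi> z)) powr p * (1 - (cmod z)\<^sup>2) powr s) * indicator unit_disk z =
      liminf (\<lambda>n. ennreal (cmod (F (c n * \<psi> z)) powr p * (1 - (cmod z)\<^sup>2) powr s) * indicator unit_disk z)"
    proof (cases "z \<in> unit_disk")
      case True
      then have "\<psi> z \<in> unit_disk" using disk_self_mapD(2)[OF psi(1)] by (simp add: in_disk_iff)
      then have "isCont F (\<psi> z)" using contF by (simp add: continuous_on_eq_continuous_at)
      moreover have "(\<lambda>n. c n * \<psi> z) \<longlonglongrightarrow> \<psi> z"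
        using tendsto_mult[OF tendsto_of_real[OF clim, where 'a=complex] tendsto_const[of "\<psi> z"]] by simp
      ultimately have "(\<lambda>n. F (c n * \<psi> z)) \<longlonglongrightarrow> F (\<psi> z)" by (rule isCont_tendsto_compose)
      then have "(\<lambda>n. cmod (F (c n * \<psi> z)) powr p) \<longlonglongrightarrow> cmod (F (\<psi> z)) powr p"
        using p by (intro tendsto_powr' tendsto_norm tendsto_const) auto
      then have "(\<lambda>n. ennreal (cmod (F (c n * \<psi> z)) powr p * (1 - (cmod z)\<^sup>2) powr s)) \<longlonglongrightarrow> ennreal (cmod (F (\<psi> z)) powr p * (1 - (cmod z)\<^sup>2) powr s)"
        by (intro tendsto_ennrealI tendsto_mult tendsto_const)
      from lim_imp_Liminf[OF _ this] True show ?thesis by simp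
    qed (simp add: Liminf_const)
  qed
  also have "\<dots> \<le> liminf (\<lambda>n. \<integral>\<^sup>+z. ennreal (cmod (F (c n * \<psi> z)) powr p * (1 - (cmod z)\<^sup>2) powr s) * indicator unit_disk z \<partial>lborel)"
    by (rule nn_integral_liminf) (auto intro!: borel_measurable_indicator_ennreal continuous_intros powc contn W)
  also have "\<dots> \<le> (\<integral>\<^sup>+z\<in>unit_disk. ennreal (cmod (F z) powr p * (1 - (cmod z)\<^sup>2) powr s) \<partial>lborel)"
    using step by (intro order_trans[OF Liminf_le_Limsup Limsup_bounded] always_eventually) auto
  finally show ?thesis .
qed

text \<open>The two branches of admissibility need different arguments. For p \<ge> 2, Schwarz--Pick
  absorbs p - 2 powers of |\<psi>'| into the weight, the Schwarz lemma handles the remaining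
  exponent s - p + 2, and the area formula for the univalent \<psi> finishes. For p < 2 there are
  fewer than two powers of |\<psi>'|, and one interpolates between the area formula and Littlewood
  subordination.\<close>

lemma dirichlet_energy_subordinate:
  assumes psi: "disk_self_map \<psi>" "inj_on \<psi> unit_disk" "\<psi> 0 = 0" and F: "F holomorphic_on unit_disk"
    and p: "1 < p" and ps: "2 \<le> p \<and> p - 2 < s \<or> p < 2 \<and> 0 \<le> s"
  shows "dirichlet_energy p s (\<lambda>z. F (\<psi> z)) \<le> dirichlet_energy p s F"
proof -
  let ?G = "\<lambda>w. cmod (deriv F w) powr p * (1 - (cmod w)\<^sup>2) powr s"
  have holF': "deriv F holomorphic_on unit_disk" by (intro holomorphic_deriv F) auto
  have contG: "continuous_on unit_disk ?G"
    using p by (intro continuous_on_norm_powr_weight holomorphic_on_imp_continuous_on holF') auto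
  have sub: "\<psi> ` unit_disk \<subseteq> unit_disk" using psi(1) by (simp add: disk_self_map_def)
  have conf: "(\<integral>\<^sup>+z\<in>unit_disk. ennreal (?G (\<psi> z) * (cmod (deriv \<psi> z))\<^sup>2) \<partial>lborel) \<le> dirichlet_energy p s F"
  proof -
    have "(\<integral>\<^sup>+z\<in>unit_disk. ennreal (?G (\<psi> z) * (cmod (deriv \<psi> z))\<^sup>2) \<partial>lborel) \<le> (\<integral>\<^sup>+w\<in>\<psi> ` unit_disk. ennreal (?G w) \<partial>lborel)"
      by (intro nn_integral_conformal_image open_ball disk_self_mapD(1) psi continuous_on_subset[OF contG sub]) auto
    also have "\<dots> \<le> dirichlet_energy p s F"
      unfolding dirichlet_energy_def using sub
      by (intro nn_integral_mono mult_left_mono) (auto simp: indicator_def)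
    finally show ?thesis .
  qed
  have deriv: "deriv (\<lambda>z. F (\<psi> z)) z = deriv F (\<psi> z) * deriv \<psi> z" if z: "cmod z < 1" for z
  proof -
    have "(F has_field_derivative deriv F (\<psi> z)) (at (\<psi> z))"
      using disk_self_mapD(2)[OF psi(1) z] F by (intro holomorphic_derivI) (auto simp: in_disk_iff)
    moreover have "(\<psi> has_field_derivative deriv \<psi> z) (at z)"
      using z disk_self_mapD(1)[OF psi(1)] by (intro holomorphic_derivI) (auto simp: in_disk_iff)
    ultimately show ?thesis by (intro DERIV_imp_deriv DERIV_chain2)
  qed
  have Schwarz: "1 - (cmod z)\<^sup>2 \<le> 1 - (cmod (\<psi> z))\<^sup>2" if z: "cmod z < 1" for z
    using Schwarz_lemma_disk[OF psi(1,3) z] by (simp add: power_mono)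
  show ?thesis
  proof (cases "2 \<le> p")
    case True
    have "dirichlet_energy p s (\<lambda>z. F (\<psi> z)) \<le> (\<integral>\<^sup>+z\<in>unit_disk. ennreal (?G (\<psi> z) * (cmod (deriv \<psi> z))\<^sup>2) \<partial>lborel)"
      unfolding dirichlet_energy_def
    proof (intro nn_integral_disk_mono ennreal_leI)
      fix z :: complex assume z: "cmod z < 1"
      let ?d = "cmod (deriv \<psi> z)" and ?x = "1 - (cmod z)\<^sup>2" and ?y = "1 - (cmod (\<psi> z))\<^sup>2"
      have pos: "0 < ?x" "0 < ?y" using z disk_self_mapD(2)[OF psi(1) z] one_minus_norm_sq_pos by auto
      have dx: "?d * ?x \<le> ?y" by (rule Schwarz_Pick_deriv[OF psi(1) z])
      have "?d powr p * ?x powr s = (if ?d = 0 then 0 else ?d\<^sup>2 * (?d * ?x) powr (p - 2) * ?x powr (s - p + 2))"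
      proof -
        have "?d powr p = ?d\<^sup>2 * ?d powr (p - 2)" if "?d \<noteq> 0" using that by (simp add: powr_diff)
        moreover have "?x powr s = ?x powr (p - 2) * ?x powr (s - p + 2)" by (simp add: powr_add[symmetric])
        ultimately show ?thesis using pos by (auto simp: powr_mult)
      qed
      also have "\<dots> \<le> ?d\<^sup>2 * ?y powr (p - 2) * ?y powr (s - p + 2)"
        using dx Schwarz[OF z] pos True ps
        by (auto intro!: mult_mono powr_mono2 mult_nonneg_nonneg)
      also have "\<dots> = ?d\<^sup>2 * ?y powr s" by (simp add: powr_add[symmetric])
      finally have "cmod (deriv F (\<psi> z)) powr p * (?d powr p * ?x powr s) \<le> cmod (deriv F (\<psi> z)) powr p * (?d\<^sup>2 * ?y powr s)"
        by (intro mult_left_mono) auto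
      then show "cmod (deriv (\<lambda>z. F (\<psi> z)) z) powr p * ?x powr s \<le> ?G (\<psi> z) * ?d\<^sup>2"
        by (simp add: deriv[OF z] norm_mult powr_mult mult_ac)
    qed
    then show ?thesis using conf by (rule order_trans)
  next
    case False
    then have p2: "p < 2" and s: "0 \<le> s" using ps by auto
    \<comment> \<open>Since |\<psi>'|^p = (|\<psi>'|^2)^\<theta>, the integrand is at most the
      geometric mean of \<open>?A\<close> and \<open>?B\<close> with weights \<theta> and 1 -
      \<theta>. \<open>?A\<close> is integrated by the area formula, \<open>?B\<close> by Littlewood
      subordination.\<close>
    define \<theta> where "\<theta> = p / 2"
    have th: "0 < \<theta>" "\<theta> < 1" using p p2 by (auto simp: \<theta>_def)
    let ?A = "\<lambda>z. ?G (\<psi> z) * (cmod (deriv \<psi> z))\<^sup>2"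
    let ?B = "\<lambda>z. cmod (deriv F (\<psi> z)) powr p * (1 - (cmod z)\<^sup>2) powr s"
    have contpsi: "continuous_on unit_disk \<psi>" by (rule holomorphic_on_imp_continuous_on[OF disk_self_mapD(1)[OF psi(1)]])
    have contA: "continuous_on unit_disk ?A"
      using sub by (intro continuous_intros continuous_on_compose2[OF contG contpsi] holomorphic_on_imp_continuous_on holomorphic_deriv disk_self_mapD(1) psi) auto
    have contB: "continuous_on unit_disk ?B"
      using sub p by (intro continuous_on_norm_powr_weight continuous_on_compose2[OF holomorphic_on_imp_continuous_on[OF holF'] contpsi]) auto
    have "dirichlet_energy p s (\<lambda>z. F (\<psi> z)) \<le> (\<integral>\<^sup>+z\<in>unit_disk. ennreal (\<theta> * ?A z + (1 - \<theta>) * ?B z) \<partial>lborel)"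
      unfolding dirichlet_energy_def
    proof (intro nn_integral_disk_mono ennreal_leI)
      fix z :: complex assume z: "cmod z < 1"
      let ?d = "cmod (deriv \<psi> z)" and ?x = "1 - (cmod z)\<^sup>2" and ?y = "1 - (cmod (\<psi> z))\<^sup>2" and ?f = "cmod (deriv F (\<psi> z))"
      have pos: "0 < ?x" "0 < ?y" using z disk_self_mapD(2)[OF psi(1) z] one_minus_norm_sq_pos by auto
      show "cmod (deriv (\<lambda>z. F (\<psi> z)) z) powr p * ?x powr s \<le> \<theta> * ?A z + (1 - \<theta>) * ?B z"
      proof (cases "?d = 0 \<or> ?f = 0")
        case True
        then show ?thesis using th by (auto simp: deriv[OF z] norm_mult)
      next
        case False
        then have AB: "0 < ?A z" "0 < ?B z" using pos by auto
        have "cmod (deriv (\<lambda>z. F (\<psi> z)) z) powr p * ?x powr s = ?f powr p * (?d\<^sup>2) powr \<theta> * (?x powr (s * \<theta>) * ?x powr (s * (1 - \<theta>)))"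
        proof -
          have "(?d\<^sup>2) powr \<theta> = ?d powr p" using False by (simp add: \<theta>_def powr_powr powr_realpow[symmetric] del: powr_numeral)
          moreover have "?x powr (s * \<theta>) * ?x powr (s * (1 - \<theta>)) = ?x powr s" by (simp add: powr_add[symmetric] algebra_simps)
          ultimately show ?thesis by (simp add: deriv[OF z] norm_mult powr_mult mult_ac)
        qed
        also have "\<dots> \<le> ?f powr p * (?d\<^sup>2) powr \<theta> * (?y powr (s * \<theta>) * ?x powr (s * (1 - \<theta>)))"
          using Schwarz[OF z] pos s th by (intro mult_left_mono mult_right_mono powr_mono2) auto
        also have "\<dots> = ?A z powr \<theta> * ?B z powr (1 - \<theta>)"
        proof -
          have f: "?f powr p = ?f powr (p * \<theta>) * ?f powr (p * (1 - \<theta>))" by (simp add: powr_add[symmetric] algebra_simps)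
          have "?A z powr \<theta> = ?f powr (p * \<theta>) * ?y powr (s * \<theta>) * (?d\<^sup>2) powr \<theta>"
            "?B z powr (1 - \<theta>) = ?f powr (p * (1 - \<theta>)) * ?x powr (s * (1 - \<theta>))"
            by (simp_all add: powr_mult powr_powr)
          then show ?thesis unfolding f by (simp only: mult_ac)
        qed
        also have "\<dots> \<le> \<theta> * ?A z + (1 - \<theta>) * ?B z"
          using th AB by (intro Youngs_inequality_0) auto
        finally show ?thesis .
      qed
    qed
    also have "\<dots> = ennreal \<theta> * (\<integral>\<^sup>+z\<in>unit_disk. ennreal (?A z) \<partial>lborel) + ennreal (1 - \<theta>) * (\<integral>\<^sup>+z\<in>unit_disk. ennreal (?B z) \<partial>lborel)"
    proof -
      have "ennreal (\<theta> * ?A z + (1 - \<theta>) * ?B z) * indicator unit_disk z = ennreal \<theta> * (ennreal (?A z) * indicator unit_disk z) + ennreal (1 - \<theta>) * (ennreal (?B z) * indicator unit_disk z)" for z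
        using th by (auto simp: indicator_def ennreal_mult)
      then show ?thesis
        using borel_measurable_indicator_ennreal[OF contA] borel_measurable_indicator_ennreal[OF contB]
        by (simp add: nn_integral_add nn_integral_cmult)
    qed
    also have "\<dots> \<le> ennreal \<theta> * dirichlet_energy p s F + ennreal (1 - \<theta>) * dirichlet_energy p s F"
      using Littlewood_subordination[OF holF' psi(1,3), of p s] p
      by (intro add_mono mult_left_mono conf) (auto simp: dirichlet_energy_def)
    also have "\<dots> = dirichlet_energy p s F"
      using th by (simp add: distrib_right[symmetric] ennreal_plus[symmetric] del: ennreal_plus)
    finally show ?thesis .
  qed
qed

text \<open>Subharmonicity of |g'|^p on every circle, integrated against the radial weight. This is
  how energies control derivatives at single points.\<close>

lemma powr_norm_deriv_le_dirichlet_energy: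
  assumes g: "g holomorphic_on unit_disk" and p: "1 \<le> p"
  shows "ennreal (cmod (deriv g 0) powr p) * (\<integral>\<^sup>+z\<in>unit_disk. ennreal ((1 - (cmod z)\<^sup>2) powr s) \<partial>lborel) \<le> dirichlet_energy p s g"
proof -
  let ?W = "\<lambda>z. (1 - (cmod z)\<^sup>2) powr s"
  have holg': "deriv g holomorphic_on unit_disk" by (intro holomorphic_deriv g) auto
  have "ennreal (cmod (deriv g 0) powr p) * (\<integral>\<^sup>+z\<in>unit_disk. ennreal (?W z) \<partial>lborel) = (\<integral>\<^sup>+z\<in>unit_disk. ennreal (cmod (deriv g 0) powr p * ?W z) \<partial>lborel)"
    using borel_measurable_indicator_ennreal[OF continuous_on_radial_powr[of s]]
    by (subst nn_integral_cmult[symmetric]) (auto intro!: nn_integral_cong simp: ennreal_mult mult.assoc)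
  also have "\<dots> \<le> (\<integral>\<^sup>+z\<in>unit_disk. ennreal (integral {0..1} (\<lambda>t. cmod (deriv g (unit_circ t * z)) powr p) * ?W z) \<partial>lborel)"
    by (intro nn_integral_disk_mono ennreal_leI mult_right_mono powr_norm_le_circle_mean[OF holg' _ p]) auto
  also have "\<dots> = dirichlet_energy p s g"
    unfolding dirichlet_energy_def using p
    by (intro nn_integral_circle_mean[symmetric] continuous_on_radial_powr continuous_on_powr' continuous_intros
         holomorphic_on_imp_continuous_on[OF holg']) (auto simp: norm_mult)
  finally show ?thesis .
qed

subsection \<open>Energies and the spaces of Dirichlet--Morrey type\<close>

text \<open>The quantity W f a of the overview; see \<open>M_weight_eq\<close>. Subtracting the
  constant f a leaves the derivative unchanged, and the function it normalises vanishes at 0, so the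
  point evaluation in \<open>D_norm\<close> contributes nothing.\<close>

definition morrey_energy :: "real \<Rightarrow> real \<Rightarrow> real \<Rightarrow> (complex \<Rightarrow> complex) \<Rightarrow> complex \<Rightarrow> ennreal" where
  "morrey_energy \<alpha> p s f a =
     ennreal ((1 - (cmod a)\<^sup>2) powr (\<alpha> * p)) * dirichlet_energy p s (\<lambda>z. f (disk_aut a z))"

lemma dirichlet_energy_cong:
  assumes "\<And>z. cmod z < 1 \<Longrightarrow> f z = g z"
  shows "dirichlet_energy p s f = dirichlet_energy p s g"
proof -
  have "deriv f z = deriv g z" if "cmod z < 1" for z
  proof (rule deriv_cong_ev)
    show "\<forall>\<^sub>F x in nhds z. f x = g x"
      by (rule eventually_mono[OF eventually_nhds_in_open[of unit_disk z]]) (use that assms in \<open>auto simp: in_disk_iff\<close>)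
  qed simp
  then show ?thesis unfolding dirichlet_energy_def by (intro nn_integral_disk_cong) simp
qed

lemma morrey_energy_cong:
  assumes "\<And>z. cmod z < 1 \<Longrightarrow> f z = g z" "cmod a < 1"
  shows "morrey_energy \<alpha> p s f a = morrey_energy \<alpha> p s g a"
  unfolding morrey_energy_def using assms norm_disk_aut_less_1
  by (intro arg_cong2[where f = "(*)"] dirichlet_energy_cong) auto

lemma holomorphic_compose_disk_aut:
  "cmod a < 1 \<Longrightarrow> f holomorphic_on unit_disk \<Longrightarrow> (\<lambda>z. f (disk_aut a z)) holomorphic_on unit_disk"
  using holomorphic_on_compose_gen[OF holomorphic_disk_aut, of a f unit_disk] disk_aut_image[of a]
  by (auto simp: comp_def)

lemma holomorphic_compose_self_map:
  "disk_self_map \<phi> \<Longrightarrow> f holomorphic_on unit_disk \<Longrightarrow> (\<lambda>z. f (\<phi> z)) holomorphic_on unit_disk"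
  using holomorphic_on_compose_gen[of \<phi> unit_disk f unit_disk]
  by (auto simp: comp_def disk_self_map_def)

lemma dirichlet_energy_diff_const:
  assumes "f holomorphic_on unit_disk"
  shows "dirichlet_energy p s (\<lambda>z. f z - c) = dirichlet_energy p s f"
proof -
  have "deriv (\<lambda>z. f z - c) z = deriv f z" if "cmod z < 1" for z
    using holomorphic_on_imp_differentiable_at[OF assms, of z] that by (simp add: in_disk_iff del: mem_ball_0)
  then show ?thesis unfolding dirichlet_energy_def by (intro nn_integral_disk_cong) simp
qed

lemma M_weight_eq:
  assumes f: "f holomorphic_on unit_disk" and a: "cmod a < 1" and p: "0 < p"
  shows "M_weight \<alpha> p s f a = ennreal_powr (morrey_energy \<alpha> p s f a) (1 / p)"
proof -
  define c where "c = 1 - (cmod a)\<^sup>2"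
  have c: "0 < c" using one_minus_norm_sq_pos[OF a] by (simp add: c_def)
  define X where "X = dirichlet_energy p s (\<lambda>z. f (disk_aut a z))"
  have "D_norm p s (\<lambda>z. f (disk_aut a z) - f a) = ennreal_powr X (1/p)"
    unfolding D_norm_def X_def
    using dirichlet_energy_diff_const[OF holomorphic_compose_disk_aut[OF a f], of p s "f a"]
    by (simp add: dirichlet_energy_def)
  then have "M_weight \<alpha> p s f a = ennreal (c powr \<alpha>) * ennreal_powr X (1/p)"
    by (simp add: M_weight_def c_def)
  also have "\<dots> = ennreal_powr (ennreal (c powr (\<alpha> * p)) * X) (1/p)"
  proof (cases X)
    case (real x)
    then show ?thesis using c p
      by (simp add: ennreal_powr_def ennreal_mult[symmetric] powr_mult powr_powr)
  next
    case top
    then show ?thesis using c by (simp add: ennreal_powr_def ennreal_mult_top)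
  qed
  finally show ?thesis by (simp add: morrey_energy_def X_def c_def)
qed

lemma ennreal_powr_mono: "x \<le> y \<Longrightarrow> 0 < r \<Longrightarrow> ennreal_powr x r \<le> ennreal_powr y r"
  by (auto simp: ennreal_powr_def top_unique less_top[symmetric] intro!: ennreal_leI powr_mono2 enn2real_mono)

lemma ennreal_powr_ennreal: "0 \<le> x \<Longrightarrow> ennreal_powr (ennreal x) r = ennreal (x powr r)"
  by (simp add: ennreal_powr_def)

lemma ennreal_powr_inverse: "0 < r \<Longrightarrow> ennreal_powr (ennreal_powr x r) (1 / r) = x"
  by (cases x) (auto simp: ennreal_powr_def powr_powr)

lemma ennreal_powr_less_top_iff: "ennreal_powr x r < \<infinity> \<longleftrightarrow> x < \<infinity>"
  by (auto simp: ennreal_powr_def less_top)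

lemma tendsto_ennreal_powr_0:
  assumes "(f \<longlongrightarrow> 0) F" "0 < r"
  shows "((\<lambda>x. ennreal_powr (f x) r) \<longlongrightarrow> 0) F"
proof (rule order_tendstoI)
  fix e :: ennreal assume "0 < e"
  then obtain d where d: "0 < d" "ennreal d < e"
    by (metis dense ennreal_cases ennreal_less_zero_iff infinity_ennreal_def less_top_ennreal top.not_eq_extremum order_less_trans)
  have "\<forall>\<^sub>F x in F. f x < ennreal (d powr (1/r))"
    using assms d by (intro order_tendstoD(2)[of f 0]) auto
  then show "\<forall>\<^sub>F x in F. ennreal_powr (f x) r < e"
  proof (rule eventually_mono)
    fix x assume "f x < ennreal (d powr (1/r))"
    then have "ennreal_powr (f x) r \<le> ennreal_powr (ennreal (d powr (1/r))) r"
      using assms by (intro ennreal_powr_mono) auto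
    also have "\<dots> = ennreal d" using d assms by (simp add: ennreal_powr_ennreal powr_powr)
    finally show "ennreal_powr (f x) r < e" using d by simp
  qed
qed simp

lemma tendsto_ennreal_powr_0_iff:
  assumes "0 < r"
  shows "((\<lambda>x. ennreal_powr (f x) r) \<longlongrightarrow> 0) F \<longleftrightarrow> (f \<longlongrightarrow> 0) F"
  using tendsto_ennreal_powr_0[of f F r] tendsto_ennreal_powr_0[of "\<lambda>x. ennreal_powr (f x) r" F "1/r"] assms
  by (auto simp: ennreal_powr_inverse)

lemma tendsto_ennreal_0_iff:
  "((f :: 'a \<Rightarrow> ennreal) \<longlongrightarrow> 0) F \<longleftrightarrow> (\<forall>e>0. \<forall>\<^sub>F x in F. f x \<le> ennreal e)"
proof
  assume lim: "(f \<longlongrightarrow> 0) F"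
  show "\<forall>e>0. \<forall>\<^sub>F x in F. f x \<le> ennreal e"
    using order_tendstoD(2)[OF lim] by (auto intro!: eventually_mono[OF order_tendstoD(2)[OF lim] less_imp_le])
next
  assume *: "\<forall>e>0. \<forall>\<^sub>F x in F. f x \<le> ennreal e"
  show "(f \<longlongrightarrow> 0) F"
  proof (rule order_tendstoI)
    fix e :: ennreal assume "0 < e"
    then obtain d where d: "0 < d" "ennreal d < e"
      by (metis dense ennreal_cases ennreal_less_zero_iff infinity_ennreal_def less_top_ennreal top.not_eq_extremum order_less_trans)
    then show "\<forall>\<^sub>F x in F. f x < e" using * by (auto elim!: eventually_mono)
  qed simp
qed

lemma eventually_to_unit_circle: "eventually P to_unit_circle \<longleftrightarrow> (\<exists>r<1. \<forall>z. r < cmod z \<and> cmod z < 1 \<longrightarrow> P z)"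
proof
  assume "eventually P to_unit_circle"
  then obtain Q where Q: "eventually Q (at_left (1::real))" "\<And>z. Q (cmod z) \<Longrightarrow> P z"
    by (auto simp: to_unit_circle_def eventually_filtercomap)
  from Q(1) obtain b where "b < 1" "\<forall>y>b. y < 1 \<longrightarrow> Q y"
    by (auto simp: eventually_at_left_field)
  then show "\<exists>r<1. \<forall>z. r < cmod z \<and> cmod z < 1 \<longrightarrow> P z" using Q(2) by blast
next
  assume "\<exists>r<1. \<forall>z. r < cmod z \<and> cmod z < 1 \<longrightarrow> P z"
  then obtain r where "r < 1" "\<forall>z. r < cmod z \<and> cmod z < 1 \<longrightarrow> P z" by auto
  then show "eventually P to_unit_circle"
    unfolding to_unit_circle_def eventually_filtercomap
    by (intro exI[of _ "\<lambda>x. r < x \<and> x < 1"]) (auto simp: eventually_at_left_field)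
qed

lemma sum_powr_le:
  fixes a b p :: real
  assumes "0 \<le> a" "0 \<le> b" "0 \<le> p"
  shows "(a + b) powr p \<le> 2 powr p * (a powr p + b powr p)"
proof -
  have "(a + b) powr p \<le> (2 * max a b) powr p" using assms by (intro powr_mono2) auto
  also have "\<dots> = 2 powr p * (max a b) powr p" using assms by (simp add: powr_mult)
  also have "(max a b) powr p \<le> a powr p + b powr p" using assms by (auto simp: max_def)
  finally show ?thesis by simp
qed

lemma borel_measurable_energy_density:
  assumes "g holomorphic_on unit_disk" "0 < p"
  shows "(\<lambda>z. ennreal (cmod (deriv g z) powr p * (1 - (cmod z)\<^sup>2) powr s) * indicator unit_disk z) \<in> borel_measurable borel"
  by (intro borel_measurable_indicator_ennreal continuous_on_norm_powr_weight holomorphic_on_imp_continuous_on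
      holomorphic_deriv assms) auto

text \<open>A quasi-triangle inequality in place of the one for norms. A constant is harmless
  wherever only finiteness or convergence to 0 is at stake.\<close>

lemma dirichlet_energy_diff_le:
  assumes f: "f holomorphic_on unit_disk" and g: "g holomorphic_on unit_disk" and p: "0 < p"
  shows "dirichlet_energy p s (\<lambda>z. f z - g z) \<le> ennreal (2 powr p) * (dirichlet_energy p s f + dirichlet_energy p s g)"
proof -
  have d: "deriv (\<lambda>z. f z - g z) z = deriv f z - deriv g z" if "cmod z < 1" for z
    using holomorphic_on_imp_differentiable_at[OF f, of z] holomorphic_on_imp_differentiable_at[OF g, of z] that
    by (simp add: in_disk_iff del: mem_ball_0)
  have "dirichlet_energy p s (\<lambda>z. f z - g z) \<le>
     (\<integral>\<^sup>+z. ennreal (2 powr p) * (ennreal (cmod (deriv f z) powr p * (1 - (cmod z)\<^sup>2) powr s) * indicator unit_disk z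
        + ennreal (cmod (deriv g z) powr p * (1 - (cmod z)\<^sup>2) powr s) * indicator unit_disk z) \<partial>lborel)"
    unfolding dirichlet_energy_def
  proof (rule nn_integral_mono)
    fix z :: complex
    let ?w = "(1 - (cmod z)\<^sup>2) powr s"
    show "ennreal (cmod (deriv (\<lambda>z. f z - g z) z) powr p * ?w) * indicator unit_disk z \<le>
      ennreal (2 powr p) * (ennreal (cmod (deriv f z) powr p * ?w) * indicator unit_disk z + ennreal (cmod (deriv g z) powr p * ?w) * indicator unit_disk z)"
    proof (cases "z \<in> unit_disk")
      case True
      then have z: "cmod z < 1" by simp
      have "cmod (deriv f z - deriv g z) powr p \<le> (cmod (deriv f z) + cmod (deriv g z)) powr p"
        using p by (intro powr_mono2 norm_triangle_ineq4) auto
      also have "\<dots> \<le> 2 powr p * (cmod (deriv f z) powr p + cmod (deriv g z) powr p)"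
        using p by (intro sum_powr_le) auto
      finally have "cmod (deriv f z - deriv g z) powr p * ?w \<le> 2 powr p * (cmod (deriv f z) powr p + cmod (deriv g z) powr p) * ?w"
        by (rule mult_right_mono) auto
      then have "ennreal (cmod (deriv f z - deriv g z) powr p * ?w) \<le> ennreal (2 powr p * (cmod (deriv f z) powr p * ?w + cmod (deriv g z) powr p * ?w))"
        by (intro ennreal_leI) (simp add: algebra_simps)
      then show ?thesis using True by (simp add: d[OF z] ennreal_mult)
    qed simp
  qed
  also have "\<dots> = ennreal (2 powr p) * (dirichlet_energy p s f + dirichlet_energy p s g)"
    using borel_measurable_energy_density[OF f p] borel_measurable_energy_density[OF g p]
    by (simp add: nn_integral_cmult nn_integral_add dirichlet_energy_def)
  finally show ?thesis .
qed

lemma morrey_energy_diff_le: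
  assumes f: "f holomorphic_on unit_disk" and g: "g holomorphic_on unit_disk" and p: "0 < p" and a: "cmod a < 1"
  shows "morrey_energy \<alpha> p s (\<lambda>z. f z - g z) a \<le> ennreal (2 powr p) * (morrey_energy \<alpha> p s f a + morrey_energy \<alpha> p s g a)"
  using mult_left_mono[OF dirichlet_energy_diff_le[OF holomorphic_compose_disk_aut[OF a f] holomorphic_compose_disk_aut[OF a g] p, of s],
      of "ennreal ((1 - (cmod a)\<^sup>2) powr (\<alpha> * p))"]
  by (simp add: morrey_energy_def distrib_left mult_ac)

lemma dirichlet_energy_cmult:
  assumes f: "f holomorphic_on unit_disk" and p: "0 < p"
  shows "dirichlet_energy p s (\<lambda>z. c * f z) = ennreal (cmod c powr p) * dirichlet_energy p s f"
proof -
  have d: "deriv (\<lambda>z. c * f z) z = c * deriv f z" if "cmod z < 1" for z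
    using holomorphic_on_imp_differentiable_at[OF f, of z] that by (simp add: in_disk_iff del: mem_ball_0)
  have "dirichlet_energy p s (\<lambda>z. c * f z) = (\<integral>\<^sup>+z. ennreal (cmod c powr p) * (ennreal (cmod (deriv f z) powr p * (1 - (cmod z)\<^sup>2) powr s) * indicator unit_disk z) \<partial>lborel)"
    unfolding dirichlet_energy_def
    by (intro nn_integral_cong) (auto simp: indicator_def d norm_mult powr_mult ennreal_mult mult.assoc)
  then show ?thesis
    using borel_measurable_energy_density[OF f p] by (simp add: nn_integral_cmult dirichlet_energy_def)
qed

lemma morrey_energy_cmult:
  assumes f: "f holomorphic_on unit_disk" and p: "0 < p" and a: "cmod a < 1"
  shows "morrey_energy \<alpha> p s (\<lambda>z. c * f z) a = ennreal (cmod c powr p) * morrey_energy \<alpha> p s f a"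
  using dirichlet_energy_cmult[OF holomorphic_compose_disk_aut[OF a f] p]
  by (simp add: morrey_energy_def mult_ac)

lemma one_minus_norm_disk_aut_le:
  assumes a: "cmod a < 1" and w: "cmod w < 1"
  shows "1 - (cmod (disk_aut a w))\<^sup>2 \<le> (1 + cmod a) / (1 - cmod a) * (1 - (cmod w)\<^sup>2)"
proof -
  have pos: "0 < 1 - (cmod w)\<^sup>2" "0 < 1 - cmod a" using one_minus_norm_sq_pos w a by auto
  have le: "1 - cmod a \<le> cmod (1 - cnj a * w)" using norm_one_minus_cnj_mult_ge'[of w a] w by auto
  have "1 - (cmod (disk_aut a w))\<^sup>2 \<le> (1 - (cmod a)\<^sup>2) * (1 - (cmod w)\<^sup>2) / (1 - cmod a)\<^sup>2"
    unfolding one_minus_norm_disk_aut[OF a w]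
  proof (rule divide_left_mono)
    show "(1 - cmod a)\<^sup>2 \<le> (cmod (1 - cnj a * w))\<^sup>2" using le pos by (intro power_mono) auto
    show "0 \<le> (1 - (cmod a)\<^sup>2) * (1 - (cmod w)\<^sup>2)" using pos one_minus_norm_sq_pos[OF a] by auto
    show "0 < (cmod (1 - cnj a * w))\<^sup>2 * (1 - cmod a)\<^sup>2" using pos one_minus_cnj_mult_neq_0[of a w] a w by auto
  qed
  also have "1 - (cmod a)\<^sup>2 = (1 - cmod a) * (1 + cmod a)" by (simp add: power2_eq_square algebra_simps)
  also have "(1 - cmod a) * (1 + cmod a) * (1 - (cmod w)\<^sup>2) / (1 - cmod a)\<^sup>2 = (1 + cmod a) / (1 - cmod a) * (1 - (cmod w)\<^sup>2)"
    using pos by (simp add: power2_eq_square)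
  finally show ?thesis .
qed

text \<open>In the form of \<open>dirichlet_energy_disk_aut\<close> the point \<open>a\<close>
  occurs only in a factor with positive exponent, which is bounded by a constant times the same
  power of 1 - |w|^2.\<close>

lemma dirichlet_energy_disk_aut_le:
  assumes a: "cmod a < 1" and f: "f holomorphic_on unit_disk" and p: "0 < p" and ps: "p - 2 < s"
  shows "dirichlet_energy p s (\<lambda>z. f (disk_aut a z)) \<le> ennreal (((1 + cmod a) / (1 - cmod a)) powr (s - p + 2)) * dirichlet_energy p s f"
proof -
  let ?q = "s - p + 2" and ?K = "((1 + cmod a) / (1 - cmod a)) powr (s - p + 2)"
  have "dirichlet_energy p s (\<lambda>z. f (disk_aut a z)) = (\<integral>\<^sup>+w\<in>unit_disk. ennreal (cmod (deriv f w) powr p * (1 - (cmod w)\<^sup>2) powr (p - 2) *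
        (1 - (cmod (disk_aut a w))\<^sup>2) powr ?q) \<partial>lborel)"
    by (rule dirichlet_energy_disk_aut[OF a f p])
  also have "\<dots> \<le> (\<integral>\<^sup>+w. ennreal ?K * (ennreal (cmod (deriv f w) powr p * (1 - (cmod w)\<^sup>2) powr s) * indicator unit_disk w) \<partial>lborel)"
  proof (rule nn_integral_mono)
    fix w :: complex
    show "ennreal (cmod (deriv f w) powr p * (1 - (cmod w)\<^sup>2) powr (p - 2) * (1 - (cmod (disk_aut a w))\<^sup>2) powr ?q) * indicator unit_disk w
      \<le> ennreal ?K * (ennreal (cmod (deriv f w) powr p * (1 - (cmod w)\<^sup>2) powr s) * indicator unit_disk w)"
    proof (cases "w \<in> unit_disk")
      case True
      then have w: "cmod w < 1" by simp
      have pos: "0 < 1 - (cmod w)\<^sup>2" "0 < 1 - cmod a" "0 < 1 - (cmod (disk_aut a w))\<^sup>2"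
        using one_minus_norm_sq_pos w a norm_disk_aut_less_1 by auto
      have "(1 - (cmod (disk_aut a w))\<^sup>2) powr ?q \<le> ((1 + cmod a) / (1 - cmod a) * (1 - (cmod w)\<^sup>2)) powr ?q"
        using ps pos one_minus_norm_disk_aut_le[OF a w] by (intro powr_mono2) auto
      also have "\<dots> = ?K * (1 - (cmod w)\<^sup>2) powr ?q" by (rule powr_mult)
      finally have "cmod (deriv f w) powr p * (1 - (cmod w)\<^sup>2) powr (p - 2) * (1 - (cmod (disk_aut a w))\<^sup>2) powr ?q
         \<le> cmod (deriv f w) powr p * (1 - (cmod w)\<^sup>2) powr (p - 2) * (?K * (1 - (cmod w)\<^sup>2) powr ?q)"
        by (intro mult_left_mono) auto
      also have "\<dots> = ?K * (cmod (deriv f w) powr p * ((1 - (cmod w)\<^sup>2) powr (p - 2) * (1 - (cmod w)\<^sup>2) powr ?q))"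
        by (simp add: mult_ac)
      also have "(1 - (cmod w)\<^sup>2) powr (p - 2) * (1 - (cmod w)\<^sup>2) powr ?q = (1 - (cmod w)\<^sup>2) powr s"
        by (simp add: powr_add[symmetric])
      finally have "ennreal (cmod (deriv f w) powr p * (1 - (cmod w)\<^sup>2) powr (p - 2) * (1 - (cmod (disk_aut a w))\<^sup>2) powr ?q)
         \<le> ennreal (?K * (cmod (deriv f w) powr p * (1 - (cmod w)\<^sup>2) powr s))" by (rule ennreal_leI)
      then show ?thesis using True by (simp add: ennreal_mult)
    qed simp
  qed
  also have "\<dots> = ennreal ?K * dirichlet_energy p s f"
    using borel_measurable_energy_density[OF f p] by (simp add: nn_integral_cmult dirichlet_energy_def)
  finally show ?thesis .
qed

text \<open>Schwarz--Pick for the pair a, 0, followed by the distortion of the automorphism at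
  \<phi> 0. It bounds the weight quotient in \<open>energy_compose\<close> uniformly in a.\<close>

lemma Schwarz_Pick_boundary:
  assumes "disk_self_map \<phi>" "cmod a < 1"
  shows "1 - (cmod a)\<^sup>2 \<le> (1 + cmod (\<phi> 0)) / (1 - cmod (\<phi> 0)) * (1 - (cmod (\<phi> a))\<^sup>2)"
proof -
  let ?b = "\<phi> 0"
  have b: "cmod ?b < 1" "cmod (\<phi> a) < 1" using disk_self_mapD(2)[OF assms(1)] assms by auto
  have pos: "0 < 1 - cmod ?b" "0 < 1 - (cmod ?b)\<^sup>2" "0 < 1 - (cmod (\<phi> a))\<^sup>2" using b one_minus_norm_sq_pos by auto
  have "cmod (disk_aut ?b (\<phi> a)) \<le> cmod (disk_aut 0 a)" using Schwarz_Pick[OF assms(1,2), of 0] by simp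
  then have "(cmod (disk_aut ?b (\<phi> a)))\<^sup>2 \<le> (cmod a)\<^sup>2" by (intro power_mono) (auto)
  then have "1 - (cmod a)\<^sup>2 \<le> 1 - (cmod (disk_aut ?b (\<phi> a)))\<^sup>2" by simp
  also have "\<dots> \<le> (1 + cmod ?b) / (1 - cmod ?b) * (1 - (cmod (\<phi> a))\<^sup>2)"
    by (rule one_minus_norm_disk_aut_le[OF b])
  finally show ?thesis .
qed

lemma M_rho_le_iff:
  assumes g: "g holomorphic_on unit_disk" and d: "0 \<le> d" and p: "0 < p"
  shows "M_rho \<alpha> p s g \<le> ennreal d \<longleftrightarrow> (\<forall>a. cmod a < 1 \<longrightarrow> morrey_energy \<alpha> p s g a \<le> ennreal (d powr p))"
proof -
  have "M_weight \<alpha> p s g a \<le> ennreal d \<longleftrightarrow> morrey_energy \<alpha> p s g a \<le> ennreal (d powr p)" if a: "cmod a < 1" for a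
  proof
    assume "M_weight \<alpha> p s g a \<le> ennreal d"
    then have "ennreal_powr (ennreal_powr (morrey_energy \<alpha> p s g a) (1/p)) p \<le> ennreal_powr (ennreal d) p"
      using p by (intro ennreal_powr_mono) (simp_all add: M_weight_eq[OF g a p])
    then show "morrey_energy \<alpha> p s g a \<le> ennreal (d powr p)"
      using ennreal_powr_inverse[of "1/p" "morrey_energy \<alpha> p s g a"] p d by (simp add: ennreal_powr_ennreal)
  next
    assume "morrey_energy \<alpha> p s g a \<le> ennreal (d powr p)"
    then have "ennreal_powr (morrey_energy \<alpha> p s g a) (1/p) \<le> ennreal_powr (ennreal (d powr p)) (1/p)"
      using p by (intro ennreal_powr_mono) auto
    then show "M_weight \<alpha> p s g a \<le> ennreal d"
      using p d by (simp add: M_weight_eq[OF g a p] ennreal_powr_ennreal powr_powr)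
  qed
  then show ?thesis unfolding M_rho_def by (auto simp: SUP_le_iff)
qed

text \<open>The point evaluation at 0 converges by \<open>g0\<close>, so only the supremum of the
  energies decides about convergence in norm.\<close>

lemma M_norm_tendsto_0_iff:
  assumes g: "\<And>t. 0 < t \<Longrightarrow> g t holomorphic_on unit_disk" and p: "0 < p"
    and g0: "((\<lambda>t. g t 0) \<longlongrightarrow> 0) (at_right 0)"
  shows "((\<lambda>t. M_norm \<alpha> p s (g t)) \<longlongrightarrow> 0) (at_right (0::real)) \<longleftrightarrow>
    (\<forall>e>0. \<forall>\<^sub>F t in at_right 0. \<forall>a. cmod a < 1 \<longrightarrow> morrey_energy \<alpha> p s (g t) a \<le> ennreal e)"
proof
  assume lim: "((\<lambda>t. M_norm \<alpha> p s (g t)) \<longlongrightarrow> 0) (at_right 0)"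
  show "\<forall>e>0. \<forall>\<^sub>F t in at_right 0. \<forall>a. cmod a < 1 \<longrightarrow> morrey_energy \<alpha> p s (g t) a \<le> ennreal e"
  proof (intro allI impI)
    fix e :: real assume e: "0 < e"
    have "\<forall>\<^sub>F t in at_right 0. M_norm \<alpha> p s (g t) \<le> ennreal (e powr (1/p))"
      using lim e unfolding tendsto_ennreal_0_iff by auto
    moreover have "\<forall>\<^sub>F t in at_right (0::real). 0 < t" by (simp add: eventually_at_right_less)
    ultimately show "\<forall>\<^sub>F t in at_right 0. \<forall>a. cmod a < 1 \<longrightarrow> morrey_energy \<alpha> p s (g t) a \<le> ennreal e"
    proof eventually_elim
      case (elim t)
      have "M_rho \<alpha> p s (g t) \<le> M_norm \<alpha> p s (g t)" by (simp add: M_norm_def)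
      also note elim(1)
      finally show ?case using M_rho_le_iff[OF g[OF elim(2)] _ p, of "e powr (1/p)"] e p by (simp add: powr_powr)
    qed
  qed
next
  assume *: "\<forall>e>0. \<forall>\<^sub>F t in at_right 0. \<forall>a. cmod a < 1 \<longrightarrow> morrey_energy \<alpha> p s (g t) a \<le> ennreal e"
  have "((\<lambda>t. M_rho \<alpha> p s (g t)) \<longlongrightarrow> 0) (at_right 0)"
    unfolding tendsto_ennreal_0_iff
  proof (intro allI impI)
    fix e :: real assume e: "0 < e"
    have "\<forall>\<^sub>F t in at_right 0. \<forall>a. cmod a < 1 \<longrightarrow> morrey_energy \<alpha> p s (g t) a \<le> ennreal (e powr p)" using * e by simp
    moreover have "\<forall>\<^sub>F t in at_right (0::real). 0 < t" by (simp add: eventually_at_right_less)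
    ultimately show "\<forall>\<^sub>F t in at_right 0. M_rho \<alpha> p s (g t) \<le> ennreal e"
      by eventually_elim (use M_rho_le_iff[OF g _ p] e in auto)
  qed
  moreover have "((\<lambda>t. ennreal (cmod (g t 0))) \<longlongrightarrow> 0) (at_right 0)"
    using tendsto_ennrealI[OF tendsto_norm_zero[OF g0]] by simp
  ultimately show "((\<lambda>t. M_norm \<alpha> p s (g t)) \<longlongrightarrow> 0) (at_right 0)"
    unfolding M_norm_def using tendsto_add[of _ 0 _ _ 0] by fastforce
qed

lemma disk_mass_pos_finite:
  assumes "0 \<le> s"
  obtains c where "0 < c" "(\<integral>\<^sup>+z\<in>unit_disk. ennreal ((1 - (cmod z)\<^sup>2) powr s) \<partial>lborel) = ennreal c"
proof -
  let ?I = "\<integral>\<^sup>+z\<in>unit_disk. ennreal ((1 - (cmod z)\<^sup>2) powr s) \<partial>lborel"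
  have "ennreal ((3/4) powr s) * emeasure lborel (ball (0::complex) (1/2)) = (\<integral>\<^sup>+z. ennreal ((3/4) powr s) * indicator (ball 0 (1/2)) z \<partial>(lborel::complex measure))"
    by (simp add: nn_integral_cmult_indicator)
  also have "\<dots> \<le> ?I"
  proof (intro nn_integral_mono)
    fix z :: complex
    show "ennreal ((3/4) powr s) * indicator (ball 0 (1/2)) z \<le> ennreal ((1 - (cmod z)\<^sup>2) powr s) * indicator unit_disk z"
    proof (cases "z \<in> ball 0 (1/2)")
      case True
      then have "(cmod z)\<^sup>2 \<le> (1/2)\<^sup>2" by (intro power_mono) auto
      then have "(3/4) powr s \<le> (1 - (cmod z)\<^sup>2) powr s" using assms by (intro powr_mono2) (auto simp: power2_eq_square)
      then show ?thesis using True by (simp add: ennreal_leI)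
    qed simp
  qed
  finally have "0 < ?I"
    by (rule order_less_le_trans[rotated]) (subst emeasure_ball, simp_all add: unit_ball_vol_2 ennreal_mult[symmetric])
  moreover have "?I < \<infinity>" using assms by (intro nn_integral_one_minus_norm_powr_finite) auto
  ultimately show ?thesis using that by (cases ?I) auto
qed

section \<open>Admissible parameters: composition bounds and growth estimates\<close>

locale morrey_params =
  fixes p s \<alpha> :: real
  assumes adm: "admissible p s \<alpha>" and alpha_pos: "0 < \<alpha>"
begin

lemma p_gt_1: "1 < p" and s_nonneg: "0 \<le> s" and p_less_s: "p - 2 < s"
  and alpha_less: "\<alpha> * p < s - p + 2"
  and p_s_cases: "2 \<le> p \<and> p - 2 < s \<or> p < 2 \<and> 0 \<le> s"
proof -
  show p: "1 < p" using adm by (auto simp: admissible_def)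
  show "2 \<le> p \<and> p - 2 < s \<or> p < 2 \<and> 0 \<le> s" "0 \<le> s" using adm by (auto simp: admissible_def)
  then show "p - 2 < s" by auto
  have "\<alpha> < (s - (p - 2)) / p" using adm by (auto simp: admissible_def)
  then show "\<alpha> * p < s - p + 2" using p by (simp add: field_simps)
qed

lemma p_pos: "0 < p" using p_gt_1 by simp

abbreviation "energy \<equiv> morrey_energy \<alpha> p s"

lemma mem_M_space_iff:
  "f \<in> M_space \<alpha> p s \<longleftrightarrow> f holomorphic_on unit_disk \<and> (\<exists>C\<ge>0. \<forall>a. cmod a < 1 \<longrightarrow> energy f a \<le> ennreal C)"
proof
  assume f: "f \<in> M_space \<alpha> p s"
  then have hol: "f holomorphic_on unit_disk" by (simp add: M_space_def D_space_def)
  have "M_rho \<alpha> p s f < \<infinity>" using f by (simp add: M_space_def)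
  then obtain d where d: "0 \<le> d" "M_rho \<alpha> p s f = ennreal d" by (cases "M_rho \<alpha> p s f") auto
  then have "\<forall>a. cmod a < 1 \<longrightarrow> energy f a \<le> ennreal (d powr p)" using M_rho_le_iff[OF hol d(1) p_pos, of \<alpha> s] by simp
  then show "f holomorphic_on unit_disk \<and> (\<exists>C\<ge>0. \<forall>a. cmod a < 1 \<longrightarrow> energy f a \<le> ennreal C)"
    using hol by (auto intro: exI[of _ "d powr p"])
next
  assume "f holomorphic_on unit_disk \<and> (\<exists>C\<ge>0. \<forall>a. cmod a < 1 \<longrightarrow> energy f a \<le> ennreal C)"
  then obtain C where hol: "f holomorphic_on unit_disk" and C: "0 \<le> C" "\<And>a. cmod a < 1 \<Longrightarrow> energy f a \<le> ennreal C" by auto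
  have "M_rho \<alpha> p s f \<le> ennreal (C powr (1/p))"
    using M_rho_le_iff[OF hol _ p_pos, of "C powr (1/p)"] C p_pos by (simp add: powr_powr)
  then have "M_rho \<alpha> p s f < \<infinity>" by (simp add: order_le_less_trans)
  moreover have "D_norm p s f < \<infinity>"
  proof -
    have "dirichlet_energy p s f = dirichlet_energy p s (\<lambda>z. f (disk_aut 0 (disk_aut 0 z)))" by simp
    also have "\<dots> \<le> ennreal (((1 + cmod 0) / (1 - cmod 0)) powr (s - p + 2)) * dirichlet_energy p s (\<lambda>z. f (disk_aut 0 z))"
      using p_pos p_less_s hol by (intro dirichlet_energy_disk_aut_le holomorphic_compose_disk_aut[of 0]) auto
    also have "\<dots> = energy f 0" by (simp add: morrey_energy_def)
    also have "\<dots> < \<infinity>" using C(2)[of 0] by (simp add: order_le_less_trans)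
    finally show ?thesis
      unfolding D_norm_def dirichlet_energy_def[symmetric] using ennreal_powr_less_top_iff[of "dirichlet_energy p s f" "1/p"] by simp
  qed
  ultimately show "f \<in> M_space \<alpha> p s" using hol by (simp add: M_space_def D_space_def)
qed

lemma mem_little_m_space_iff:
  "f \<in> little_m_space \<alpha> p s \<longleftrightarrow> f \<in> M_space \<alpha> p s \<and>
     (\<forall>e>0. \<exists>r<1. \<forall>a. r < cmod a \<and> cmod a < 1 \<longrightarrow> energy f a \<le> ennreal e)"
proof -
  have "((M_weight \<alpha> p s f) \<longlongrightarrow> 0) to_unit_circle \<longleftrightarrow> (energy f \<longlongrightarrow> 0) to_unit_circle" if "f holomorphic_on unit_disk"
  proof -
    have "((M_weight \<alpha> p s f) \<longlongrightarrow> 0) to_unit_circle \<longleftrightarrow> ((\<lambda>a. ennreal_powr (energy f a) (1/p)) \<longlongrightarrow> 0) to_unit_circle"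
    proof (rule tendsto_cong)
      show "\<forall>\<^sub>F x in to_unit_circle. M_weight \<alpha> p s f x = ennreal_powr (energy f x) (1 / p)"
        unfolding eventually_to_unit_circle using M_weight_eq[OF that _ p_pos] by (intro exI[of _ 0]) auto
    qed
    then show ?thesis using tendsto_ennreal_powr_0_iff[of "1/p" "energy f"] p_pos by simp
  qed
  then show ?thesis
    unfolding little_m_space_def tendsto_ennreal_0_iff eventually_to_unit_circle
    by (auto simp: mem_M_space_iff)
qed

text \<open>With b = \<phi> a the map \<psi> = sigma_b o \<phi> o sigma_a is univalent and fixes 0,
  so subordination compares the two Dirichlet energies with constant 1. What remains is the quotient
  of the outer weights at a and at b.\<close>

lemma energy_compose:
  assumes phi: "disk_self_map \<phi>" "inj_on \<phi> unit_disk" and f: "f holomorphic_on unit_disk" and a: "cmod a < 1"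
  shows "energy (\<lambda>z. f (\<phi> z)) a \<le> ennreal (((1 - (cmod a)\<^sup>2) / (1 - (cmod (\<phi> a))\<^sup>2)) powr (\<alpha> * p)) * energy f (\<phi> a)"
proof -
  define b where "b = \<phi> a"
  have b: "cmod b < 1" unfolding b_def using disk_self_mapD(2)[OF phi(1) a] .
  define \<psi> where "\<psi> = (\<lambda>z. disk_aut b (\<phi> (disk_aut a z)))"
  have psi: "disk_self_map \<psi>" unfolding \<psi>_def b_def using disk_self_map_normalise[OF phi(1) a] .
  have "inj_on \<psi> unit_disk"
  proof -
    have "inj_on (\<phi> \<circ> disk_aut a) unit_disk"
      using inj_on_disk_aut[OF a] phi(2) disk_aut_image[OF a] by (intro comp_inj_on) auto
    moreover have "inj_on (disk_aut b) ((\<phi> \<circ> disk_aut a) ` unit_disk)"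
      by (rule inj_on_subset[OF inj_on_disk_aut[OF b]])
         (use disk_self_mapD(2)[OF phi(1)] norm_disk_aut_less_1[OF a] in auto)
    ultimately have "inj_on (disk_aut b \<circ> (\<phi> \<circ> disk_aut a)) unit_disk"
      by (rule comp_inj_on)
    then show ?thesis by (simp add: \<psi>_def comp_def)
  qed
  moreover have "\<psi> 0 = 0" by (simp add: \<psi>_def b_def)
  moreover have "dirichlet_energy p s (\<lambda>z. f (\<phi> (disk_aut a z))) = dirichlet_energy p s (\<lambda>z. f (disk_aut b (\<psi> z)))"
    using b disk_self_mapD(2)[OF phi(1)] norm_disk_aut_less_1[OF a]
    by (intro dirichlet_energy_cong) (simp add: \<psi>_def disk_aut_disk_aut)
  ultimately have "dirichlet_energy p s (\<lambda>z. f (\<phi> (disk_aut a z))) \<le> dirichlet_energy p s (\<lambda>z. f (disk_aut b z))"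
    using dirichlet_energy_subordinate[OF psi _ _ holomorphic_compose_disk_aut[OF b f] p_gt_1 p_s_cases] by simp
  then have "energy (\<lambda>z. f (\<phi> z)) a \<le> ennreal ((1 - (cmod a)\<^sup>2) powr (\<alpha> * p)) * dirichlet_energy p s (\<lambda>z. f (disk_aut b z))"
    by (simp add: morrey_energy_def mult_left_mono)
  also have "ennreal ((1 - (cmod a)\<^sup>2) powr (\<alpha> * p)) =
     ennreal (((1 - (cmod a)\<^sup>2) / (1 - (cmod b)\<^sup>2)) powr (\<alpha> * p)) * ennreal ((1 - (cmod b)\<^sup>2) powr (\<alpha> * p))"
    using one_minus_norm_sq_pos[OF a] one_minus_norm_sq_pos[OF b]
    by (simp add: ennreal_mult[symmetric] powr_divide)
  finally show ?thesis by (simp add: morrey_energy_def b_def mult.assoc)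
qed

text \<open>The explicit constant matters: it tends to 1 as \<phi> 0 tends to 0, as the convergence
  argument in \<open>tendsto_dirichlet_energy_diff\<close> requires.\<close>

lemma dirichlet_energy_compose:
  assumes phi: "disk_self_map \<phi>" "inj_on \<phi> unit_disk" and f: "f holomorphic_on unit_disk"
  shows "dirichlet_energy p s (\<lambda>z. f (\<phi> z)) \<le> ennreal (((1 + cmod (\<phi> 0)) / (1 - cmod (\<phi> 0))) powr (s - p + 2)) * dirichlet_energy p s f"
proof -
  define b where "b = \<phi> 0"
  have b: "cmod b < 1" unfolding b_def using disk_self_mapD(2)[OF phi(1)] by simp
  let ?\<psi> = "\<lambda>z. disk_aut b (\<phi> z)"
  have psi: "disk_self_map ?\<psi>" by (rule disk_self_map_compose[OF disk_self_map_disk_aut[OF b] phi(1)])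
  have "inj_on (disk_aut b \<circ> \<phi>) unit_disk"
    using inj_on_subset[OF inj_on_disk_aut[OF b]] phi by (intro comp_inj_on) (auto simp: disk_self_map_def)
  then have inj: "inj_on ?\<psi> unit_disk" by (simp add: comp_def)
  have "dirichlet_energy p s (\<lambda>z. f (\<phi> z)) = dirichlet_energy p s (\<lambda>z. f (disk_aut b (?\<psi> z)))"
    using b disk_self_mapD(2)[OF phi(1)] by (intro dirichlet_energy_cong) (simp add: disk_aut_disk_aut)
  also have "\<dots> \<le> dirichlet_energy p s (\<lambda>z. f (disk_aut b z))"
    by (rule dirichlet_energy_subordinate[OF psi inj _ holomorphic_compose_disk_aut[OF b f] p_gt_1 p_s_cases]) (simp add: b_def)
  also have "\<dots> \<le> ennreal (((1 + cmod b) / (1 - cmod b)) powr (s - p + 2)) * dirichlet_energy p s f"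
    by (rule dirichlet_energy_disk_aut_le[OF b f p_pos p_less_s])
  finally show ?thesis by (simp add: b_def)
qed

lemma energy_compose_le:
  assumes phi: "disk_self_map \<phi>" "inj_on \<phi> unit_disk" and f: "f holomorphic_on unit_disk" and a: "cmod a < 1"
  shows "energy (\<lambda>z. f (\<phi> z)) a \<le> ennreal (((1 + cmod (\<phi> 0)) / (1 - cmod (\<phi> 0))) powr (\<alpha> * p)) * energy f (\<phi> a)"
proof -
  have "(1 - (cmod a)\<^sup>2) / (1 - (cmod (\<phi> a))\<^sup>2) \<le> (1 + cmod (\<phi> 0)) / (1 - cmod (\<phi> 0))"
    using Schwarz_Pick_boundary[OF phi(1) a] one_minus_norm_sq_pos[OF disk_self_mapD(2)[OF phi(1) a]]
    by (simp only: pos_divide_le_eq)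
  then have "((1 - (cmod a)\<^sup>2) / (1 - (cmod (\<phi> a))\<^sup>2)) powr (\<alpha> * p) \<le> ((1 + cmod (\<phi> 0)) / (1 - cmod (\<phi> 0))) powr (\<alpha> * p)"
    using one_minus_norm_sq_pos[OF disk_self_mapD(2)[OF phi(1) a]] one_minus_norm_sq_pos[OF a] alpha_pos p_pos
    by (intro powr_mono2) auto
  then show ?thesis
    by (intro order_trans[OF energy_compose[OF assms]] mult_right_mono ennreal_leI) auto
qed

text \<open>The derivative of f o sigma_a at 0 has modulus |f' a| * (1 - |a|^2), and the mean value
  estimate applies to it. So the space embeds in the Bloch-type space of order 1 + \<alpha>.\<close>

lemma norm_deriv_le_energy:
  obtains c where "0 < c" "\<And>f a. f holomorphic_on unit_disk \<Longrightarrow> cmod a < 1 \<Longrightarrow>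
    ennreal (c * (cmod (deriv f a) * (1 - (cmod a)\<^sup>2) powr (1 + \<alpha>)) powr p) \<le> energy f a"
proof -
  obtain c where c: "0 < c" "(\<integral>\<^sup>+z\<in>unit_disk. ennreal ((1 - (cmod z)\<^sup>2) powr s) \<partial>lborel) = ennreal c"
    using disk_mass_pos_finite[OF s_nonneg] .
  show ?thesis
  proof (rule that[OF c(1)])
    fix f a assume f: "f holomorphic_on unit_disk" and a: "cmod a < 1"
    let ?g = "\<lambda>z. f (disk_aut a z)" and ?x = "1 - (cmod a)\<^sup>2"
    have x: "0 < ?x" by (rule one_minus_norm_sq_pos[OF a])
    have "(f has_field_derivative deriv f a) (at (disk_aut a 0))"
      using a f by (auto intro!: holomorphic_derivI[of _ unit_disk])
    moreover have "(disk_aut a has_field_derivative - of_real ?x) (at 0)"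
      using has_field_derivative_disk_aut[OF a, of 0] by simp
    ultimately have "deriv ?g 0 = deriv f a * - of_real ?x" by (intro DERIV_imp_deriv DERIV_chain2)
    then have d: "cmod (deriv ?g 0) = cmod (deriv f a) * ?x"
      using x by (simp only: norm_mult norm_minus_cancel norm_of_real abs_of_pos)
    have "ennreal (cmod (deriv ?g 0) powr p) * ennreal c \<le> dirichlet_energy p s ?g"
      using powr_norm_deriv_le_dirichlet_energy[OF holomorphic_compose_disk_aut[OF a f], of p s] c p_gt_1 by simp
    then have "ennreal (?x powr (\<alpha> * p)) * (ennreal (cmod (deriv ?g 0) powr p) * ennreal c) \<le> energy f a"
      unfolding morrey_energy_def by (rule mult_left_mono) simp
    moreover have "ennreal (?x powr (\<alpha> * p)) * (ennreal (cmod (deriv ?g 0) powr p) * ennreal c)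
      = ennreal (c * (cmod (deriv f a) * ?x powr (1 + \<alpha>)) powr p)"
    proof -
      have "?x powr (1 + \<alpha>) = ?x * ?x powr \<alpha>" using x by (simp add: powr_add)
      then show ?thesis using c x by (simp add: d ennreal_mult[symmetric] powr_mult powr_powr mult_ac)
    qed
    ultimately show "ennreal (c * (cmod (deriv f a) * ?x powr (1 + \<alpha>)) powr p) \<le> energy f a" by simp
  qed
qed

lemma norm_deriv_M_space_le:
  assumes "f \<in> M_space \<alpha> p s"
  obtains C where "0 \<le> C" "\<And>a. cmod a < 1 \<Longrightarrow> cmod (deriv f a) \<le> C * (1 - (cmod a)\<^sup>2) powr (- 1 - \<alpha>)"
proof -
  obtain C where f: "f holomorphic_on unit_disk" and C: "0 \<le> C" "\<And>a. cmod a < 1 \<Longrightarrow> energy f a \<le> ennreal C"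
    using assms by (auto simp: mem_M_space_iff)
  obtain c where c: "0 < c" "\<And>f a. f holomorphic_on unit_disk \<Longrightarrow> cmod a < 1 \<Longrightarrow>
    ennreal (c * (cmod (deriv f a) * (1 - (cmod a)\<^sup>2) powr (1 + \<alpha>)) powr p) \<le> energy f a"
    using norm_deriv_le_energy by blast
  show ?thesis
  proof (rule that[of "(C / c) powr (1/p)"])
    fix a :: complex assume a: "cmod a < 1"
    let ?x = "1 - (cmod a)\<^sup>2"
    have x: "0 < ?x" by (rule one_minus_norm_sq_pos[OF a])
    let ?y = "cmod (deriv f a) * ?x powr (1 + \<alpha>)"
    have "ennreal (c * ?y powr p) \<le> ennreal C" using c(2)[OF f a] C(2)[OF a] by (rule order_trans)
    then have "?y powr p \<le> C / c" using C c by (simp add: field_simps)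
    then have "(?y powr p) powr (1/p) \<le> (C / c) powr (1/p)" using p_pos by (intro powr_mono2) auto
    then have "?y \<le> (C / c) powr (1/p)" using p_pos by (simp add: powr_powr)
    then have "?y * ?x powr (- 1 - \<alpha>) \<le> (C / c) powr (1/p) * ?x powr (- 1 - \<alpha>)" by (rule mult_right_mono) simp
    moreover have "?x powr (1 + \<alpha>) * ?x powr (- 1 - \<alpha>) = 1" using x by (simp add: powr_add[symmetric])
    ultimately show "cmod (deriv f a) \<le> (C / c) powr (1/p) * ?x powr (- 1 - \<alpha>)" by (simp add: mult.assoc)
  qed simp
qed

text \<open>Integrate the derivative bound along the radius; because \<alpha> > 0 the primitive of
  (1 - x)^(-1 - \<alpha>) is again a power. Passing from 1 - |w| to 1 - |w|^2 costs 2 powr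
  \<alpha>.\<close>

lemma norm_M_space_le:
  assumes "f \<in> M_space \<alpha> p s"
  obtains C where "0 \<le> C" "\<And>w. cmod w < 1 \<Longrightarrow> cmod (f w) \<le> C * (1 - (cmod w)\<^sup>2) powr (- \<alpha>)"
proof -
  have f: "f holomorphic_on unit_disk" using assms by (simp add: mem_M_space_iff)
  obtain C where C: "0 \<le> C" "\<And>a. cmod a < 1 \<Longrightarrow> cmod (deriv f a) \<le> C * (1 - (cmod a)\<^sup>2) powr (- 1 - \<alpha>)"
    using norm_deriv_M_space_le[OF assms] by blast
  show ?thesis
  proof (rule that[of "cmod (f 0) + C / \<alpha> * 2 powr \<alpha>"])
    fix w :: complex assume w: "cmod w < 1"
    let ?r = "cmod w"
    \<comment> \<open>For w = 0 this is 0, so only |e| \<le> 1 is available in what follows.\<close>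
    define e where "e = sgn w"
    have e: "w = ?r * e" "cmod e \<le> 1" by (auto simp: e_def sgn_eq norm_divide)
    have "norm (f (?r * e) - f (of_real 0 * e)) \<le> C / \<alpha> * (1 - ?r) powr (- \<alpha>) - C / \<alpha> * (1 - 0) powr (- \<alpha>)"
    proof (cases "?r = 0")
      case False
      show ?thesis
      proof (rule differentiable_bound_general[of 0 ?r "\<lambda>x. f (of_real x * e)" "\<lambda>x. C / \<alpha> * (1 - x) powr (- \<alpha>)" "\<lambda>x. deriv f (of_real x * e) * e" "\<lambda>x. C * (1 - x) powr (- 1 - \<alpha>)"])
        show "0 < ?r" using False by simp
        have xe: "cmod (of_real x * e) < 1" if "0 \<le> x" "x \<le> ?r" for x
          using that w e(2) mult_left_le[of "cmod e" x] by (simp add: norm_mult)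
        have fc: "continuous_on unit_disk f" by (rule holomorphic_on_imp_continuous_on[OF f])
        show "continuous_on {0..?r} (\<lambda>x. f (of_real x * e))"
          by (intro continuous_on_compose2[OF fc] continuous_intros) (use xe in \<open>auto simp: in_disk_iff\<close>)
        show "continuous_on {0..?r} (\<lambda>x. C / \<alpha> * (1 - x) powr (- \<alpha>))"
          using alpha_pos w by (intro continuous_intros continuous_on_powr) auto
        fix x assume x: "0 < x" "x < ?r"
        have "(f has_field_derivative deriv f (of_real x * e)) (at (of_real x * e))"
          using xe[of x] x by (intro holomorphic_derivI[OF f]) (auto simp: in_disk_iff simp del: mem_ball_0)
        moreover have "((\<lambda>x. of_real x * e) has_vector_derivative e) (at x)"
          by (auto intro!: derivative_eq_intros simp: scaleR_conv_of_real)
        ultimately have "((f \<circ> (\<lambda>x. of_real x * e)) has_vector_derivative e * deriv f (of_real x * e)) (at x)"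
          by (intro field_vector_diff_chain_at)
        then show "((\<lambda>x. f (of_real x * e)) has_vector_derivative deriv f (of_real x * e) * e) (at x)"
          by (simp add: comp_def mult.commute)
        have x1: "x < 1" using x w by simp
        show "((\<lambda>x. C / \<alpha> * (1 - x) powr (- \<alpha>)) has_vector_derivative C * (1 - x) powr (- 1 - \<alpha>)) (at x)"
          unfolding has_real_derivative_iff_has_vector_derivative[symmetric]
          using alpha_pos x1 by (auto intro!: derivative_eq_intros simp: powr_diff powr_minus field_simps)
        have "cmod (deriv f (of_real x * e) * e) \<le> cmod (deriv f (of_real x * e))"
          using e(2) by (simp add: norm_mult mult_left_le)
        also have "\<dots> \<le> C * (1 - (cmod (of_real x * e))\<^sup>2) powr (- 1 - \<alpha>)" using C(2)[OF xe[of x]] x by simp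
        also have "\<dots> \<le> C * (1 - x) powr (- 1 - \<alpha>)"
        proof (intro mult_left_mono powr_mono2' C(1))
          have "cmod (of_real x * e) \<le> x" using x e(2) mult_left_le[of "cmod e" x] by (simp add: norm_mult)
          then have "(cmod (of_real x * e))\<^sup>2 \<le> x\<^sup>2" by (intro power_mono) auto
          also have "x\<^sup>2 \<le> x" using x x1 by (simp add: power2_eq_square mult_left_le)
          finally show "1 - x \<le> 1 - (cmod (of_real x * e))\<^sup>2" by simp
        qed (use x1 alpha_pos in auto)
        finally show "cmod (deriv f (of_real x * e) * e) \<le> C * (1 - x) powr (- 1 - \<alpha>)" .
      qed
    qed simp
    also have "\<dots> \<le> C / \<alpha> * (1 - ?r) powr (- \<alpha>)" using C(1) alpha_pos by simp
    also have "\<dots> \<le> C / \<alpha> * (2 powr \<alpha> * (1 - ?r\<^sup>2) powr (- \<alpha>))"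
    proof (intro mult_left_mono)
      have pos: "0 < 1 - ?r\<^sup>2" "0 < 1 - ?r" using one_minus_norm_sq_pos[OF w] w by auto
      have "(1 - ?r) powr (- \<alpha>) \<le> ((1 - ?r\<^sup>2) / 2) powr (- \<alpha>)"
      proof (rule powr_mono2')
        have "1 - ?r\<^sup>2 = (1 - ?r) * (1 + ?r)" by (simp add: power2_eq_square algebra_simps)
        also have "\<dots> \<le> (1 - ?r) * 2" using w by (intro mult_left_mono) auto
        finally show "(1 - ?r\<^sup>2) / 2 \<le> 1 - ?r" by simp
      qed (use pos alpha_pos in auto)
      also have "\<dots> = 2 powr \<alpha> * (1 - ?r\<^sup>2) powr (- \<alpha>)" using pos by (simp add: powr_divide powr_minus field_simps)
      finally show "(1 - ?r) powr (- \<alpha>) \<le> 2 powr \<alpha> * (1 - ?r\<^sup>2) powr (- \<alpha>)" .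
    qed (use C(1) alpha_pos in auto)
    finally have d: "cmod (f w - f 0) \<le> C / \<alpha> * 2 powr \<alpha> * (1 - ?r\<^sup>2) powr (- \<alpha>)" using e(1) by simp
    have "1 powr (- \<alpha>) \<le> (1 - ?r\<^sup>2) powr (- \<alpha>)"
      using one_minus_norm_sq_pos[OF w] alpha_pos by (intro powr_mono2') auto
    then have "cmod (f 0) \<le> cmod (f 0) * (1 - ?r\<^sup>2) powr (- \<alpha>)" by (simp add: mult_le_cancel_left1)
    then show "cmod (f w) \<le> (cmod (f 0) + C / \<alpha> * 2 powr \<alpha>) * (1 - ?r\<^sup>2) powr (- \<alpha>)"
      using d norm_triangle_sub[of "f w" "f 0"] by (simp add: distrib_right)
  qed (use C alpha_pos in auto)
qed

end

subsection \<open>Semigroups and their generators\<close>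

lemma norm_deriv_le_cball:
  assumes "f holomorphic_on S" "cball z r \<subseteq> S" "0 < r" "\<And>w. w \<in> cball z r \<Longrightarrow> cmod (f w) \<le> B"
  shows "cmod (deriv f z) \<le> B / r"
proof -
  have "cmod ((deriv ^^ 1) f z) \<le> fact 1 * B / r ^ 1"
  proof (rule Cauchy_inequality)
    show "f holomorphic_on ball z r"
      using holomorphic_on_subset[OF assms(1)] assms(2) ball_subset_cball[of z r] by blast
    show "continuous_on (cball z r) f"
      by (rule holomorphic_on_imp_continuous_on[OF holomorphic_on_subset[OF assms(1,2)]])
  qed (use assms in \<open>auto simp: dist_norm\<close>)
  then show ?thesis by simp
qed

text \<open>Joint continuity passes from K to its z-derivative: Cauchy's estimate for K u - K u0 on
  a ball of fixed radius handles the parameter, continuity of the derivative of K u0 handles the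
  point. It justifies differentiation under the integral.\<close>

lemma continuous_on_deriv_param:
  fixes K :: "real \<Rightarrow> complex \<Rightarrow> complex"
  assumes K: "continuous_on ({0..T} \<times> U) (\<lambda>x. K (fst x) (snd x))" and U: "open U"
    and hol: "\<And>u. u \<in> {0..T} \<Longrightarrow> K u holomorphic_on U"
  shows "continuous_on ({0..T} \<times> U) (\<lambda>x. deriv (K (fst x)) (snd x))"
  unfolding continuous_on_iff
proof (intro ballI allI impI)
  fix x and e :: real assume x: "x \<in> {0..T} \<times> U" and e: "0 < e"
  obtain u0 z0 where x0: "x = (u0, z0)" by (cases x)
  from x have u0: "u0 \<in> {0..T}" and z0: "z0 \<in> U" by (auto simp: x0)
  obtain \<rho>' where r': "0 < \<rho>'" "cball z0 \<rho>' \<subseteq> U" using open_contains_cball U z0 by blast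
  \<comment> \<open>Half the radius, so that balls of radius \<rho> around points \<rho>-close to z0
    stay in the compact ball on which K is uniformly continuous.\<close>
  define \<rho> where "\<rho> = \<rho>' / 2"
  have r: "0 < \<rho>" "cball z0 (2 * \<rho>) \<subseteq> U" using r' by (auto simp: \<rho>_def)
  have "compact ({0..T} \<times> cball z0 (2 * \<rho>))" by (intro compact_Times) auto
  from compact_uniformly_continuous[OF continuous_on_subset[OF K] this] r(2)
  have "uniformly_continuous_on ({0..T} \<times> cball z0 (2 * \<rho>)) (\<lambda>x. K (fst x) (snd x))" by blast
  moreover have "0 < e * \<rho> / 4" using e r by simp
  ultimately obtain d where d: "0 < d" "\<And>x x'. x \<in> {0..T} \<times> cball z0 (2 * \<rho>) \<Longrightarrow> x' \<in> {0..T} \<times> cball z0 (2 * \<rho>) \<Longrightarrow>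
     dist x' x < d \<Longrightarrow> dist (K (fst x') (snd x')) (K (fst x) (snd x)) < e * \<rho> / 4"
    unfolding uniformly_continuous_on_def by (metis (no_types, lifting))
  have "continuous_on U (deriv (K u0))" by (intro holomorphic_on_imp_continuous_on holomorphic_deriv hol u0 U)
  then obtain d' where d': "0 < d'" "\<And>z. z \<in> U \<Longrightarrow> dist z z0 < d' \<Longrightarrow> dist (deriv (K u0) z) (deriv (K u0) z0) < e / 2"
    using z0 e unfolding continuous_on_iff by (metis half_gt_zero)
  show "\<exists>d>0. \<forall>x'\<in>{0..T} \<times> U. dist x' x < d \<longrightarrow> dist (deriv (K (fst x')) (snd x')) (deriv (K (fst x)) (snd x)) < e"
  proof (intro exI conjI ballI impI)
    show "0 < min (min d d') \<rho>" using d d' r by simp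
    fix x' assume x': "x' \<in> {0..T} \<times> U" "dist x' x < min (min d d') \<rho>"
    obtain u z where xz: "x' = (u, z)" by (cases x')
    have u: "u \<in> {0..T}" and z: "z \<in> U" using x' by (auto simp: xz)
    have du: "dist u u0 < d" using x'(2) dist_fst_le[of x' x] by (simp add: xz x0)
    have dz: "dist z z0 < d'" "dist z z0 < \<rho>" using x'(2) dist_snd_le[of x' x] by (simp_all add: xz x0)
    have sub: "cball z \<rho> \<subseteq> cball z0 (2 * \<rho>)"
    proof
      fix v assume "v \<in> cball z \<rho>"
      then show "v \<in> cball z0 (2 * \<rho>)" using dz(2) dist_triangle[of z0 v z] by (simp add: dist_commute)
    qed
    have "cmod (deriv (\<lambda>w. K u w - K u0 w) z) \<le> (e * \<rho> / 4) / \<rho>"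
    proof (rule norm_deriv_le_cball)
      show "(\<lambda>w. K u w - K u0 w) holomorphic_on U" by (intro holomorphic_intros hol u u0)
      show "cball z \<rho> \<subseteq> U" using sub r(2) by blast
      fix w assume "w \<in> cball z \<rho>"
      then have "w \<in> cball z0 (2 * \<rho>)" using sub by blast
      then show "cmod (K u w - K u0 w) \<le> e * \<rho> / 4"
        using d(2)[of "(u0, w)" "(u, w)"] u u0 du by (auto simp: dist_Pair_Pair dist_norm)
    qed (rule r(1))
    moreover have "deriv (\<lambda>w. K u w - K u0 w) z = deriv (K u) z - deriv (K u0) z"
      using holomorphic_on_imp_differentiable_at[OF hol U] u u0 z by (intro deriv_diff) auto
    ultimately have "dist (deriv (K u) z) (deriv (K u0) z) \<le> e / 4" using r(1) by (simp add: dist_norm)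
    then show "dist (deriv (K (fst x')) (snd x')) (deriv (K (fst x)) (snd x)) < e"
      using d'(2)[OF z dz(1)] dist_triangle[of "deriv (K u) z" "deriv (K u0) z0" "deriv (K u0) z"] e by (simp add: xz x0)
  qed
qed

lemma has_field_derivative_integral_param:
  fixes K :: "real \<Rightarrow> complex \<Rightarrow> complex"
  assumes K: "continuous_on ({0..T} \<times> unit_disk) (\<lambda>x. K (fst x) (snd x))"
    and hol: "\<And>u. u \<in> {0..T} \<Longrightarrow> K u holomorphic_on unit_disk" and z: "cmod z < 1"
  shows "((\<lambda>z. integral {0..T} (\<lambda>u. K u z)) has_field_derivative integral {0..T} (\<lambda>u. deriv (K u) z)) (at z)"
proof -
  have "((\<lambda>x. integral (cbox 0 T) (\<lambda>u. K u x)) has_field_derivative integral (cbox 0 T) (\<lambda>u. deriv (K u) z)) (at z within unit_disk)"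
  proof (rule leibniz_rule_field_derivative)
    fix x u assume x: "x \<in> unit_disk" "u \<in> cbox 0 T"
    then show "((\<lambda>x. K u x) has_field_derivative deriv (K u) x) (at x within unit_disk)"
      by (intro holomorphic_derivI[OF hol open_ball]) auto
  next
    fix x assume "x \<in> unit_disk"
    then have "continuous_on {0..T} (\<lambda>u. (u, x))" "(\<lambda>u. (u, x)) ` {0..T} \<subseteq> {0..T} \<times> unit_disk"
      by (auto intro!: continuous_intros)
    from continuous_on_compose2[OF K this] show "(\<lambda>u. K u x) integrable_on cbox 0 T"
      by (intro integrable_continuous) simp
  next
    have "continuous_on (unit_disk \<times> cbox 0 T) (\<lambda>x. (snd x, fst x))"
      "(\<lambda>x. (snd x, fst x)) ` (unit_disk \<times> cbox 0 T) \<subseteq> {0..T} \<times> unit_disk"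
      by (auto intro!: continuous_intros)
    from continuous_on_compose2[OF continuous_on_deriv_param[OF K open_ball hol] this]
    show "continuous_on (unit_disk \<times> cbox 0 T) (\<lambda>(x, u). deriv (K u) x)"
      by (simp add: split_beta')
  qed (use z in auto)
  then show ?thesis
    using z at_within_open[of z unit_disk] by simp
qed

text \<open>Schwarz--Pick makes all self-maps locally Lipschitz with a constant independent of the
  map. This equicontinuity turns continuity of a semigroup at time 0 into joint continuity.\<close>

lemma disk_self_map_dist_le:
  assumes "disk_self_map \<psi>" "cmod z < 1" "cmod w < 1"
  shows "cmod (\<psi> z - \<psi> w) \<le> 2 * cmod (z - w) / (1 - cmod w)"
proof -
  have n: "cmod (\<psi> z) < 1" "cmod (\<psi> w) < 1" using disk_self_mapD(2)[OF assms(1)] assms by auto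
  have nz: "1 - cnj (\<psi> w) * \<psi> z \<noteq> 0" using one_minus_cnj_mult_neq_0[of "\<psi> w" "\<psi> z"] n by auto
  have "cmod (\<psi> z - \<psi> w) = cmod (disk_aut (\<psi> w) (\<psi> z)) * cmod (1 - cnj (\<psi> w) * \<psi> z)"
    using nz by (simp add: disk_aut_def norm_divide norm_minus_commute)
  also have "\<dots> \<le> cmod (disk_aut w z) * 2"
    using Schwarz_Pick[OF assms] norm_one_minus_cnj_mult_le[of "\<psi> w" "\<psi> z"] n by (intro mult_mono) auto
  also have "cmod (disk_aut w z) \<le> cmod (z - w) / (1 - cmod w)"
    using norm_one_minus_cnj_mult_ge'[of z w] assms one_minus_cnj_mult_neq_0[of w z]
    by (auto simp: disk_aut_def norm_divide norm_minus_commute intro!: divide_left_mono)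
  finally show ?thesis by (simp add: mult_ac)
qed

section \<open>Joint continuity, univalence and orbit integrals\<close>

locale disk_semigroup =
  fixes \<phi> :: "real \<Rightarrow> complex \<Rightarrow> complex"
  assumes semigroup: "holo_semigroup \<phi>"
begin

lemma self_map: "0 \<le> t \<Longrightarrow> disk_self_map (\<phi> t)"
  using semigroup by (simp add: holo_semigroup_def disk_self_map_def)

lemma norm_less_1: "0 \<le> t \<Longrightarrow> cmod z < 1 \<Longrightarrow> cmod (\<phi> t z) < 1"
  using disk_self_mapD(2)[OF self_map] .

lemma phi_0: "cmod z < 1 \<Longrightarrow> \<phi> 0 z = z"
  using semigroup by (simp add: holo_semigroup_def)

lemma phi_add: "0 \<le> t \<Longrightarrow> 0 \<le> u \<Longrightarrow> cmod z < 1 \<Longrightarrow> \<phi> (t + u) z = \<phi> t (\<phi> u z)"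
  using semigroup by (simp add: holo_semigroup_def)

lemma uniform_limit_phi: "compact K \<Longrightarrow> K \<subseteq> unit_disk \<Longrightarrow> uniform_limit K \<phi> (\<lambda>z. z) (at_right 0)"
  using semigroup by (simp add: holo_semigroup_def)

lemma tendsto_phi_0: "cmod z < 1 \<Longrightarrow> ((\<lambda>t. \<phi> t z) \<longlongrightarrow> z) (at_right 0)"
  using tendsto_uniform_limitI[OF uniform_limit_phi[of "{z}"]] by simp

text \<open>For u \<ge> v write \<phi> u z = \<phi> v (\<phi> (u - v) z). Equicontinuity of the
  self-map \<phi> v leaves only a displacement over the time |u - v|.\<close>

lemma norm_phi_diff_le:
  assumes "0 \<le> u" "0 \<le> v" "cmod z < 1"
  shows "cmod (\<phi> u z - \<phi> v z) \<le> 2 * cmod (\<phi> \<bar>u - v\<bar> z - z) / (1 - cmod z)"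
proof -
  have *: "cmod (\<phi> u z - \<phi> v z) \<le> 2 * cmod (\<phi> \<bar>u - v\<bar> z - z) / (1 - cmod z)" if "0 \<le> v" "v \<le> u" for u v
  proof -
    have "\<phi> u z = \<phi> v (\<phi> (u - v) z)" using phi_add[of v "u - v" z] that assms by simp
    then show ?thesis
      using disk_self_map_dist_le[OF self_map[of v], of "\<phi> (u - v) z" z] norm_less_1[of "u - v" z] that assms by simp
  qed
  show ?thesis using *[of v u] *[of u v] assms by (cases "v \<le> u") (auto simp: norm_minus_commute abs_minus_commute)
qed

lemma continuous_on_phi: "continuous_on ({0..} \<times> unit_disk) (\<lambda>x. \<phi> (fst x) (snd x))"
  unfolding continuous_on_def
proof
  fix x :: "real \<times> complex" assume x: "x \<in> {0..} \<times> unit_disk"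
  obtain u0 z0 where x0: "x = (u0, z0)" by (cases x)
  from x have u0: "0 \<le> u0" and z0: "cmod z0 < 1" by (auto simp: x0)
  let ?F = "at x within ({0..} \<times> unit_disk)"
  have lim0: "((\<lambda>h. \<phi> h z0) \<longlongrightarrow> z0) (at 0 within {0..})"
    using tendsto_phi_0[OF z0] by (simp add: at_within_Ici_at_right)
  have "((\<lambda>y. \<phi> \<bar>fst y - u0\<bar> z0) \<longlongrightarrow> \<phi> 0 z0) ?F"
  proof -
    have "continuous (at 0 within {0..}) (\<lambda>h. \<phi> h z0)"
      using lim0 phi_0[OF z0] by (simp add: continuous_within)
    moreover have "((\<lambda>y. \<bar>fst y - u0\<bar>) \<longlongrightarrow> 0) ?F"
    proof -
      have "((\<lambda>y. \<bar>fst y - u0\<bar>) \<longlongrightarrow> \<bar>fst x - u0\<bar>) ?F" by (intro tendsto_intros)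
      then show ?thesis by (simp add: x0)
    qed
    ultimately show ?thesis
      by (intro continuous_within_tendsto_compose[of 0 "{0..}" "\<lambda>h. \<phi> h z0"]) (auto simp: eventually_at_filter)
  qed
  then have l1: "((\<lambda>y. \<phi> \<bar>fst y - u0\<bar> z0 - z0) \<longlongrightarrow> 0) ?F"
    using phi_0[OF z0] tendsto_diff[OF _ tendsto_const[of z0]] by fastforce
  have "((\<lambda>y. snd y - z0) \<longlongrightarrow> snd x - z0) ?F" by (intro tendsto_intros)
  then have l2: "((\<lambda>y. snd y - z0) \<longlongrightarrow> 0) ?F" by (simp add: x0)
  have "((\<lambda>y. 2 * cmod (snd y - z0) / (1 - cmod z0) + 2 * cmod (\<phi> \<bar>fst y - u0\<bar> z0 - z0) / (1 - cmod z0)) \<longlongrightarrow>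
       2 * 0 / (1 - cmod z0) + 2 * 0 / (1 - cmod z0)) ?F"
    by (intro tendsto_intros tendsto_norm_zero l1 l2) (use z0 in auto)
  then have B: "((\<lambda>y. 2 * cmod (snd y - z0) / (1 - cmod z0) + 2 * cmod (\<phi> \<bar>fst y - u0\<bar> z0 - z0) / (1 - cmod z0)) \<longlongrightarrow> 0) ?F" by simp
  have "((\<lambda>y. \<phi> (fst y) (snd y) - \<phi> u0 z0) \<longlongrightarrow> 0) ?F"
  proof (rule Lim_null_comparison[OF _ B])
    have "\<forall>\<^sub>F y in ?F. y \<in> {0..} \<times> unit_disk" by (simp add: eventually_at_filter)
    then show "\<forall>\<^sub>F y in ?F. cmod (\<phi> (fst y) (snd y) - \<phi> u0 z0) \<le> 2 * cmod (snd y - z0) / (1 - cmod z0) + 2 * cmod (\<phi> \<bar>fst y - u0\<bar> z0 - z0) / (1 - cmod z0)"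
    proof eventually_elim
      case (elim y)
      then have y: "0 \<le> fst y" "cmod (snd y) < 1" by auto
      have "cmod (\<phi> (fst y) (snd y) - \<phi> (fst y) z0) \<le> 2 * cmod (snd y - z0) / (1 - cmod z0)"
        by (rule disk_self_map_dist_le[OF self_map[OF y(1)] y(2) z0])
      moreover have "cmod (\<phi> (fst y) z0 - \<phi> u0 z0) \<le> 2 * cmod (\<phi> \<bar>fst y - u0\<bar> z0 - z0) / (1 - cmod z0)"
        by (rule norm_phi_diff_le[OF y(1) u0 z0])
      ultimately show ?case
        using norm_triangle_ineq[of "\<phi> (fst y) (snd y) - \<phi> (fst y) z0" "\<phi> (fst y) z0 - \<phi> u0 z0"] by simp
    qed
  qed
  then show "((\<lambda>y. \<phi> (fst y) (snd y)) \<longlongrightarrow> \<phi> (fst x) (snd x)) ?F"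
    unfolding x0 fst_conv snd_conv by (rule LIM_zero_cancel)
qed

lemma continuous_on_compose_phi:
  assumes "f holomorphic_on unit_disk"
  shows "continuous_on ({0..T} \<times> unit_disk) (\<lambda>x. f (\<phi> (fst x) (snd x)))"
  by (rule continuous_on_compose2[OF holomorphic_on_imp_continuous_on[OF assms] continuous_on_subset[OF continuous_on_phi]])
     (auto simp: norm_less_1)

lemma continuous_on_orbit:
  assumes "f holomorphic_on unit_disk" "cmod z < 1"
  shows "continuous_on {0..T} (\<lambda>u. f (\<phi> u z))"
proof -
  have "continuous_on {0..T} (\<lambda>u. (u, z))" "(\<lambda>u. (u, z)) ` {0..T} \<subseteq> {0..T} \<times> unit_disk"
    using assms(2) by (auto intro!: continuous_intros)
  from continuous_on_compose2[OF continuous_on_compose_phi[OF assms(1)] this] show ?thesis by simp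
qed

lemma holomorphic_compose_phi:
  "f holomorphic_on unit_disk \<Longrightarrow> 0 \<le> u \<Longrightarrow> (\<lambda>z. f (\<phi> u z)) holomorphic_on unit_disk"
  by (rule holomorphic_compose_self_map[OF self_map])

text \<open>Let t0 be the first time at which the orbits of z1 and z2 meet; it is positive. Shortly
  before t0 both orbits are near the meeting point c, and the map over the remaining short time h is
  so close to the identity near c that it is injective there, a contradiction.\<close>

lemma inj_on_phi:
  assumes t: "0 \<le> t"
  shows "inj_on (\<phi> t) unit_disk"
proof (rule inj_onI, rule ccontr)
  fix z1 z2 assume "z1 \<in> unit_disk" "z2 \<in> unit_disk" and eq: "\<phi> t z1 = \<phi> t z2" and ne: "z1 \<noteq> z2"
  then have z: "cmod z1 < 1" "cmod z2 < 1" by auto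
  define S where "S = {u \<in> {0..t}. \<phi> u z1 - \<phi> u z2 = 0}"
  have id: "(\<lambda>z. z) holomorphic_on unit_disk" by simp
  have "closed S"
    unfolding S_def using continuous_on_orbit[OF id] z
    by (intro continuous_closed_preimage_constant continuous_intros) auto
  moreover have "S \<noteq> {}" "bdd_below S" using eq t by (auto simp: S_def intro!: exI[of _ t] bdd_belowI[of _ 0])
  ultimately have "Inf S \<in> S" by (intro closed_contains_Inf)
  define t0 where "t0 = Inf S"
  have t0: "0 \<le> t0" "t0 \<le> t" "\<phi> t0 z1 = \<phi> t0 z2" using \<open>Inf S \<in> S\<close> by (auto simp: S_def t0_def)
  have "t0 \<noteq> 0" using t0(3) phi_0 z ne by auto
  then have t0pos: "0 < t0" using t0 by simp
  define c where "c = \<phi> t0 z1"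
  have c: "cmod c < 1" unfolding c_def using norm_less_1 t0 z by auto
  \<comment> \<open>A third of the distance to the circle: the ball of radius 2 * \<rho> around c
    stays in the disk, and points of \<open>ball c \<rho>\<close> still have room for Cauchy's
    estimate with radius \<rho>.\<close>
  define \<rho> where "\<rho> = (1 - cmod c) / 3"
  have rho: "0 < \<rho>" using c by (simp add: \<rho>_def)
  have sub: "cball c (2 * \<rho>) \<subseteq> unit_disk"
  proof
    fix x assume "x \<in> cball c (2 * \<rho>)"
    then have "cmod x \<le> cmod c + 2 * \<rho>" using norm_triangle_sub[of x c] by (simp add: dist_norm norm_minus_commute)
    then show "x \<in> unit_disk" using c by (simp add: \<rho>_def field_simps)
  qed
  have ev1: "\<forall>\<^sub>F h in at_right 0. \<forall>x\<in>cball c (2 * \<rho>). dist (\<phi> h x) x < \<rho> / 2"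
    using uniform_limitD[OF uniform_limit_phi[OF compact_cball sub], of "\<rho> / 2"] rho by simp
  have lim: "((\<lambda>h. \<phi> (t0 - h) z') \<longlongrightarrow> \<phi> t0 z') (at_right 0)" if z': "cmod z' < 1" for z'
  proof -
    have "continuous_on {0..t0} (\<lambda>u. \<phi> u z')" using continuous_on_orbit[OF id z'] by simp
    then have "continuous_on {0..t0} (\<lambda>h. \<phi> (t0 - h) z')"
      by (rule continuous_on_compose2) (auto intro!: continuous_intros)
    then have "((\<lambda>h. \<phi> (t0 - h) z') \<longlongrightarrow> \<phi> (t0 - 0) z') (at 0 within {0..t0})"
      using t0pos unfolding continuous_on_def by (metis atLeastAtMost_iff less_eq_real_def order_refl)
    then show ?thesis using t0pos by (simp add: at_within_Icc_at_right)
  qed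
  have ev2: "\<forall>\<^sub>F h in at_right 0. dist (\<phi> (t0 - h) z1) c < \<rho>"
    using tendstoD[OF lim[OF z(1)] rho] by (simp add: c_def)
  have ev3: "\<forall>\<^sub>F h in at_right 0. dist (\<phi> (t0 - h) z2) c < \<rho>"
    using tendstoD[OF lim[OF z(2)] rho] t0(3) by (simp add: c_def)
  have ev4: "\<forall>\<^sub>F h in at_right 0. h \<in> {0<..<t0}" using t0pos by (rule eventually_at_right_real)
  have "\<forall>\<^sub>F h in at_right (0::real). False"
    using ev1 ev2 ev3 ev4
  proof eventually_elim
    case (elim h)
    let ?x = "\<phi> (t0 - h) z1" and ?y = "\<phi> (t0 - h) z2"
    have h: "0 < h" "h < t0" using elim by auto
    have holh: "(\<lambda>x. \<phi> h x - x) holomorphic_on unit_disk"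
      using h by (intro holomorphic_intros disk_self_mapD(1)[OF self_map]) auto
    have d: "cmod (deriv (\<lambda>x. \<phi> h x - x) w) \<le> 1/2" if w: "w \<in> ball c \<rho>" for w
    proof -
      have wsub: "cball w \<rho> \<subseteq> cball c (2 * \<rho>)"
      proof
        fix v assume "v \<in> cball w \<rho>"
        then show "v \<in> cball c (2 * \<rho>)" using w dist_triangle[of c v w] by simp
      qed
      have "cmod (deriv (\<lambda>x. \<phi> h x - x) w) \<le> (\<rho> / 2) / \<rho>"
      proof (rule norm_deriv_le_cball[OF holh subset_trans[OF wsub sub] rho])
        fix v assume "v \<in> cball w \<rho>"
        then have "dist (\<phi> h v) v < \<rho> / 2" using wsub elim(1) by blast
        then show "cmod (\<phi> h v - v) \<le> \<rho> / 2" by (simp add: dist_norm)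
      qed
      then show ?thesis using rho by simp
    qed
    \<comment> \<open>The map \<phi> h minus the identity is bounded by \<rho>/2, hence
      1/2-Lipschitz near c. If \<phi> h takes equal values at both points, their distance is at most
      half of itself.\<close>
    have "cmod ((\<phi> h ?x - ?x) - (\<phi> h ?y - ?y)) \<le> 1/2 * cmod (?x - ?y)"
    proof (rule field_differentiable_bound[where f' = "deriv (\<lambda>x. \<phi> h x - x)" and S = "ball c \<rho>"])
      fix w assume w: "w \<in> ball c \<rho>"
      have "ball c \<rho> \<subseteq> cball c (2 * \<rho>)" using rho by (intro order_trans[OF ball_subset_cball] subset_cball) auto
      then have "w \<in> unit_disk" using w sub by blast
      then show "((\<lambda>x. \<phi> h x - x) has_field_derivative deriv (\<lambda>x. \<phi> h x - x) w) (at w within ball c \<rho>)"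
        by (rule holomorphic_derivI[OF holh open_ball])
    qed (use d elim in \<open>auto simp: dist_commute\<close>)
    moreover have "\<phi> h ?x = \<phi> h ?y"
      using phi_add[of h "t0 - h" z1] phi_add[of h "t0 - h" z2] h t0(3) z by simp
    ultimately have "cmod (?x - ?y) \<le> 1/2 * cmod (?x - ?y)" by (simp add: norm_minus_commute)
    then have "?x - ?y = 0" by simp
    then have "t0 - h \<in> S" using h t0 by (auto simp: S_def)
    then have "t0 \<le> t0 - h" unfolding t0_def by (intro cInf_lower) (auto simp: S_def intro!: bdd_belowI[of _ 0])
    then show False using h by simp
  qed
  then show False using trivial_limit_at_right_real[of 0] by (simp add: eventually_False)
qed

definition orbit_integral :: "(complex \<Rightarrow> complex) \<Rightarrow> real \<Rightarrow> complex \<Rightarrow> complex" where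
  "orbit_integral f t z = integral {0..t} (\<lambda>u. f (\<phi> u z))"

lemma continuous_on_deriv_compose_phi:
  assumes "f holomorphic_on unit_disk"
  shows "continuous_on ({0..T} \<times> unit_disk) (\<lambda>x. deriv (\<lambda>z. f (\<phi> (fst x) z)) (snd x))"
  by (rule continuous_on_deriv_param[OF continuous_on_compose_phi[OF assms]])
     (auto intro!: holomorphic_compose_phi assms)

lemma has_field_derivative_orbit_integral:
  assumes f: "f holomorphic_on unit_disk" and z: "cmod z < 1"
  shows "(orbit_integral f t has_field_derivative integral {0..t} (\<lambda>u. deriv (\<lambda>z. f (\<phi> u z)) z)) (at z)"
  unfolding orbit_integral_def[abs_def]
  by (rule has_field_derivative_integral_param[OF continuous_on_compose_phi[OF f]])
     (auto intro!: holomorphic_compose_phi f simp: z)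

lemma deriv_orbit_integral:
  "f holomorphic_on unit_disk \<Longrightarrow> cmod z < 1 \<Longrightarrow>
    deriv (orbit_integral f t) z = integral {0..t} (\<lambda>u. deriv (\<lambda>z. f (\<phi> u z)) z)"
  by (rule DERIV_imp_deriv[OF has_field_derivative_orbit_integral])

lemma holomorphic_orbit_integral:
  "f holomorphic_on unit_disk \<Longrightarrow> orbit_integral f t holomorphic_on unit_disk"
  using has_field_derivative_orbit_integral[of f _ t]
  by (intro holomorphic_onI) (auto simp: field_differentiable_def intro: has_field_derivative_at_within)

lemma orbit_integral_phi:
  assumes f: "f holomorphic_on unit_disk" and z: "cmod z < 1" and t: "0 \<le> t" "0 \<le> h"
  shows "orbit_integral f t (\<phi> h z) = orbit_integral f (t + h) z - orbit_integral f h z"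
proof -
  have "orbit_integral f t (\<phi> h z) = integral {0..t} ((\<lambda>u. f (\<phi> u z)) \<circ> (+) h)"
    unfolding orbit_integral_def using phi_add z t by (intro integral_cong) (simp add: add.commute)
  also have "\<dots> = integral {h..t + h} (\<lambda>u. f (\<phi> u z))"
    by (subst integral_shift_Icc_real) simp
  also have "\<dots> = orbit_integral f (t + h) z - orbit_integral f h z"
    unfolding orbit_integral_def
    using Henstock_Kurzweil_Integration.integral_combine[of 0 h "t + h" "\<lambda>u. f (\<phi> u z)"] t
      integrable_continuous_real[OF continuous_on_orbit[OF f z, of "t + h"]]
    by (simp add: algebra_simps)
  finally show ?thesis .
qed

end

section \<open>Infinitesimal generators and the Berkson--Porta formula\<close>

lemma Re_of_real_mult: "Re (of_real x * c) = x * Re c"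
  by simp

lemma Re_mult_cnj_le: "cmod a \<le> cmod c \<Longrightarrow> Re (a * cnj c) \<le> cmod c * cmod c"
  using complex_Re_le_cmod[of "a * cnj c"] mult_right_mono[of "cmod a" "cmod c" "cmod c"] by (simp add: norm_mult)

locale generated_semigroup = disk_semigroup +
  fixes G :: "complex \<Rightarrow> complex"
  assumes generator: "is_generator \<phi> G" and nontrivial: "nontrivial_semigroup \<phi>"
begin

lemma tendsto_generator: "cmod z < 1 \<Longrightarrow> ((\<lambda>t. (\<phi> t z - z) / of_real t) \<longlongrightarrow> G z) (at_right 0)"
  using generator by (simp add: is_generator_def)

text \<open>Compute the right derivative at h = 0 of the orbit integral at \<phi> h z in two ways.
  The chain rule gives G z times the complex derivative; the semigroup law turns composition into a
  time shift, and the fundamental theorem gives f (\<phi> t z) - f z.\<close>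

lemma generator_deriv_orbit_integral:
  assumes f: "f holomorphic_on unit_disk" and z: "cmod z < 1" and t: "0 < t"
  shows "G z * deriv (orbit_integral f t) z = f (\<phi> t z) - f z"
proof -
  let ?A = "orbit_integral f t"
  \<comment> \<open>Caratheodory's form of differentiability, which allows composition with the
    one-sided limit defining the generator.\<close>
  obtain g where g: "\<And>y. ?A y - ?A z = g y * (y - z)" "isCont g z" "g z = deriv ?A z"
    using has_field_derivative_orbit_integral[OF f z, of t] deriv_orbit_integral[OF f z, of t]
    unfolding CARAT_DERIV by auto
  have "((\<lambda>h. g (\<phi> h z) * ((\<phi> h z - z) / of_real h)) \<longlongrightarrow> g z * G z) (at_right 0)"
    by (intro tendsto_mult isCont_tendsto_compose[OF g(2)] tendsto_phi_0 tendsto_generator z)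
  then have lim1: "((\<lambda>h. (?A (\<phi> h z) - ?A z) / of_real h) \<longlongrightarrow> deriv ?A z * G z) (at_right 0)"
    by (simp add: g)
  define I where "I = (\<lambda>x. orbit_integral f x z)"
  have dI: "(I has_vector_derivative f (\<phi> x z)) (at x within {0..t + 1})" if "0 \<le> x" "x \<le> t + 1" for x
    unfolding I_def orbit_integral_def
    using integral_has_vector_derivative[OF continuous_on_orbit[OF f z, of "t + 1"], of x] that by simp
  have q: "((\<lambda>h. (I (x + h) - I x) / of_real h) \<longlongrightarrow> f (\<phi> x z)) (at_right 0)" if x: "0 \<le> x" "x \<le> t" for x
  proof -
    have "(I has_vector_derivative f (\<phi> x z)) (at x within {x..t + 1})"
      by (rule has_vector_derivative_within_subset[OF dI]) (use x in auto)
    then have "((\<lambda>y. norm (I y - I x - (y - x) *\<^sub>R f (\<phi> x z)) / norm (y - x)) \<longlongrightarrow> 0) (at_right x)"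
      using x by (simp add: has_vector_derivative_def has_derivative_iff_norm at_within_Icc_at_right)
    then have "((\<lambda>h. norm (I (h + x) - I x - (h + x - x) *\<^sub>R f (\<phi> x z)) / norm (h + x - x)) \<longlongrightarrow> 0) (at_right 0)"
      by (subst (asm) filterlim_at_right_to_0)
    then have "((\<lambda>h. norm ((I (x + h) - I x) / of_real h - f (\<phi> x z))) \<longlongrightarrow> 0) (at_right 0)"
    proof (rule Lim_transform_eventually)
      have "\<forall>\<^sub>F h in at_right (0::real). 0 < h" by (simp add: eventually_at_right_less)
      then show "\<forall>\<^sub>F h in at_right 0. norm (I (h + x) - I x - (h + x - x) *\<^sub>R f (\<phi> x z)) / norm (h + x - x) = norm ((I (x + h) - I x) / of_real h - f (\<phi> x z))"
      proof eventually_elim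
        case (elim h)
        then have "(I (x + h) - I x) / of_real h - f (\<phi> x z) = (I (h + x) - I x - (h + x - x) *\<^sub>R f (\<phi> x z)) / of_real h"
          by (simp add: diff_divide_distrib scaleR_conv_of_real add.commute)
        then show ?case using elim by (simp add: norm_divide)
      qed
    qed
    then show ?thesis by (rule LIM_zero_cancel[OF tendsto_norm_zero_cancel])
  qed
  have "((\<lambda>h. (I (t + h) - I t) / of_real h - (I (0 + h) - I 0) / of_real h) \<longlongrightarrow> f (\<phi> t z) - f (\<phi> 0 z)) (at_right 0)"
    using t by (intro tendsto_diff q) auto
  moreover have "\<forall>\<^sub>F h in at_right 0. (I (t + h) - I t) / of_real h - (I (0 + h) - I 0) / of_real h = (?A (\<phi> h z) - ?A z) / of_real h"
  proof -
    have "\<forall>\<^sub>F h in at_right (0::real). 0 < h" by (simp add: eventually_at_right_less)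
    then show ?thesis
    proof eventually_elim
      case (elim h)
      have "I 0 = 0" by (simp add: I_def orbit_integral_def)
      then show ?case
        using orbit_integral_phi[OF f z, of t h] t elim by (simp add: I_def diff_divide_distrib)
    qed
  qed
  ultimately have "((\<lambda>h. (?A (\<phi> h z) - ?A z) / of_real h) \<longlongrightarrow> f (\<phi> t z) - f z) (at_right 0)"
    using z by (simp add: tendsto_cong phi_0)
  from tendsto_unique[OF _ lim1 this] show ?thesis by (simp add: mult.commute)
qed

text \<open>\<open>is_generator\<close> is a pointwise limit. Holomorphy follows from the previous
  identity with f the identity: G = (\<phi> t z - z) / A' z, where A is the orbit integral of the
  identity. For small t its derivative at z0 is close to t, hence not 0.\<close>

lemma holomorphic_generator: "G holomorphic_on unit_disk"
proof (rule holomorphic_onI)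
  fix z0 :: complex assume "z0 \<in> unit_disk"
  then have z0: "cmod z0 < 1" by simp
  have id: "(\<lambda>z::complex. z) holomorphic_on unit_disk" by simp
  have cont: "continuous_on {0..1} (\<lambda>u. deriv (\<phi> u) z0)"
  proof -
    have "continuous_on {0..1} (\<lambda>u. (u, z0))" "(\<lambda>u. (u, z0)) ` {0..1} \<subseteq> {0..1} \<times> unit_disk"
      using z0 by (auto intro!: continuous_intros)
    from continuous_on_compose2[OF continuous_on_deriv_compose_phi[OF id] this] show ?thesis by simp
  qed
  have d0: "deriv (\<phi> 0) z0 = 1"
  proof -
    have "deriv (\<phi> 0) z0 = deriv (\<lambda>z. z) z0"
      by (rule deriv_cong_ev, rule eventually_mono[OF eventually_nhds_in_open[of unit_disk z0]])
         (use z0 phi_0 in \<open>auto simp: in_disk_iff\<close>)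
    then show ?thesis by simp
  qed
  obtain d where d: "0 < d" "\<And>u. u \<in> {0..1} \<Longrightarrow> dist u 0 < d \<Longrightarrow> dist (deriv (\<phi> u) z0) (deriv (\<phi> 0) z0) < 1/2"
    using cont unfolding continuous_on_iff by (metis atLeastAtMost_iff half_gt_zero less_eq_real_def zero_less_one zero_le_one order_refl)
  define t where "t = min 1 (d / 2)"
  have t: "0 < t" "t \<le> 1" "t < d" using d by (auto simp: t_def)
  let ?A = "orbit_integral (\<lambda>z. z) t"
  have contt: "continuous_on {0..t} (\<lambda>u. deriv (\<phi> u) z0)" using continuous_on_subset[OF cont] t by simp
  have "cmod (integral {0..t} (\<lambda>u. deriv (\<phi> u) z0 - 1)) \<le> 1/2 * (t - 0)"
    by (rule integral_bound) (use t d d0 contt in \<open>auto intro!: continuous_intros simp: dist_norm less_imp_le\<close>)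
  moreover have "integral {0..t} (\<lambda>u. deriv (\<phi> u) z0 - 1) = deriv ?A z0 - t"
    using integrable_continuous_real[OF contt] t
    by (subst integral_diff) (auto simp: deriv_orbit_integral[OF id z0] scaleR_conv_of_real)
  ultimately have nz: "deriv ?A z0 \<noteq> 0" using t by auto
  have holA: "deriv ?A holomorphic_on unit_disk"
    by (intro holomorphic_deriv holomorphic_orbit_integral id) auto
  have "isCont (deriv ?A) z0" using holA z0 by (auto simp: continuous_on_eq_continuous_at[symmetric] intro: continuous_on_interior holomorphic_on_imp_continuous_on)
  then have ev: "\<forall>\<^sub>F z in nhds z0. deriv ?A z \<noteq> 0"
    using nz tendsto_imp_eventually_ne[of "deriv ?A" "deriv ?A z0" "nhds z0" 0] by (simp add: continuous_at tendsto_nhds_iff)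
  have "(\<lambda>z. (\<phi> t z - z) / deriv ?A z) field_differentiable at z0"
    using z0 t holA nz disk_self_mapD(1)[OF self_map[of t]]
    by (intro field_differentiable_divide field_differentiable_diff field_differentiable_ident)
       (auto intro!: holomorphic_on_imp_differentiable_at[of _ unit_disk])
  then obtain D where D: "((\<lambda>z. (\<phi> t z - z) / deriv ?A z) has_field_derivative D) (at z0)" by (auto simp: field_differentiable_def)
  have "\<forall>\<^sub>F z in nhds z0. z \<in> unit_disk" using z0 by (intro eventually_nhds_in_open) auto
  with ev have "\<forall>\<^sub>F z in nhds z0. (\<phi> t z - z) / deriv ?A z = G z"
  proof eventually_elim
    case (elim z)
    then show ?case using generator_deriv_orbit_integral[OF id _ t(1), of z] by (simp add: field_simps)
  qed
  then have "(G has_field_derivative D) (at z0)"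
    using D by (subst (asm) DERIV_cong_ev[OF refl _ refl]) auto
  then show "G field_differentiable at z0 within unit_disk"
    by (auto simp: field_differentiable_def intro: has_field_derivative_at_within)
qed

lemma generator_not_identically_0: "\<exists>z. cmod z < 1 \<and> G z \<noteq> 0"
proof (rule ccontr)
  assume *: "\<not> ?thesis"
  have "\<phi> t z = z" if "0 \<le> t" "cmod z < 1" for t z
  proof (cases "t = 0")
    case False
    then show ?thesis using generator_deriv_orbit_integral[of "\<lambda>z. z" z t] * that by auto
  qed (use phi_0 that in simp)
  then show False using nontrivial by (auto simp: nontrivial_semigroup_def)
qed

text \<open>The displacement is G y times an integral of the derivatives of \<phi> v at y, and
  Schwarz--Pick bounds these derivatives through the displacement itself. The restriction on t
  closes the loop.\<close>

lemma displacement_le: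
  assumes y: "cmod y < 1" and t: "t * cmod (G y) \<le> (1 - (cmod y)\<^sup>2) / 4" and u: "0 \<le> u" "u \<le> t"
  shows "cmod (\<phi> u y - y) \<le> 2 * u * cmod (G y)"
proof -
  define x where "x = 1 - (cmod y)\<^sup>2"
  have x: "0 < x" using one_minus_norm_sq_pos[OF y] by (simp add: x_def)
  have id: "(\<lambda>z::complex. z) holomorphic_on unit_disk" by simp
  have t0: "0 \<le> t" using u by simp
  have "continuous_on {0..t} (\<lambda>v. cmod (\<phi> v y - y))"
    using continuous_on_orbit[OF id y] by (intro continuous_intros)
  then obtain v0 where v0: "v0 \<in> {0..t}" "\<And>v. v \<in> {0..t} \<Longrightarrow> cmod (\<phi> v y - y) \<le> cmod (\<phi> v0 y - y)"
    using continuous_attains_sup[of "{0..t}" "\<lambda>v. cmod (\<phi> v y - y)"] t0 by (auto simp: compact_Icc)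
  \<comment> \<open>The largest displacement up to time t. With x = 1 - |y|^2, the estimates below
    give M \<le> x/4 + M/2, so the derivatives are at most 2.\<close>
  define M where "M = cmod (\<phi> v0 y - y)"
  have d: "cmod (deriv (\<phi> v) y) \<le> 1 + 2 * M / x" if v: "v \<in> {0..t}" for v
  proof -
    have v1: "cmod (\<phi> v y) < 1" using norm_less_1 v y by auto
    have "cmod (deriv (\<phi> v) y) * x \<le> 1 - (cmod (\<phi> v y))\<^sup>2"
      unfolding x_def using v by (intro Schwarz_Pick_deriv self_map y) auto
    also have "\<dots> \<le> x + 2 * M"
    proof -
      have "(cmod y)\<^sup>2 - (cmod (\<phi> v y))\<^sup>2 = (cmod y + cmod (\<phi> v y)) * (cmod y - cmod (\<phi> v y))"
        by (simp add: power2_eq_square algebra_simps)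
      also have "\<dots> \<le> (cmod y + cmod (\<phi> v y)) * M"
        using v0(2)[OF v] norm_triangle_ineq2[of y "\<phi> v y"] by (intro mult_left_mono) (auto simp: M_def norm_minus_commute)
      also have "\<dots> \<le> 2 * M" using y v1 by (intro mult_right_mono) (auto simp: M_def)
      finally show ?thesis by (simp add: x_def)
    qed
    finally show ?thesis using x by (simp add: field_simps)
  qed
  have disp: "cmod (\<phi> v y - y) \<le> cmod (G y) * (v * (1 + 2 * M / x))" if v: "v \<in> {0..t}" for v
  proof (cases "v = 0")
    case True
    then show ?thesis using phi_0[OF y] by simp
  next
    case False
    have cont: "continuous_on {0..v} (\<lambda>u. deriv (\<phi> u) y)"
    proof -
      have "continuous_on {0..v} (\<lambda>u. (u, y))" "(\<lambda>u. (u, y)) ` {0..v} \<subseteq> {0..v} \<times> unit_disk"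
        using y by (auto intro!: continuous_intros)
      from continuous_on_compose2[OF continuous_on_deriv_compose_phi[OF id] this] show ?thesis by simp
    qed
    have "cmod (integral {0..v} (\<lambda>u. deriv (\<phi> u) y)) \<le> (1 + 2 * M / x) * (v - 0)"
      by (rule integral_bound) (use v d cont in auto)
    moreover have "\<phi> v y - y = G y * integral {0..v} (\<lambda>u. deriv (\<phi> u) y)"
      using generator_deriv_orbit_integral[OF id y, of v] deriv_orbit_integral[OF id y, of v] v False by simp
    ultimately show ?thesis by (simp add: norm_mult mult_left_mono mult.commute)
  qed
  have Gt: "cmod (G y) * v0 \<le> cmod (G y) * t" using v0 by (intro mult_left_mono) auto
  have "M \<le> cmod (G y) * v0 * (1 + 2 * M / x)" using disp[OF v0(1)] by (simp add: M_def mult.assoc)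
  also have "\<dots> \<le> cmod (G y) * t * (1 + 2 * M / x)" using x Gt by (intro mult_right_mono) (auto simp: M_def)
  also have "\<dots> \<le> x / 4 * (1 + 2 * M / x)" using t x by (intro mult_right_mono) (auto simp: M_def x_def mult.commute)
  also have "\<dots> = x / 4 + M / 2" using x by (simp add: field_simps)
  finally have "2 * M / x \<le> 1" using x by simp
  then have "cmod (G y) * (u * (1 + 2 * M / x)) \<le> cmod (G y) * (u * 2)" using u by (intro mult_left_mono) auto
  then show ?thesis using disp[of u] u by (simp add: mult_ac)
qed

text \<open>The pseudohyperbolic distance of \<phi> t z and \<phi> t w never exceeds its value at t
  = 0. The left side is the right derivative at 0 of the logarithm of this distance; n and d are
  numerator and denominator of the quotient.\<close>

lemma infinitesimal_Schwarz_Pick: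
  assumes z: "cmod z < 1" and w: "cmod w < 1" and ne: "z \<noteq> w"
  shows "Re ((G z - G w) / (z - w) + (cnj (G w) * z + cnj w * G z) / (1 - cnj w * z)) \<le> 0"
proof -
  define n where "n = (\<lambda>t. \<phi> t z - \<phi> t w)"
  define d where "d = (\<lambda>t. 1 - cnj (\<phi> t w) * \<phi> t z)"
  define n0 where "n0 = z - w"
  define d0 where "d0 = 1 - cnj w * z"
  have nz: "n0 \<noteq> 0" "d0 \<noteq> 0" using ne one_minus_cnj_mult_neq_0[of w z] z w by (auto simp: n0_def d0_def)
  have pos: "\<forall>\<^sub>F t in at_right (0::real). 0 < t" by (simp add: eventually_at_right_less)
  have ln: "((\<lambda>t. (n t - n0) / of_real t) \<longlongrightarrow> G z - G w) (at_right 0)"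
    using tendsto_diff[OF tendsto_generator[OF z] tendsto_generator[OF w]]
  proof (rule Lim_transform_eventually)
    have "(\<phi> t z - z) / of_real t - (\<phi> t w - w) / of_real t = (n t - n0) / of_real t" for t
      unfolding diff_divide_distrib[symmetric] by (simp add: n_def n0_def algebra_simps)
    then show "\<forall>\<^sub>F t in at_right 0. (\<phi> t z - z) / of_real t - (\<phi> t w - w) / of_real t = (n t - n0) / of_real t" by simp
  qed
  have cw: "((\<lambda>t. cnj ((\<phi> t w - w) / of_real t)) \<longlongrightarrow> cnj (G w)) (at_right 0)"
    by (intro tendsto_cnj tendsto_generator w)
  have "((\<lambda>t. - (cnj (\<phi> t w) * ((\<phi> t z - z) / of_real t) + cnj ((\<phi> t w - w) / of_real t) * z)) \<longlongrightarrow> - (cnj w * G z + cnj (G w) * z)) (at_right 0)"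
    by (intro tendsto_intros tendsto_phi_0 tendsto_generator z w cw)
  then have ld: "((\<lambda>t. (d t - d0) / of_real t) \<longlongrightarrow> - (cnj w * G z + cnj (G w) * z)) (at_right 0)"
  proof (rule Lim_transform_eventually)
    show "\<forall>\<^sub>F t in at_right 0. - (cnj (\<phi> t w) * ((\<phi> t z - z) / of_real t) + cnj ((\<phi> t w - w) / of_real t) * z) = (d t - d0) / of_real t"
      using pos by eventually_elim (simp add: d_def d0_def field_simps)
  qed
  have ldt: "(d \<longlongrightarrow> d0) (at_right 0)" unfolding d_def d0_def by (intro tendsto_intros tendsto_phi_0 z w)
  let ?q = "\<lambda>t. n t / d t" and ?r = "n0 / d0"
  let ?L = "((G z - G w) * d0 - n0 * (- (cnj w * G z + cnj (G w) * z))) / (d0 * d0)"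
  have "((\<lambda>t. ((n t - n0) / of_real t * d0 - n0 * ((d t - d0) / of_real t)) / (d t * d0)) \<longlongrightarrow> ?L) (at_right 0)"
    using nz by (intro tendsto_intros ln ld ldt) auto
  then have lq: "((\<lambda>t. (?q t - ?r) / of_real t) \<longlongrightarrow> ?L) (at_right 0)"
  proof (rule Lim_transform_eventually)
    show "\<forall>\<^sub>F t in at_right 0. ((n t - n0) / of_real t * d0 - n0 * ((d t - d0) / of_real t)) / (d t * d0) = (?q t - ?r) / of_real t"
      using pos
    proof eventually_elim
      case (elim t)
      have "d t \<noteq> 0" using one_minus_cnj_mult_neq_0[of "\<phi> t w" "\<phi> t z"] norm_less_1[of t z] norm_less_1[of t w] elim z w by (auto simp: d_def)
      then show ?case using nz elim by (simp add: field_simps)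
    qed
  qed
  have "((\<lambda>t. Re ((?q t - ?r) / of_real t * cnj ?r)) \<longlongrightarrow> Re (?L * cnj ?r)) (at_right 0)"
    by (intro tendsto_intros lq)
  moreover have "\<forall>\<^sub>F t in at_right 0. Re ((?q t - ?r) / of_real t * cnj ?r) \<le> 0"
    using pos
  proof eventually_elim
    case (elim t)
    have "cmod (?q t) \<le> cmod ?r"
    proof -
      have "cmod (disk_aut (\<phi> t w) (\<phi> t z)) \<le> cmod (disk_aut w z)"
        using elim by (intro Schwarz_Pick self_map z w) auto
      then show ?thesis by (simp add: disk_aut_def n_def n0_def d_def d0_def norm_divide norm_minus_commute)
    qed
    then have "Re (?q t * cnj ?r) \<le> cmod ?r * cmod ?r" by (rule Re_mult_cnj_le)
    moreover have "Re (?r * cnj ?r) = cmod ?r * cmod ?r"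
      using complex_norm_square[of ?r] by (metis Re_complex_of_real power2_eq_square)
    ultimately have "Re ((?q t - ?r) * cnj ?r) \<le> 0" by (simp only: left_diff_distrib minus_complex.sel)
    moreover have "Re ((?q t - ?r) / of_real t * cnj ?r) = Re ((?q t - ?r) * cnj ?r) / t"
      by (metis Re_divide_of_real times_divide_eq_left)
    ultimately show ?case using elim by (simp only: divide_le_0_iff) auto
  qed
  ultimately have "Re (?L * cnj ?r) \<le> 0"
    by (rule tendsto_upperbound) simp
  \<comment> \<open>Multiplication by the conjugate turns the derivative of the quotient into |r|^2
    times its logarithmic derivative.\<close>
  moreover have "?L * cnj ?r = of_real ((cmod ?r)\<^sup>2) * ((G z - G w) / n0 + (cnj (G w) * z + cnj w * G z) / d0)"
    unfolding complex_norm_square using nz by (simp add: field_simps)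
  ultimately have "(cmod ?r)\<^sup>2 * Re ((G z - G w) / n0 + (cnj (G w) * z + cnj w * G z) / d0) \<le> 0"
    by (simp only: Re_of_real_mult)
  moreover have "0 < (cmod ?r)\<^sup>2" using nz by simp
  ultimately show ?thesis unfolding n0_def d0_def by (simp only: mult_le_0_iff) auto
qed

text \<open>The perturbation \<open>G z - e z\<close> points strictly inward near the circle, so it has a zero in the disk even if \<open>G\<close> has none.
  Limits of these zeros as \<open>e\<close> tends to 0 yield the Denjoy--Wolff point.\<close>

lemma generator_perturbed_zero:
  assumes e: "0 < e"
  shows "\<exists>b. cmod b < 1 \<and> G b = of_real e * b"
proof (rule ccontr)
  assume no: "\<not> ?thesis"
  define k where "k = cmod (G 0)"
  \<comment> \<open>Chosen so that e * r^2 - k * (1 - r^2) = e/2: on the circle of radius r the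
    inward term e * z outweighs what G 0 can contribute.\<close>
  define r where "r = sqrt ((k + e / 2) / (k + e))"
  have k: "0 \<le> k" by (simp add: k_def)
  have r2: "r\<^sup>2 = (k + e / 2) / (k + e)" using k e by (simp add: r_def)
  have r: "0 < r" "r < 1" using k e by (auto simp: r_def field_simps)
  have key: "k * (1 - r\<^sup>2) < e * r\<^sup>2"
  proof -
    have "(k + e) * r\<^sup>2 = k + e / 2" unfolding r2 using k e by simp
    then show ?thesis using e by (simp add: algebra_simps)
  qed
  define g where "g = (\<lambda>z. G z - of_real e * z)"
  have contg: "continuous_on (cball 0 r) g"
    unfolding g_def using r
    by (intro continuous_intros holomorphic_on_imp_continuous_on holomorphic_on_subset[OF holomorphic_generator]) auto
  have gnz: "g z \<noteq> 0" if "z \<in> cball 0 r" for z using no that r by (auto simp: g_def)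
  \<comment> \<open>Without a zero of g, Brouwer's theorem yields a fixed point of r * sgn g. It
    lies on the circle of radius r, and there g is a positive multiple of z, so it points outward.
    Infinitesimal Schwarz--Pick against the point 0 says that it points inward.\<close>
  have "continuous_on (cball 0 r) (\<lambda>z. of_real r * sgn (g z))"
    using gnz by (intro continuous_intros continuous_on_sgn contg) auto
  moreover have "(\<lambda>z. of_real r * sgn (g z)) \<in> cball 0 r \<rightarrow> cball 0 r"
    using r gnz by (auto simp: norm_mult norm_sgn)
  ultimately obtain z where z: "z \<in> cball 0 r" "of_real r * sgn (g z) = z"
    using brouwer_ball[OF r(1)] by metis
  have nz: "cmod z = r"
  proof -
    have "cmod (of_real r * sgn (g z)) = r" using r gnz[OF z(1)] by (simp add: norm_mult norm_sgn)
    then show ?thesis by (simp only: z(2))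
  qed
  then have z0: "z \<noteq> 0" using r by auto
  have gz: "g z = of_real (cmod (g z) / r) * z"
  proof -
    have "of_real (cmod (g z) / r) * z = of_real (cmod (g z) / r) * (of_real r * sgn (g z))" by (simp only: z(2))
    also have "\<dots> = of_real (cmod (g z)) * sgn (g z)" using r by simp
    also have "\<dots> = g z" using gnz[OF z(1)] by (simp add: sgn_eq)
    finally show ?thesis by simp
  qed
  have zz: "cnj z * z = of_real (r\<^sup>2)" using complex_norm_square[of z] nz by (simp add: mult.commute)
  have "Re ((G z - G 0) / (z - 0) + (cnj (G 0) * z + cnj 0 * G z) / (1 - cnj 0 * z)) \<le> 0"
    using nz r z0 by (intro infinitesimal_Schwarz_Pick) auto
  then have "r\<^sup>2 * Re ((G z - G 0) / z + cnj (G 0) * z) \<le> 0" by (simp add: mult_nonneg_nonpos)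
  moreover have "r\<^sup>2 * Re ((G z - G 0) / z + cnj (G 0) * z) = Re (of_real (r\<^sup>2) * ((G z - G 0) / z + cnj (G 0) * z))"
    by (simp only: Re_of_real_mult)
  moreover have "of_real (r\<^sup>2) * ((G z - G 0) / z + cnj (G 0) * z) = cnj z * (G z - G 0) + of_real (r\<^sup>2) * (cnj (G 0) * z)"
    unfolding distrib_left zz[symmetric] using z0 by simp
  ultimately have "Re (cnj z * (G z - G 0) + of_real (r\<^sup>2) * (cnj (G 0) * z)) \<le> 0" by (simp only:)
  then have "Re (cnj z * G z) \<le> Re (cnj z * G 0) - r\<^sup>2 * Re (cnj (G 0) * z)"
    by (simp only: plus_complex.sel Re_of_real_mult right_diff_distrib minus_complex.sel)
  also have "Re (cnj (G 0) * z) = Re (cnj z * G 0)" by (simp add: algebra_simps)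
  also have "Re (cnj z * G 0) - r\<^sup>2 * Re (cnj z * G 0) = Re (cnj z * G 0) * (1 - r\<^sup>2)" by (simp add: algebra_simps)
  also have "\<dots> \<le> k * (1 - r\<^sup>2)"
  proof (rule mult_right_mono)
    have "Re (cnj z * G 0) \<le> cmod (cnj z * G 0)" by (rule complex_Re_le_cmod)
    also have "\<dots> \<le> k" using nz r by (simp add: norm_mult k_def mult_left_le_one_le)
    finally show "Re (cnj z * G 0) \<le> k" .
    show "0 \<le> 1 - r\<^sup>2" using r by (simp add: power_le_one)
  qed
  finally have "Re (cnj z * G z) < e * r\<^sup>2" using key by simp
  moreover have "cnj z * G z = cnj z * g z + of_real (e * r\<^sup>2)"
    using zz by (simp add: g_def algebra_simps)
  ultimately have "Re (cnj z * g z) < 0" by simp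
  moreover have "cnj z * g z = of_real (cmod (g z) / r * r\<^sup>2)"
    by (subst gz) (metis mult.left_commute of_real_mult zz)
  ultimately have "cmod (g z) / r * r\<^sup>2 < 0" by (simp only: Re_complex_of_real)
  then show False using r by (simp add: mult_less_0_iff divide_less_0_iff)
qed

lemma generator_perturbed_sign:
  assumes b: "cmod b < 1" "G b = of_real e * b" and e: "0 \<le> e" and z: "cmod z < 1"
  shows "0 \<le> Re ((G z - of_real e * z) * cnj ((cnj b * z - 1) * (z - b)))"
proof (cases "z = b")
  case False
  define g where "g = G z - of_real e * z"
  define m where "m = (z - b) * (1 - cnj b * z)"
  have nz: "1 - cnj b * z \<noteq> 0" using one_minus_cnj_mult_neq_0[of b z] b z by auto
  have m0: "m \<noteq> 0" using nz False by (simp add: m_def)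
  have "(G z - G b) / (z - b) + (cnj (G b) * z + cnj b * G z) / (1 - cnj b * z)
     = of_real (1 - (cmod b)\<^sup>2) * (g / m) + of_real e * ((1 + cnj b * z) / (1 - cnj b * z))"
  proof -
    have bb: "of_real (1 - (cmod b)\<^sup>2) = 1 - cnj b * b"
      by (simp only: of_real_diff of_real_1 complex_norm_square mult.commute)
    have Gz: "G z = g + of_real e * z" by (simp add: g_def)
    have h1: "(G z - G b) / (z - b) = g / (z - b) + of_real e"
      using False by (simp add: Gz b(2) field_simps)
    have h2: "(cnj (G b) * z + cnj b * G z) / (1 - cnj b * z) = cnj b * g / (1 - cnj b * z) + of_real e * (2 * cnj b * z / (1 - cnj b * z))"
    proof -
      have "cnj (G b) * z + cnj b * G z = cnj b * g + of_real e * (2 * cnj b * z)" by (simp add: Gz b(2) algebra_simps)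
      then show ?thesis by (simp add: add_divide_distrib)
    qed
    have h3: "g / (z - b) + cnj b * g / (1 - cnj b * z) = (1 - cnj b * b) * (g / m)"
      using nz False by (simp add: m_def field_simps)
    have h4: "1 + 2 * cnj b * z / (1 - cnj b * z) = (1 + cnj b * z) / (1 - cnj b * z)"
      using nz by (simp add: field_simps)
    show ?thesis unfolding bb h1 h2 h3[symmetric] h4[symmetric]
      by (simp only: distrib_left mult_1_right add_ac)
  qed
  then have "Re (of_real (1 - (cmod b)\<^sup>2) * (g / m)) + Re (of_real e * ((1 + cnj b * z) / (1 - cnj b * z))) \<le> 0"
    using infinitesimal_Schwarz_Pick[OF z b(1) False] by (simp only: plus_complex.sel)
  then have "(1 - (cmod b)\<^sup>2) * Re (g / m) + e * Re ((1 + cnj b * z) / (1 - cnj b * z)) \<le> 0"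
    by (simp only: Re_of_real_mult)
  moreover have "0 \<le> Re ((1 + cnj b * z) / (1 - cnj b * z))"
  proof -
    have "cmod (cnj b * z) < 1" using norm_cnj_mult_less_1[of b z] b z by simp
    then have "(cmod (cnj b * z))\<^sup>2 \<le> 1" by (intro power_le_one) auto
    then show ?thesis using nz by (subst Re_Cayley_quotient) auto
  qed
  ultimately have "(1 - (cmod b)\<^sup>2) * Re (g / m) \<le> 0" using e by (smt (verit) mult_nonneg_nonneg)
  then have "Re (g / m) \<le> 0" using one_minus_norm_sq_pos[OF b(1)] by (simp add: mult_le_0_iff)
  then have "(cmod m)\<^sup>2 * Re (g / m) \<le> 0" by (simp add: mult_nonneg_nonpos)
  moreover have "g * cnj m = of_real ((cmod m)\<^sup>2) * (g / m)" unfolding complex_norm_square using m0 by simp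
  ultimately have "Re (g * cnj m) \<le> 0" by (simp only: Re_of_real_mult)
  moreover have "(cnj b * z - 1) * (z - b) = - m" by (simp add: m_def algebra_simps)
  ultimately show ?thesis unfolding g_def[symmetric] by (simp only: complex_cnj_minus mult_minus_right uminus_complex.sel)
qed simp

text \<open>A subsequence of the perturbed zeros converges in the closed disk. The sign condition
  was multiplied out so that it has no denominators and passes to the limit even when b lies on the
  circle.\<close>

lemma generator_sign:
  obtains b where "cmod b \<le> 1" "cmod b < 1 \<Longrightarrow> G b = 0"
    "\<And>z. cmod z < 1 \<Longrightarrow> 0 \<le> Re (G z * cnj ((cnj b * z - 1) * (z - b)))"
proof -
  define e where "e = (\<lambda>n::nat. 1 / (real n + 1))"
  have e: "0 < e n" for n by (simp add: e_def)
  have elim: "e \<longlonglongrightarrow> 0" unfolding e_def by real_asymp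
  obtain B where B: "\<And>n. cmod (B n) < 1" "\<And>n. G (B n) = of_real (e n) * B n"
    using generator_perturbed_zero[OF e] by metis
  have "B n \<in> cball 0 1" for n using B(1)[of n] by simp
  then obtain b r where b: "b \<in> cball 0 1" "strict_mono r" "(B \<circ> r) \<longlonglongrightarrow> b"
    using compact_cball[of "0::complex" 1] unfolding compact_def by metis
  have er: "(\<lambda>n. of_real (e (r n)) :: complex) \<longlonglongrightarrow> 0"
    using tendsto_of_real[OF LIMSEQ_subseq_LIMSEQ[OF elim b(2)], where 'a=complex] by (simp add: comp_def)
  have Br: "(\<lambda>n. B (r n)) \<longlonglongrightarrow> b" using b(3) by (simp add: comp_def)
  show ?thesis
  proof (rule that[of b])
    show "cmod b \<le> 1" using b(1) by simp
    show "G b = 0" if "cmod b < 1"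
    proof -
      have "isCont G b" using that holomorphic_on_imp_continuous_on[OF holomorphic_generator]
        by (simp add: continuous_on_eq_continuous_at)
      then have "(\<lambda>n. G (B (r n))) \<longlonglongrightarrow> G b" using Br by (rule isCont_tendsto_compose)
      moreover have "(\<lambda>n. G (B (r n))) \<longlonglongrightarrow> 0 * b" unfolding B(2) by (intro tendsto_mult er Br)
      ultimately show ?thesis using LIMSEQ_unique by fastforce
    qed
    fix z :: complex assume z: "cmod z < 1"
    have "(\<lambda>n. Re ((G z - of_real (e (r n)) * z) * cnj ((cnj (B (r n)) * z - 1) * (z - B (r n))))) \<longlonglongrightarrow>
        Re ((G z - 0 * z) * cnj ((cnj b * z - 1) * (z - b)))"
      by (intro tendsto_intros er Br)
    then have "0 \<le> Re ((G z - 0 * z) * cnj ((cnj b * z - 1) * (z - b)))"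
      by (rule tendsto_lowerbound) (intro always_eventually allI generator_perturbed_sign B z less_imp_le[OF e], simp)
    then show "0 \<le> Re (G z * cnj ((cnj b * z - 1) * (z - b)))" by simp
  qed
qed

text \<open>P is the quotient of G by the quadratic factor, with a removable singularity when b is
  in the disk. A zero of P would, by the open mapping theorem, produce values with negative real
  part unless P vanishes identically, and then the semigroup would be trivial.\<close>

lemma Berkson_Porta:
  obtains b P where "cmod b \<le> 1" "P holomorphic_on unit_disk" "\<And>z. cmod z < 1 \<Longrightarrow> 0 \<le> Re (P z)"
    "\<And>z. cmod z < 1 \<Longrightarrow> P z \<noteq> 0" "\<And>z. cmod z < 1 \<Longrightarrow> G z = (cnj b * z - 1) * (z - b) * P z"
proof -
  obtain b where b: "cmod b \<le> 1" "cmod b < 1 \<Longrightarrow> G b = 0"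
    "\<And>z. cmod z < 1 \<Longrightarrow> 0 \<le> Re (G z * cnj ((cnj b * z - 1) * (z - b)))" using generator_sign by blast
  have nz: "cnj b * z - 1 \<noteq> 0" if "cmod z < 1" for z
    using one_minus_cnj_mult_neq_0[OF b(1) that] by auto
  define F where "F = (\<lambda>z. G z / (cnj b * z - 1))"
  have F: "F holomorphic_on unit_disk" unfolding F_def
    using nz by (intro holomorphic_intros holomorphic_generator) auto
  define P where "P = (\<lambda>z. if z = b then deriv F b else F z / (z - b))"
  have P: "P holomorphic_on unit_disk"
  proof (cases "cmod b < 1")
    case True
    \<comment> \<open>The zero G b = 0 makes the singularity of F z / (z - b) removable, with value
      the derivative of F at b.\<close>
    show ?thesis
      by (rule pole_theorem_open_0[OF F open_ball, where a = b]) (auto simp: P_def F_def b(2)[OF True])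
  next
    case False
    have "(\<lambda>z. F z / (z - b)) holomorphic_on unit_disk" using False by (intro holomorphic_intros F) auto
    then show ?thesis by (rule holomorphic_transform) (use False in \<open>auto simp: P_def\<close>)
  qed
  have eq: "G z = (cnj b * z - 1) * (z - b) * P z" if "cmod z < 1" for z
    using nz[OF that] b(2) that by (auto simp: P_def F_def)
  have Re_ne: "0 \<le> Re (P z)" if z: "cmod z < 1" "z \<noteq> b" for z
  proof -
    define m where "m = (cnj b * z - 1) * (z - b)"
    have "m \<noteq> 0" using nz z by (simp add: m_def)
    have "0 \<le> Re (G z * cnj m)" unfolding m_def by (rule b(3)[OF z(1)])
    moreover have "G z * cnj m = of_real ((cmod m)\<^sup>2) * P z"
      unfolding complex_norm_square by (simp add: eq[OF z(1)] m_def)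
    ultimately have "0 \<le> (cmod m)\<^sup>2 * Re (P z)" by (simp only: Re_of_real_mult)
    moreover have "0 < (cmod m)\<^sup>2" using \<open>m \<noteq> 0\<close> by simp
    ultimately show ?thesis by (simp only: zero_le_mult_iff) auto
  qed
  have RePb: "0 \<le> Re (P b)" if bb: "cmod b < 1"
  proof -
    have "isCont P b" using bb holomorphic_on_imp_continuous_on[OF P] by (simp add: continuous_on_eq_continuous_at)
    then have "((\<lambda>z. Re (P z)) \<longlongrightarrow> Re (P b)) (at b)" by (intro tendsto_Re) (simp add: isCont_def)
    moreover have "\<forall>\<^sub>F z in at b. 0 \<le> Re (P z)"
    proof -
      have "\<forall>\<^sub>F z in at b. z \<in> unit_disk - {b}"
        using bb by (intro eventually_at_in_open) auto
      then show ?thesis by eventually_elim (auto intro!: Re_ne)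
    qed
    ultimately show ?thesis by (rule tendsto_lowerbound) simp
  qed
  have Re: "0 \<le> Re (P z)" if "cmod z < 1" for z using Re_ne RePb that by (cases "z = b") auto
  have "P z \<noteq> 0" if z: "cmod z < 1" for z
  proof
    assume 0: "P z = 0"
    have "P constant_on unit_disk"
    proof (rule ccontr)
      assume "\<not> P constant_on unit_disk"
      from open_mapping_thm[OF P open_ball connected_ball open_ball order_refl this]
      have "open (P ` unit_disk)" .
      moreover have "0 \<in> P ` unit_disk" using 0 z by (metis imageI in_disk_iff)
      ultimately obtain d where d: "0 < d" "ball 0 d \<subseteq> P ` unit_disk" by (meson openE)
      have "- of_real (d / 2) \<in> ball (0::complex) d" using d by (simp add: norm_divide)
      then have "- of_real (d / 2) \<in> P ` unit_disk" using d(2) by blast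
      then obtain w where "cmod w < 1" "P w = - of_real (d / 2)" by (metis imageE in_disk_iff)
      then show False using Re[of w] d(1) by simp
    qed
    then have "P w = 0" if "cmod w < 1" for w using 0 z that unfolding constant_on_def by (metis in_disk_iff)
    then show False using generator_not_identically_0 eq by auto
  qed
  then show ?thesis using that[OF b(1) P Re _ eq] by blast
qed

end

subsection \<open>The little space is contained in the continuity part\<close>

text \<open>Jensen's inequality in u for the derivative at each z, then Fubini. In contrast to a
  triangle inequality for finitely many terms, this loses no constant.\<close>

lemma dirichlet_energy_average:
  fixes K :: "real \<Rightarrow> complex \<Rightarrow> complex"
  assumes T: "0 < T" and K: "continuous_on ({0..T} \<times> unit_disk) (\<lambda>x. K (fst x) (snd x))"
    and hol: "\<And>u. u \<in> {0..T} \<Longrightarrow> K u holomorphic_on unit_disk" and p: "1 \<le> p"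
    and B: "\<And>u. u \<in> {0..T} \<Longrightarrow> dirichlet_energy p s (K u) \<le> B"
  shows "dirichlet_energy p s (\<lambda>z. of_real (1 / T) * integral {0..T} (\<lambda>u. K u z)) \<le> B"
proof -
  let ?W = "\<lambda>z. (1 - (cmod z)\<^sup>2) powr s"
  let ?k = "\<lambda>u z. deriv (K u) z"
  have contk: "continuous_on ({0..T} \<times> unit_disk) (\<lambda>x. ?k (fst x) (snd x))"
    by (rule continuous_on_deriv_param[OF K open_ball hol])
  have contku: "continuous_on {0..T} (\<lambda>u. ?k u z)" if z: "cmod z < 1" for z
  proof -
    have "continuous_on {0..T} (\<lambda>u. (u, z))" "(\<lambda>u. (u, z)) ` {0..T} \<subseteq> {0..T} \<times> unit_disk"
      using z by (auto intro!: continuous_intros)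
    from continuous_on_compose2[OF contk this] show ?thesis by simp
  qed
  have d: "deriv (\<lambda>z. of_real (1 / T) * integral {0..T} (\<lambda>u. K u z)) z = integral {0..T} (\<lambda>u. (1 / T) *\<^sub>R ?k u z)" if z: "cmod z < 1" for z
    using DERIV_imp_deriv[OF DERIV_cmult[OF has_field_derivative_integral_param[OF K hol z], of "of_real (1 / T)"]]
    by (simp add: scaleR_conv_of_real)
  let ?f = "\<lambda>u z. ennreal (indicator ({0..T} \<times> unit_disk) (u, z) *\<^sub>R (1 / T * cmod (?k u z) powr p * ?W z))"
  have contF: "continuous_on ({0..T} \<times> unit_disk) (\<lambda>x. 1 / T * cmod (?k (fst x) (snd x)) powr p * ?W (snd x))"
    using p by (intro continuous_on_mult continuous_on_const continuous_on_powr' continuous_on_norm contk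
       continuous_on_compose2[OF continuous_on_radial_powr] continuous_on_snd continuous_on_id) auto
  have "(\<lambda>x. indicator ({0..T} \<times> unit_disk) x *\<^sub>R (1 / T * cmod (?k (fst x) (snd x)) powr p * ?W (snd x))) \<in> borel_measurable borel"
    by (rule borel_measurable_continuous_on_indicator[OF _ contF]) (auto simp: borel_Times)
  then have meas: "(\<lambda>(u, z). ?f u z) \<in> borel_measurable (lborel \<Otimes>\<^sub>M lborel)"
    by (simp add: lborel_prod split_beta')
  have "dirichlet_energy p s (\<lambda>z. of_real (1 / T) * integral {0..T} (\<lambda>u. K u z)) \<le> (\<integral>\<^sup>+z. (\<integral>\<^sup>+u. ?f u z \<partial>lborel) \<partial>lborel)"
    unfolding dirichlet_energy_def
  proof (rule nn_integral_mono)
    fix z :: complex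
    let ?D = "deriv (\<lambda>z. of_real (1 / T) * integral {0..T} (\<lambda>u. K u z)) z"
    show "ennreal (cmod ?D powr p * ?W z) * indicator unit_disk z \<le> (\<integral>\<^sup>+u. ?f u z \<partial>lborel)"
    proof (cases "z \<in> unit_disk")
      case True
      then have z: "cmod z < 1" by simp
      have "cmod ?D powr p \<le> integral {0..T} (\<lambda>u. 1 / T * cmod (?k u z) powr p)"
        unfolding d[OF z] using T p by (intro powr_norm_integral_le contku z) auto
      then have "ennreal (cmod ?D powr p * ?W z) \<le> ennreal (integral {0..T} (\<lambda>u. 1 / T * cmod (?k u z) powr p) * ?W z)"
        by (intro ennreal_leI mult_right_mono) auto
      also have "\<dots> = (\<integral>\<^sup>+u. ennreal (1 / T * cmod (?k u z) powr p * ?W z) * indicator {0..T} u \<partial>lborel)"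
      proof (rule nn_integral_has_integral_lebesgue'[symmetric])
        have "(\<lambda>u. 1 / T * cmod (?k u z) powr p) integrable_on {0..T}"
          using p by (intro integrable_continuous_real continuous_intros continuous_on_powr' contku z) auto
        then show "((\<lambda>u. 1 / T * cmod (?k u z) powr p * ?W z) has_integral integral {0..T} (\<lambda>u. 1 / T * cmod (?k u z) powr p) * ?W z) {0..T}"
          by (intro has_integral_mult_left integrable_integral)
      qed (use T in auto)
      also have "\<dots> = (\<integral>\<^sup>+u. ?f u z \<partial>lborel)" using True by (intro nn_integral_cong) (auto simp: indicator_def)
      finally show ?thesis using True by simp
    qed simp
  qed
  also have "\<dots> = (\<integral>\<^sup>+u. (\<integral>\<^sup>+z. ?f u z \<partial>lborel) \<partial>lborel)"
    by (rule lborel_pair.Fubini'[OF meas])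
  also have "\<dots> \<le> (\<integral>\<^sup>+u. ennreal (1 / T) * B * indicator {0..T} u \<partial>lborel)"
  proof (rule nn_integral_mono)
    fix u :: real
    show "(\<integral>\<^sup>+z. ?f u z \<partial>lborel) \<le> ennreal (1 / T) * B * indicator {0..T} u"
    proof (cases "u \<in> {0..T}")
      case True
      have "(\<integral>\<^sup>+z. ?f u z \<partial>lborel) = (\<integral>\<^sup>+z. ennreal (1 / T) * (ennreal (cmod (?k u z) powr p * ?W z) * indicator unit_disk z) \<partial>lborel)"
        using True T by (intro nn_integral_cong) (auto simp: indicator_def ennreal_mult[symmetric] mult.assoc)
      also have "\<dots> = ennreal (1 / T) * dirichlet_energy p s (K u)"
        using borel_measurable_energy_density[OF hol[OF True], of p s] p
        by (simp add: nn_integral_cmult dirichlet_energy_def)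
      finally show ?thesis using B[OF True] True by (simp add: mult_left_mono)
    next
      case False
      then have "(\<integral>\<^sup>+z. ?f u z \<partial>lborel) = (\<integral>\<^sup>+z. 0 \<partial>(lborel :: complex measure))"
        by (intro nn_integral_cong) (auto simp: indicator_def)
      then show ?thesis by simp
    qed
  qed
  also have "\<dots> = ennreal (1 / T) * B * ennreal T"
    using T by (subst nn_integral_cmult_indicator) auto
  also have "\<dots> = ennreal (1 / T) * ennreal T * B" by (simp only: mult_ac)
  also have "\<dots> = B" using T by (simp add: ennreal_mult[symmetric])
  finally show ?thesis .
qed

lemma morrey_energy_average:
  fixes K :: "real \<Rightarrow> complex \<Rightarrow> complex"
  assumes T: "0 < T" and K: "continuous_on ({0..T} \<times> unit_disk) (\<lambda>x. K (fst x) (snd x))"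
    and hol: "\<And>u. u \<in> {0..T} \<Longrightarrow> K u holomorphic_on unit_disk" and p: "1 \<le> p" and a: "cmod a < 1"
    and B: "\<And>u. u \<in> {0..T} \<Longrightarrow> morrey_energy \<alpha> p s (K u) a \<le> B"
  shows "morrey_energy \<alpha> p s (\<lambda>z. of_real (1 / T) * integral {0..T} (\<lambda>u. K u z)) a \<le> B"
proof -
  \<comment> \<open>Working with the supremum avoids dividing \<open>B\<close> by the weight;
    multiplication by the weight commutes with the supremum in \<open>ennreal\<close>.\<close>
  define B' where "B' = (SUP u\<in>{0..T}. dirichlet_energy p s (\<lambda>z. K u (disk_aut a z)))"
  have "dirichlet_energy p s (\<lambda>z. of_real (1 / T) * integral {0..T} (\<lambda>u. K u (disk_aut a z))) \<le> B'"
  proof (rule dirichlet_energy_average[OF T _ _ p])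
    have c: "continuous_on unit_disk (disk_aut a)"
      by (intro holomorphic_on_imp_continuous_on holomorphic_disk_aut a)
    have "continuous_on ({0..T} \<times> unit_disk) (\<lambda>x. disk_aut a (snd x))"
      by (rule continuous_on_compose2[OF c continuous_on_snd[OF continuous_on_id]]) auto
    then have c2: "continuous_on ({0..T} \<times> unit_disk) (\<lambda>x. (fst x, disk_aut a (snd x)))"
      by (intro continuous_on_Pair continuous_on_fst continuous_on_id)
    have sub: "(\<lambda>x. (fst x, disk_aut a (snd x))) ` ({0..T} \<times> unit_disk) \<subseteq> {0..T} \<times> unit_disk"
      using norm_disk_aut_less_1[OF a] by auto
    show "continuous_on ({0..T} \<times> unit_disk) (\<lambda>x. K (fst x) (disk_aut a (snd x)))"
      using continuous_on_compose2[OF K c2 sub] by simp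
  qed (auto intro!: holomorphic_compose_disk_aut a hol SUP_upper simp: B'_def)
  then have "morrey_energy \<alpha> p s (\<lambda>z. of_real (1 / T) * integral {0..T} (\<lambda>u. K u z)) a \<le> ennreal ((1 - (cmod a)\<^sup>2) powr (\<alpha> * p)) * B'"
    by (simp add: morrey_energy_def mult_left_mono)
  also have "\<dots> = (SUP u\<in>{0..T}. morrey_energy \<alpha> p s (K u) a)"
    unfolding B'_def morrey_energy_def using T by (intro SUP_mult_left_ennreal)
  also have "\<dots> \<le> B" by (intro SUP_least B)
  finally show ?thesis .
qed

locale morrey_semigroup = morrey_params p s \<alpha> + generated_semigroup \<phi> G
  for p s \<alpha> :: real and \<phi> :: "real \<Rightarrow> complex \<Rightarrow> complex" and G :: "complex \<Rightarrow> complex"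
begin

lemma mem_strong_cont_part_iff:
  "f \<in> strong_cont_part \<phi> (M_space \<alpha> p s) (M_norm \<alpha> p s) \<longleftrightarrow> f \<in> M_space \<alpha> p s \<and>
     (\<forall>e>0. \<forall>\<^sub>F t in at_right 0. \<forall>a. cmod a < 1 \<longrightarrow> energy (\<lambda>z. f (\<phi> t z) - f z) a \<le> ennreal e)"
proof (cases "f \<in> M_space \<alpha> p s")
  case True
  then have f: "f holomorphic_on unit_disk" by (simp add: mem_M_space_iff)
  have "isCont f 0" using holomorphic_on_imp_continuous_on[OF f] by (simp add: continuous_on_eq_continuous_at)
  then have "((\<lambda>t. f (\<phi> t 0)) \<longlongrightarrow> f 0) (at_right 0)" by (rule isCont_tendsto_compose) (simp add: tendsto_phi_0)
  then have "((\<lambda>t. f (\<phi> t 0) - f 0) \<longlongrightarrow> 0) (at_right 0)" by (rule LIM_zero)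
  moreover have "(\<lambda>z. f (\<phi> t z) - f z) holomorphic_on unit_disk" if "0 < t" for t
    using that by (intro holomorphic_intros holomorphic_compose_phi f) auto
  ultimately show ?thesis
    unfolding strong_cont_part_def using M_norm_tendsto_0_iff[of "\<lambda>t z. f (\<phi> t z) - f z" p \<alpha> s] p_pos True by simp
qed (simp add: strong_cont_part_def)

lemma energy_compose_phi_bounded:
  obtains K where "1 \<le> K" "\<And>f t a. f holomorphic_on unit_disk \<Longrightarrow> t \<in> {0..T} \<Longrightarrow> cmod a < 1 \<Longrightarrow>
     energy (\<lambda>z. f (\<phi> t z)) a \<le> ennreal K * energy f (\<phi> t a)"
proof -
  have "continuous_on {0..T} (\<lambda>t. (1 + cmod (\<phi> t 0)) / (1 - cmod (\<phi> t 0)))"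
    using continuous_on_orbit[of "\<lambda>z. z" 0 T] norm_less_1[of _ 0] by (intro continuous_intros) force+
  then have "compact ((\<lambda>t. (1 + cmod (\<phi> t 0)) / (1 - cmod (\<phi> t 0))) ` {0..T})"
    by (intro compact_continuous_image) auto
  then have "bounded ((\<lambda>t. (1 + cmod (\<phi> t 0)) / (1 - cmod (\<phi> t 0))) ` {0..T})" by (rule compact_imp_bounded)
  then obtain k where k: "\<And>t. t \<in> {0..T} \<Longrightarrow> \<bar>(1 + cmod (\<phi> t 0)) / (1 - cmod (\<phi> t 0))\<bar> \<le> k"
    unfolding bounded_iff real_norm_def by blast
  define k' where "k' = max 1 k"
  show ?thesis
  proof (rule that[of "k' powr (\<alpha> * p)"])
    show "1 \<le> k' powr (\<alpha> * p)" using alpha_pos p_pos by (intro ge_one_powr_ge_zero) (auto simp: k'_def)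
    fix f t a assume f: "f holomorphic_on unit_disk" and t: "t \<in> {0..T}" and a: "cmod a < 1"
    have "energy (\<lambda>z. f (\<phi> t z)) a \<le> ennreal (((1 + cmod (\<phi> t 0)) / (1 - cmod (\<phi> t 0))) powr (\<alpha> * p)) * energy f (\<phi> t a)"
      using t by (intro energy_compose_le self_map inj_on_phi f a) auto
    also have "\<dots> \<le> ennreal (k' powr (\<alpha> * p)) * energy f (\<phi> t a)"
      using k[OF t] alpha_pos p_pos norm_less_1[of t 0] t
      by (intro mult_right_mono ennreal_leI powr_mono2) (auto simp: k'_def)
    finally show "energy (\<lambda>z. f (\<phi> t z)) a \<le> ennreal (k' powr (\<alpha> * p)) * energy f (\<phi> t a)" .
  qed
qed

lemma tendsto_deriv_compose_phi:
  assumes f: "f holomorphic_on unit_disk" and z: "cmod z < 1"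
  shows "((\<lambda>t. deriv (\<lambda>z. f (\<phi> t z)) z) \<longlongrightarrow> deriv f z) (at_right 0)"
proof -
  have "continuous_on {0..1} (\<lambda>u. (u, z))" "(\<lambda>u. (u, z)) ` {0..1} \<subseteq> {0..1} \<times> unit_disk"
    using z by (auto intro!: continuous_intros)
  from continuous_on_compose2[OF continuous_on_deriv_compose_phi[OF f] this]
  have c: "continuous_on {0..1} (\<lambda>u. deriv (\<lambda>z. f (\<phi> u z)) z)" by simp
  have "((\<lambda>t. deriv (\<lambda>z. f (\<phi> t z)) z) \<longlongrightarrow> deriv (\<lambda>z. f (\<phi> 0 z)) z) (at 0 within {0..1})"
    using bspec[OF c[unfolded continuous_on_def], of 0] by simp
  then have "((\<lambda>t. deriv (\<lambda>z. f (\<phi> t z)) z) \<longlongrightarrow> deriv (\<lambda>z. f (\<phi> 0 z)) z) (at_right 0)"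
    by (simp add: at_within_Icc_at_right)
  moreover have "deriv (\<lambda>z. f (\<phi> 0 z)) z = deriv f z"
    by (rule deriv_cong_ev, rule eventually_mono[OF eventually_nhds_in_open[of unit_disk z]])
       (use z phi_0 in \<open>auto simp: in_disk_iff\<close>)
  ultimately show ?thesis by simp
qed

text \<open>The derivatives converge pointwise, but no common integrable majorant is at hand.
  Instead the energies of f o \<phi> t have upper limit at most that of f, which with Fatou's lemma
  gives convergence in mean.\<close>

lemma tendsto_dirichlet_energy_diff:
  assumes f: "f holomorphic_on unit_disk" and fin: "dirichlet_energy p s f < \<infinity>"
  shows "((\<lambda>t. dirichlet_energy p s (\<lambda>z. f (\<phi> t z) - f z)) \<longlongrightarrow> 0) (at_right 0)"
proof (rule tendsto_at_right_sequentially[of 0 1])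
  fix S :: "nat \<Rightarrow> real" assume S: "\<And>n. 0 < S n" "S \<longlonglongrightarrow> 0"
  have SF: "filterlim S (at_right 0) sequentially"
    using S by (simp add: filterlim_at always_eventually less_imp_neq[THEN not_sym])
  let ?w = "\<lambda>z. (1 - (cmod z)\<^sup>2) powr s"
  let ?fn = "\<lambda>n z. f (\<phi> (S n) z)"
  have holn: "?fn n holomorphic_on unit_disk" for n using S(1)[of n] by (intro holomorphic_compose_phi f) auto
  obtain d where d: "0 \<le> d" "dirichlet_energy p s f = ennreal d" using fin by (cases "dirichlet_energy p s f") auto
  \<comment> \<open>The constant of \<open>dirichlet_energy_compose\<close> at time S n; it tends to
    1 because \<phi> t 0 tends to 0.\<close>
  define c where "c = (\<lambda>n. ((1 + cmod (\<phi> (S n) 0)) / (1 - cmod (\<phi> (S n) 0))) powr (s - p + 2))"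
  have c: "c \<longlonglongrightarrow> 1"
  proof -
    have "((\<lambda>t. \<phi> t 0) \<longlongrightarrow> 0) (at_right 0)" by (rule tendsto_phi_0) simp
    from filterlim_compose[OF this SF] have "(\<lambda>n. \<phi> (S n) 0) \<longlonglongrightarrow> 0" .
    then have "(\<lambda>n. ((1 + cmod (\<phi> (S n) 0)) / (1 - cmod (\<phi> (S n) 0))) powr (s - p + 2)) \<longlonglongrightarrow> ((1 + cmod 0) / (1 - cmod 0)) powr (s - p + 2)"
      by (intro tendsto_intros) auto
    then show ?thesis by (simp add: c_def)
  qed
  have Dn: "dirichlet_energy p s (?fn n) \<le> ennreal (c n * d)" for n
    using dirichlet_energy_compose[OF self_map inj_on_phi f, of "S n"] S(1)[of n] d
    by (simp add: c_def ennreal_mult less_imp_le)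
  have deriv_diff: "deriv (\<lambda>z. ?fn n z - f z) z = deriv (?fn n) z - deriv f z" if "cmod z < 1" for n z
    using holomorphic_on_imp_differentiable_at[OF holn, of z n] holomorphic_on_imp_differentiable_at[OF f, of z] that
    by (intro deriv_diff) auto
  \<comment> \<open>The gap in the quasi-triangle inequality for the densities, nonnegative. It
    tends pointwise to 2 * 2 powr p times the density of f. The integrals of h and of the difference
    add up to at most 2 powr p * (c n * d + d), which has the same limit as Fatou's lower bound for
    h alone; nothing is left for the difference.\<close>
  define h where "h = (\<lambda>n z. (2 powr p * (cmod (deriv (?fn n) z) powr p + cmod (deriv f z) powr p) - cmod (deriv (?fn n) z - deriv f z) powr p) * ?w z)"
  have h0: "0 \<le> h n z" for n z
  proof -
    have "cmod (deriv (?fn n) z - deriv f z) powr p \<le> (cmod (deriv (?fn n) z) + cmod (deriv f z)) powr p"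
      using p_pos by (intro powr_mono2 norm_triangle_ineq4) auto
    also have "\<dots> \<le> 2 powr p * (cmod (deriv (?fn n) z) powr p + cmod (deriv f z) powr p)"
      using p_pos by (intro sum_powr_le) auto
    finally show ?thesis by (simp add: h_def)
  qed
  have contd: "continuous_on unit_disk (deriv (?fn n))" "continuous_on unit_disk (deriv f)" for n
    by (intro holomorphic_on_imp_continuous_on holomorphic_deriv f holn open_ball)+
  have conth: "continuous_on unit_disk (h n)" for n
    unfolding h_def using p_pos by (intro continuous_intros continuous_on_powr' continuous_on_radial_powr contd) auto
  have measB: "(\<lambda>z. ennreal (cmod (deriv (?fn n) z - deriv f z) powr p * ?w z) * indicator unit_disk z) \<in> borel_measurable borel" for n
    using p_pos by (intro borel_measurable_indicator_ennreal continuous_intros continuous_on_powr' continuous_on_radial_powr contd) auto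
  define H where "H = (\<lambda>n. \<integral>\<^sup>+z\<in>unit_disk. ennreal (h n z) \<partial>lborel)"
  define E where "E = (\<lambda>n. dirichlet_energy p s (\<lambda>z. ?fn n z - f z))"
  have En: "E n = (\<integral>\<^sup>+z\<in>unit_disk. ennreal (cmod (deriv (?fn n) z - deriv f z) powr p * ?w z) \<partial>lborel)" for n
    unfolding E_def dirichlet_energy_def by (intro nn_integral_disk_cong) (simp add: deriv_diff)
  have sum: "H n + E n = ennreal (2 powr p) * (dirichlet_energy p s (?fn n) + dirichlet_energy p s f)" for n
  proof -
    have "H n + E n = (\<integral>\<^sup>+z. ennreal (h n z) * indicator unit_disk z + ennreal (cmod (deriv (?fn n) z - deriv f z) powr p * ?w z) * indicator unit_disk z \<partial>lborel)"
      unfolding H_def En using measB borel_measurable_indicator_ennreal[OF conth] by (subst nn_integral_add) auto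
    also have "\<dots> = (\<integral>\<^sup>+z. ennreal (2 powr p) * (ennreal (cmod (deriv (?fn n) z) powr p * ?w z) * indicator unit_disk z + ennreal (cmod (deriv f z) powr p * ?w z) * indicator unit_disk z) \<partial>lborel)"
    proof (rule nn_integral_cong)
      fix z :: complex
      have "ennreal (h n z) + ennreal (cmod (deriv (?fn n) z - deriv f z) powr p * ?w z) = ennreal (h n z + cmod (deriv (?fn n) z - deriv f z) powr p * ?w z)"
        using h0 by (intro ennreal_plus[symmetric]) auto
      also have "\<dots> = ennreal (2 powr p * (cmod (deriv (?fn n) z) powr p * ?w z + cmod (deriv f z) powr p * ?w z))"
        by (simp add: h_def algebra_simps)
      also have "\<dots> = ennreal (2 powr p) * (ennreal (cmod (deriv (?fn n) z) powr p * ?w z) + ennreal (cmod (deriv f z) powr p * ?w z))"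
        by (simp add: ennreal_mult)
      finally show "ennreal (h n z) * indicator unit_disk z + ennreal (cmod (deriv (?fn n) z - deriv f z) powr p * ?w z) * indicator unit_disk z
        = ennreal (2 powr p) * (ennreal (cmod (deriv (?fn n) z) powr p * ?w z) * indicator unit_disk z + ennreal (cmod (deriv f z) powr p * ?w z) * indicator unit_disk z)"
        by (auto simp: indicator_def)
    qed
    also have "\<dots> = ennreal (2 powr p) * (dirichlet_energy p s (?fn n) + dirichlet_energy p s f)"
      using borel_measurable_energy_density[OF f p_pos, of s] borel_measurable_energy_density[OF holn p_pos, of n s]
      by (simp add: nn_integral_cmult nn_integral_add dirichlet_energy_def)
    finally show ?thesis .
  qed
  have sum_le: "H n + E n \<le> ennreal (2 powr p * (c n * d + d))" for n
  proof -
    have "H n + E n \<le> ennreal (2 powr p) * (ennreal (c n * d) + ennreal d)"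
      unfolding sum d(2) by (intro mult_left_mono add_mono Dn) auto
    also have "\<dots> = ennreal (2 powr p * (c n * d + d))" using d(1) by (simp add: ennreal_mult c_def)
    finally show ?thesis .
  qed
  have "ennreal (2 * 2 powr p * d) \<le> liminf H"
  proof -
    have "ennreal (2 * 2 powr p * d) = (\<integral>\<^sup>+z. ennreal (2 * 2 powr p) * (ennreal (cmod (deriv f z) powr p * ?w z) * indicator unit_disk z) \<partial>lborel)"
      using borel_measurable_energy_density[OF f p_pos, of s] d
      by (simp add: nn_integral_cmult dirichlet_energy_def ennreal_mult)
    also have "\<dots> = (\<integral>\<^sup>+z. liminf (\<lambda>n. ennreal (h n z) * indicator unit_disk z) \<partial>lborel)"
    proof (rule nn_integral_cong)
      fix z :: complex
      show "ennreal (2 * 2 powr p) * (ennreal (cmod (deriv f z) powr p * ?w z) * indicator unit_disk z) = liminf (\<lambda>n. ennreal (h n z) * indicator unit_disk z)"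
      proof (cases "z \<in> unit_disk")
        case True
        then have z: "cmod z < 1" by simp
        have l: "(\<lambda>n. deriv (?fn n) z) \<longlonglongrightarrow> deriv f z"
          using filterlim_compose[OF tendsto_deriv_compose_phi[OF f z] SF] by simp
        have "(\<lambda>n. cmod (deriv (?fn n) z - deriv f z) powr p) \<longlonglongrightarrow> cmod (deriv f z - deriv f z) powr p"
          using p_pos by (intro tendsto_powr' tendsto_norm tendsto_diff l tendsto_const) auto
        moreover have "(\<lambda>n. cmod (deriv (?fn n) z) powr p) \<longlonglongrightarrow> cmod (deriv f z) powr p"
          using p_pos by (intro tendsto_powr' tendsto_norm l tendsto_const) auto
        ultimately have "(\<lambda>n. h n z) \<longlonglongrightarrow> (2 powr p * (cmod (deriv f z) powr p + cmod (deriv f z) powr p) - cmod (deriv f z - deriv f z) powr p) * ?w z"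
          unfolding h_def by (intro tendsto_mult tendsto_diff tendsto_add tendsto_const)
        then have "(\<lambda>n. ennreal (h n z)) \<longlonglongrightarrow> ennreal (2 * 2 powr p * (cmod (deriv f z) powr p * ?w z))"
          by (intro tendsto_ennrealI) (simp add: mult_ac)
        from lim_imp_Liminf[OF _ this] True show ?thesis by (simp add: ennreal_mult)
      qed (simp add: Liminf_const)
    qed
    also have "\<dots> \<le> liminf H"
      unfolding H_def by (rule nn_integral_liminf) (use borel_measurable_indicator_ennreal[OF conth] in auto)
    finally show ?thesis .
  qed
  note liminfH = this
  have "E \<longlonglongrightarrow> 0"
    unfolding tendsto_ennreal_0_iff
  proof (intro allI impI)
    fix e :: real assume e: "0 < e"
    have "\<forall>\<^sub>F n in sequentially. ennreal (2 * 2 powr p * d) \<le> H n + ennreal (e / 2)"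
    proof (cases "2 * 2 powr p * d - e / 2 < 0")
      case True
      then have "ennreal (2 * 2 powr p * d) \<le> ennreal (e / 2)" by (intro ennreal_leI) simp
      also have "\<dots> \<le> H n + ennreal (e / 2)" for n by simp
      finally show ?thesis by simp
    next
      case False
      have "ennreal (2 * 2 powr p * d - e / 2) < liminf H"
        using e False by (intro order_less_le_trans[OF _ liminfH]) (auto simp: ennreal_less_iff)
      then have "\<forall>\<^sub>F n in sequentially. ennreal (2 * 2 powr p * d - e / 2) < H n" by (rule less_LiminfD)
      then show ?thesis
      proof eventually_elim
        case (elim n)
        have "ennreal (2 * 2 powr p * d) = ennreal (2 * 2 powr p * d - e / 2) + ennreal (e / 2)"
          using e False by (subst ennreal_plus[symmetric]) auto
        also have "\<dots> \<le> H n + ennreal (e / 2)" using elim by (intro add_right_mono) auto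
        finally show ?case .
      qed
    qed
    moreover have "\<forall>\<^sub>F n in sequentially. 2 powr p * (c n * d + d) < 2 * 2 powr p * d + e / 2"
    proof -
      have "(\<lambda>n. 2 powr p * (c n * d + d)) \<longlonglongrightarrow> 2 powr p * (1 * d + d)" by (intro tendsto_intros c)
      then show ?thesis using e by (intro order_tendstoD(2)[of _ "2 powr p * (1 * d + d)"]) auto
    qed
    ultimately show "\<forall>\<^sub>F n in sequentially. E n \<le> ennreal e"
    proof eventually_elim
      case (elim n)
      \<comment> \<open>Finiteness is required for cancelling H n in \<open>ennreal\<close>.\<close>
      have "H n \<noteq> top" using sum_le[of n] by (auto simp: top_unique)
      have "H n + E n \<le> ennreal (2 powr p * (c n * d + d))" by (rule sum_le)
      also have "\<dots> \<le> ennreal (2 * 2 powr p * d + e / 2)" using elim(2) by (intro ennreal_leI) auto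
      also have "\<dots> = ennreal (2 * 2 powr p * d) + ennreal (e / 2)" using d e by simp
      also have "\<dots> \<le> H n + ennreal (e / 2) + ennreal (e / 2)" using elim(1) by (rule add_right_mono)
      also have "\<dots> = H n + ennreal e" using e by (simp add: add.assoc ennreal_plus[symmetric] del: ennreal_plus)
      finally show ?case using \<open>H n \<noteq> top\<close> by (simp add: ennreal_add_left_cancel_le)
    qed
  qed
  then show "(\<lambda>n. dirichlet_energy p s (\<lambda>z. f (\<phi> (S n) z) - f z)) \<longlonglongrightarrow> 0" by (simp add: E_def)
qed simp

lemma energy_le_dirichlet_energy:
  assumes g: "g holomorphic_on unit_disk" and a: "cmod a \<le> r" "r < 1"
  shows "energy g a \<le> ennreal (((1 + r) / (1 - r)) powr (s - p + 2)) * dirichlet_energy p s g"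
proof -
  have a1: "cmod a < 1" using a by simp
  have "energy g a \<le> 1 * dirichlet_energy p s (\<lambda>z. g (disk_aut a z))"
    unfolding morrey_energy_def
  proof (rule mult_right_mono)
    have "(1 - (cmod a)\<^sup>2) powr (\<alpha> * p) \<le> 1"
      using one_minus_norm_sq_pos[OF a1] alpha_pos p_pos by (intro powr_le1) auto
    then show "ennreal ((1 - (cmod a)\<^sup>2) powr (\<alpha> * p)) \<le> 1" by (simp add: ennreal_le_1)
  qed simp
  also have "\<dots> \<le> ennreal (((1 + cmod a) / (1 - cmod a)) powr (s - p + 2)) * dirichlet_energy p s g"
    using dirichlet_energy_disk_aut_le[OF a1 g p_pos p_less_s] by simp
  also have "\<dots> \<le> ennreal (((1 + r) / (1 - r)) powr (s - p + 2)) * dirichlet_energy p s g"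
    using a p_less_s order_trans[OF norm_ge_zero a(1)]
    by (intro mult_right_mono ennreal_leI powr_mono2 frac_le) auto
  finally show ?thesis .
qed

lemma dirichlet_energy_le_energy_0:
  assumes f: "f holomorphic_on unit_disk"
  shows "dirichlet_energy p s f \<le> energy f 0"
  using dirichlet_energy_disk_aut_le[of 0 "\<lambda>z. f (disk_aut 0 z)" p s] holomorphic_compose_disk_aut[of 0 f] f p_pos p_less_s
  by (simp add: morrey_energy_def)

text \<open>For |a| \<le> R the energies are controlled by the Dirichlet energy, which tends to 0.
  For |a| > R the energies of f and of f o \<phi> t are both small, uniformly for t in the unit
  interval.\<close>

lemma little_m_space_subset: "little_m_space \<alpha> p s \<subseteq> strong_cont_part \<phi> (M_space \<alpha> p s) (M_norm \<alpha> p s)"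
proof
  fix f assume "f \<in> little_m_space \<alpha> p s"
  then have fM: "f \<in> M_space \<alpha> p s"
    and little: "\<And>e. 0 < e \<Longrightarrow> \<exists>r<1. \<forall>a. r < cmod a \<and> cmod a < 1 \<longrightarrow> energy f a \<le> ennreal e"
    unfolding mem_little_m_space_iff by auto
  obtain C where f: "f holomorphic_on unit_disk" and C: "0 \<le> C" "\<And>a. cmod a < 1 \<Longrightarrow> energy f a \<le> ennreal C"
    using fM by (auto simp: mem_M_space_iff)
  obtain K where K: "1 \<le> K" "\<And>f t a. f holomorphic_on unit_disk \<Longrightarrow> t \<in> {0..1} \<Longrightarrow> cmod a < 1 \<Longrightarrow>
     energy (\<lambda>z. f (\<phi> t z)) a \<le> ennreal K * energy f (\<phi> t a)" using energy_compose_phi_bounded[of 1] by blast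
  have fin: "dirichlet_energy p s f < \<infinity>"
    using dirichlet_energy_le_energy_0[OF f] C(2)[of 0] by (auto intro: order_le_less_trans order_trans)
  show "f \<in> strong_cont_part \<phi> (M_space \<alpha> p s) (M_norm \<alpha> p s)"
    unfolding mem_strong_cont_part_iff
  proof (intro conjI fM allI impI)
    fix e :: real assume e: "0 < e"
    \<comment> \<open>Divides out the composition bound K, the constant 2 powr p and the two
      summands of the difference.\<close>
    define e' where "e' = e / (2 powr p * (2 * K))"
    have e': "0 < e'" using e K by (simp add: e'_def)
    obtain r0 where r0: "r0 < 1" "\<And>a. r0 < cmod a \<and> cmod a < 1 \<Longrightarrow> energy f a \<le> ennreal e'" using little[OF e'] by blast
    define r where "r = max r0 0"
    have r: "0 \<le> r" "r < 1" "\<And>a. r < cmod a \<Longrightarrow> cmod a < 1 \<Longrightarrow> energy f a \<le> ennreal e'" using r0 by (auto simp: r_def)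
    have r2: "0 < 1 - r\<^sup>2" using r by (simp add: abs_square_less_1)
    \<comment> \<open>A point a near the circle may be carried by \<phi> t into |w| \<le> r, where f
      has no small energy. Then the factor ((1 - |a|^2) / (1 - r^2)) powr (\<alpha> * p) of
      \<open>energy_compose\<close> is small, by \<alpha> > 0.\<close>
    have "((\<lambda>x. ((1 - x\<^sup>2) / (1 - r\<^sup>2)) powr (\<alpha> * p) * C) \<longlongrightarrow> ((1 - 1\<^sup>2) / (1 - r\<^sup>2)) powr (\<alpha> * p) * C) (at_left 1)"
    proof (rule tendsto_mult[OF tendsto_powr' tendsto_const])
      show "((\<lambda>x. (1 - x\<^sup>2) / (1 - r\<^sup>2)) \<longlongrightarrow> (1 - 1\<^sup>2) / (1 - r\<^sup>2)) (at_left 1)"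
        using r2 by (intro tendsto_intros) auto
      have "\<forall>\<^sub>F x in at_left 1. 0 \<le> (1 - x\<^sup>2) / (1 - r\<^sup>2)"
        unfolding eventually_at_left_field
      proof (intro exI[of _ 0] conjI allI impI)
        fix y :: real assume "0 < y" "y < 1"
        then have "y\<^sup>2 \<le> 1" by (intro power_le_one) auto
        then show "0 \<le> (1 - y\<^sup>2) / (1 - r\<^sup>2)" using r2 by simp
      qed simp
      then show "(1 - 1\<^sup>2) / (1 - r\<^sup>2) \<noteq> 0 \<or> 0 < \<alpha> * p \<and> (\<forall>\<^sub>F x in at_left 1. 0 \<le> (1 - x\<^sup>2) / (1 - r\<^sup>2))"
        using alpha_pos p_pos by simp
    qed (rule tendsto_const)
    then have "\<forall>\<^sub>F x in at_left 1. ((1 - x\<^sup>2) / (1 - r\<^sup>2)) powr (\<alpha> * p) * C < e'"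
      using e' by (intro order_tendstoD(2)) auto
    then obtain r1 where r1: "r1 < 1" "\<And>x. r1 < x \<Longrightarrow> x < 1 \<Longrightarrow> ((1 - x\<^sup>2) / (1 - r\<^sup>2)) powr (\<alpha> * p) * C < e'"
      by (auto simp: eventually_at_left_field)
    define R where "R = max r r1"
    have R: "r \<le> R" "r1 \<le> R" "R < 1" "0 \<le> R" using r r1 by (auto simp: R_def)
    define c where "c = ((1 + R) / (1 - R)) powr (s - p + 2)"
    have c: "0 < c" using R by (simp add: c_def)
    have "\<forall>\<^sub>F t in at_right 0. dirichlet_energy p s (\<lambda>z. f (\<phi> t z) - f z) \<le> ennreal (e / c)"
      using tendsto_dirichlet_energy_diff[OF f fin] e c unfolding tendsto_ennreal_0_iff by simp
    moreover have "\<forall>\<^sub>F t in at_right 0. t \<in> {0<..<1::real}" by (rule eventually_at_right_real) simp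
    ultimately show "\<forall>\<^sub>F t in at_right 0. \<forall>a. cmod a < 1 \<longrightarrow> energy (\<lambda>z. f (\<phi> t z) - f z) a \<le> ennreal e"
    proof eventually_elim
      case (elim t)
      then have t: "0 \<le> t" "t \<in> {0..1}" by auto
      have holt: "(\<lambda>z. f (\<phi> t z)) holomorphic_on unit_disk" by (rule holomorphic_compose_phi[OF f t(1)])
      show ?case
      proof (intro allI impI)
        fix a :: complex assume a: "cmod a < 1"
        show "energy (\<lambda>z. f (\<phi> t z) - f z) a \<le> ennreal e"
        proof (cases "cmod a \<le> R")
          case True
          have "energy (\<lambda>z. f (\<phi> t z) - f z) a \<le> ennreal c * dirichlet_energy p s (\<lambda>z. f (\<phi> t z) - f z)"
            unfolding c_def using True R by (intro energy_le_dirichlet_energy holomorphic_intros holt f) auto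
          also have "\<dots> \<le> ennreal c * ennreal (e / c)" by (intro mult_left_mono elim(1)) auto
          also have "\<dots> = ennreal e" using c e by (simp add: ennreal_mult[symmetric])
          finally show ?thesis .
        next
          case False
          have pa: "cmod (\<phi> t a) < 1" by (rule norm_less_1[OF t(1) a])
          have "energy (\<lambda>z. f (\<phi> t z)) a \<le> ennreal (K * e')"
          proof (cases "r < cmod (\<phi> t a)")
            case True
            have "energy (\<lambda>z. f (\<phi> t z)) a \<le> ennreal K * energy f (\<phi> t a)" by (rule K(2)[OF f t(2) a])
            also have "\<dots> \<le> ennreal K * ennreal e'" by (intro mult_left_mono r(3) True pa) auto
            finally show ?thesis using K e' by (simp add: ennreal_mult)
          next
            case False2: False
            have "energy (\<lambda>z. f (\<phi> t z)) a \<le> ennreal (((1 - (cmod a)\<^sup>2) / (1 - (cmod (\<phi> t a))\<^sup>2)) powr (\<alpha> * p)) * energy f (\<phi> t a)"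
              by (intro energy_compose self_map inj_on_phi f t a)
            also have "\<dots> \<le> ennreal (((1 - (cmod a)\<^sup>2) / (1 - r\<^sup>2)) powr (\<alpha> * p)) * ennreal C"
            proof (intro mult_mono ennreal_leI powr_mono2 divide_left_mono C(2) pa)
              show "1 - r\<^sup>2 \<le> 1 - (cmod (\<phi> t a))\<^sup>2" using False2 by (simp add: power_mono)
            qed (use one_minus_norm_sq_pos[OF a] one_minus_norm_sq_pos[OF pa] r2 alpha_pos p_pos in auto)
            also have "\<dots> = ennreal (((1 - (cmod a)\<^sup>2) / (1 - r\<^sup>2)) powr (\<alpha> * p) * C)"
              using C(1) by (simp add: ennreal_mult)
            also have "\<dots> \<le> ennreal e'" using r1(2)[of "cmod a"] False R a by (intro ennreal_leI) auto
            also have "\<dots> \<le> ennreal (K * e')" using K e' by (intro ennreal_leI) simp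
            finally show ?thesis .
          qed
          moreover have "energy f a \<le> ennreal (K * e')"
          proof -
            have "energy f a \<le> ennreal e'" using False R a by (intro r(3)) auto
            also have "\<dots> \<le> ennreal (K * e')" using K e' by (intro ennreal_leI) simp
            finally show ?thesis .
          qed
          ultimately have "energy (\<lambda>z. f (\<phi> t z)) a + energy f a \<le> ennreal (K * e') + ennreal (K * e')" by (rule add_mono)
          then have "ennreal (2 powr p) * (energy (\<lambda>z. f (\<phi> t z)) a + energy f a) \<le> ennreal (2 powr p) * (ennreal (K * e') + ennreal (K * e'))"
            by (rule mult_left_mono) simp
          also have "\<dots> = ennreal (2 powr p * (K * e' + K * e'))"
            using K e' by (simp add: ennreal_mult[symmetric] ennreal_plus[symmetric] del: ennreal_plus)
          also have "2 powr p * (K * e' + K * e') = e" using K by (simp add: e'_def)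
          finally show ?thesis using morrey_energy_diff_le[OF holt f p_pos a] by (rule order_trans[rotated])
        qed
      qed
    qed
  qed
qed

section \<open>Averages along orbits\<close>

lemma energy_orbit_average_le:
  assumes f: "f holomorphic_on unit_disk" and T: "0 < T" and a: "cmod a < 1"
    and B: "\<And>u. u \<in> {0..T} \<Longrightarrow> energy (\<lambda>z. f (\<phi> u z)) a \<le> B"
  shows "energy (\<lambda>z. of_real (1 / T) * orbit_integral f T z) a \<le> B"
  unfolding orbit_integral_def using p_gt_1
  by (intro morrey_energy_average[OF T continuous_on_compose_phi[OF f]] holomorphic_compose_phi f a B) auto

lemma orbit_average_in_M_space:
  assumes f: "f \<in> M_space \<alpha> p s" and T: "0 < T"
  shows "(\<lambda>z. of_real (1 / T) * orbit_integral f T z) \<in> M_space \<alpha> p s"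
proof -
  obtain C where hol: "f holomorphic_on unit_disk" and C: "0 \<le> C" "\<And>a. cmod a < 1 \<Longrightarrow> energy f a \<le> ennreal C"
    using f by (auto simp: mem_M_space_iff)
  obtain K where K: "1 \<le> K" "\<And>f t a. f holomorphic_on unit_disk \<Longrightarrow> t \<in> {0..T} \<Longrightarrow> cmod a < 1 \<Longrightarrow>
     energy (\<lambda>z. f (\<phi> t z)) a \<le> ennreal K * energy f (\<phi> t a)" using energy_compose_phi_bounded[of T] by blast
  have "energy (\<lambda>z. of_real (1 / T) * orbit_integral f T z) a \<le> ennreal (K * C)" if a: "cmod a < 1" for a
  proof (rule energy_orbit_average_le[OF hol T a])
    fix u assume u: "u \<in> {0..T}"
    have "energy (\<lambda>z. f (\<phi> u z)) a \<le> ennreal K * energy f (\<phi> u a)" by (rule K(2)[OF hol u a])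
    also have "\<dots> \<le> ennreal K * ennreal C" using u by (intro mult_left_mono C norm_less_1 a) auto
    finally show "energy (\<lambda>z. f (\<phi> u z)) a \<le> ennreal (K * C)" using K C by (simp add: ennreal_mult)
  qed
  then show ?thesis
    unfolding mem_M_space_iff using K C
    by (intro conjI holomorphic_intros holomorphic_orbit_integral hol exI[of _ "K * C"]) auto
qed

lemma M_space_diff_compose:
  assumes f: "f \<in> M_space \<alpha> p s" and t: "0 \<le> t"
  shows "(\<lambda>z. f (\<phi> t z) - f z) \<in> M_space \<alpha> p s"
proof -
  obtain C where hol: "f holomorphic_on unit_disk" and C: "0 \<le> C" "\<And>a. cmod a < 1 \<Longrightarrow> energy f a \<le> ennreal C"
    using f by (auto simp: mem_M_space_iff)
  obtain K where K: "1 \<le> K" "\<And>f u a. f holomorphic_on unit_disk \<Longrightarrow> u \<in> {0..t} \<Longrightarrow> cmod a < 1 \<Longrightarrow>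
     energy (\<lambda>z. f (\<phi> u z)) a \<le> ennreal K * energy f (\<phi> u a)" using energy_compose_phi_bounded[of t] by blast
  have holt: "(\<lambda>z. f (\<phi> t z)) holomorphic_on unit_disk" by (rule holomorphic_compose_phi[OF hol t])
  have "energy (\<lambda>z. f (\<phi> t z) - f z) a \<le> ennreal (2 powr p * (K * C + C))" if a: "cmod a < 1" for a
  proof -
    have "energy (\<lambda>z. f (\<phi> t z)) a \<le> ennreal K * energy f (\<phi> t a)" using t by (intro K(2) hol a) auto
    also have "\<dots> \<le> ennreal K * ennreal C" by (intro mult_left_mono C norm_less_1 a t) auto
    finally have "energy (\<lambda>z. f (\<phi> t z)) a + energy f a \<le> ennreal (K * C) + ennreal C"
      using K C a by (intro add_mono) (auto simp: ennreal_mult)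
    then have "ennreal (2 powr p) * (energy (\<lambda>z. f (\<phi> t z)) a + energy f a) \<le> ennreal (2 powr p) * (ennreal (K * C) + ennreal C)"
      by (rule mult_left_mono) simp
    also have "\<dots> = ennreal (2 powr p * (K * C + C))" using K C by (simp add: ennreal_mult)
    finally show ?thesis using morrey_energy_diff_le[OF holt hol p_pos a] by (rule order_trans[rotated])
  qed
  then show ?thesis
    unfolding mem_M_space_iff using K C
    by (intro conjI holomorphic_intros holt hol exI[of _ "2 powr p * (K * C + C)"]) auto
qed

text \<open>For every f in the space: with g = f o \<phi> T - f, shifting the average by time h
  changes it by h/T times the average of g over the time h. Averages are bounded, so the energy of
  the change is of order h powr p.\<close>

lemma orbit_average_in_strong_cont_part:
  assumes f: "f \<in> M_space \<alpha> p s" and T: "0 < T"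
  shows "(\<lambda>z. of_real (1 / T) * orbit_integral f T z) \<in> strong_cont_part \<phi> (M_space \<alpha> p s) (M_norm \<alpha> p s)"
  unfolding mem_strong_cont_part_iff
proof (intro conjI orbit_average_in_M_space f T allI impI)
  fix e :: real assume e: "0 < e"
  have hol: "f holomorphic_on unit_disk" using f by (simp add: mem_M_space_iff)
  define g where "g = (\<lambda>z. f (\<phi> T z) - f z)"
  have "g \<in> M_space \<alpha> p s" unfolding g_def using M_space_diff_compose[OF f] T by simp
  then obtain C where g: "g holomorphic_on unit_disk" and C: "0 \<le> C" "\<And>a. cmod a < 1 \<Longrightarrow> energy g a \<le> ennreal C"
    by (auto simp: mem_M_space_iff)
  obtain K where K: "1 \<le> K" "\<And>f u a. f holomorphic_on unit_disk \<Longrightarrow> u \<in> {0..1} \<Longrightarrow> cmod a < 1 \<Longrightarrow>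
     energy (\<lambda>z. f (\<phi> u z)) a \<le> ennreal K * energy f (\<phi> u a)" using energy_compose_phi_bounded[of 1] by blast
  have "((\<lambda>h. (h / T) powr p * (K * C)) \<longlongrightarrow> (0 / T) powr p * (K * C)) (at_right 0)"
  proof (rule tendsto_mult[OF tendsto_powr' tendsto_const])
    show "((\<lambda>h. h / T) \<longlongrightarrow> 0 / T) (at_right 0)" using T by (intro tendsto_intros) auto
    have "\<forall>\<^sub>F x in at_right 0. 0 \<le> x / T" using T by (auto simp: eventually_at_right_field intro!: exI[of _ 1])
    then show "0 / T \<noteq> 0 \<or> 0 < p \<and> (\<forall>\<^sub>F x in at_right 0. 0 \<le> x / T)" using p_pos by simp
  qed (rule tendsto_const)
  then have "\<forall>\<^sub>F h in at_right 0. (h / T) powr p * (K * C) < e" using e p_pos by (intro order_tendstoD(2)) auto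
  moreover have "\<forall>\<^sub>F t in at_right 0. t \<in> {0<..<1::real}" by (rule eventually_at_right_real) simp
  ultimately show "\<forall>\<^sub>F t in at_right 0. \<forall>a. cmod a < 1 \<longrightarrow>
      energy (\<lambda>z. of_real (1 / T) * orbit_integral f T (\<phi> t z) - of_real (1 / T) * orbit_integral f T z) a \<le> ennreal e"
  proof eventually_elim
    case (elim h)
    then have h: "0 < h" "h < 1" by auto
    show ?case
    proof (intro allI impI)
      fix a :: complex assume a: "cmod a < 1"
      have eq: "of_real (1 / T) * orbit_integral f T (\<phi> h z) - of_real (1 / T) * orbit_integral f T z
         = of_real (h / T) * (of_real (1 / h) * orbit_integral g h z)" if z: "cmod z < 1" for z
      proof -
        have "orbit_integral g h z = orbit_integral f h (\<phi> T z) - orbit_integral f h z"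
        proof -
          have c: "(\<lambda>u. f (\<phi> u z)) integrable_on {0..h}" "(\<lambda>u. f (\<phi> u (\<phi> T z))) integrable_on {0..h}"
            using T by (intro integrable_continuous_real continuous_on_orbit hol z norm_less_1; simp)+
          have "\<phi> T (\<phi> u z) = \<phi> u (\<phi> T z)" if "u \<in> {0..h}" for u
            using phi_add[of T u z] phi_add[of u T z] that T z by (simp add: add.commute)
          then have "orbit_integral g h z = integral {0..h} (\<lambda>u. f (\<phi> u (\<phi> T z)) - f (\<phi> u z))"
            unfolding orbit_integral_def g_def by (intro integral_cong) simp
          then show ?thesis unfolding orbit_integral_def using c by (simp add: integral_diff)
        qed
        also have "orbit_integral f h (\<phi> T z) = orbit_integral f (h + T) z - orbit_integral f T z"
          using T h by (intro orbit_integral_phi hol z) auto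
        moreover have "orbit_integral f T (\<phi> h z) = orbit_integral f (T + h) z - orbit_integral f h z"
          using T h by (intro orbit_integral_phi hol z) auto
        ultimately show ?thesis using h by (simp add: add.commute) (simp add: diff_divide_distrib add_divide_distrib)
      qed
      have "energy (\<lambda>z. of_real (1 / T) * orbit_integral f T (\<phi> h z) - of_real (1 / T) * orbit_integral f T z) a
         = energy (\<lambda>z. of_real (h / T) * (of_real (1 / h) * orbit_integral g h z)) a"
        by (rule morrey_energy_cong[OF eq a])
      also have "\<dots> = ennreal (cmod (of_real (h / T)) powr p) * energy (\<lambda>z. of_real (1 / h) * orbit_integral g h z) a"
        by (intro morrey_energy_cmult holomorphic_intros holomorphic_orbit_integral g p_pos a)
      also have "cmod (of_real (h / T)) = h / T" using h T by (simp add: norm_divide)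
      also have "ennreal ((h / T) powr p) * energy (\<lambda>z. of_real (1 / h) * orbit_integral g h z) a \<le> ennreal ((h / T) powr p) * ennreal (K * C)"
      proof (intro mult_left_mono energy_orbit_average_le[OF g h(1) a])
        fix u assume "u \<in> {0..h}"
        then have u: "u \<in> {0..1}" "0 \<le> u" using h by auto
        have "energy (\<lambda>z. g (\<phi> u z)) a \<le> ennreal K * energy g (\<phi> u a)" by (rule K(2)[OF g u(1) a])
        also have "\<dots> \<le> ennreal K * ennreal C" by (intro mult_left_mono C norm_less_1 a u) auto
        finally show "energy (\<lambda>z. g (\<phi> u z)) a \<le> ennreal (K * C)" using K C by (simp add: ennreal_mult)
      qed simp
      also have "\<dots> = ennreal ((h / T) powr p * (K * C))" using K C by (simp add: ennreal_mult)
      also have "\<dots> \<le> ennreal e" using elim(1) by (intro ennreal_leI) auto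
      finally show "energy (\<lambda>z. of_real (1 / T) * orbit_integral f T (\<phi> h z) - of_real (1 / T) * orbit_integral f T z) a \<le> ennreal e" .
    qed
  qed
qed

lemma orbit_average_diff:
  assumes "f holomorphic_on unit_disk" "cmod z < 1" "0 < T"
  shows "of_real (1 / T) * orbit_integral f T z - f z = of_real (1 / T) * integral {0..T} (\<lambda>u. f (\<phi> u z) - f z)"
proof -
  have "(\<lambda>u. f (\<phi> u z)) integrable_on {0..T}"
    by (intro integrable_continuous_real continuous_on_orbit assms)
  then have "integral {0..T} (\<lambda>u. f (\<phi> u z) - f z) = orbit_integral f T z - T * f z"
    using assms(3) by (subst integral_diff) (auto simp: orbit_integral_def scaleR_conv_of_real)
  then show ?thesis using assms(3) by (simp add: field_simps)
qed

lemma orbit_average_approximates: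
  assumes f: "f \<in> strong_cont_part \<phi> (M_space \<alpha> p s) (M_norm \<alpha> p s)" and e: "0 < e"
  obtains T where "0 < T" "\<And>a. cmod a < 1 \<Longrightarrow> energy (\<lambda>z. of_real (1 / T) * orbit_integral f T z - f z) a \<le> ennreal e"
proof -
  have hol: "f holomorphic_on unit_disk"
    and ev: "\<forall>\<^sub>F t in at_right 0. \<forall>a. cmod a < 1 \<longrightarrow> energy (\<lambda>z. f (\<phi> t z) - f z) a \<le> ennreal e"
    using f e unfolding mem_strong_cont_part_iff mem_M_space_iff by auto
  obtain b where b: "0 < b" "\<And>t a. 0 < t \<Longrightarrow> t < b \<Longrightarrow> cmod a < 1 \<Longrightarrow> energy (\<lambda>z. f (\<phi> t z) - f z) a \<le> ennreal e"
    using ev by (auto simp: eventually_at_right_field)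
  define T where "T = b / 2"
  have T: "0 < T" "T < b" using b(1) by (auto simp: T_def)
  show ?thesis
  proof (rule that[OF T(1)])
    fix a :: complex assume a: "cmod a < 1"
    let ?K = "\<lambda>u z. f (\<phi> u z) - f z"
    have "energy (\<lambda>z. of_real (1 / T) * orbit_integral f T z - f z) a = energy (\<lambda>z. of_real (1 / T) * integral {0..T} (\<lambda>u. ?K u z)) a"
      by (rule morrey_energy_cong[OF orbit_average_diff[OF hol _ T(1)] a])
    also have "\<dots> \<le> ennreal e"
    proof (rule morrey_energy_average[OF T(1) _ _ _ a])
      have "continuous_on ({0..T} \<times> unit_disk) (\<lambda>x. f (snd x))"
        by (rule continuous_on_compose2[OF holomorphic_on_imp_continuous_on[OF hol] continuous_on_snd[OF continuous_on_id]]) auto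
      then show "continuous_on ({0..T} \<times> unit_disk) (\<lambda>x. f (\<phi> (fst x) (snd x)) - f (snd x))"
        by (rule continuous_on_diff[OF continuous_on_compose_phi[OF hol]])
      show "1 \<le> p" using p_gt_1 by simp
      fix u assume u: "u \<in> {0..T}"
      then show "?K u holomorphic_on unit_disk" by (intro holomorphic_intros holomorphic_compose_phi hol) auto
      show "energy (?K u) a \<le> ennreal e"
      \<comment> \<open>The limit from the right gives no information at u = 0; there the difference
        vanishes on the disk.\<close>
      proof (cases "u = 0")
        case True
        have "energy (?K u) a = energy (\<lambda>z. 0) a" using True phi_0 by (intro morrey_energy_cong[OF _ a]) simp
        also have "\<dots> = 0" using p_pos by (simp add: morrey_energy_def dirichlet_energy_def)
        finally show ?thesis by simp
      next
        case False
        then show ?thesis using u T by (intro b(2) a) auto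
      qed
    qed
    finally show "energy (\<lambda>z. of_real (1 / T) * orbit_integral f T z - f z) a \<le> ennreal e" .
  qed
qed

end

subsection \<open>Circle means of powers of functions with nonnegative real part\<close>

text \<open>The argument of z lies between -pi/2 and pi/2, hence that of z powr \<delta> between
  -\<delta> * pi/2 and \<delta> * pi/2, where the cosine stays away from 0 for \<delta> < 1.\<close>

lemma Re_powr_ge:
  assumes z: "0 \<le> Re z" "z \<noteq> 0" and d: "0 < \<delta>" "\<delta> < 1"
  shows "cos (\<delta> * pi / 2) * cmod z powr \<delta> \<le> Re (z powr of_real \<delta>)"
proof -
  have im: "\<bar>Im (Ln z)\<bar> \<le> pi / 2" using z Re_Ln_pos_le by blast
  have "z powr of_real \<delta> = exp (of_real \<delta> * Ln z)" using z by (simp add: powr_def)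
  then have "Re (z powr of_real \<delta>) = exp (\<delta> * ln (cmod z)) * cos (\<delta> * Im (Ln z))"
    using z by (simp add: Re_exp)
  moreover have "exp (\<delta> * ln (cmod z)) = cmod z powr \<delta>" using z by (simp add: powr_def)
  moreover have "cos (\<delta> * pi / 2) \<le> cos (\<delta> * Im (Ln z))"
  proof -
    have "\<bar>\<delta> * Im (Ln z)\<bar> = \<delta> * \<bar>Im (Ln z)\<bar>" using d by (simp add: abs_mult)
    also have "\<dots> \<le> \<delta> * (pi / 2)" using d im by (intro mult_left_mono) auto
    finally have le: "\<bar>\<delta> * Im (Ln z)\<bar> \<le> \<delta> * pi / 2" by simp
    have "\<delta> * pi / 2 \<le> pi" using d pi_gt_zero by (simp add: mult_left_le_one_le order_trans[of "\<delta> * pi" "pi" "pi * 2"])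
    then have "cos (\<delta> * pi / 2) \<le> cos \<bar>\<delta> * Im (Ln z)\<bar>" using le by (intro cos_monotone_0_pi_le) auto
    then show ?thesis by simp
  qed
  ultimately show ?thesis by (simp add: mult.commute mult_left_mono)
qed

text \<open>The Poisson formula for the holomorphic power X^\<delta>, whose real part dominates a
  multiple of |X|^\<delta>. It reverses the subharmonic inequality
  \<open>powr_norm_le_poisson\<close>.\<close>

lemma poisson_powr_norm_le:
  assumes X: "X holomorphic_on unit_disk" "\<And>z. cmod z < 1 \<Longrightarrow> 0 \<le> Re (X z)" "\<And>z. cmod z < 1 \<Longrightarrow> X z \<noteq> 0"
    and d: "0 < \<delta>" "\<delta> < 1" and R: "R < 1" and w: "cmod w < R"
  shows "cos (\<delta> * pi / 2) * integral {0..1} (\<lambda>t. poisson R w t * cmod (X (R * unit_circ t)) powr \<delta>) \<le> cmod (X w) powr \<delta>"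
proof -
  define F where "F = (\<lambda>z. X z powr of_real \<delta>)"
  have R0: "0 < R" using w norm_ge_zero[of w] by linarith
  have nR: "cmod (R * unit_circ t) < 1" for t using R R0 by (simp add: norm_mult)
  have slit: "X z \<notin> \<real>\<^sub>\<le>\<^sub>0" if "cmod z < 1" for z
    using X(2,3)[OF that] by (auto simp: complex_nonpos_Reals_iff complex_eq_iff)
  have F: "F holomorphic_on unit_disk" unfolding F_def using slit by (intro holomorphic_intros X(1)) auto
  have "((\<lambda>t. poisson R w t *\<^sub>R F (R * unit_circ t)) has_integral F w) {0..1}"
    using R by (intro Poisson_integral_formula holomorphic_on_subset[OF F] w) auto
  from has_integral_Re[OF this]
  have hi: "((\<lambda>t. poisson R w t * Re (F (R * unit_circ t))) has_integral Re (F w)) {0..1}" by simp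
  have cont: "continuous_on {0..1} (\<lambda>t. poisson R w t * cmod (X (R * unit_circ t)) powr \<delta>)"
    using d nR by (intro continuous_on_mult continuous_on_poisson w continuous_on_powr' continuous_on_norm
        continuous_on_compose2[OF holomorphic_on_imp_continuous_on[OF X(1)]] continuous_intros) (auto simp: in_disk_iff)
  have "cos (\<delta> * pi / 2) * integral {0..1} (\<lambda>t. poisson R w t * cmod (X (R * unit_circ t)) powr \<delta>)
     = integral {0..1} (\<lambda>t. cos (\<delta> * pi / 2) * (poisson R w t * cmod (X (R * unit_circ t)) powr \<delta>))"
    by simp
  also have "\<dots> \<le> integral {0..1} (\<lambda>t. poisson R w t * Re (F (R * unit_circ t)))"
  proof (rule integral_le)
    show "(\<lambda>t. cos (\<delta> * pi / 2) * (poisson R w t * cmod (X (R * unit_circ t)) powr \<delta>)) integrable_on {0..1}"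
      by (intro integrable_continuous_real continuous_on_mult continuous_on_const cont)
    show "(\<lambda>t. poisson R w t * Re (F (R * unit_circ t))) integrable_on {0..1}" using hi by blast
    fix t :: real
    have "poisson R w t * (cos (\<delta> * pi / 2) * cmod (X (R * unit_circ t)) powr \<delta>) \<le> poisson R w t * Re (F (R * unit_circ t))"
      unfolding F_def using w by (intro mult_left_mono Re_powr_ge X nR d poisson_nonneg) auto
    then show "cos (\<delta> * pi / 2) * (poisson R w t * cmod (X (R * unit_circ t)) powr \<delta>) \<le> poisson R w t * Re (F (R * unit_circ t))"
      by (simp add: mult.left_commute)
  qed
  also have "\<dots> = Re (F w)" using hi by (simp add: integral_unique)
  also have "\<dots> \<le> cmod (F w)" by (rule complex_Re_le_cmod)
  also have "\<dots> = cmod (X w) powr \<delta>"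
    using X(3)[of w] w R by (simp add: F_def norm_powr_real_powr')
  finally show ?thesis .
qed

lemma nn_integral_one_minus_powr_le:
  assumes d: "0 < \<delta>" "\<delta> < 1" and R: "0 < R" "R < 1"
  shows "(\<integral>\<^sup>+\<rho>. ennreal ((1 - \<rho>) powr (- \<delta>)) * indicator {0..R} \<rho> \<partial>lborel) \<le> ennreal (1 / (1 - \<delta>))"
proof -
  let ?F = "\<lambda>\<rho>. - ((1 - \<rho>) powr (1 - \<delta>) / (1 - \<delta>))"
  have "(\<integral>\<^sup>+\<rho>. ennreal ((1 - \<rho>) powr (- \<delta>)) * indicator {0..R} \<rho> \<partial>lborel) = ?F R - ?F 0"
  proof (rule nn_integral_FTC_Icc)
    fix x :: real assume x: "x \<in> {0..R}"
    show "DERIV ?F x :> (1 - x) powr (- \<delta>)"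
    proof -
      have "DERIV (\<lambda>x. (1 - x) powr (1 - \<delta>)) x :> (1 - \<delta>) * (1 - x) powr (1 - \<delta> - of_nat 1) * (- 1)"
        by (rule DERIV_fun_powr) (use x R in \<open>auto intro!: derivative_eq_intros\<close>)
      from DERIV_minus[OF DERIV_cdivide[OF this, of "1 - \<delta>"]] show ?thesis using d by simp
    qed
  qed (use R in auto)
  also have "\<dots> \<le> ennreal (1 / (1 - \<delta>))" using d R by (intro ennreal_leI) (auto simp: field_simps)
  finally show ?thesis .
qed

text \<open>The factor |1 - k * \<zeta>|^(-2 * \<delta>) is unbounded as k * \<zeta> approaches 1.
  It is dominated by a superposition of Poisson kernels at points \<rho> of the radius towards the
  pole, to which the Poisson estimate for |X|^\<delta> applies. The bound is uniform in k, R and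
  \<zeta>.\<close>

lemma kernel_integral_ge:
  fixes k :: real
  assumes d: "0 < \<delta>" "\<delta> < 1" and k: "0 \<le> k" "k \<le> 1" and R: "1/2 \<le> R" "R < 1" and z: "cmod \<zeta> = R"
  shows "ennreal (cmod (1 - of_real k * \<zeta>) powr (- 2 * \<delta>) / 5000) \<le>
    (\<integral>\<^sup>+\<rho>\<in>{0<..<R}. ennreal ((R\<^sup>2 - \<rho>\<^sup>2) / (cmod (\<zeta> - of_real \<rho>))\<^sup>2 * (1 - k * \<rho>) powr (- 2 * \<delta>)) \<partial>lborel)"
proof -
  define D where "D = cmod (1 - of_real k * \<zeta>)"
  have kR: "k * R < 1" using k R by (metis le_less_trans linorder_not_less mult_left_le_one_le mult_le_one order_less_imp_le less_eq_real_def zero_le_one order_trans half_gt_zero_iff zero_less_one)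
  have D1: "1 - k * R \<le> D"
    using norm_triangle_ineq2[of 1 "of_real k * \<zeta>"] k z by (simp add: D_def norm_mult)
  have D0: "0 < D" using D1 kR by simp
  have D2: "D \<le> 2" using norm_triangle_ineq4[of 1 "of_real k * \<zeta>"] k z kR by (simp add: D_def norm_mult)
  \<comment> \<open>For k \<ge> 1/2 compare 1 - k * R with 1 - k * \<zeta>. For smaller k, D is at
    least 1/2 while the left side is at most 2.\<close>
  have zR: "cmod (\<zeta> - of_real R) \<le> 4 * D"
  proof (cases "1/2 \<le> k")
    case True
    have "of_real k * (\<zeta> - of_real R) = (1 - of_real (k * R)) - (1 - of_real k * \<zeta>)" by (simp add: algebra_simps)
    then have "cmod (of_real k * (\<zeta> - of_real R)) \<le> cmod (1 - of_real (k * R)) + D"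
      unfolding D_def by (metis norm_triangle_ineq4)
    also have "cmod (1 - of_real (k * R)) = 1 - k * R"
      using kR by (metis abs_of_nonneg diff_ge_0_iff_ge less_imp_le norm_of_real of_real_1 of_real_diff)
    finally have "k * cmod (\<zeta> - of_real R) \<le> 2 * D" using D1 k by (simp add: norm_mult)
    moreover have "1/2 * cmod (\<zeta> - of_real R) \<le> k * cmod (\<zeta> - of_real R)" using True by (intro mult_right_mono) auto
    ultimately show ?thesis by simp
  next
    case False
    have "k * R \<le> 1/2 * 1" using False k R by (intro mult_mono) auto
    then have "1/2 \<le> D" using D1 by simp
    moreover have "cmod (\<zeta> - of_real R) \<le> 2" using norm_triangle_ineq4[of \<zeta> "of_real R"] z R by simp
    ultimately show ?thesis by simp
  qed
  \<comment> \<open>The part of the radius at distance of order D from the end. There the kernel is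
    at least (D/16) / (5 * D)^2 = 1/(400 * D), and 1 - k * \<rho> \<le> 5/4 * D costs at most the
    factor 16/25. With the length D/8 this makes (16/25) * (1/400) * (1/8) = 1/5000.\<close>
  define I where "I = {R - D / 4..R - D / 8}"
  define c where "c = D powr (- 2 * \<delta>) * (16 / 25) * (1 / (400 * D))"
  have bound: "c \<le> (R\<^sup>2 - \<rho>\<^sup>2) / (cmod (\<zeta> - of_real \<rho>))\<^sup>2 * (1 - k * \<rho>) powr (- 2 * \<delta>)" if r: "\<rho> \<in> {0<..<R}" "\<rho> \<in> I" for \<rho>
  proof -
    have r1: "D / 8 \<le> R - \<rho>" "R - \<rho> \<le> D / 4" "0 < \<rho>" "\<rho> < R" using r by (auto simp: I_def)
    have "cmod (\<zeta> - of_real \<rho>) \<le> cmod (\<zeta> - of_real R) + cmod (of_real R - of_real \<rho>)"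
      using norm_triangle_ineq[of "\<zeta> - of_real R" "of_real R - of_real \<rho>"] by simp
    also have "cmod (of_real R - of_real \<rho> :: complex) = R - \<rho>" using r1 by (metis abs_of_pos diff_gt_0_iff_gt norm_of_real of_real_diff)
    finally have n: "cmod (\<zeta> - of_real \<rho>) \<le> 5 * D" using zR r1 D0 by simp
    have n0: "0 < cmod (\<zeta> - of_real \<rho>)" using z r1 by auto
    have "(D / 8) * (1/2) \<le> (R - \<rho>) * (R + \<rho>)" using r1 R D0 by (intro mult_mono) auto
    then have num: "D / 16 \<le> R\<^sup>2 - \<rho>\<^sup>2" by (simp add: power2_eq_square algebra_simps)
    have "1 / (400 * D) = (D / 16) / (5 * D)\<^sup>2" using D0 by (simp add: power2_eq_square)
    also have "\<dots> \<le> (R\<^sup>2 - \<rho>\<^sup>2) / (cmod (\<zeta> - of_real \<rho>))\<^sup>2"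
      using num n n0 D0 by (intro frac_le power_mono) auto
    finally have q: "1 / (400 * D) \<le> (R\<^sup>2 - \<rho>\<^sup>2) / (cmod (\<zeta> - of_real \<rho>))\<^sup>2" .
    have "k * (R - \<rho>) \<le> 1 * (R - \<rho>)" using k r1 by (intro mult_right_mono) auto
    then have kr: "1 - k * \<rho> \<le> 5/4 * D" using D1 r1 by (simp add: algebra_simps)
    have kr0: "0 < 1 - k * \<rho>"
    proof -
      have "k * \<rho> \<le> k * R" using k r1 by (intro mult_left_mono) auto
      then show ?thesis using kR by simp
    qed
    have "(16/25::real) = (5/4) powr (-2)" by (simp add: powr_minus powr_realpow[symmetric] power2_eq_square)
    also have "\<dots> \<le> (5/4) powr (- 2 * \<delta>)" using d by (intro powr_mono) auto
    finally have "D powr (- 2 * \<delta>) * (16/25) \<le> D powr (- 2 * \<delta>) * (5/4) powr (- 2 * \<delta>)" by (rule mult_left_mono) simp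
    also have "\<dots> = (5/4 * D) powr (- 2 * \<delta>)" by (subst powr_mult) (rule mult.commute)
    also have "\<dots> \<le> (1 - k * \<rho>) powr (- 2 * \<delta>)" using kr kr0 d by (intro powr_mono2') auto
    finally have "D powr (- 2 * \<delta>) * (16/25) \<le> (1 - k * \<rho>) powr (- 2 * \<delta>)" .
    then have "D powr (- 2 * \<delta>) * (16/25) * (1 / (400 * D)) \<le> (1 - k * \<rho>) powr (- 2 * \<delta>) * ((R\<^sup>2 - \<rho>\<^sup>2) / (cmod (\<zeta> - of_real \<rho>))\<^sup>2)"
      using q D0 by (intro mult_mono) auto
    then show ?thesis by (simp add: c_def mult.commute)
  qed
  have "ennreal (D powr (- 2 * \<delta>) / 5000) = ennreal c * ennreal (D / 8)"
    using D0 by (simp add: c_def ennreal_mult[symmetric])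
  \<comment> \<open>Open at the left: \<open>D \<le> 2\<close> and \<open>1/2 \<le> R\<close> only
    show that R - D/4 is nonnegative, while \<rho> must be positive.\<close>
  also have "\<dots> = (\<integral>\<^sup>+\<rho>. ennreal c * indicator {R - D / 4<..R - D / 8} \<rho> \<partial>lborel)"
    using D0 by (subst nn_integral_cmult_indicator) auto
  also have "\<dots> \<le> (\<integral>\<^sup>+\<rho>\<in>{0<..<R}. ennreal ((R\<^sup>2 - \<rho>\<^sup>2) / (cmod (\<zeta> - of_real \<rho>))\<^sup>2 * (1 - k * \<rho>) powr (- 2 * \<delta>)) \<partial>lborel)"
  proof (rule nn_integral_mono)
    fix \<rho> :: real
    show "ennreal c * indicator {R - D / 4<..R - D / 8} \<rho> \<le> ennreal ((R\<^sup>2 - \<rho>\<^sup>2) / (cmod (\<zeta> - of_real \<rho>))\<^sup>2 * (1 - k * \<rho>) powr (- 2 * \<delta>)) * indicator {0<..<R} \<rho>"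
    proof (cases "\<rho> \<in> {R - D / 4<..R - D / 8}")
      case True
      then have "\<rho> \<in> {0<..<R}" "\<rho> \<in> I" using D0 D2 R by (auto simp: I_def)
      then show ?thesis using bound[of \<rho>] True by (auto intro!: ennreal_leI)
    qed simp
  qed
  finally show ?thesis by (simp add: D_def)
qed

text \<open>Replace the factor with the pole by the superposition of Poisson kernels and exchange
  the integrals. The Poisson mean of |X|^\<delta> at \<rho> * u is at most |X(\<rho> * u)|^\<delta>
  divided by the cosine, and the hypothesis at \<rho> * u cancels (1 - k * \<rho>)^(-2 * \<delta>).
  The remaining (1 - \<rho>)^(-\<delta>) is integrable because \<delta> < 1, and the pole has
  disappeared from the bound.\<close>

lemma kolmogorov_circle_aux:
  fixes R :: real
  assumes X: "X holomorphic_on unit_disk" "\<And>z. cmod z < 1 \<Longrightarrow> 0 \<le> Re (X z)" "\<And>z. cmod z < 1 \<Longrightarrow> X z \<noteq> 0"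
    and d: "0 < \<delta>" "\<delta> < 1" and c: "cmod c \<le> 1" and N: "0 \<le> N"
    and le: "\<And>z. cmod z < 1 \<Longrightarrow> cmod (X z) * (1 - (cmod z)\<^sup>2) \<le> N * (cmod (1 - cnj c * z))\<^sup>2"
    and R: "1/2 \<le> R" "R < 1"
  shows "integral {0..1} (\<lambda>t. (cmod (X (R * unit_circ t)) / (cmod (1 - cnj c * (R * unit_circ t)))\<^sup>2) powr \<delta>)
    \<le> 5000 / (cos (\<delta> * pi / 2) * (1 - \<delta>)) * N powr \<delta>"
proof -
  define k where "k = cmod c"
  \<comment> \<open>The direction of the pole c; for c = 0 any unit vector serves.\<close>
  define u where "u = (if c = 0 then 1 else c / cmod c)"
  have u: "cmod u = 1" "c = of_real k * u" by (auto simp: u_def k_def norm_divide)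
  have k: "0 \<le> k" "k \<le> 1" using c by (auto simp: k_def)
  have uu: "cnj u * u = 1" "u * cnj u = 1" using complex_norm_square[of u] u by (simp_all add: mult.commute)
  have cosp: "0 < cos (\<delta> * pi / 2)"
  proof -
    have "0 < \<delta> * pi" "\<delta> * pi < 1 * pi" using d by (auto intro: mult_strict_right_mono simp del: mult_1)
    then show ?thesis using d by (intro cos_gt_zero) simp_all
  qed
  define \<zeta> where "\<zeta> = (\<lambda>t. of_real R * unit_circ t)"
  have n\<zeta>: "cmod (\<zeta> t) = R" for t using R by (simp add: \<zeta>_def norm_mult)
  define x where "x = (\<lambda>t. cmod (X (\<zeta> t)) powr \<delta>)"
  define D where "D = (\<lambda>t. cmod (1 - cnj c * \<zeta> t))"
  have D: "D t = cmod (1 - of_real k * (cnj u * \<zeta> t))" for t by (simp add: D_def u(2) mult.assoc)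
  have D0: "0 < D t" for t using one_minus_cnj_mult_neq_0[OF c, of "\<zeta> t"] n\<zeta> R by (simp add: D_def)
  have contx: "continuous_on S x" for S
    unfolding x_def \<zeta>_def using d R
    by (intro continuous_on_powr' continuous_on_norm continuous_on_const
        continuous_on_compose2[OF holomorphic_on_imp_continuous_on[OF X(1)]] continuous_on_mult continuous_on_unit_circ) (auto simp: norm_mult)
  have contD: "continuous_on S D" for S unfolding D_def \<zeta>_def by (intro continuous_intros)
  let ?P = "\<lambda>\<rho> t. (R\<^sup>2 - \<rho>\<^sup>2) / (cmod (cnj u * \<zeta> t - of_real \<rho>))\<^sup>2"
  let ?w = "\<lambda>\<rho>. (1 - k * \<rho>) powr (- 2 * \<delta>)"
  have P: "?P \<rho> t = poisson R (of_real \<rho> * u) t" if "0 < \<rho>" for \<rho> t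
  proof -
    have "cnj u * \<zeta> t - of_real \<rho> = cnj u * (\<zeta> t - of_real \<rho> * u)" using uu by (simp add: algebra_simps)
    then have "cmod (cnj u * \<zeta> t - of_real \<rho>) = cmod (\<zeta> t - of_real \<rho> * u)" by (simp add: norm_mult u)
    then show ?thesis using that by (simp add: poisson_def \<zeta>_def norm_mult u)
  qed
  have wpos: "0 < 1 - k * \<rho>" if "\<rho> \<in> {0<..<R}" for \<rho>
  proof -
    have "k * \<rho> \<le> \<rho>" "\<rho> < R" using k that by (auto intro: mult_left_le_one_le)
    then show ?thesis using R by linarith
  qed
  let ?f = "\<lambda>\<rho> t. ennreal (indicator ({0<..<R} \<times> {0..1}) (\<rho>, t) *\<^sub>R (?P \<rho> t * ?w \<rho> * x t))"
  have contf: "continuous_on ({0<..<R} \<times> {0..1::real}) (\<lambda>y. ?P (fst y) (snd y) * ?w (fst y) * x (snd y))"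
  proof (intro continuous_on_mult continuous_on_divide continuous_on_powr)
    show "continuous_on ({0<..<R} \<times> {0..1::real}) (\<lambda>y. x (snd y))"
      by (rule continuous_on_compose2[OF contx[of UNIV]]) (auto intro!: continuous_intros)
    show "\<forall>y\<in>{0<..<R} \<times> {0..1::real}. (cmod (cnj u * \<zeta> (snd y) - of_real (fst y)))\<^sup>2 \<noteq> 0"
    proof
      fix y :: "real \<times> real" assume "y \<in> {0<..<R} \<times> {0..1}"
      then have "cmod (cnj u * \<zeta> (snd y)) \<noteq> cmod (of_real (fst y) :: complex)" using n\<zeta> u by (auto simp: norm_mult)
      then show "(cmod (cnj u * \<zeta> (snd y) - of_real (fst y)))\<^sup>2 \<noteq> 0" by auto
    qed
    show "\<forall>y\<in>{0<..<R} \<times> {0..1::real}. 1 - k * fst y \<noteq> 0" using wpos by fastforce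
  qed (auto intro!: continuous_intros simp: \<zeta>_def)
  have "(\<lambda>y. indicator ({0<..<R} \<times> {0..1}) y *\<^sub>R (?P (fst y) (snd y) * ?w (fst y) * x (snd y))) \<in> borel_measurable borel"
    by (rule borel_measurable_continuous_on_indicator[OF _ contf]) (auto simp: borel_Times)
  then have meas: "(\<lambda>(\<rho>, t). ?f \<rho> t) \<in> borel_measurable (lborel \<Otimes>\<^sub>M lborel)"
    by (simp add: lborel_prod split_beta')
  have "ennreal (integral {0..1} (\<lambda>t. x t * D t powr (- 2 * \<delta>)) / 5000)
     = (\<integral>\<^sup>+t. ennreal (x t * D t powr (- 2 * \<delta>) / 5000) * indicator {0..1} t \<partial>lborel)"
  proof (rule nn_integral_has_integral_lebesgue'[symmetric])
    have "(\<lambda>t. x t * D t powr (- 2 * \<delta>)) integrable_on {0..1}"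
      using D0 by (intro integrable_continuous_real continuous_intros contx contD continuous_on_powr) (metis less_irrefl)
    then show "((\<lambda>t. x t * D t powr (- 2 * \<delta>) / 5000) has_integral integral {0..1} (\<lambda>t. x t * D t powr (- 2 * \<delta>)) / 5000) {0..1}"
      by (intro has_integral_divide integrable_integral)
  qed (simp add: x_def)
  also have "\<dots> \<le> (\<integral>\<^sup>+t. (\<integral>\<^sup>+\<rho>. ?f \<rho> t \<partial>lborel) \<partial>lborel)"
  proof (rule nn_integral_mono)
    fix t :: real
    show "ennreal (x t * D t powr (- 2 * \<delta>) / 5000) * indicator {0..1} t \<le> (\<integral>\<^sup>+\<rho>. ?f \<rho> t \<partial>lborel)"
    proof (cases "t \<in> {0..1}")
      case True
      have nu: "cmod (cnj u * \<zeta> t) = R" using u n\<zeta> by (simp add: norm_mult)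
      let ?g = "\<lambda>\<rho>. ennreal (?P \<rho> t * ?w \<rho>) * indicator {0<..<R} \<rho>"
      have mg: "?g \<in> borel_measurable lborel" by measurable
      have "ennreal (x t * D t powr (- 2 * \<delta>) / 5000) = ennreal (x t) * ennreal (D t powr (- 2 * \<delta>) / 5000)"
        by (simp add: ennreal_mult[symmetric] x_def)
      also have "\<dots> \<le> ennreal (x t) * (\<integral>\<^sup>+\<rho>. ?g \<rho> \<partial>lborel)"
        using kernel_integral_ge[OF d k R nu] by (intro mult_left_mono) (auto simp: D)
      also have "\<dots> = (\<integral>\<^sup>+\<rho>. ennreal (x t) * ?g \<rho> \<partial>lborel)" using mg by (simp add: nn_integral_cmult)
      also have "\<dots> = (\<integral>\<^sup>+\<rho>. ?f \<rho> t \<partial>lborel)"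
        using True by (intro nn_integral_cong) (auto simp: indicator_def x_def ennreal_mult'[symmetric] mult.commute)
      finally show ?thesis using True by simp
    qed simp
  qed
  also have "\<dots> = (\<integral>\<^sup>+\<rho>. (\<integral>\<^sup>+t. ?f \<rho> t \<partial>lborel) \<partial>lborel)"
    by (rule lborel_pair.Fubini'[OF meas])
  also have "\<dots> \<le> (\<integral>\<^sup>+\<rho>. ennreal (N powr \<delta> / cos (\<delta> * pi / 2)) * (ennreal ((1 - \<rho>) powr (- \<delta>)) * indicator {0..R} \<rho>) \<partial>lborel)"
  proof (rule nn_integral_mono)
    fix \<rho> :: real
    show "(\<integral>\<^sup>+t. ?f \<rho> t \<partial>lborel) \<le> ennreal (N powr \<delta> / cos (\<delta> * pi / 2)) * (ennreal ((1 - \<rho>) powr (- \<delta>)) * indicator {0..R} \<rho>)"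
    proof (cases "\<rho> \<in> {0<..<R}")
      case True
      let ?v = "of_real \<rho> * u"
      have v: "cmod ?v = \<rho>" using True u by (simp add: norm_mult)
      have "1 - cnj c * ?v = of_real (1 - k * \<rho>)" using uu by (simp add: u(2) mult_ac)
      then have cv: "cmod (1 - cnj c * ?v) = 1 - k * \<rho>" using wpos[OF True] by (metis abs_of_pos norm_of_real)
      have "cmod (X ?v) * (1 - \<rho>) \<le> cmod (X ?v) * (1 - \<rho>\<^sup>2)"
        using True R by (intro mult_left_mono) (auto simp: power2_eq_square mult_left_le)
      also have "\<dots> \<le> N * (1 - k * \<rho>)\<^sup>2" using le[of ?v] True R by (simp add: v cv)
      finally have "cmod (X ?v) \<le> N * (1 - k * \<rho>)\<^sup>2 / (1 - \<rho>)" using True R by (simp add: pos_le_divide_eq)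
      then have Xv: "cmod (X ?v) powr \<delta> \<le> (N * (1 - k * \<rho>)\<^sup>2 / (1 - \<rho>)) powr \<delta>" using d by (intro powr_mono2) auto
      have "(N * (1 - k * \<rho>)\<^sup>2 / (1 - \<rho>)) powr \<delta> = N powr \<delta> * (1 - k * \<rho>) powr (2 * \<delta>) * (1 - \<rho>) powr (- \<delta>)"
      proof -
        have "((1 - k * \<rho>)\<^sup>2) powr \<delta> = (1 - k * \<rho>) powr (2 * \<delta>)"
          using wpos[OF True] by (simp add: powr_powr powr_realpow[symmetric] del: powr_numeral)
        then show ?thesis by (simp add: powr_mult powr_divide powr_minus_divide)
      qed
      then have "?w \<rho> * cmod (X ?v) powr \<delta> \<le> ?w \<rho> * (N powr \<delta> * (1 - k * \<rho>) powr (2 * \<delta>) * (1 - \<rho>) powr (- \<delta>))"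
        using Xv by (intro mult_left_mono) auto
      also have "\<dots> = N powr \<delta> * (1 - \<rho>) powr (- \<delta>)"
      proof -
        have "?w \<rho> * (1 - k * \<rho>) powr (2 * \<delta>) = 1" using wpos[OF True] by (simp add: powr_add[symmetric])
        then show ?thesis by (simp add: mult_ac)
      qed
      finally have wX: "?w \<rho> * cmod (X ?v) powr \<delta> \<le> N powr \<delta> * (1 - \<rho>) powr (- \<delta>)" .
      define J where "J = integral {0..1} (\<lambda>t. poisson R ?v t * x t)"
      have "cos (\<delta> * pi / 2) * J \<le> cmod (X ?v) powr \<delta>"
        unfolding J_def x_def \<zeta>_def using True R v by (intro poisson_powr_norm_le X d) auto
      then have J: "J \<le> cmod (X ?v) powr \<delta> / cos (\<delta> * pi / 2)" using cosp by (simp add: pos_le_divide_eq mult.commute)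
      have "(\<integral>\<^sup>+t. ?f \<rho> t \<partial>lborel) = (\<integral>\<^sup>+t. ennreal (?w \<rho> * (poisson R ?v t * x t)) * indicator {0..1} t \<partial>lborel)"
        using True by (intro nn_integral_cong) (auto simp: indicator_def P mult_ac)
      also have "\<dots> = ennreal (?w \<rho> * J)"
      proof (rule nn_integral_has_integral_lebesgue')
        have "(\<lambda>t. poisson R ?v t * x t) integrable_on {0..1}"
          using v True by (intro integrable_continuous_real continuous_on_mult continuous_on_poisson contx) auto
        then show "((\<lambda>t. ?w \<rho> * (poisson R ?v t * x t)) has_integral ?w \<rho> * J) {0..1}"
          unfolding J_def by (intro has_integral_mult_right integrable_integral)
        show "0 \<le> ?w \<rho> * (poisson R ?v t * x t)" for t
          using poisson_nonneg[of ?v R t] v True by (simp add: x_def)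
      qed
      also have "\<dots> \<le> ennreal (?w \<rho> * (cmod (X ?v) powr \<delta> / cos (\<delta> * pi / 2)))"
        by (intro ennreal_leI mult_left_mono J) auto
      also have "\<dots> \<le> ennreal (N powr \<delta> / cos (\<delta> * pi / 2) * (1 - \<rho>) powr (- \<delta>))"
        using divide_right_mono[OF wX, of "cos (\<delta> * pi / 2)"] cosp by (intro ennreal_leI) simp
      finally show ?thesis using True cosp by (simp add: ennreal_mult[symmetric])
    next
      case False
      then have "(\<integral>\<^sup>+t. ?f \<rho> t \<partial>lborel) = (\<integral>\<^sup>+t. 0 \<partial>(lborel :: real measure))"
        by (intro nn_integral_cong) (auto simp: indicator_def)
      then show ?thesis by simp
    qed
  qed
  also have "\<dots> = ennreal (N powr \<delta> / cos (\<delta> * pi / 2)) * (\<integral>\<^sup>+\<rho>. ennreal ((1 - \<rho>) powr (- \<delta>)) * indicator {0..R} \<rho> \<partial>lborel)"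
    by (rule nn_integral_cmult) measurable
  also have "\<dots> \<le> ennreal (N powr \<delta> / cos (\<delta> * pi / 2)) * ennreal (1 / (1 - \<delta>))"
    using R by (intro mult_left_mono nn_integral_one_minus_powr_le d) auto
  also have "\<dots> = ennreal (N powr \<delta> / cos (\<delta> * pi / 2) * (1 / (1 - \<delta>)))"
    using cosp d by (intro ennreal_mult[symmetric]) auto
  finally have "integral {0..1} (\<lambda>t. x t * D t powr (- 2 * \<delta>)) / 5000 \<le> N powr \<delta> / cos (\<delta> * pi / 2) * (1 / (1 - \<delta>))"
    using cosp d by (subst (asm) ennreal_le_iff) auto
  then have "integral {0..1} (\<lambda>t. x t * D t powr (- 2 * \<delta>)) \<le> 5000 / (cos (\<delta> * pi / 2) * (1 - \<delta>)) * N powr \<delta>"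
    using cosp d by (simp add: field_simps)
  moreover have "x t * D t powr (- 2 * \<delta>) = (cmod (X (R * unit_circ t)) / (cmod (1 - cnj c * (R * unit_circ t)))\<^sup>2) powr \<delta>" for t
  proof -
    have "(D t)\<^sup>2 powr \<delta> = D t powr (2 * \<delta>)" using D0[of t] by (simp add: powr_powr powr_realpow[symmetric] del: powr_numeral)
    then show ?thesis by (simp add: x_def D_def \<zeta>_def powr_divide powr_minus_divide)
  qed
  ultimately show ?thesis by simp
qed

text \<open>Rotating the disk moves the circle point z to a positive radius and the pole to cnj e *
  c, which is harmless since the estimate holds for every pole in the closed disk.\<close>

lemma kolmogorov_circle:
  assumes d: "0 < \<delta>" "\<delta> < 1"
  obtains C where "0 \<le> C" "\<And>X c N z. X holomorphic_on unit_disk \<Longrightarrow> (\<And>z. cmod z < 1 \<Longrightarrow> 0 \<le> Re (X z)) \<Longrightarrow>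
     (\<And>z. cmod z < 1 \<Longrightarrow> X z \<noteq> 0) \<Longrightarrow> cmod c \<le> 1 \<Longrightarrow> 0 \<le> N \<Longrightarrow>
     (\<And>z. cmod z < 1 \<Longrightarrow> cmod (X z) * (1 - (cmod z)\<^sup>2) \<le> N * (cmod (1 - cnj c * z))\<^sup>2) \<Longrightarrow> cmod z < 1 \<Longrightarrow>
     integral {0..1} (\<lambda>t. (cmod (X (unit_circ t * z)) / (cmod (1 - cnj c * (unit_circ t * z)))\<^sup>2) powr \<delta>) \<le> C * N powr \<delta>"
proof
  \<comment> \<open>2 powr \<delta> is for |z| < 1/2, where 1 - |w|^2 is at least 1/2 and the
    hypothesis on X is itself a pointwise bound.\<close>
  define C where "C = max (2 powr \<delta>) (5000 / (cos (\<delta> * pi / 2) * (1 - \<delta>)))"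
  show "0 \<le> C" by (simp add: C_def le_max_iff_disj)
  fix X :: "complex \<Rightarrow> complex" and c N z
  assume X: "X holomorphic_on unit_disk" "\<And>z. cmod z < 1 \<Longrightarrow> 0 \<le> Re (X z)" "\<And>z. cmod z < 1 \<Longrightarrow> X z \<noteq> 0"
    and c: "cmod c \<le> 1" and N: "0 \<le> N"
    and le: "\<And>z. cmod z < 1 \<Longrightarrow> cmod (X z) * (1 - (cmod z)\<^sup>2) \<le> N * (cmod (1 - cnj c * z))\<^sup>2" and z: "cmod z < 1"
  let ?Y = "\<lambda>w. (cmod (X w) / (cmod (1 - cnj c * w))\<^sup>2) powr \<delta>"
  have nz: "1 - cnj c * w \<noteq> 0" if "cmod w < 1" for w using one_minus_cnj_mult_neq_0[OF c that] .
  show "integral {0..1} (\<lambda>t. ?Y (unit_circ t * z)) \<le> C * N powr \<delta>"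
  proof (cases "1/2 \<le> cmod z")
    case True
    define e where "e = z / cmod z"
    have e: "cmod e = 1" "z = e * cmod z" using True by (auto simp: e_def norm_divide)
    have im: "(*) e ` unit_disk \<subseteq> unit_disk" using e by (auto simp: norm_mult)
    have hol: "(\<lambda>w. X (e * w)) holomorphic_on unit_disk"
      using holomorphic_on_compose_gen[OF _ X(1) im] by (auto simp: comp_def intro!: holomorphic_intros)
    have ew: "cmod (e * w) < 1" if "cmod w < 1" for w using that e by (simp add: norm_mult)
    have "integral {0..1} (\<lambda>t. (cmod (X (e * (of_real (cmod z) * unit_circ t))) / (cmod (1 - cnj (cnj e * c) * (of_real (cmod z) * unit_circ t)))\<^sup>2) powr \<delta>)
      \<le> 5000 / (cos (\<delta> * pi / 2) * (1 - \<delta>)) * N powr \<delta>"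
    proof (rule kolmogorov_circle_aux[OF hol _ _ d _ N _ True z])
      fix w :: complex assume w: "cmod w < 1"
      show "0 \<le> Re (X (e * w))" "X (e * w) \<noteq> 0" using X(2,3)[OF ew[OF w]] by auto
      show "cmod (X (e * w)) * (1 - (cmod w)\<^sup>2) \<le> N * (cmod (1 - cnj (cnj e * c) * w))\<^sup>2"
        using le[OF ew[OF w]] e by (simp add: norm_mult mult_ac)
    qed (use c e in \<open>simp add: norm_mult\<close>)
    also have "\<dots> \<le> C * N powr \<delta>" by (intro mult_right_mono) (auto simp: C_def)
    finally have *: "integral {0..1} (\<lambda>t. (cmod (X (e * (of_real (cmod z) * unit_circ t))) / (cmod (1 - cnj (cnj e * c) * (of_real (cmod z) * unit_circ t)))\<^sup>2) powr \<delta>) \<le> C * N powr \<delta>" .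
    have ez: "e * (of_real (cmod z) * unit_circ t) = unit_circ t * z" for t by (subst e(2)) (simp add: mult_ac)
    have "cnj (cnj e * c) * (of_real (cmod z) * unit_circ t) = cnj c * (unit_circ t * z)" for t
      unfolding ez[symmetric] by (simp add: mult_ac)
    with * show ?thesis by (simp only: ez)
  next
    case False
    have Y: "?Y w \<le> (2 * N) powr \<delta>" if w: "cmod w \<le> 1/2" for w
    proof -
      have w1: "cmod w < 1" using w by simp
      have "(cmod w)\<^sup>2 \<le> (1/2)\<^sup>2" using w by (intro power_mono) auto
      then have "cmod (X w) * (1/2) \<le> cmod (X w) * (1 - (cmod w)\<^sup>2)" by (intro mult_left_mono) (auto simp: power2_eq_square)
      also have "\<dots> \<le> N * (cmod (1 - cnj c * w))\<^sup>2" by (rule le[OF w1])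
      finally have "cmod (X w) / (cmod (1 - cnj c * w))\<^sup>2 \<le> 2 * N" using nz[OF w1] by (simp add: pos_divide_le_eq)
      then show ?thesis using d by (intro powr_mono2) auto
    qed
    have cont: "continuous_on {0..1} (\<lambda>t. ?Y (unit_circ t * z))"
      using d z nz by (intro continuous_on_powr' continuous_on_divide continuous_on_norm continuous_on_power
          continuous_on_compose2[OF holomorphic_on_imp_continuous_on[OF X(1)]] continuous_intros) (auto simp: norm_mult)
    have "integral {0..1} (\<lambda>t. ?Y (unit_circ t * z)) \<le> integral {0..1} (\<lambda>t::real. (2 * N) powr \<delta>)"
      using False by (intro integral_le integrable_continuous_real cont Y) (auto simp: norm_mult)
    also have "\<dots> = 2 powr \<delta> * N powr \<delta>" by (simp add: powr_mult)
    also have "\<dots> \<le> C * N powr \<delta>" by (intro mult_right_mono) (auto simp: C_def)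
    finally show ?thesis .
  qed
qed

subsection \<open>Sufficiency of the vanishing Bloch condition\<close>

lemma norm_disk_aut_le_1: "cmod a < 1 \<Longrightarrow> cmod b \<le> 1 \<Longrightarrow> cmod (disk_aut a b) \<le> 1"
proof -
  assume a: "cmod a < 1" and b: "cmod b \<le> 1"
  have "0 \<le> (1 - (cmod a)\<^sup>2) * (1 - (cmod b)\<^sup>2)"
    using a b by (intro mult_nonneg_nonneg) (auto simp: abs_square_le_1)
  then have "(cmod (a - b))\<^sup>2 \<le> (cmod (1 - cnj a * b))\<^sup>2" using norm_sq_diff_identity[of a b] by linarith
  then have "cmod (a - b) \<le> cmod (1 - cnj a * b)" by (rule power2_le_imp_le) simp
  then show ?thesis by (auto simp: disk_aut_def norm_divide divide_le_eq_1)
qed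

lemma one_minus_norm_disk_aut_le':
  assumes a: "cmod a < 1" and z: "cmod z < 1"
  shows "1 - (cmod (disk_aut a z))\<^sup>2 \<le> (1 + cmod z) / (1 - cmod z) * (1 - (cmod a)\<^sup>2)"
proof -
  have "cmod (1 - cnj a * z) = cmod (1 - cnj z * a)"
    using complex_mod_cnj[of "1 - cnj a * z"] by (simp add: mult.commute del: complex_mod_cnj)
  then have "1 - (cmod (disk_aut a z))\<^sup>2 = 1 - (cmod (disk_aut z a))\<^sup>2"
    by (simp add: one_minus_norm_disk_aut a z mult.commute)
  then show ?thesis using one_minus_norm_disk_aut_le[OF z a] by simp
qed

text \<open>In \<^term>\<open>disk_weight H b\<close>, \<open>b\<close> is the Denjoy--Wolff point and \<open>1 / H\<close> the Berkson--Porta function.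
  The advantage over \<open>(1 - |z|\<^sup>2) / |G z|\<close> is that the shape is preserved by disk automorphisms.\<close>

definition disk_weight :: "(complex \<Rightarrow> complex) \<Rightarrow> complex \<Rightarrow> complex \<Rightarrow> real" where
  "disk_weight H b w = cmod (H w) * (1 - (cmod w)\<^sup>2) / (cmod (1 - cnj b * w))\<^sup>2"

lemma disk_weight_nonneg: "cmod w \<le> 1 \<Longrightarrow> 0 \<le> disk_weight H b w"
  by (simp add: disk_weight_def abs_square_le_1)

lemma continuous_on_disk_weight:
  assumes "H holomorphic_on unit_disk" "cmod b \<le> 1"
  shows "continuous_on unit_disk (disk_weight H b)"
  unfolding disk_weight_def[abs_def] using one_minus_cnj_mult_neq_0[OF assms(2)]
  by (intro continuous_intros holomorphic_on_imp_continuous_on assms) auto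

text \<open>With c = sigma_a b one has (1 - cnj b * sigma_a z) * (1 - cnj a * z) = (1 - cnj c * z) *
  (1 - cnj b * a). The remaining factor is a positive constant, so the pulled-back function keeps a
  nonnegative real part, and circle means can be estimated with the pole c.\<close>

lemma disk_weight_disk_aut:
  assumes a: "cmod a < 1" and z: "cmod z < 1" and b: "cmod b \<le> 1"
  shows "disk_weight H b (disk_aut a z) =
    disk_weight (\<lambda>z. of_real ((1 - (cmod a)\<^sup>2) / (cmod (1 - cnj b * a))\<^sup>2) * H (disk_aut a z)) (disk_aut a b) z"
proof -
  have nz: "1 - cnj a * z \<noteq> 0" "1 - cnj b * a \<noteq> 0" "1 - cnj a * b \<noteq> 0"
    using one_minus_cnj_mult_neq_0[of a z] one_minus_cnj_mult_neq_0[of b a] a z b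
      complex_cnj_cancel_iff[of "1 - cnj b * a" 0] by (auto simp: mult.commute)
  let ?k = "(1 - (cmod a)\<^sup>2) / (cmod (1 - cnj b * a))\<^sup>2"
  have k: "0 \<le> ?k" using one_minus_norm_sq_pos[OF a] by simp
  have h1: "(1 - cnj b * disk_aut a z) * (1 - cnj a * z) = (1 - cnj a * z) - cnj b * (a - z)"
    using nz by (simp add: disk_aut_def left_diff_distrib)
  have h2: "(1 - cnj (disk_aut a b) * z) * (1 - cnj b * a) = (1 - cnj b * a) - (cnj a - cnj b) * z"
  proof -
    have "cnj (disk_aut a b) * (1 - cnj b * a) = cnj a - cnj b" using nz by (simp add: disk_aut_def mult.commute[of a])
    moreover have "(1 - d * z) * m = m - d * m * z" for d m :: complex by (simp add: algebra_simps)
    ultimately show ?thesis by simp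
  qed
  have "(1 - cnj b * disk_aut a z) * (1 - cnj a * z) = (1 - cnj (disk_aut a b) * z) * (1 - cnj b * a)"
    unfolding h1 h2 by (simp add: algebra_simps)
  then have "cmod (1 - cnj b * disk_aut a z) * cmod (1 - cnj a * z) = cmod (1 - cnj (disk_aut a b) * z) * cmod (1 - cnj b * a)"
    by (metis norm_mult)
  then have e: "(cmod (1 - cnj b * disk_aut a z))\<^sup>2 * (cmod (1 - cnj a * z))\<^sup>2 = (cmod (1 - cnj (disk_aut a b) * z))\<^sup>2 * (cmod (1 - cnj b * a))\<^sup>2"
    by (metis power_mult_distrib)
  have "disk_weight H b (disk_aut a z) = cmod (H (disk_aut a z)) * ((1 - (cmod a)\<^sup>2) * (1 - (cmod z)\<^sup>2)) / ((cmod (1 - cnj b * disk_aut a z))\<^sup>2 * (cmod (1 - cnj a * z))\<^sup>2)"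
    by (simp add: disk_weight_def one_minus_norm_disk_aut[OF a z] mult.commute)
  also have "\<dots> = disk_weight (\<lambda>z. of_real ?k * H (disk_aut a z)) (disk_aut a b) z"
    unfolding e disk_weight_def norm_mult norm_of_real abs_of_nonneg[OF k] by (simp add: mult_ac)
  finally show ?thesis .
qed

lemma tendsto_one_minus_power_powr_at_left:
  assumes "0 < \<eta>"
  shows "((\<lambda>R::real. (1 - R\<^sup>2) powr \<eta>) \<longlongrightarrow> 0) (at_left 1)"
proof -
  have "((\<lambda>R::real. (1 - R\<^sup>2) powr \<eta>) \<longlongrightarrow> (1 - 1\<^sup>2) powr \<eta>) (at_left 1)"
  proof (rule tendsto_powr')
    show "((\<lambda>R::real. 1 - R\<^sup>2) \<longlongrightarrow> 1 - 1\<^sup>2) (at_left 1)" by (intro tendsto_intros)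
    have "\<forall>\<^sub>F x in at_left 1. 0 \<le> 1 - (x::real)\<^sup>2"
      unfolding eventually_at_left_field
    proof (intro exI[of _ 0] conjI allI impI)
      fix y :: real assume "0 < y" "y < 1"
      then have "y\<^sup>2 \<le> 1" by (intro power_le_one) auto
      then show "0 \<le> 1 - y\<^sup>2" by simp
    qed simp
    then show "1 - 1\<^sup>2 \<noteq> (0::real) \<or> 0 < \<eta> \<and> (\<forall>\<^sub>F x in at_left 1. 0 \<le> 1 - (x::real)\<^sup>2)" using assms by simp
  qed (rule tendsto_const)
  then show ?thesis using assms by simp
qed

lemma exists_radius_one_minus_powr_less:
  assumes "0 < \<eta>" "0 < e"
  obtains R :: real where "0 < R" "R < 1" "\<And>x. R \<le> x \<Longrightarrow> x < 1 \<Longrightarrow> (1 - x\<^sup>2) powr \<eta> < e"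
proof -
  have "\<forall>\<^sub>F R in at_left 1. (1 - R\<^sup>2) powr \<eta> < e"
    using assms by (intro order_tendstoD(2)[OF tendsto_one_minus_power_powr_at_left]) auto
  then obtain b where b: "b < 1" "\<And>y. b < y \<Longrightarrow> y < 1 \<Longrightarrow> (1 - y\<^sup>2) powr \<eta> < e"
    by (auto simp: eventually_at_left_field)
  show ?thesis by (rule that[of "max (1/2) ((b + 1) / 2)"]) (use b in \<open>auto simp: max_def split: if_splits\<close>)
qed

lemma nn_integral_indicator_plus_cmult:
  fixes g :: "complex \<Rightarrow> ennreal"
  assumes "g \<in> borel_measurable borel"
  shows "(\<integral>\<^sup>+z. A * indicator unit_disk z + B * g z \<partial>lborel) = A * ennreal pi + B * (\<integral>\<^sup>+z. g z \<partial>lborel)"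
proof -
  have "emeasure lborel unit_disk = ennreal pi" by (simp add: emeasure_ball unit_ball_vol_2)
  then have "(\<integral>\<^sup>+z. A * indicator unit_disk z \<partial>lborel) = A * ennreal pi"
    by (subst nn_integral_cmult_indicator) auto
  moreover have "(\<lambda>z. A * indicator unit_disk z) \<in> borel_measurable (lborel :: complex measure)"
    by (intro borel_measurable_times_ennreal borel_measurable_const borel_measurable_indicator) auto
  ultimately show ?thesis using assms by (subst nn_integral_add) (auto simp: nn_integral_cmult)
qed

text \<open>Fix R first. On |z| \<ge> R, use only \<delta> of the p powers: their circle means are
  bounded uniformly in a, the others are at most powers of N, and a factor (1 - R^2)^\<eta> makes
  the contribution small. On |z| < R, sigma_a z approaches the circle uniformly as |a| tends to 1,
  so the weight itself is small.\<close>

lemma nn_integral_disk_weight_vanishes: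
  assumes H: "H holomorphic_on unit_disk" "\<And>z. cmod z < 1 \<Longrightarrow> 0 \<le> Re (H z)" "\<And>z. cmod z < 1 \<Longrightarrow> H z \<noteq> 0"
    and b: "cmod b \<le> 1" and N: "\<And>w. cmod w < 1 \<Longrightarrow> disk_weight H b w \<le> N"
    and van: "\<And>\<epsilon>. 0 < \<epsilon> \<Longrightarrow> \<exists>r<1. \<forall>w. r < cmod w \<and> cmod w < 1 \<longrightarrow> disk_weight H b w \<le> \<epsilon>"
    and \<kappa>: "0 < \<kappa>" and p: "1 \<le> p" and e: "0 < e"
  obtains r where "r < 1" "\<And>a. r < cmod a \<Longrightarrow> cmod a < 1 \<Longrightarrow>
    (\<integral>\<^sup>+z\<in>unit_disk. ennreal ((1 - (cmod z)\<^sup>2) powr (\<kappa> - 2) * disk_weight H b (disk_aut a z) powr p) \<partial>lborel) \<le> ennreal e"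
proof -
  define m where "m = min \<kappa> 1"
  \<comment> \<open>Then \<beta> = \<kappa> - 1 - m/2 > -1, which makes the remaining weight
    integrable. Capping \<kappa> at 1 keeps \<delta> positive.\<close>
  define \<delta> \<eta> where "\<delta> = 1 - m / 4" and "\<eta> = m / 4"
  have m: "0 < m" "m \<le> 1" "m \<le> \<kappa>" using \<kappa> by (auto simp: m_def)
  have d: "0 < \<delta>" "\<delta> < 1" and eta: "0 < \<eta>" using m by (auto simp: \<delta>_def \<eta>_def)
  define \<beta> where "\<beta> = \<kappa> - 2 - \<eta> + \<delta>"
  have beta: "- 1 < \<beta>" using m by (simp add: \<beta>_def \<delta>_def \<eta>_def)
  have N0: "0 \<le> N" using N[of 0] disk_weight_nonneg[of 0 H b] by simp
  obtain C where C: "0 \<le> C" "\<And>X c N z. X holomorphic_on unit_disk \<Longrightarrow> (\<And>z. cmod z < 1 \<Longrightarrow> 0 \<le> Re (X z)) \<Longrightarrow>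
     (\<And>z. cmod z < 1 \<Longrightarrow> X z \<noteq> 0) \<Longrightarrow> cmod c \<le> 1 \<Longrightarrow> 0 \<le> N \<Longrightarrow>
     (\<And>z. cmod z < 1 \<Longrightarrow> cmod (X z) * (1 - (cmod z)\<^sup>2) \<le> N * (cmod (1 - cnj c * z))\<^sup>2) \<Longrightarrow> cmod z < 1 \<Longrightarrow>
     integral {0..1} (\<lambda>t. (cmod (X (unit_circ t * z)) / (cmod (1 - cnj c * (unit_circ t * z)))\<^sup>2) powr \<delta>) \<le> C * N powr \<delta>"
    using kolmogorov_circle[OF d] by blast
  obtain i0 where i0: "0 \<le> i0" "(\<integral>\<^sup>+z\<in>unit_disk. ennreal ((1 - (cmod z)\<^sup>2) powr \<beta>) \<partial>lborel) = ennreal i0"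
    using nn_integral_one_minus_norm_powr_finite[OF beta]
    by (cases "\<integral>\<^sup>+z\<in>unit_disk. ennreal ((1 - (cmod z)\<^sup>2) powr \<beta>) \<partial>lborel") auto
  define K where "K = N powr (p - \<delta>) * (C * N powr \<delta> * i0)"
  have K: "0 \<le> K" using C i0 by (simp add: K_def)
  obtain R where R: "0 < R" "R < 1" "(1 - R\<^sup>2) powr \<eta> < e / (2 * (K + 1))"
    using exists_radius_one_minus_powr_less[OF eta, of "e / (2 * (K + 1))"] e K by (metis divide_pos_pos add_nonneg_pos mult_pos_pos order_refl zero_less_numeral zero_less_one)
  have R2: "0 < 1 - R\<^sup>2" using R by (simp add: abs_square_less_1)
  \<comment> \<open>Solves \<epsilon>^p * pi / (1 - R^2)^2 = e/2, the share of the inner disk; pi is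
    the area of the unit disk.\<close>
  define \<epsilon> where "\<epsilon> = (e * (1 - R\<^sup>2)\<^sup>2 / (2 * pi)) powr (1 / p)"
  have eps: "0 < \<epsilon>" "\<epsilon> powr p = e * (1 - R\<^sup>2)\<^sup>2 / (2 * pi)" using e R2 p by (auto simp: \<epsilon>_def powr_powr)
  obtain r0 where r0: "r0 < 1" "\<And>w. r0 < cmod w \<Longrightarrow> cmod w < 1 \<Longrightarrow> disk_weight H b w \<le> \<epsilon>" using van[OF eps(1)] by blast
  \<comment> \<open>If 1 - |a|^2 < x0, the distortion factor 2 / (1 - R) still leaves 1 - |sigma_a
    z|^2 below 1 - (max r0 0)^2 for |z| < R.\<close>
  define x0 where "x0 = (1 - (max r0 0)\<^sup>2) * (1 - R) / 2"
  have x0: "0 < x0" using r0(1) R by (simp add: x0_def abs_square_less_1)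
  obtain r where r: "0 < r" "r < 1" "\<And>x. r \<le> x \<Longrightarrow> x < 1 \<Longrightarrow> (1 - x\<^sup>2) powr 1 < x0"
    using exists_radius_one_minus_powr_less[of 1 x0] x0 by (metis zero_less_one)
  show ?thesis
  proof (rule that[OF r(2)])
    fix a :: complex assume a: "r < cmod a" "cmod a < 1"
    have ax: "1 - (cmod a)\<^sup>2 < x0" using r(3)[of "cmod a"] a one_minus_norm_sq_pos[OF a(2)] by simp
    define k where "k = (1 - (cmod a)\<^sup>2) / (cmod (1 - cnj b * a))\<^sup>2"
    define X where "X = (\<lambda>z. of_real k * H (disk_aut a z))"
    define c where "c = disk_aut a b"
    have k: "0 < k" using one_minus_norm_sq_pos[OF a(2)] one_minus_cnj_mult_neq_0[OF b a(2)] by (simp add: k_def)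
    let ?L = "\<lambda>z. disk_weight H b (disk_aut a z)"
    have L: "?L z = cmod (X z) * (1 - (cmod z)\<^sup>2) / (cmod (1 - cnj c * z))\<^sup>2" if "cmod z < 1" for z
      using disk_weight_disk_aut[OF a(2) that b, of H] by (simp add: X_def c_def k_def disk_weight_def)
    have c1: "cmod c \<le> 1" unfolding c_def by (rule norm_disk_aut_le_1[OF a(2) b])
    have nz: "1 - cnj c * z \<noteq> 0" if "cmod z < 1" for z using one_minus_cnj_mult_neq_0[OF c1 that] .
    have X: "X holomorphic_on unit_disk" "\<And>z. cmod z < 1 \<Longrightarrow> 0 \<le> Re (X z)" "\<And>z. cmod z < 1 \<Longrightarrow> X z \<noteq> 0"
      unfolding X_def using H k norm_disk_aut_less_1[OF a(2)]
      by (auto intro!: holomorphic_intros holomorphic_compose_disk_aut a mult_nonneg_nonneg)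
    have Xle: "cmod (X z) * (1 - (cmod z)\<^sup>2) \<le> N * (cmod (1 - cnj c * z))\<^sup>2" if z: "cmod z < 1" for z
      using N[OF norm_disk_aut_less_1[OF a(2) z]] nz[OF z] unfolding L[OF z] by (simp add: pos_divide_le_eq)
    have Lnn: "0 \<le> ?L z" if "cmod z < 1" for z using disk_weight_nonneg norm_disk_aut_less_1[OF a(2) that] by (simp add: less_imp_le)
    have LN: "?L z \<le> N" if "cmod z < 1" for z using N norm_disk_aut_less_1[OF a(2) that] by simp
    have Leps: "?L z \<le> \<epsilon>" if z: "cmod z < R" for z
    proof (rule r0(2))
      have z1: "cmod z < 1" using z R by simp
      show "cmod (disk_aut a z) < 1" by (rule norm_disk_aut_less_1[OF a(2) z1])
      have "1 - (cmod (disk_aut a z))\<^sup>2 \<le> (1 + cmod z) / (1 - cmod z) * (1 - (cmod a)\<^sup>2)"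
        by (rule one_minus_norm_disk_aut_le'[OF a(2) z1])
      also have "\<dots> \<le> 2 / (1 - R) * (1 - (cmod a)\<^sup>2)"
        using z z1 R one_minus_norm_sq_pos[OF a(2)] by (intro mult_right_mono frac_le) auto
      also have "\<dots> < 2 / (1 - R) * x0" using ax R by (intro mult_strict_left_mono) auto
      also have "\<dots> = 1 - (max r0 0)\<^sup>2" using R by (simp add: x0_def)
      finally have "(max r0 0)\<^sup>2 < (cmod (disk_aut a z))\<^sup>2" by simp
      then have "max r0 0 < cmod (disk_aut a z)" by (rule power_less_imp_less_base) simp
      then show "r0 < cmod (disk_aut a z)" by simp
    qed
    let ?Y = "\<lambda>z. (cmod (X z) / (cmod (1 - cnj c * z))\<^sup>2) powr \<delta>"
    let ?A = "\<epsilon> powr p * (1 / (1 - R\<^sup>2)\<^sup>2)" and ?B = "N powr (p - \<delta>) * (1 - R\<^sup>2) powr \<eta>"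
    have pw: "(1 - (cmod z)\<^sup>2) powr (\<kappa> - 2) * ?L z powr p \<le> ?A + ?B * (?Y z * (1 - (cmod z)\<^sup>2) powr \<beta>)" if z: "cmod z < 1" for z
    proof (cases "cmod z < R")
      case True
      have x: "0 < 1 - (cmod z)\<^sup>2" "1 - (cmod z)\<^sup>2 \<le> 1" using one_minus_norm_sq_pos[OF z] by auto
      have xR: "1 - R\<^sup>2 \<le> 1 - (cmod z)\<^sup>2" using True by (simp add: power_mono)
      have "(1 - (cmod z)\<^sup>2) powr (\<kappa> - 2) = (1 - (cmod z)\<^sup>2) powr \<kappa> * (1 / (1 - (cmod z)\<^sup>2)\<^sup>2)"
        using x by (simp add: powr_diff powr_realpow[symmetric] del: powr_numeral)
      also have "\<dots> \<le> 1 * (1 / (1 - R\<^sup>2)\<^sup>2)"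
        using x xR R2 \<kappa> by (intro mult_mono powr_le1 divide_left_mono power_mono) auto
      finally have "(1 - (cmod z)\<^sup>2) powr (\<kappa> - 2) * ?L z powr p \<le> 1 * (1 / (1 - R\<^sup>2)\<^sup>2) * \<epsilon> powr p"
        using Leps[OF True] Lnn[OF z] p by (intro mult_mono powr_mono2) auto
      also have "\<dots> \<le> ?A + ?B * (?Y z * (1 - (cmod z)\<^sup>2) powr \<beta>)" by simp
      finally show ?thesis .
    next
      case False
      have x: "0 < 1 - (cmod z)\<^sup>2" using one_minus_norm_sq_pos[OF z] by auto
      have xR: "1 - (cmod z)\<^sup>2 \<le> 1 - R\<^sup>2" using False R by (simp add: power_mono)
      \<comment> \<open>Split off exactly \<delta> powers: the circle estimate needs an exponent
        below 1, and for the rest the uniform bound N is enough.\<close>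
      have "?L z powr p = ?L z powr (p - \<delta>) * ?L z powr \<delta>" by (simp add: powr_add[symmetric])
      also have "\<dots> \<le> N powr (p - \<delta>) * ?L z powr \<delta>"
        using LN[OF z] Lnn[OF z] p d by (intro mult_right_mono powr_mono2) auto
      also have "?L z powr \<delta> = ?Y z * (1 - (cmod z)\<^sup>2) powr \<delta>"
        unfolding L[OF z] by (simp add: powr_mult powr_divide)
      finally have "(1 - (cmod z)\<^sup>2) powr (\<kappa> - 2) * ?L z powr p \<le> (1 - (cmod z)\<^sup>2) powr (\<kappa> - 2) * (N powr (p - \<delta>) * (?Y z * (1 - (cmod z)\<^sup>2) powr \<delta>))"
        by (rule mult_left_mono) simp
      also have "\<dots> = N powr (p - \<delta>) * (?Y z * (1 - (cmod z)\<^sup>2) powr (\<eta> + \<beta>))"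
      proof -
        have "(1 - (cmod z)\<^sup>2) powr (\<kappa> - 2) * (1 - (cmod z)\<^sup>2) powr \<delta> = (1 - (cmod z)\<^sup>2) powr (\<eta> + \<beta>)"
          by (simp add: powr_add[symmetric] \<beta>_def algebra_simps)
        then show ?thesis by (simp only: mult_ac) (simp add: mult.left_commute)
      qed
      also have "\<dots> = N powr (p - \<delta>) * (1 - (cmod z)\<^sup>2) powr \<eta> * (?Y z * (1 - (cmod z)\<^sup>2) powr \<beta>)"
        by (simp add: powr_add mult_ac)
      also have "\<dots> \<le> ?B * (?Y z * (1 - (cmod z)\<^sup>2) powr \<beta>)"
        using x xR eta by (intro mult_right_mono mult_left_mono powr_mono2) auto
      also have "\<dots> \<le> ?A + ?B * (?Y z * (1 - (cmod z)\<^sup>2) powr \<beta>)" by simp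
      finally show ?thesis .
    qed
    have contY: "continuous_on unit_disk ?Y"
      using d nz by (intro continuous_on_powr' continuous_intros holomorphic_on_imp_continuous_on X) auto
    have measY: "(\<lambda>z. ennreal (?Y z * (1 - (cmod z)\<^sup>2) powr \<beta>) * indicator unit_disk z) \<in> borel_measurable borel"
      by (intro borel_measurable_indicator_ennreal continuous_on_mult contY continuous_on_radial_powr)
    have IY: "(\<integral>\<^sup>+z\<in>unit_disk. ennreal (?Y z * (1 - (cmod z)\<^sup>2) powr \<beta>) \<partial>lborel) \<le> ennreal (C * N powr \<delta>) * ennreal i0"
    proof -
      have "(\<integral>\<^sup>+z\<in>unit_disk. ennreal (?Y z * (1 - (cmod z)\<^sup>2) powr \<beta>) \<partial>lborel)
        = (\<integral>\<^sup>+z\<in>unit_disk. ennreal (integral {0..1} (\<lambda>t. ?Y (unit_circ t * z)) * (1 - (cmod z)\<^sup>2) powr \<beta>) \<partial>lborel)"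
        by (rule nn_integral_circle_mean[OF contY _ continuous_on_radial_powr]) (auto simp: norm_mult)
      also have "\<dots> \<le> (\<integral>\<^sup>+z\<in>unit_disk. ennreal (C * N powr \<delta> * (1 - (cmod z)\<^sup>2) powr \<beta>) \<partial>lborel)"
        by (intro nn_integral_disk_mono ennreal_leI mult_right_mono C(2)[OF X c1 N0 Xle]) auto
      also have "\<dots> = (\<integral>\<^sup>+z. ennreal (C * N powr \<delta>) * (ennreal ((1 - (cmod z)\<^sup>2) powr \<beta>) * indicator unit_disk z) \<partial>lborel)"
        using C(1) by (intro nn_integral_cong) (auto simp: indicator_def ennreal_mult)
      also have "\<dots> = ennreal (C * N powr \<delta>) * ennreal i0"
        using borel_measurable_indicator_ennreal[OF continuous_on_radial_powr[of \<beta>]] by (simp add: nn_integral_cmult i0(2))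
      finally show ?thesis .
    qed
    have B0: "0 \<le> ?B" by simp
    have s1: "(\<integral>\<^sup>+z\<in>unit_disk. ennreal ((1 - (cmod z)\<^sup>2) powr (\<kappa> - 2) * ?L z powr p) \<partial>lborel)
      \<le> (\<integral>\<^sup>+z. ennreal ?A * indicator unit_disk z + ennreal ?B * (ennreal (?Y z * (1 - (cmod z)\<^sup>2) powr \<beta>) * indicator unit_disk z) \<partial>lborel)"
    proof (rule nn_integral_mono)
      fix z :: complex
      show "ennreal ((1 - (cmod z)\<^sup>2) powr (\<kappa> - 2) * ?L z powr p) * indicator unit_disk z
        \<le> ennreal ?A * indicator unit_disk z + ennreal ?B * (ennreal (?Y z * (1 - (cmod z)\<^sup>2) powr \<beta>) * indicator unit_disk z)"
      proof (cases "z \<in> unit_disk")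
        case True
        then have z: "cmod z < 1" by simp
        have "ennreal ((1 - (cmod z)\<^sup>2) powr (\<kappa> - 2) * ?L z powr p) \<le> ennreal (?A + ?B * (?Y z * (1 - (cmod z)\<^sup>2) powr \<beta>))"
          by (intro ennreal_leI pw z)
        also have "\<dots> = ennreal ?A + ennreal ?B * ennreal (?Y z * (1 - (cmod z)\<^sup>2) powr \<beta>)"
          by (subst ennreal_mult[symmetric]) (auto intro!: ennreal_plus)
        finally show ?thesis using True by simp
      qed simp
    qed
    have s2: "(\<integral>\<^sup>+z. ennreal ?A * indicator unit_disk z + ennreal ?B * (ennreal (?Y z * (1 - (cmod z)\<^sup>2) powr \<beta>) * indicator unit_disk z) \<partial>lborel)
       = ennreal ?A * ennreal pi + ennreal ?B * (\<integral>\<^sup>+z\<in>unit_disk. ennreal (?Y z * (1 - (cmod z)\<^sup>2) powr \<beta>) \<partial>lborel)"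
      by (rule nn_integral_indicator_plus_cmult[OF measY])
    have sum_ennreal: "ennreal A * ennreal pi + ennreal B * (ennreal c * ennreal d) = ennreal (A * pi + B * (c * d))"
      if nn: "0 \<le> A" "0 \<le> B" "0 \<le> c" "0 \<le> d" for A B c d :: real
    proof -
      have "ennreal A * ennreal pi = ennreal (A * pi)" by (rule ennreal_mult[symmetric]) (use nn in auto)
      moreover have "ennreal B * (ennreal c * ennreal d) = ennreal (B * (c * d))"
        using ennreal_mult[OF nn(3,4)] ennreal_mult[OF nn(2) mult_nonneg_nonneg[OF nn(3,4)]] by metis
      moreover have "ennreal (A * pi + B * (c * d)) = ennreal (A * pi) + ennreal (B * (c * d))"
        by (rule ennreal_plus) (use nn in auto)
      ultimately show ?thesis by metis
    qed
    have s3: "ennreal ?A * ennreal pi + ennreal ?B * (ennreal (C * N powr \<delta>) * ennreal i0) = ennreal (?A * pi + ?B * (C * N powr \<delta> * i0))"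
      by (rule sum_ennreal) (use C(1) i0(1) in auto)
    have s4: "ennreal (?A * pi + ?B * (C * N powr \<delta> * i0)) \<le> ennreal e"
    proof (rule ennreal_leI)
      have A: "?A * pi = e / 2" unfolding eps(2) using R2 by (simp add: field_simps)
      have "?B * (C * N powr \<delta> * i0) = (1 - R\<^sup>2) powr \<eta> * K" by (simp add: K_def)
      also have "\<dots> \<le> e / (2 * (K + 1)) * K" using R(3) K by (intro mult_right_mono) auto
      also have "\<dots> \<le> e / 2" using K e by (simp add: field_simps)
      finally show "?A * pi + ?B * (C * N powr \<delta> * i0) \<le> e" unfolding A by simp
    qed
    show "(\<integral>\<^sup>+z\<in>unit_disk. ennreal ((1 - (cmod z)\<^sup>2) powr (\<kappa> - 2) * ?L z powr p) \<partial>lborel) \<le> ennreal e"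
      by (rule order_trans[OF s1[unfolded s2] order_trans[OF add_left_mono[OF mult_left_mono[OF IY zero_le]] s4[folded s3]]])
  qed
qed

lemma norm_diff_le_norm_one_minus_cnj_mult:
  assumes "cmod b \<le> 1" "cmod w \<le> 1"
  shows "cmod (w - b) \<le> cmod (1 - cnj b * w)"
proof -
  have "0 \<le> (1 - (cmod b)\<^sup>2) * (1 - (cmod w)\<^sup>2)"
    using assms by (intro mult_nonneg_nonneg) (auto simp: abs_square_le_1)
  then have "(cmod (b - w))\<^sup>2 \<le> (cmod (1 - cnj b * w))\<^sup>2" using norm_sq_diff_identity[of b w] by linarith
  then have "cmod (b - w) \<le> cmod (1 - cnj b * w)" by (rule power2_le_imp_le) simp
  then show ?thesis by (simp add: norm_minus_commute)
qed

text \<open>For b on the circle the two moduli agree up to the sign of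
  \<open>norm_sq_diff_identity\<close>; for b inside, w stays away from b near the circle. Thus |G|
  is comparable to |1 - cnj b * w|^2 * |P| there.\<close>

lemma norm_one_minus_cnj_mult_le_norm_diff:
  assumes b: "cmod b \<le> 1"
  obtains R0 k where "0 \<le> R0" "R0 < 1" "0 < k" "\<And>w. R0 < cmod w \<Longrightarrow> cmod w < 1 \<Longrightarrow> k * cmod (1 - cnj b * w) \<le> cmod (w - b)"
proof (cases "cmod b = 1")
  case True
  have "cmod (1 - cnj b * w) \<le> cmod (w - b)" for w
  proof -
    have "(cmod (1 - cnj b * w))\<^sup>2 \<le> (cmod (b - w))\<^sup>2" using norm_sq_diff_identity[of b w] True by simp
    then have "cmod (1 - cnj b * w) \<le> cmod (b - w)" by (rule power2_le_imp_le) simp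
    then show ?thesis by (simp add: norm_minus_commute)
  qed
  then show ?thesis using that[of 0 1] by simp
next
  case False
  then have b1: "cmod b < 1" using b by simp
  show ?thesis
  proof (rule that[of "(1 + cmod b) / 2" "(1 - cmod b) / 4"])
    fix w assume w: "(1 + cmod b) / 2 < cmod w" "cmod w < 1"
    have "(1 - cmod b) / 4 * cmod (1 - cnj b * w) \<le> (1 - cmod b) / 4 * 2"
      using b1 w norm_one_minus_cnj_mult_le[of b w] by (intro mult_left_mono) auto
    also have "\<dots> \<le> cmod (w - b)" using norm_triangle_ineq2[of w b] w by simp
    finally show "(1 - cmod b) / 4 * cmod (1 - cnj b * w) \<le> cmod (w - b)" .
  qed (use b1 in auto)
qed

text \<open>Zeros of G near the circle are excluded because the quotient in \<open>ennreal\<close>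
  is infinite at them.\<close>

lemma vanishing_Bloch_conditionD:
  assumes "vanishing_Bloch_condition G" "0 < e"
  obtains r where "r < 1" "\<And>w. r < cmod w \<Longrightarrow> cmod w < 1 \<Longrightarrow> G w \<noteq> 0 \<and> (1 - (cmod w)\<^sup>2) / cmod (G w) \<le> e"
proof -
  obtain r where r: "r < 1" "\<And>w. r < cmod w \<Longrightarrow> cmod w < 1 \<Longrightarrow> ennreal (1 - (cmod w)\<^sup>2) / ennreal (cmod (G w)) \<le> ennreal e"
    using assms unfolding vanishing_Bloch_condition_def tendsto_ennreal_0_iff eventually_to_unit_circle by blast
  show ?thesis
  proof (rule that[OF r(1)])
    fix w assume w: "r < cmod w" "cmod w < 1"
    have pos: "0 < 1 - (cmod w)\<^sup>2" by (rule one_minus_norm_sq_pos[OF w(2)])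
    have le: "ennreal (1 - (cmod w)\<^sup>2) / ennreal (cmod (G w)) \<le> ennreal e" by (rule r(2)[OF w])
    have nz: "G w \<noteq> 0"
    proof
      assume "G w = 0"
      then have "ennreal (1 - (cmod w)\<^sup>2) / ennreal (cmod (G w)) = top"
        using pos by (simp add: ennreal_divide_zero ennreal_eq_0_iff del: ennreal_minus)
      then show False using le by (simp add: top_unique)
    qed
    have "ennreal ((1 - (cmod w)\<^sup>2) / cmod (G w)) \<le> ennreal e"
      using le pos nz by (subst (asm) divide_ennreal) auto
    then show "G w \<noteq> 0 \<and> (1 - (cmod w)\<^sup>2) / cmod (G w) \<le> e" using nz assms(2) by (auto simp: ennreal_le_iff)
  qed
qed

section \<open>Energies of orbit averages under the Bloch condition\<close>

context morrey_semigroup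
begin

text \<open>Inside radius R0 the derivative is bounded, which gives the first summand, vanishing at
  the circle. Outside, insert the bound, substitute w = sigma_a z and distribute the outer weight;
  the exponent becomes \<kappa> - 2 with \<kappa> = s - p + 2 - \<alpha> * p, positive by
  \<open>alpha_less\<close>.\<close>

lemma energy_le_disk_weight_integral:
  assumes g: "g holomorphic_on unit_disk" and H: "H holomorphic_on unit_disk" and b: "cmod b \<le> 1"
    and R0: "0 \<le> R0" "R0 < 1" and C: "0 \<le> C"
    and le: "\<And>w. R0 < cmod w \<Longrightarrow> cmod w < 1 \<Longrightarrow> cmod (deriv g w) \<le> C * (1 - (cmod w)\<^sup>2) powr (- \<alpha> - 1) * disk_weight H b w"
  obtains M where "0 \<le> M" "\<And>a. cmod a < 1 \<Longrightarrow> energy g a \<le> ennreal (M * (1 - (cmod a)\<^sup>2) powr (\<alpha> * p)) +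
    ennreal (C powr p * 4 powr (\<alpha> * p)) * (\<integral>\<^sup>+z\<in>unit_disk. ennreal ((1 - (cmod z)\<^sup>2) powr (s - p + 2 - \<alpha> * p - 2) * disk_weight H b (disk_aut a z) powr p) \<partial>lborel)"
proof -
  have contg: "continuous_on unit_disk (\<lambda>w. cmod (deriv g w) powr p * (1 - (cmod w)\<^sup>2) powr (p - 2))"
    by (intro continuous_on_norm_powr_weight p_pos holomorphic_on_imp_continuous_on holomorphic_deriv g) auto
  have "compact ((\<lambda>w. cmod (deriv g w) powr p * (1 - (cmod w)\<^sup>2) powr (p - 2)) ` cball 0 R0)"
    using R0 by (intro compact_continuous_image continuous_on_subset[OF contg]) auto
  then obtain M0 where M0: "\<forall>w\<in>cball 0 R0. cmod (deriv g w) powr p * (1 - (cmod w)\<^sup>2) powr (p - 2) \<le> M0"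
    by (auto dest!: compact_imp_bounded simp: bounded_iff)
  define M where "M = max M0 0"
  have M: "0 \<le> M" "\<And>w. cmod w \<le> R0 \<Longrightarrow> cmod (deriv g w) powr p * (1 - (cmod w)\<^sup>2) powr (p - 2) \<le> M"
    using M0 by (auto simp: M_def le_max_iff_disj)
  show ?thesis
  proof (rule that[of "M * pi"])
    show "0 \<le> M * pi" using M by simp
    fix a :: complex assume a: "cmod a < 1"
    let ?\<sigma> = "disk_aut a"
    let ?L = "disk_weight H b"
    define F where "F = (\<lambda>w. (1 - (cmod w)\<^sup>2) powr (- \<alpha> * p - 2) * ?L w powr p * (1 - (cmod (?\<sigma> w))\<^sup>2) powr (s - p + 2))"
    have ca: "continuous_on unit_disk ?\<sigma>" by (intro holomorphic_on_imp_continuous_on holomorphic_disk_aut a)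
    have contF: "continuous_on unit_disk F"
      unfolding F_def
    proof (intro continuous_on_mult continuous_on_radial_powr)
      show "continuous_on unit_disk (\<lambda>w. ?L w powr p)"
        using p_pos disk_weight_nonneg by (intro continuous_on_powr' continuous_on_disk_weight H b continuous_on_const) auto
      show "continuous_on unit_disk (\<lambda>w. (1 - (cmod (?\<sigma> w))\<^sup>2) powr (s - p + 2))"
        using one_minus_norm_sq_pos norm_disk_aut_less_1[OF a]
        by (intro continuous_on_powr continuous_intros ca) (fastforce simp: in_disk_iff)+
    qed
    have measF: "(\<lambda>w. ennreal (F w) * indicator unit_disk w) \<in> borel_measurable borel"
      by (rule borel_measurable_indicator_ennreal[OF contF])
    have F0: "0 \<le> F w" for w by (simp add: F_def)
    have pw: "cmod (deriv g w) powr p * (1 - (cmod w)\<^sup>2) powr (p - 2) * (1 - (cmod (?\<sigma> w))\<^sup>2) powr (s - p + 2) \<le> M + C powr p * F w"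
      if w: "cmod w < 1" for w
    proof -
      have y: "0 < 1 - (cmod (?\<sigma> w))\<^sup>2" by (intro one_minus_norm_sq_pos norm_disk_aut_less_1 a w)
      have y1: "(1 - (cmod (?\<sigma> w))\<^sup>2) powr (s - p + 2) \<le> 1" using y p_less_s by (intro powr_le1) auto
      have x: "0 < 1 - (cmod w)\<^sup>2" by (rule one_minus_norm_sq_pos[OF w])
      show ?thesis
      proof (cases "cmod w \<le> R0")
        case True
        have "cmod (deriv g w) powr p * (1 - (cmod w)\<^sup>2) powr (p - 2) * (1 - (cmod (?\<sigma> w))\<^sup>2) powr (s - p + 2) \<le> M * 1"
          using M y1 True by (intro mult_mono) auto
        also have "\<dots> \<le> M + C powr p * F w" using F0 by simp
        finally show ?thesis .
      next
        case False
        have "cmod (deriv g w) powr p \<le> (C * (1 - (cmod w)\<^sup>2) powr (- \<alpha> - 1) * ?L w) powr p"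
          using le[of w] False w p_pos by (intro powr_mono2) auto
        also have "\<dots> = C powr p * (1 - (cmod w)\<^sup>2) powr ((- \<alpha> - 1) * p) * ?L w powr p"
          by (simp add: powr_mult powr_powr)
        finally have "cmod (deriv g w) powr p * (1 - (cmod w)\<^sup>2) powr (p - 2) \<le> C powr p * (1 - (cmod w)\<^sup>2) powr ((- \<alpha> - 1) * p) * ?L w powr p * (1 - (cmod w)\<^sup>2) powr (p - 2)"
          by (rule mult_right_mono) simp
        also have "\<dots> = C powr p * ((1 - (cmod w)\<^sup>2) powr ((- \<alpha> - 1) * p) * (1 - (cmod w)\<^sup>2) powr (p - 2)) * ?L w powr p"
          by (simp add: mult_ac)
        also have "(1 - (cmod w)\<^sup>2) powr ((- \<alpha> - 1) * p) * (1 - (cmod w)\<^sup>2) powr (p - 2) = (1 - (cmod w)\<^sup>2) powr (- \<alpha> * p - 2)"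
          by (simp add: powr_add[symmetric] algebra_simps)
        finally have "cmod (deriv g w) powr p * (1 - (cmod w)\<^sup>2) powr (p - 2) * (1 - (cmod (?\<sigma> w))\<^sup>2) powr (s - p + 2)
           \<le> C powr p * (1 - (cmod w)\<^sup>2) powr (- \<alpha> * p - 2) * ?L w powr p * (1 - (cmod (?\<sigma> w))\<^sup>2) powr (s - p + 2)"
          by (rule mult_right_mono) simp
        also have "\<dots> = C powr p * F w" by (simp add: F_def mult.assoc)
        finally show ?thesis using M(1) by simp
      qed
    qed
    have "dirichlet_energy p s (\<lambda>z. g (?\<sigma> z)) \<le> (\<integral>\<^sup>+w. ennreal M * indicator unit_disk w + ennreal (C powr p) * (ennreal (F w) * indicator unit_disk w) \<partial>lborel)"
      unfolding dirichlet_energy_disk_aut[OF a g p_pos]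
    proof (rule nn_integral_mono)
      fix w :: complex
      let ?E = "cmod (deriv g w) powr p * (1 - (cmod w)\<^sup>2) powr (p - 2) * (1 - (cmod (?\<sigma> w))\<^sup>2) powr (s - p + 2)"
      show "ennreal ?E * indicator unit_disk w \<le> ennreal M * indicator unit_disk w + ennreal (C powr p) * (ennreal (F w) * indicator unit_disk w)"
      proof (cases "w \<in> unit_disk")
        case True
        then have "ennreal ?E \<le> ennreal (M + C powr p * F w)" by (intro ennreal_leI pw) simp
        also have "\<dots> = ennreal M + ennreal (C powr p * F w)" using M(1) F0 by (intro ennreal_plus) auto
        also have "ennreal (C powr p * F w) = ennreal (C powr p) * ennreal (F w)" using F0 by (intro ennreal_mult) auto
        finally show ?thesis using True by simp
      qed simp
    qed
    also have "\<dots> = ennreal M * ennreal pi + ennreal (C powr p) * (\<integral>\<^sup>+w\<in>unit_disk. ennreal (F w) \<partial>lborel)"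
      by (rule nn_integral_indicator_plus_cmult[OF measF])
    finally have J: "dirichlet_energy p s (\<lambda>z. g (?\<sigma> z)) \<le> ennreal M * ennreal pi + ennreal (C powr p) * (\<integral>\<^sup>+w\<in>unit_disk. ennreal (F w) \<partial>lborel)" .
    define c where "c = (1 - (cmod a)\<^sup>2) powr (\<alpha> * p)"
    let ?Q = "\<lambda>z. (1 - (cmod z)\<^sup>2) powr (s - p + 2 - \<alpha> * p - 2) * ?L (?\<sigma> z) powr p"
    have IF: "ennreal c * (\<integral>\<^sup>+w\<in>unit_disk. ennreal (F w) \<partial>lborel) \<le> ennreal (4 powr (\<alpha> * p)) * (\<integral>\<^sup>+z\<in>unit_disk. ennreal (?Q z) \<partial>lborel)"
    proof -
      have contG: "continuous_on unit_disk (\<lambda>z. F (?\<sigma> z) * (cmod (deriv ?\<sigma> z))\<^sup>2)"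
        using disk_aut_image[OF a] holomorphic_disk_aut[OF a]
        by (intro continuous_intros continuous_on_compose2[OF contF ca] holomorphic_on_imp_continuous_on holomorphic_deriv) auto
      have contQ: "continuous_on unit_disk ?Q"
        using p_pos disk_weight_nonneg disk_aut_image[OF a] norm_disk_aut_less_1[OF a]
        by (intro continuous_on_mult continuous_on_radial_powr continuous_on_powr' continuous_on_const
            continuous_on_compose2[OF continuous_on_disk_weight[OF H b] ca]) (auto simp: less_imp_le)
      have pwF: "c * (F (?\<sigma> z) * (cmod (deriv ?\<sigma> z))\<^sup>2) \<le> 4 powr (\<alpha> * p) * ?Q z" if z: "cmod z < 1" for z
      proof -
        define x where "x = 1 - (cmod z)\<^sup>2"
        define y where "y = 1 - (cmod (?\<sigma> z))\<^sup>2"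
        define A where "A = 1 - (cmod a)\<^sup>2"
        define q where "q = s - p + 2"
        have pos: "0 < x" "0 < y" "0 < A" using one_minus_norm_sq_pos norm_disk_aut_less_1[OF a z] z a by (auto simp: x_def y_def A_def)
        have dy: "cmod (deriv ?\<sigma> z) = y / x" using norm_deriv_disk_aut'[OF a z] by (simp add: x_def y_def)
        have "(cmod (1 - cnj a * z))\<^sup>2 \<le> 2\<^sup>2" using norm_one_minus_cnj_mult_le[of a z] a z by (intro power_mono) auto
        \<comment> \<open>By the formula for 1 - |sigma_a z|^2 the quotient equals |1 - cnj a * z|^2
          / (1 - |z|^2), and the numerator is at most 4.\<close>
        then have Ay: "A / y \<le> 4 / x"
          using pos one_minus_cnj_mult_neq_0[of a z] a z
          unfolding y_def one_minus_norm_disk_aut[OF a z] A_def[symmetric] x_def[symmetric]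
          by (simp add: divide_right_mono)
        have "F (?\<sigma> z) * (y / x)\<^sup>2 = y powr (- \<alpha> * p - 2) * ?L (?\<sigma> z) powr p * x powr q * (y / x)\<^sup>2"
          by (simp add: F_def y_def x_def q_def disk_aut_disk_aut[OF a z])
        also have "\<dots> = (y powr (- \<alpha> * p - 2) * y powr 2) * ?L (?\<sigma> z) powr p * (x powr q / x powr 2)"
          using pos by (simp add: power_divide)
        also have "\<dots> = y powr (- \<alpha> * p) * ?L (?\<sigma> z) powr p * x powr (q - 2)"
          by (simp only: powr_add[symmetric] powr_diff[symmetric]) simp
        finally have e: "F (?\<sigma> z) * (y / x)\<^sup>2 = y powr (- \<alpha> * p) * ?L (?\<sigma> z) powr p * x powr (q - 2)" .
        have "c * (F (?\<sigma> z) * (cmod (deriv ?\<sigma> z))\<^sup>2) = (A / y) powr (\<alpha> * p) * (?L (?\<sigma> z) powr p * x powr (q - 2))"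
          unfolding dy e c_def A_def[symmetric] by (simp add: powr_divide powr_minus_divide)
        also have "\<dots> \<le> (4 / x) powr (\<alpha> * p) * (?L (?\<sigma> z) powr p * x powr (q - 2))"
          using Ay pos alpha_pos p_pos by (intro mult_right_mono powr_mono2) auto
        also have "\<dots> = 4 powr (\<alpha> * p) * (x powr (q - 2) / x powr (\<alpha> * p) * ?L (?\<sigma> z) powr p)"
          by (simp add: powr_divide)
        also have "x powr (q - 2) / x powr (\<alpha> * p) = x powr (s - p + 2 - \<alpha> * p - 2)"
          by (simp add: powr_diff[symmetric] q_def algebra_simps)
        finally show ?thesis by (simp add: x_def)
      qed
      have "ennreal c * (\<integral>\<^sup>+w\<in>unit_disk. ennreal (F w) \<partial>lborel) = ennreal c * (\<integral>\<^sup>+z\<in>unit_disk. ennreal (F (?\<sigma> z) * (cmod (deriv ?\<sigma> z))\<^sup>2) \<partial>lborel)"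
        using nn_integral_disk_aut[OF a contF] F0 by simp
      also have "\<dots> = (\<integral>\<^sup>+z. ennreal c * (ennreal (F (?\<sigma> z) * (cmod (deriv ?\<sigma> z))\<^sup>2) * indicator unit_disk z) \<partial>lborel)"
        using borel_measurable_indicator_ennreal[OF contG] by (simp add: nn_integral_cmult)
      also have "\<dots> \<le> (\<integral>\<^sup>+z. ennreal (4 powr (\<alpha> * p)) * (ennreal (?Q z) * indicator unit_disk z) \<partial>lborel)"
      proof (rule nn_integral_mono)
        fix z :: complex
        show "ennreal c * (ennreal (F (?\<sigma> z) * (cmod (deriv ?\<sigma> z))\<^sup>2) * indicator unit_disk z) \<le> ennreal (4 powr (\<alpha> * p)) * (ennreal (?Q z) * indicator unit_disk z)"
        proof (cases "z \<in> unit_disk")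
          case True
          have "ennreal c * ennreal (F (?\<sigma> z) * (cmod (deriv ?\<sigma> z))\<^sup>2) = ennreal (c * (F (?\<sigma> z) * (cmod (deriv ?\<sigma> z))\<^sup>2))"
            using F0 by (intro ennreal_mult[symmetric]) (auto simp: c_def)
          also have "\<dots> \<le> ennreal (4 powr (\<alpha> * p) * ?Q z)" using True by (intro ennreal_leI pwF) simp
          also have "\<dots> = ennreal (4 powr (\<alpha> * p)) * ennreal (?Q z)" by (intro ennreal_mult) auto
          finally show ?thesis using True by simp
        qed simp
      qed
      also have "\<dots> = ennreal (4 powr (\<alpha> * p)) * (\<integral>\<^sup>+z\<in>unit_disk. ennreal (?Q z) \<partial>lborel)"
        using borel_measurable_indicator_ennreal[OF contQ] by (simp add: nn_integral_cmult)
      finally show ?thesis .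
    qed
    define I1 where "I1 = (\<integral>\<^sup>+w\<in>unit_disk. ennreal (F w) \<partial>lborel)"
    define I2 where "I2 = (\<integral>\<^sup>+z\<in>unit_disk. ennreal (?Q z) \<partial>lborel)"
    note J = J[folded I1_def] and IF = IF[folded I1_def I2_def]
    have "energy g a \<le> ennreal c * (ennreal M * ennreal pi + ennreal (C powr p) * I1)"
      unfolding morrey_energy_def c_def[symmetric] by (rule mult_left_mono[OF J zero_le])
    also have "\<dots> = ennreal c * (ennreal M * ennreal pi) + ennreal (C powr p) * (ennreal c * I1)"
      by (simp only: distrib_left mult_ac)
    also have "\<dots> \<le> ennreal c * (ennreal M * ennreal pi) + ennreal (C powr p) * (ennreal (4 powr (\<alpha> * p)) * I2)"
      by (rule add_left_mono[OF mult_left_mono[OF IF zero_le]])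
    also have "\<dots> = ennreal (M * pi * c) + ennreal (C powr p * 4 powr (\<alpha> * p)) * I2"
    proof -
      have "ennreal c * (ennreal M * ennreal pi) = ennreal (M * pi * c)"
        using M(1) ennreal_mult[of M pi] ennreal_mult[of c "M * pi"] by (simp add: c_def mult.commute)
      moreover have "ennreal (C powr p) * ennreal (4 powr (\<alpha> * p)) = ennreal (C powr p * 4 powr (\<alpha> * p))"
        by (rule ennreal_mult[symmetric]) auto
      ultimately show ?thesis by (metis mult.assoc)
    qed
    finally show "energy g a \<le> ennreal (M * pi * (1 - (cmod a)\<^sup>2) powr (\<alpha> * p)) +
      ennreal (C powr p * 4 powr (\<alpha> * p)) * (\<integral>\<^sup>+z\<in>unit_disk. ennreal (?Q z) \<partial>lborel)" unfolding c_def I2_def .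
  qed
qed

lemma disk_weight_le_Bloch_quotient:
  assumes b: "cmod b \<le> 1" and w: "cmod w < 1" and P: "P w \<noteq> 0" and Gw: "G w = (cnj b * w - 1) * (w - b) * P w" "G w \<noteq> 0"
  shows "disk_weight (\<lambda>z. 1 / P z) b w \<le> (1 - (cmod w)\<^sup>2) / cmod (G w)"
proof -
  define A B where "A = cmod (1 - cnj b * w)" and "B = cmod (w - b)"
  have A: "0 < A" using one_minus_cnj_mult_neq_0[OF b w] by (simp add: A_def)
  have B: "0 < B" "B \<le> A" using Gw norm_diff_le_norm_one_minus_cnj_mult[OF b, of w] w by (auto simp: A_def B_def)
  have G: "cmod (G w) = A * B * cmod (P w)" by (simp add: Gw(1) norm_mult A_def B_def norm_minus_commute)
  have "disk_weight (\<lambda>z. 1 / P z) b w = (1 - (cmod w)\<^sup>2) / (A * A * cmod (P w))"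
    by (simp add: disk_weight_def norm_divide A_def power2_eq_square)
  also have "\<dots> \<le> (1 - (cmod w)\<^sup>2) / (A * B * cmod (P w))"
    using A B P one_minus_norm_sq_pos[OF w] by (intro divide_left_mono mult_right_mono mult_left_mono) auto
  finally show ?thesis by (simp only: G)
qed

text \<open>The derivative of the average is (f o \<phi> T - f) / (T * G). Its numerator grows at
  most like (1 - |w|^2)^(-\<alpha>), and near the circle Berkson--Porta bounds 1/|G| by a multiple
  of \<open>disk_weight H b w\<close> divided by 1 - |w|^2, where H = 1/P again has nonnegative real
  part.\<close>

lemma orbit_average_in_little_m_space:
  assumes Bloch: "vanishing_Bloch_condition G" and f: "f \<in> M_space \<alpha> p s" and T: "0 < T"
  shows "(\<lambda>z. of_real (1 / T) * orbit_integral f T z) \<in> little_m_space \<alpha> p s"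
  unfolding mem_little_m_space_iff
proof (intro conjI orbit_average_in_M_space f T allI impI)
  fix e :: real assume e: "0 < e"
  obtain b P where bP: "cmod b \<le> 1" "P holomorphic_on unit_disk" "\<And>z. cmod z < 1 \<Longrightarrow> 0 \<le> Re (P z)"
    "\<And>z. cmod z < 1 \<Longrightarrow> P z \<noteq> 0" "\<And>z. cmod z < 1 \<Longrightarrow> G z = (cnj b * z - 1) * (z - b) * P z"
    using Berkson_Porta by blast
  define H where "H = (\<lambda>z. 1 / P z)"
  have H: "H holomorphic_on unit_disk" "\<And>z. cmod z < 1 \<Longrightarrow> 0 \<le> Re (H z)" "\<And>z. cmod z < 1 \<Longrightarrow> H z \<noteq> 0"
    unfolding H_def using bP(2-4) by (auto intro!: holomorphic_intros divide_nonneg_nonneg simp: Re_divide)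
  have van: "\<exists>r<1. \<forall>w. r < cmod w \<and> cmod w < 1 \<longrightarrow> disk_weight H b w \<le> \<epsilon>" if eps: "0 < \<epsilon>" for \<epsilon>
  proof -
    obtain r where r: "r < 1" "\<And>w. r < cmod w \<Longrightarrow> cmod w < 1 \<Longrightarrow> G w \<noteq> 0 \<and> (1 - (cmod w)\<^sup>2) / cmod (G w) \<le> \<epsilon>"
      using vanishing_Bloch_conditionD[OF Bloch eps] by blast
    have "disk_weight H b w \<le> \<epsilon>" if "r < cmod w" "cmod w < 1" for w
      using disk_weight_le_Bloch_quotient[of b w P, OF bP(1) that(2) bP(4)[OF that(2)] bP(5)[OF that(2)]] r(2)[OF that]
      unfolding H_def by linarith
    then show ?thesis using r(1) by blast
  qed
  obtain r1 where r1: "r1 < 1" "\<And>w. r1 < cmod w \<and> cmod w < 1 \<Longrightarrow> disk_weight H b w \<le> 1" using van[of 1] by auto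
  have "compact (disk_weight H b ` cball 0 (max r1 0))"
    using r1 by (intro compact_continuous_image continuous_on_subset[OF continuous_on_disk_weight[OF H(1) bP(1)]]) auto
  then have "bounded (disk_weight H b ` cball 0 (max r1 0))" by (rule compact_imp_bounded)
  then obtain N1 where "\<forall>x\<in>disk_weight H b ` cball 0 (max r1 0). norm x \<le> N1" unfolding bounded_iff by blast
  then have N1: "disk_weight H b w \<le> N1" if "w \<in> cball 0 (max r1 0)" for w
    using that by (fastforce dest: abs_le_D1)
  have N: "disk_weight H b w \<le> max N1 1" if "cmod w < 1" for w
    using N1 r1(2)[of w] that by (cases "r1 < cmod w") (auto simp: le_max_iff_disj)
  obtain R0 k where R0: "0 \<le> R0" "R0 < 1" "0 < k" "\<And>w. R0 < cmod w \<Longrightarrow> cmod w < 1 \<Longrightarrow> k * cmod (1 - cnj b * w) \<le> cmod (w - b)"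
    using norm_one_minus_cnj_mult_le_norm_diff[OF bP(1)] by blast
  have hol: "f holomorphic_on unit_disk" using f by (simp add: mem_M_space_iff)
  obtain C1 where C1: "0 \<le> C1" "\<And>w. cmod w < 1 \<Longrightarrow> cmod (f (\<phi> T w) - f w) \<le> C1 * (1 - (cmod w)\<^sup>2) powr (- \<alpha>)"
    using norm_M_space_le[OF M_space_diff_compose[OF f less_imp_le[OF T]]] by blast
  let ?g = "\<lambda>z. of_real (1 / T) * orbit_integral f T z"
  define C where "C = C1 / (T * k)"
  have C: "0 \<le> C" using C1 T R0 by (simp add: C_def)
  have holg: "?g holomorphic_on unit_disk" by (intro holomorphic_intros holomorphic_orbit_integral hol)
  have le: "cmod (deriv ?g w) \<le> C * (1 - (cmod w)\<^sup>2) powr (- \<alpha> - 1) * disk_weight H b w" if w: "R0 < cmod w" "cmod w < 1" for w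
  proof -
    define A where "A = cmod (1 - cnj b * w)"
    define B where "B = cmod (w - b)"
    define x where "x = 1 - (cmod w)\<^sup>2"
    have x: "0 < x" using one_minus_norm_sq_pos[OF w(2)] by (simp add: x_def)
    have A: "0 < A" using one_minus_cnj_mult_neq_0[OF bP(1) w(2)] by (simp add: A_def)
    have B: "k * A \<le> B" unfolding A_def B_def by (rule R0(4)[OF w])
    then have B0: "0 < B" using A R0(3) by (metis less_le_trans mult_pos_pos)
    have G: "cmod (G w) = A * B * cmod (P w)" by (simp add: bP(5)[OF w(2)] norm_mult A_def B_def norm_minus_commute)
    have Pw: "0 < cmod (P w)" using bP(4)[OF w(2)] by simp
    have "deriv ?g w = of_real (1 / T) * deriv (orbit_integral f T) w"
      using holomorphic_on_imp_differentiable_at[OF holomorphic_orbit_integral[OF hol], of w T] w(2)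
      by (intro deriv_cmult) auto
    moreover have "G w \<noteq> 0" using A B0 Pw G by auto
    then have "deriv (orbit_integral f T) w = (f (\<phi> T w) - f w) / G w"
      using generator_deriv_orbit_integral[OF hol w(2) T] by (simp add: field_simps)
    ultimately have "cmod (deriv ?g w) = cmod (f (\<phi> T w) - f w) / (T * (A * B * cmod (P w)))"
      using T by (simp add: norm_mult norm_divide G)
    also have "\<dots> \<le> (C1 * x powr (- \<alpha>)) / (T * (A * (k * A) * cmod (P w)))"
      using C1(2)[OF w(2)] C1(1) T A B R0(3) Pw
      by (intro frac_le mult_left_mono mult_right_mono) (auto simp: x_def)
    also have "\<dots> = C * (x powr (- \<alpha>) / x powr 1) * disk_weight H b w"
    proof -
      have "disk_weight H b w = x / (cmod (P w) * (A * A))"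
        unfolding disk_weight_def H_def A_def x_def by (simp add: norm_divide power2_eq_square)
      then show ?thesis using x A R0(3) T Pw by (simp add: C_def)
    qed
    also have "x powr (- \<alpha>) / x powr 1 = x powr (- \<alpha> - 1)" by (rule powr_diff[symmetric])
    finally show ?thesis by (simp add: x_def)
  qed
  obtain M where M: "0 \<le> M" "\<And>a. cmod a < 1 \<Longrightarrow> energy ?g a \<le> ennreal (M * (1 - (cmod a)\<^sup>2) powr (\<alpha> * p)) +
    ennreal (C powr p * 4 powr (\<alpha> * p)) * (\<integral>\<^sup>+z\<in>unit_disk. ennreal ((1 - (cmod z)\<^sup>2) powr (s - p + 2 - \<alpha> * p - 2) * disk_weight H b (disk_aut a z) powr p) \<partial>lborel)"
    using energy_le_disk_weight_integral[OF holg H(1) bP(1) R0(1,2) C le] by blast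
  define K where "K = C powr p * 4 powr (\<alpha> * p)"
  have K: "0 \<le> K" by (simp add: K_def)
  have e2: "0 < e / (2 * (K + 1))" using e K by simp
  have kap: "0 < s - p + 2 - \<alpha> * p" and p1: "1 \<le> p" using alpha_less p_gt_1 by auto
  obtain r2 where r2: "r2 < 1" "\<And>a. r2 < cmod a \<Longrightarrow> cmod a < 1 \<Longrightarrow>
    (\<integral>\<^sup>+z\<in>unit_disk. ennreal ((1 - (cmod z)\<^sup>2) powr (s - p + 2 - \<alpha> * p - 2) * disk_weight H b (disk_aut a z) powr p) \<partial>lborel) \<le> ennreal (e / (2 * (K + 1)))"
    by (rule nn_integral_disk_weight_vanishes[OF H bP(1) N van kap p1 e2]) blast+
  have "0 < \<alpha> * p" "0 < e / (2 * (M + 1))" using alpha_pos p_pos e M by auto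
  then obtain r3 where r3: "r3 < 1" "\<And>x. r3 \<le> x \<Longrightarrow> x < 1 \<Longrightarrow> (1 - x\<^sup>2) powr (\<alpha> * p) < e / (2 * (M + 1))"
    using exists_radius_one_minus_powr_less by metis
  show "\<exists>r<1. \<forall>a. r < cmod a \<and> cmod a < 1 \<longrightarrow> energy ?g a \<le> ennreal e"
  proof (intro exI[of _ "max r2 r3"] conjI allI impI)
    show "max r2 r3 < 1" using r2 r3 by simp
    fix a :: complex assume a: "max r2 r3 < cmod a \<and> cmod a < 1"
    define I where "I = (\<integral>\<^sup>+z\<in>unit_disk. ennreal ((1 - (cmod z)\<^sup>2) powr (s - p + 2 - \<alpha> * p - 2) * disk_weight H b (disk_aut a z) powr p) \<partial>lborel)"
    have I: "I \<le> ennreal (e / (2 * (K + 1)))" unfolding I_def using r2(2)[of a] a by simp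
    have "M * (1 - (cmod a)\<^sup>2) powr (\<alpha> * p) \<le> M * (e / (2 * (M + 1)))"
      using r3(2)[of "cmod a"] a M(1) by (intro mult_left_mono) auto
    also have "\<dots> \<le> e / 2" using M(1) e by (simp add: field_simps)
    finally have 1: "ennreal (M * (1 - (cmod a)\<^sup>2) powr (\<alpha> * p)) \<le> ennreal (e / 2)" by (rule ennreal_leI)
    have "ennreal K * I \<le> ennreal K * ennreal (e / (2 * (K + 1)))" by (rule mult_left_mono[OF I zero_le])
    also have "\<dots> = ennreal (K * (e / (2 * (K + 1))))" using K e by (intro ennreal_mult[symmetric]) auto
    also have "\<dots> \<le> ennreal (e / 2)" using K e by (intro ennreal_leI) (simp add: field_simps)
    finally have 2: "ennreal K * I \<le> ennreal (e / 2)" .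
    have "energy ?g a \<le> ennreal (M * (1 - (cmod a)\<^sup>2) powr (\<alpha> * p)) + ennreal K * I"
      unfolding K_def I_def using M(2) a by blast
    also have "\<dots> \<le> ennreal (e / 2) + ennreal (e / 2)" by (rule add_mono[OF 1 2])
    also have "\<dots> = ennreal e" using e by (simp add: ennreal_plus[symmetric] del: ennreal_plus)
    finally show "energy ?g a \<le> ennreal e" .
  qed
qed

lemma strong_cont_part_subset_little_m_space:
  assumes "vanishing_Bloch_condition G"
  shows "strong_cont_part \<phi> (M_space \<alpha> p s) (M_norm \<alpha> p s) \<subseteq> little_m_space \<alpha> p s"
proof
  fix f assume f: "f \<in> strong_cont_part \<phi> (M_space \<alpha> p s) (M_norm \<alpha> p s)"
  then have fM: "f \<in> M_space \<alpha> p s" by (simp add: strong_cont_part_def)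
  then have hol: "f holomorphic_on unit_disk" by (simp add: mem_M_space_iff)
  show "f \<in> little_m_space \<alpha> p s"
    unfolding mem_little_m_space_iff
  proof (intro conjI fM allI impI)
    fix e :: real assume e: "0 < e"
    define e' where "e' = e / (2 * 2 powr p)"
    have e': "0 < e'" "2 powr p * (e' + e') = e" using e by (auto simp: e'_def)
    obtain T where T: "0 < T" "\<And>a. cmod a < 1 \<Longrightarrow> energy (\<lambda>z. of_real (1 / T) * orbit_integral f T z - f z) a \<le> ennreal e'"
      using orbit_average_approximates[OF f e'(1)] by blast
    let ?g = "\<lambda>z. of_real (1 / T) * orbit_integral f T z"
    have holg: "?g holomorphic_on unit_disk" by (intro holomorphic_intros holomorphic_orbit_integral hol)
    have "?g \<in> little_m_space \<alpha> p s" by (rule orbit_average_in_little_m_space[OF assms fM T(1)])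
    then obtain r where r: "r < 1" "\<And>a. r < cmod a \<and> cmod a < 1 \<Longrightarrow> energy ?g a \<le> ennreal e'"
      using e'(1) unfolding mem_little_m_space_iff by meson
    show "\<exists>r<1. \<forall>a. r < cmod a \<and> cmod a < 1 \<longrightarrow> energy f a \<le> ennreal e"
    proof (intro exI[of _ r] conjI r(1) allI impI)
      fix a :: complex assume a: "r < cmod a \<and> cmod a < 1"
      have "energy f a = energy (\<lambda>z. ?g z - (?g z - f z)) a" by simp
      also have "\<dots> \<le> ennreal (2 powr p) * (energy ?g a + energy (\<lambda>z. ?g z - f z) a)"
        using a by (intro morrey_energy_diff_le holg holomorphic_on_diff hol p_pos) auto
      also have "\<dots> \<le> ennreal (2 powr p) * (ennreal e' + ennreal e')"
        using a by (intro mult_left_mono add_mono r(2) T(2)) auto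
      also have "\<dots> = ennreal (2 powr p * (e' + e'))"
        using e'(1) by (simp add: ennreal_mult[symmetric] ennreal_plus[symmetric] del: ennreal_plus)
      also have "\<dots> = ennreal e" unfolding e'(2) ..
      finally show "energy f a \<le> ennreal e" .
    qed
  qed
qed

end

subsection \<open>Necessity of the vanishing Bloch condition\<close>

text \<open>With X = |sigma_d'| one has X * (1 - |z|^2) \<le> 1, so X^(e * p) * (1 - |z|^2)^s is at
  most 1 + X^2 as long as e * p \<le> s + 2. The integral of X^2 is the area of the disk for every
  d, which makes the bound uniform.\<close>

lemma dirichlet_energy_le_powr_deriv_disk_aut:
  assumes d: "cmod d < 1" and p: "0 < p" and s: "0 \<le> s" and e: "0 \<le> e" "e * p \<le> s + 2" and L: "0 \<le> L"
    and g: "\<And>z. cmod z < 1 \<Longrightarrow> cmod (deriv g z) \<le> L * cmod (deriv (disk_aut d) z) powr e"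
  shows "dirichlet_energy p s g \<le> ennreal (L powr p * (2 * pi))"
proof -
  define X where "X = (\<lambda>z. cmod (deriv (disk_aut d) z))"
  have pw: "cmod (deriv g z) powr p * (1 - (cmod z)\<^sup>2) powr s \<le> L powr p * (1 + (X z)\<^sup>2)" if z: "cmod z < 1" for z
  proof -
    define u where "u = 1 - (cmod z)\<^sup>2"
    have u: "0 < u" "u \<le> 1" using one_minus_norm_sq_pos[OF z] by (auto simp: u_def)
    have X0: "0 < X z"
      using one_minus_norm_sq_pos[OF d] one_minus_cnj_mult_neq_0[of d z] d z by (simp add: X_def norm_deriv_disk_aut)
    have "X z * u \<le> 1" using u by (simp add: X_def norm_deriv_disk_aut'[OF d z] u_def)
    then have ux: "u \<le> 1 / X z" using X0 by (simp add: field_simps)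
    have "X z powr (e * p) * u powr s \<le> 1 + (X z)\<^sup>2"
    proof (cases "X z \<le> 1")
      case True
      then have "X z powr (e * p) * u powr s \<le> 1 * 1"
        using u X0 e p s by (intro mult_mono powr_le1) auto
      also have "\<dots> \<le> 1 + (X z)\<^sup>2" by simp
      finally show ?thesis .
    next
      case False
      have "X z powr (e * p) * u powr s \<le> X z powr (e * p) * (1 / X z) powr s"
        using u ux s by (intro mult_left_mono powr_mono2) auto
      also have "\<dots> = X z powr (e * p - s)" using X0 by (simp add: powr_divide powr_diff)
      also have "\<dots> \<le> X z powr 2" using False e by (intro powr_mono) auto
      also have "\<dots> \<le> 1 + (X z)\<^sup>2" using X0 by simp
      finally show ?thesis .
    qed
    moreover have "cmod (deriv g z) powr p \<le> (L * X z powr e) powr p"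
      using g[OF z] p by (intro powr_mono2) (auto simp: X_def)
    then have "cmod (deriv g z) powr p * u powr s \<le> (L powr p * X z powr (e * p)) * u powr s"
      using L X0 by (intro mult_right_mono) (auto simp: powr_mult powr_powr)
    moreover have "L powr p * (X z powr (e * p) * u powr s) \<le> L powr p * (1 + (X z)\<^sup>2)"
      using calculation(1) by (intro mult_left_mono) auto
    ultimately show ?thesis by (simp add: u_def mult.assoc)
  qed
  have pi: "(\<integral>\<^sup>+z\<in>unit_disk. 1 \<partial>(lborel :: complex measure)) = ennreal pi"
    by (simp add: emeasure_ball unit_ball_vol_2)
  have X2: "(\<integral>\<^sup>+z\<in>unit_disk. ennreal ((X z)\<^sup>2) \<partial>lborel) = ennreal pi"
    using nn_integral_disk_aut[OF d, of "\<lambda>_. 1"] pi by (simp add: X_def)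
  have contX: "continuous_on unit_disk (\<lambda>z. (X z)\<^sup>2)"
    unfolding X_def by (intro continuous_intros holomorphic_on_imp_continuous_on holomorphic_deriv holomorphic_disk_aut d) auto
  have "dirichlet_energy p s g \<le> (\<integral>\<^sup>+z\<in>unit_disk. ennreal (L powr p * (1 + (X z)\<^sup>2)) \<partial>lborel)"
    unfolding dirichlet_energy_def by (intro nn_integral_disk_mono ennreal_leI pw)
  also have "\<dots> = (\<integral>\<^sup>+z. ennreal (L powr p) * (1 * indicator unit_disk z + ennreal ((X z)\<^sup>2) * indicator unit_disk z) \<partial>lborel)"
    by (intro nn_integral_cong) (auto simp: indicator_def ennreal_mult ennreal_plus)
  also have "\<dots> = ennreal (L powr p) * (ennreal pi + ennreal pi)"
    using nn_integral_indicator_plus_cmult[OF borel_measurable_indicator_ennreal[OF contX], of "ennreal (L powr p)" "ennreal (L powr p)"] X2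
    by (simp add: distrib_left)
  also have "\<dots> = ennreal (L powr p * (2 * pi))"
    by (simp add: ennreal_mult[symmetric] ennreal_plus[symmetric] del: ennreal_plus)
  finally show ?thesis .
qed

text \<open>A kernel-type function with its hump at b. For \<mu> = m - \<alpha> its derivative at b,
  multiplied by (1 - |b|^2) powr (1 + \<alpha>), has modulus m * |b|, while the function tends to 0
  on compact sets as |b| tends to 1 if m > \<alpha>.\<close>

definition peak :: "real \<Rightarrow> nat \<Rightarrow> complex \<Rightarrow> complex \<Rightarrow> complex" where
  "peak \<mu> m b z = of_real ((1 - (cmod b)\<^sup>2) powr \<mu>) / (1 - cnj b * z) ^ m"

lemma has_field_derivative_peak:
  assumes "cmod b \<le> 1" "cmod z < 1"
  shows "(peak \<mu> m b has_field_derivative of_nat m * cnj b * of_real ((1 - (cmod b)\<^sup>2) powr \<mu>) / (1 - cnj b * z) ^ Suc m) (at z)"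
proof -
  have nz: "1 - cnj b * z \<noteq> 0" by (rule one_minus_cnj_mult_neq_0[OF assms])
  have *: "((\<lambda>z. c / (1 - cnj b * z) ^ m) has_field_derivative of_nat m * cnj b * c / (1 - cnj b * z) ^ Suc m) (at z)" for c :: complex
  proof (cases m)
    case (Suc k)
    have "((\<lambda>z. c / (1 - cnj b * z) ^ m) has_field_derivative
        - (c * (of_nat m * (1 - cnj b * z) ^ (m - 1) * (- cnj b))) / ((1 - cnj b * z) ^ m * (1 - cnj b * z) ^ m)) (at z)"
      by (rule derivative_eq_intros refl | use nz in simp)+
    moreover have "- (c * (of_nat (Suc k) * Y ^ k * - \<beta>)) / (Y ^ Suc k * Y ^ Suc k) = of_nat (Suc k) * \<beta> * c / Y ^ Suc (Suc k)"
      if "Y \<noteq> 0" for Y \<beta> :: complex using that by (simp add: field_simps)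
    ultimately show ?thesis using nz Suc by (simp add: mult.commute)
  qed simp
  show ?thesis using *[of "of_real ((1 - (cmod b)\<^sup>2) powr \<mu>)"] unfolding peak_def[abs_def] .
qed

lemma holomorphic_peak: "cmod b \<le> 1 \<Longrightarrow> peak \<mu> m b holomorphic_on unit_disk"
  using has_field_derivative_peak by (fastforce simp: holomorphic_on_open)

lemma norm_deriv_peak:
  assumes "cmod b < 1" "cmod z < 1"
  shows "cmod (deriv (peak \<mu> m b) z) = real m * cmod b * (1 - (cmod b)\<^sup>2) powr \<mu> / cmod (1 - cnj b * z) ^ Suc m"
  using DERIV_imp_deriv[OF has_field_derivative_peak[of b z \<mu> m]] assms
  by (simp add: norm_mult norm_divide norm_power)

lemma norm_peak_le:
  assumes "cmod b < 1" "cmod z < 1"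
  shows "cmod (peak \<mu> m b z) \<le> (1 - (cmod b)\<^sup>2) powr \<mu> / (1 - cmod z) ^ m"
proof -
  have "cmod (peak \<mu> m b z) = (1 - (cmod b)\<^sup>2) powr \<mu> / cmod (1 - cnj b * z) ^ m"
    by (simp add: peak_def norm_divide norm_power)
  also have "\<dots> \<le> (1 - (cmod b)\<^sup>2) powr \<mu> / (1 - cmod z) ^ m"
    using norm_one_minus_cnj_mult_ge[of b z] assms by (intro divide_left_mono power_mono mult_pos_pos zero_less_power) auto
  finally show ?thesis .
qed

text \<open>Since 1 - cnj b * sigma_b z = (1 - |b|^2) / (1 - cnj b * z), the peak is a polynomial
  composed with an automorphism, a form in which energies can be transformed.\<close>

lemma peak_eq_compose_disk_aut:
  assumes b: "cmod b < 1" and z: "cmod z < 1"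
  shows "peak (real m - \<alpha>) m b z = of_real ((1 - (cmod b)\<^sup>2) powr (- \<alpha>)) * (1 - cnj b * disk_aut b z) ^ m"
proof -
  define B where "B = 1 - (cmod b)\<^sup>2"
  have B: "0 < B" using one_minus_norm_sq_pos[OF b] by (simp add: B_def)
  have nz: "1 - cnj b * z \<noteq> 0" using one_minus_cnj_mult_neq_0[of b z] b z by simp
  have "b * cnj b = of_real ((cmod b)\<^sup>2)" by (simp add: complex_norm_square[symmetric])
  then have "(1 - cnj b * z) - cnj b * (b - z) = of_real B"
    by (simp add: B_def algebra_simps)
  then have "1 - cnj b * disk_aut b z = of_real B / (1 - cnj b * z)"
    using nz by (simp add: disk_aut_def field_simps)
  moreover have "B powr (real m - \<alpha>) = B powr (- \<alpha>) * B ^ m"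
    using B by (simp add: powr_diff powr_minus powr_realpow field_simps)
  ultimately show ?thesis
    by (simp add: peak_def B_def[symmetric] power_divide)
qed

section \<open>Energy estimates for peak functions\<close>

context morrey_params
begin

text \<open>The chain rule bounds the derivative by L * |sigma_a'|, so the Dirichlet energy is
  bounded independently of a and the outer weight gives the decay.\<close>

lemma energy_bounded_deriv_le:
  assumes f: "f holomorphic_on unit_disk" and L: "0 \<le> L" "\<And>z. cmod z < 1 \<Longrightarrow> cmod (deriv f z) \<le> L" and a: "cmod a < 1"
  shows "energy f a \<le> ennreal ((1 - (cmod a)\<^sup>2) powr (\<alpha> * p) * (L powr p * (2 * pi)))"
proof -
  have "dirichlet_energy p s (\<lambda>z. f (disk_aut a z)) \<le> ennreal (L powr p * (2 * pi))"
  proof (rule dirichlet_energy_le_powr_deriv_disk_aut[OF a p_pos s_nonneg, of 1])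
    fix z assume z: "cmod z < 1"
    have "deriv (\<lambda>z. f (disk_aut a z)) z = deriv f (disk_aut a z) * deriv (disk_aut a) z"
      using deriv_chain[of "disk_aut a" z f] has_field_derivative_disk_aut[OF a z]
        holomorphic_on_imp_differentiable_at[OF f, of "disk_aut a z"] norm_disk_aut_less_1[OF a z]
      by (auto simp: comp_def field_differentiable_def)
    then show "cmod (deriv (\<lambda>z. f (disk_aut a z)) z) \<le> L * cmod (deriv (disk_aut a) z) powr 1"
      using L(2)[OF norm_disk_aut_less_1[OF a z]] by (simp add: norm_mult mult_right_mono)
  qed (use p_less_s L in auto)
  then have "energy f a \<le> ennreal ((1 - (cmod a)\<^sup>2) powr (\<alpha> * p)) * ennreal (L powr p * (2 * pi))"
    unfolding morrey_energy_def by (rule mult_left_mono) simp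
  then show ?thesis by (simp add: ennreal_mult)
qed

text \<open>With \<open>d = \<sigma>\<^sub>b a\<close> and \<open>F z = (1 - cnj b * z) ^ m\<close> the energy at \<open>a\<close> becomes an energy of \<open>F \<circ> \<sigma>\<^sub>d\<close>, and the powers of
  \<open>|1 - cnj b * d|\<close> cancel, which leaves a bound independent of \<open>b\<close>.\<close>

lemma energy_peak_le:
  assumes m: "1 + 2 * \<alpha> \<le> real m"
  obtains C where "0 \<le> C" "\<And>a b. cmod a < 1 \<Longrightarrow> cmod b < 1 \<Longrightarrow> energy (peak (real m - \<alpha>) m b) a \<le> ennreal C"
proof -
  define L0 where "L0 = real m * 2 powr (real m - 1)"
  have m1: "1 \<le> m" using m alpha_pos by (cases m) auto
  have "energy (peak (real m - \<alpha>) m b) a \<le> ennreal (L0 powr p * (2 * pi))" if a: "cmod a < 1" and b: "cmod b < 1" for a b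
  proof -
    define d where "d = disk_aut b a"
    have d: "cmod d < 1" unfolding d_def by (rule norm_disk_aut_less_1[OF b a])
    have bd: "disk_aut b d = a" unfolding d_def by (rule disk_aut_disk_aut[OF b a])
    define A B D E where "A = 1 - (cmod a)\<^sup>2" and "B = 1 - (cmod b)\<^sup>2" and "D = 1 - (cmod d)\<^sup>2" and "E = cmod (1 - cnj b * d)"
    have pos: "0 < A" "0 < B" "0 < D" using one_minus_norm_sq_pos a b d by (auto simp: A_def B_def D_def)
    have E: "0 < E" using one_minus_cnj_mult_neq_0[of b d] b d by (simp add: E_def)
    have AB: "A = B * D / E\<^sup>2" unfolding A_def B_def D_def E_def bd[symmetric] by (rule one_minus_norm_disk_aut[OF b d])
    define F where "F = (\<lambda>w. (1 - cnj b * w) ^ m)"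
    have F: "F holomorphic_on unit_disk" unfolding F_def by (intro holomorphic_intros)
    have dF: "deriv F w = of_nat m * (1 - cnj b * w) ^ (m - 1) * (- cnj b)" for w
      unfolding F_def by (rule DERIV_imp_deriv) (rule derivative_eq_intros refl | simp)+
    define L where "L = L0 * (E\<^sup>2 / D) powr \<alpha>"
    have J: "dirichlet_energy p s (\<lambda>z. F (disk_aut d z)) \<le> ennreal (L powr p * (2 * pi))"
    proof (rule dirichlet_energy_le_powr_deriv_disk_aut[OF d p_pos s_nonneg, of "1 + \<alpha>"])
      fix z assume z: "cmod z < 1"
      define w where "w = disk_aut d z"
      have w: "cmod w < 1" unfolding w_def by (rule norm_disk_aut_less_1[OF d z])
      define y X where "y = cmod (1 - cnj d * z)" and "X = cmod (deriv (disk_aut d) z)"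
      have y: "0 < y" using one_minus_cnj_mult_neq_0[of d z] d z by (simp add: y_def)
      have X: "X = D / y\<^sup>2" unfolding X_def D_def y_def by (rule norm_deriv_disk_aut[OF d z])
      then have X0: "0 < X" using pos y by simp
      \<comment> \<open>Writing 1 - cnj b * w over the denominator y, its numerator is 1 - cnj b * d
        minus cnj (d - b) * z, and both parts are at most E.\<close>
      have W: "cmod (1 - cnj b * w) \<le> 2 * E / y"
      proof -
        have nz: "1 - cnj d * z \<noteq> 0" using y by (auto simp: y_def)
        have "1 - cnj b * w = ((1 - cnj b * d) - cnj (d - b) * z) / (1 - cnj d * z)"
          using nz by (simp add: w_def disk_aut_def field_simps)
        then have "cmod (1 - cnj b * w) = cmod ((1 - cnj b * d) - cnj (d - b) * z) / y"
          by (simp add: norm_divide y_def)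
        also have "\<dots> \<le> (E + E * 1) / y"
        proof (intro divide_right_mono order_trans[OF norm_triangle_ineq4 add_mono])
          have "cmod (cnj (d - b) * z) = cmod (d - b) * cmod z" by (simp only: norm_mult complex_mod_cnj)
          also have "\<dots> \<le> E * 1"
            using norm_diff_le_norm_one_minus_cnj_mult[of b d] b d z by (intro mult_mono) (auto simp: E_def)
          finally show "cmod (cnj (d - b) * z) \<le> E * 1" .
        qed (use y in \<open>auto simp: E_def\<close>)
        finally show ?thesis by simp
      qed
      define W where "W = cmod (1 - cnj b * w)"
      have W0: "0 < W" "W \<le> 2" using one_minus_cnj_mult_neq_0[of b w] norm_one_minus_cnj_mult_le[of b w] b w by (auto simp: W_def)
      have "cmod (deriv F w) = real m * W ^ (m - 1) * cmod b" by (simp add: dF norm_mult norm_power W_def)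
      also have "\<dots> \<le> real m * W ^ (m - 1) * 1" using b W0 by (intro mult_left_mono) auto
      \<comment> \<open>The hypothesis on m makes the first exponent nonnegative, so W \<le> 2
        suffices for it. The other 2 * \<alpha> powers take the sharper bound 2 * E / y and produce
        |sigma_d'| powr \<alpha>.\<close>
      also have "W ^ (m - 1) = W powr (real m - 1 - 2 * \<alpha>) * W powr (2 * \<alpha>)"
        using W0 m1 by (simp add: powr_add[symmetric] powr_realpow[symmetric] of_nat_diff)
      also have "real m * (W powr (real m - 1 - 2 * \<alpha>) * W powr (2 * \<alpha>)) * 1
        \<le> real m * (2 powr (real m - 1 - 2 * \<alpha>) * (2 * E / y) powr (2 * \<alpha>)) * 1"
        using W0 W m alpha_pos by (intro mult_right_mono mult_left_mono mult_mono powr_mono2) (auto simp: W_def)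
      also have "\<dots> = L0 * (E / y) powr (2 * \<alpha>)"
      proof -
        have "2 powr (real m - 1 - 2 * \<alpha>) * 2 powr (2 * \<alpha>) = 2 powr (real m - 1)" by (simp add: powr_add[symmetric])
        moreover have "(2 * E / y) powr (2 * \<alpha>) = 2 powr (2 * \<alpha>) * (E / y) powr (2 * \<alpha>)"
          using E y by (simp add: powr_mult[symmetric])
        ultimately show ?thesis by (simp add: L0_def)
      qed
      also have "(E / y) powr (2 * \<alpha>) = (E\<^sup>2 / D) powr \<alpha> * X powr \<alpha>"
      proof -
        have "(E / y) powr (2 * \<alpha>) = ((E / y) powr 2) powr \<alpha>" by (simp add: powr_powr)
        also have "(E / y) powr 2 = (E\<^sup>2 / D) * X" using E y pos by (simp add: X power_divide)
        also have "((E\<^sup>2 / D) * X) powr \<alpha> = (E\<^sup>2 / D) powr \<alpha> * X powr \<alpha>" by (rule powr_mult)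
        finally show ?thesis .
      qed
      finally have "cmod (deriv F w) \<le> L * X powr \<alpha>" by (simp only: L_def mult.assoc)
      then have "cmod (deriv F w) * X \<le> L * X powr \<alpha> * X" using X0 by (intro mult_right_mono) auto
      also have "\<dots> = L * X powr (1 + \<alpha>)" using X0 by (simp add: powr_add mult_ac)
      finally have "cmod (deriv F w) * X \<le> L * X powr (1 + \<alpha>)" .
      moreover have "deriv (\<lambda>z. F (disk_aut d z)) z = deriv F w * deriv (disk_aut d) z"
        using deriv_chain[of "disk_aut d" z F] has_field_derivative_disk_aut[OF d z]
          holomorphic_on_imp_differentiable_at[OF F, of w] w
        by (auto simp: comp_def field_differentiable_def w_def)
      ultimately show "cmod (deriv (\<lambda>z. F (disk_aut d z)) z) \<le> L * cmod (deriv (disk_aut d) z) powr (1 + \<alpha>)"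
        by (simp add: norm_mult X_def)
    qed (use alpha_less alpha_pos in \<open>auto simp: L_def L0_def algebra_simps\<close>)
    have "energy (peak (real m - \<alpha>) m b) a = energy (\<lambda>z. of_real (B powr (- \<alpha>)) * F (disk_aut b z)) a"
      by (rule morrey_energy_cong[OF _ a]) (simp add: peak_eq_compose_disk_aut[OF b] F_def B_def)
    also have "\<dots> = ennreal ((B powr (- \<alpha>)) powr p) * energy (\<lambda>z. F (disk_aut b z)) a"
      by (subst morrey_energy_cmult[OF holomorphic_compose_disk_aut[OF b F] p_pos a]) simp
    also have "\<dots> \<le> ennreal ((B powr (- \<alpha>)) powr p) * (ennreal ((A / D) powr (\<alpha> * p)) * energy F d)"
      using energy_compose[OF disk_self_map_disk_aut[OF b] inj_on_disk_aut[OF b] F a]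
      by (intro mult_left_mono) (auto simp: A_def D_def d_def)
    also have "\<dots> \<le> ennreal ((B powr (- \<alpha>)) powr p) * (ennreal ((A / D) powr (\<alpha> * p)) * (ennreal (D powr (\<alpha> * p)) * ennreal (L powr p * (2 * pi))))"
      unfolding morrey_energy_def D_def[symmetric] by (intro mult_left_mono J) auto
    also have "\<dots> = ennreal ((B powr (- \<alpha>)) powr p * ((A / D) powr (\<alpha> * p) * (D powr (\<alpha> * p) * (L powr p * (2 * pi)))))"
      by (simp add: ennreal_mult)
    also have "(B powr (- \<alpha>)) powr p * ((A / D) powr (\<alpha> * p) * (D powr (\<alpha> * p) * (L powr p * (2 * pi)))) = L0 powr p * (2 * pi)"
    proof -
      have "L powr p = L0 powr p * (E\<^sup>2 / D) powr (\<alpha> * p)" by (simp add: L_def powr_mult powr_powr L0_def)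
      moreover have "(B powr (- \<alpha>)) powr p * ((A / D) powr (\<alpha> * p) * (D powr (\<alpha> * p) * (E\<^sup>2 / D) powr (\<alpha> * p))) = 1"
      proof -
        have "(B powr (- \<alpha>)) powr p = (1 / B) powr (\<alpha> * p)" using pos by (simp add: powr_powr powr_minus_divide powr_divide)
        then have "(B powr (- \<alpha>)) powr p * ((A / D) powr (\<alpha> * p) * (D powr (\<alpha> * p) * (E\<^sup>2 / D) powr (\<alpha> * p)))
          = (1 / B * (A / D * (D * (E\<^sup>2 / D)))) powr (\<alpha> * p)"
          using pos E by (simp only: powr_mult)
        also have "1 / B * (A / D * (D * (E\<^sup>2 / D))) = 1" using pos E by (simp add: AB)
        finally show ?thesis by simp
      qed
      moreover have "u * (v * (w * (l * x * y))) = l * y" if "u * (v * (w * x)) = 1" for u v w l x y :: real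
        using that by (metis mult.assoc mult.left_commute mult.right_neutral)
      ultimately show ?thesis by metis
    qed
    finally show ?thesis .
  qed
  then show ?thesis using that[of "L0 powr p * (2 * pi)"] by simp
qed

text \<open>For fixed b the pole of the peak lies outside the closed disk, so its derivative is
  bounded.\<close>

lemma energy_peak_vanishes_at_circle:
  assumes b: "cmod b < 1" and e: "0 < e"
  obtains r where "r < 1" "\<And>a. r < cmod a \<Longrightarrow> cmod a < 1 \<Longrightarrow> energy (peak \<mu> m b) a \<le> ennreal e"
proof -
  define L where "L = real m * cmod b * (1 - (cmod b)\<^sup>2) powr \<mu> / (1 - cmod b) ^ Suc m"
  have L: "0 \<le> L" using b by (simp add: L_def)
  have der: "cmod (deriv (peak \<mu> m b) z) \<le> L" if z: "cmod z < 1" for z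
    unfolding norm_deriv_peak[OF b z] L_def
    using norm_one_minus_cnj_mult_ge'[of z b] b z
    by (intro divide_left_mono power_mono mult_pos_pos zero_less_power mult_nonneg_nonneg) auto
  define K where "K = L powr p * (2 * pi)"
  have K: "0 \<le> K" by (simp add: K_def)
  have "0 < \<alpha> * p" "0 < e / (K + 1)" using alpha_pos p_pos e K by auto
  then obtain r where r: "0 < r" "r < 1" "\<And>x. r \<le> x \<Longrightarrow> x < 1 \<Longrightarrow> (1 - x\<^sup>2) powr (\<alpha> * p) < e / (K + 1)"
    by (rule exists_radius_one_minus_powr_less) blast+
  show ?thesis
  proof (rule that[OF r(2)])
    fix a assume a: "r < cmod a" "cmod a < 1"
    have "energy (peak \<mu> m b) a \<le> ennreal ((1 - (cmod a)\<^sup>2) powr (\<alpha> * p) * K)"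
      unfolding K_def using b by (intro energy_bounded_deriv_le holomorphic_peak L der a) auto
    also have "(1 - (cmod a)\<^sup>2) powr (\<alpha> * p) * K \<le> e / (K + 1) * K"
      using r(3)[of "cmod a"] a K by (intro mult_right_mono) auto
    also have "e / (K + 1) * K \<le> e" using K e by (simp add: field_simps)
    finally show "energy (peak \<mu> m b) a \<le> ennreal e" by (simp add: ennreal_leI)
  qed
qed

text \<open>The strict inequality \<open>alpha_less\<close> leaves room to raise the exponent of
  |sigma_b'| from 1 + \<alpha> to 1 + \<alpha> + \<eta>. This frees a factor (1 - |b|^2) powr
  \<eta>, which tends to 0 as |b| tends to 1.\<close>

lemma energy_peak_vanishes_on_compact:
  assumes m: "3 + 2 * \<alpha> \<le> real m" and R: "0 \<le> R" "R < 1" and e: "0 < e"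
  obtains r where "r < 1" "\<And>a b. cmod a \<le> R \<Longrightarrow> r < cmod b \<Longrightarrow> cmod b < 1 \<Longrightarrow> energy (peak (real m - \<alpha>) m b) a \<le> ennreal e"
proof -
  \<comment> \<open>The second entry is the room in the exponent. The cap 1 keeps m - 1 - 2 *
    \<alpha> - 2 * \<eta> nonnegative for 3 + 2 * \<alpha> \<le> m.\<close>
  define \<eta> where "\<eta> = min 1 ((s + 2 - (1 + \<alpha>) * p) / p)"
  have eta: "0 < \<eta>" "\<eta> \<le> 1" "(1 + \<alpha> + \<eta>) * p \<le> s + 2"
  proof -
    have "\<eta> * p \<le> (s + 2 - (1 + \<alpha>) * p) / p * p" unfolding \<eta>_def using p_pos by (intro mult_right_mono) auto
    also have "\<dots> = s + 2 - (1 + \<alpha>) * p" using p_pos by simp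
    finally show "(1 + \<alpha> + \<eta>) * p \<le> s + 2" by (simp add: distrib_right)
  qed (use alpha_less p_pos in \<open>auto simp: \<eta>_def algebra_simps\<close>)
  define L0 where "L0 = real m * 2 powr (real m - 1 - 2 * \<alpha> - 2 * \<eta>)"
  have L0: "0 \<le> L0" by (simp add: L0_def)
  have J: "dirichlet_energy p s (peak (real m - \<alpha>) m b) \<le> ennreal ((L0 * (1 - (cmod b)\<^sup>2) powr \<eta>) powr p * (2 * pi))"
    if b: "cmod b < 1" for b
  proof (rule dirichlet_energy_le_powr_deriv_disk_aut[OF b p_pos s_nonneg, of "1 + \<alpha> + \<eta>"])
    fix z assume z: "cmod z < 1"
    define B y where "B = 1 - (cmod b)\<^sup>2" and "y = cmod (1 - cnj b * z)"
    have B: "0 < B" using one_minus_norm_sq_pos[OF b] by (simp add: B_def)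
    have y: "0 < y" using one_minus_cnj_mult_neq_0[of b z] b z by (simp add: y_def)
    have "B = (1 - cmod b) * (1 + cmod b)" by (simp add: B_def power2_eq_square algebra_simps)
    also have "\<dots> \<le> (1 - cmod b) * 2" using b by (intro mult_left_mono) auto
    also have "\<dots> \<le> y * 2" using norm_one_minus_cnj_mult_ge'[of z b] z by (intro mult_right_mono) (auto simp: y_def)
    finally have By: "B / y \<le> 2" using y by (simp add: field_simps)
    have "cmod (deriv (peak (real m - \<alpha>) m b) z) = real m * cmod b * (B powr (real m - \<alpha>) / y ^ Suc m)"
      by (simp add: norm_deriv_peak[OF b z] B_def y_def)
    also have "\<dots> \<le> real m * 1 * (B powr (real m - \<alpha>) / y ^ Suc m)"
      using b B y by (intro mult_right_mono mult_left_mono) auto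
    also have "B powr (real m - \<alpha>) / y ^ Suc m = (B / y) powr (real m - 1 - 2 * \<alpha> - 2 * \<eta>) * B powr \<eta> * (B / y\<^sup>2) powr (1 + \<alpha> + \<eta>)"
    proof -
      have "y ^ Suc m = y powr (real m + 1)" using y by (simp add: powr_add powr_realpow)
      moreover have "(B / y\<^sup>2) powr (1 + \<alpha> + \<eta>) = B powr (1 + \<alpha> + \<eta>) / y powr (2 * (1 + \<alpha> + \<eta>))"
      proof -
        have "y\<^sup>2 powr (1 + \<alpha> + \<eta>) = y powr (2 * (1 + \<alpha> + \<eta>))"
          using y powr_powr[of y 2 "1 + \<alpha> + \<eta>"] by simp
        then show ?thesis using B y by (simp only: powr_divide)
      qed
      moreover have "(B / y) powr (real m - 1 - 2 * \<alpha> - 2 * \<eta>) = B powr (real m - 1 - 2 * \<alpha> - 2 * \<eta>) / y powr (real m - 1 - 2 * \<alpha> - 2 * \<eta>)"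
        using B y by (simp add: powr_divide)
      moreover have "B powr (real m - \<alpha>) = B powr (real m - 1 - 2 * \<alpha> - 2 * \<eta>) * B powr \<eta> * B powr (1 + \<alpha> + \<eta>)"
        using B by (simp add: powr_add[symmetric])
      moreover have "y powr (real m + 1) = y powr (real m - 1 - 2 * \<alpha> - 2 * \<eta>) * y powr (2 * (1 + \<alpha> + \<eta>))"
        using y by (simp add: powr_add[symmetric] algebra_simps)
      ultimately show ?thesis by simp
    qed
    also have "real m * 1 * ((B / y) powr (real m - 1 - 2 * \<alpha> - 2 * \<eta>) * B powr \<eta> * (B / y\<^sup>2) powr (1 + \<alpha> + \<eta>))
      \<le> real m * 1 * (2 powr (real m - 1 - 2 * \<alpha> - 2 * \<eta>) * B powr \<eta> * (B / y\<^sup>2) powr (1 + \<alpha> + \<eta>))"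
      using B y By m eta by (intro mult_left_mono mult_right_mono powr_mono2) auto
    finally show "cmod (deriv (peak (real m - \<alpha>) m b) z) \<le> L0 * (1 - (cmod b)\<^sup>2) powr \<eta> * cmod (deriv (disk_aut b) z) powr (1 + \<alpha> + \<eta>)"
      by (simp add: L0_def B_def y_def norm_deriv_disk_aut[OF b z] mult.assoc)
  qed (use eta alpha_pos L0 in auto)
  define Q where "Q = ((1 + R) / (1 - R)) powr (s - p + 2)"
  define K where "K = Q * (L0 powr p * (2 * pi))"
  have K: "0 \<le> K" by (simp add: K_def Q_def)
  have "0 < \<eta> * p" "0 < e / (K + 1)" using eta p_pos e K by auto
  then obtain r where r: "0 < r" "r < 1" "\<And>x. r \<le> x \<Longrightarrow> x < 1 \<Longrightarrow> (1 - x\<^sup>2) powr (\<eta> * p) < e / (K + 1)"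
    by (rule exists_radius_one_minus_powr_less) blast+
  show ?thesis
  proof (rule that[OF r(2)])
    fix a b assume a: "cmod a \<le> R" and b: "r < cmod b" "cmod b < 1"
    have a1: "cmod a < 1" using a R by simp
    define N where "N = (L0 * (1 - (cmod b)\<^sup>2) powr \<eta>) powr p * (2 * pi)"
    have "(1 - (cmod a)\<^sup>2) powr (\<alpha> * p) \<le> 1"
      using a1 alpha_pos p_pos by (intro powr_le1) (auto simp: abs_square_le_1)
    then have "energy (peak (real m - \<alpha>) m b) a \<le> ennreal 1 * dirichlet_energy p s (\<lambda>z. peak (real m - \<alpha>) m b (disk_aut a z))"
      unfolding morrey_energy_def by (intro mult_right_mono ennreal_leI) auto
    also have "\<dots> \<le> ennreal (((1 + cmod a) / (1 - cmod a)) powr (s - p + 2)) * dirichlet_energy p s (peak (real m - \<alpha>) m b)"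
      using dirichlet_energy_disk_aut_le[OF a1 holomorphic_peak p_pos, of b s] b p_less_s by simp
    also have "\<dots> \<le> ennreal Q * ennreal N"
    proof (rule mult_mono[OF ennreal_leI])
      show "((1 + cmod a) / (1 - cmod a)) powr (s - p + 2) \<le> Q"
        unfolding Q_def using a R p_less_s by (intro powr_mono2 frac_le) auto
    qed (use J[OF b(2)] in \<open>auto simp: N_def\<close>)
    also have "\<dots> = ennreal (Q * N)" by (simp add: Q_def N_def ennreal_mult)
    also have "Q * N = K * (1 - (cmod b)\<^sup>2) powr (\<eta> * p)"
      by (simp add: K_def N_def powr_mult powr_powr)
    also have "\<dots> \<le> K * (e / (K + 1))" using r(3)[of "cmod b"] b K by (intro mult_left_mono) auto
    also have "K * (e / (K + 1)) \<le> e" using K e by (simp add: field_simps)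
    finally show "energy (peak (real m - \<alpha>) m b) a \<le> ennreal e" by (simp add: ennreal_leI)
  qed
qed

text \<open>Peeling off the first summand each time gives constants that depend on the index j but
  not on N. They can be absorbed by making the j-th energy small, whatever the number of
  summands.\<close>

lemma energy_sum_le:
  assumes "\<And>j. f j holomorphic_on unit_disk" "cmod a < 1"
  shows "energy (\<lambda>z. \<Sum>j<N. f j z) a \<le> (\<Sum>j<N. ennreal (2 powr (p * real (Suc j))) * energy (f j) a)"
  using assms(1)
proof (induction N arbitrary: f)
  case 0
  then show ?case by (simp add: morrey_energy_def dirichlet_energy_def p_pos)
next
  case (Suc N)
  let ?g = "\<lambda>z. \<Sum>j<N. f (Suc j) z"
  have g: "?g holomorphic_on unit_disk" using Suc.prems by (intro holomorphic_intros)
  have neg: "energy (\<lambda>z. - ?g z) a = energy ?g a"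
    unfolding minus_mult_left[of 1 "\<Sum>j<N. f (Suc j) z" for z, unfolded mult_1_left]
    by (subst morrey_energy_cmult[OF g p_pos assms(2)]) simp
  have "energy (\<lambda>z. \<Sum>j<Suc N. f j z) a = energy (\<lambda>z. f 0 z - (- ?g z)) a"
    by (simp only: sum.lessThan_Suc_shift diff_minus_eq_add)
  also have "\<dots> \<le> ennreal (2 powr p) * (energy (f 0) a + energy ?g a)"
    by (rule order_trans[OF morrey_energy_diff_le[OF Suc.prems[of 0] holomorphic_on_minus[OF g] p_pos assms(2)]])
       (simp only: neg order_refl)
  also have "\<dots> \<le> ennreal (2 powr p) * (energy (f 0) a + (\<Sum>j<N. ennreal (2 powr (p * real (Suc j))) * energy (f (Suc j)) a))"
    by (rule mult_left_mono[OF add_left_mono[OF Suc.IH[OF Suc.prems]] zero_le])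
  also have "\<dots> = (\<Sum>j<Suc N. ennreal (2 powr (p * real (Suc j))) * energy (f j) a)"
  proof -
    have "ennreal (2 powr p) * ennreal (2 powr (p * real (Suc j))) = ennreal (2 powr (p * real (Suc (Suc j))))" for j
      by (simp add: ennreal_mult[symmetric] powr_add[symmetric] algebra_simps)
    then show ?thesis
      by (simp only: sum.lessThan_Suc_shift distrib_left sum_distrib_left mult.assoc[symmetric]) simp
  qed
  finally show ?case .
qed

text \<open>Energies involve only derivatives, so pointwise convergence of these and Fatou's lemma
  suffice.\<close>

lemma energy_limit_le:
  assumes g: "\<And>n. g n holomorphic_on unit_disk" and f: "f holomorphic_on unit_disk" and a: "cmod a < 1"
    and lim: "\<And>z. cmod z < 1 \<Longrightarrow> (\<lambda>n. deriv (g n) z) \<longlonglongrightarrow> deriv f z"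
    and le: "\<forall>\<^sub>F n in sequentially. energy (g n) a \<le> ennreal C"
  shows "energy f a \<le> ennreal C"
proof -
  have der: "deriv (\<lambda>z. h (disk_aut a z)) z = deriv h (disk_aut a z) * deriv (disk_aut a) z"
    if "h holomorphic_on unit_disk" "cmod z < 1" for h z
    using deriv_chain[of "disk_aut a" z h] has_field_derivative_disk_aut[OF a that(2)]
      holomorphic_on_imp_differentiable_at[OF that(1), of "disk_aut a z"] norm_disk_aut_less_1[OF a that(2)]
    by (auto simp: comp_def field_differentiable_def)
  define c where "c = (1 - (cmod a)\<^sup>2) powr (\<alpha> * p)"
  define H where "H = (\<lambda>g z. ennreal (cmod (deriv (\<lambda>z. g (disk_aut a z)) z) powr p * (1 - (cmod z)\<^sup>2) powr s) * indicator unit_disk z)"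
  have H: "(\<lambda>n. H (g n) z) \<longlonglongrightarrow> H f z" for z
  proof (cases "cmod z < 1")
    case True
    have "(\<lambda>n. cmod (deriv (g n) (disk_aut a z) * deriv (disk_aut a) z) powr p * (1 - (cmod z)\<^sup>2) powr s)
        \<longlonglongrightarrow> cmod (deriv f (disk_aut a z) * deriv (disk_aut a) z) powr p * (1 - (cmod z)\<^sup>2) powr s"
      by (rule tendsto_mult[OF tendsto_powr'[OF tendsto_norm[OF tendsto_mult[OF lim[OF norm_disk_aut_less_1[OF a True]] tendsto_const]] tendsto_const] tendsto_const])
         (use p_pos in auto)
    from tendsto_ennrealI[OF this] show ?thesis using True by (simp add: H_def der[OF g True] der[OF f True])
  qed (simp add: H_def)
  have meas: "H g \<in> borel_measurable lborel" if "g holomorphic_on unit_disk" for g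
    unfolding H_def using borel_measurable_energy_density[OF holomorphic_compose_disk_aut[OF a that] p_pos] by simp
  have en: "energy g a = (\<integral>\<^sup>+z. ennreal c * H g z \<partial>lborel)" if "g holomorphic_on unit_disk" for g
    unfolding nn_integral_cmult[OF meas[OF that]] by (simp add: morrey_energy_def dirichlet_energy_def H_def c_def)
  have "ennreal c * H f z = liminf (\<lambda>n. ennreal c * H (g n) z)" for z
    by (rule lim_imp_Liminf[symmetric, OF _ tendsto_mult_ennreal[OF tendsto_const H]]) (auto simp: H_def indicator_def)
  then have "energy f a = (\<integral>\<^sup>+z. liminf (\<lambda>n. ennreal c * H (g n) z) \<partial>lborel)" by (simp add: en[OF f])
  also have "\<dots> \<le> liminf (\<lambda>n. energy (g n) a)"
    unfolding en[OF g] using meas[OF g] by (intro nn_integral_liminf) auto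
  also have "\<dots> \<le> limsup (\<lambda>n. energy (g n) a)" by (rule Liminf_le_Limsup) simp
  also have "\<dots> \<le> ennreal C" using le by (rule Limsup_bounded)
  finally show ?thesis .
qed

end

text \<open>Harnack's inequality, for the modulus; \<open>P\<close> may be purely imaginary.\<close>

lemma norm_le_3_of_Re_nonneg:
  assumes P: "P holomorphic_on unit_disk" "\<And>z. cmod z < 1 \<Longrightarrow> 0 \<le> Re (P z)"
    and a: "cmod a < 1" and y: "cmod (y - a) \<le> (1 - cmod a) / 2"
  shows "cmod (P y) \<le> 3 * cmod (P a)"
proof (rule field_le_epsilon)
  fix \<epsilon> :: real assume eps: "0 < \<epsilon>"
  \<comment> \<open>Adding \<delta> makes the real part strictly positive. The final error is 3 *
    \<delta> + \<delta>, whence \<epsilon>/4.\<close>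
  define \<delta> \<rho> where "\<delta> = \<epsilon> / 4" and "\<rho> = 1 - cmod a"
  have pos: "0 < \<delta>" "0 < \<rho>" using eps a by (auto simp: \<delta>_def \<rho>_def)
  define X where "X = (\<lambda>\<zeta>. P (a + of_real \<rho> * \<zeta>) + of_real \<delta>)"
  have in_disk: "cmod (a + of_real \<rho> * \<zeta>) < 1" if "cmod \<zeta> < 1" for \<zeta>
  proof -
    have "cmod (a + of_real \<rho> * \<zeta>) \<le> cmod a + \<rho> * cmod \<zeta>"
      using norm_triangle_ineq[of a "of_real \<rho> * \<zeta>"] pos by (simp add: norm_mult)
    also have "\<dots> < cmod a + \<rho> * 1" using that pos by simp
    finally show ?thesis by (simp add: \<rho>_def)
  qed
  have ReX: "0 < Re (X \<zeta>)" if "cmod \<zeta> < 1" for \<zeta>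
    using P(2)[OF in_disk[OF that]] pos by (simp add: X_def)
  have "P \<circ> (\<lambda>\<zeta>. a + of_real \<rho> * \<zeta>) holomorphic_on unit_disk"
    by (rule holomorphic_on_compose_gen[OF _ P(1)]) (use in_disk in \<open>auto intro!: holomorphic_intros\<close>)
  then have holX: "X holomorphic_on unit_disk" unfolding X_def comp_def by (intro holomorphic_intros)
  define X0 where "X0 = X 0"
  have ReX0: "0 < Re X0" using ReX[of 0] by (simp add: X0_def)
  \<comment> \<open>The Cayley transform sends the right half-plane to the disk and X0 to 0. By
    Schwarz, |\<zeta>| \<le> 1/2 gives |X - X0| \<le> (|X| + |X0|) / 2, which is the factor
    3.\<close>
  define Y where "Y = (\<lambda>\<zeta>. (X \<zeta> - X0) / (X \<zeta> + cnj X0))"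
  have nz: "X \<zeta> + cnj X0 \<noteq> 0" if "cmod \<zeta> < 1" for \<zeta>
    using ReX[OF that] ReX0 by (auto simp: complex_eq_iff)
  have "cmod (Y \<zeta>) \<le> cmod \<zeta>" if "cmod \<zeta> < 1" for \<zeta>
  proof (rule Schwarz_Lemma(1)[OF _ _ _ that])
    show "Y holomorphic_on unit_disk" unfolding Y_def using holX nz by (auto intro!: holomorphic_intros)
    show "Y 0 = 0" by (simp add: Y_def X0_def)
    fix z :: complex assume z: "cmod z < 1"
    have "(cmod (X z - X0))\<^sup>2 < (cmod (X z + cnj X0))\<^sup>2"
      using mult_pos_pos[OF ReX[OF z] ReX0] unfolding cmod_power2 by (simp add: power2_eq_square algebra_simps)
    then have "cmod (X z - X0) < cmod (X z + cnj X0)" by (rule power2_less_imp_less) simp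
    then show "cmod (Y z) < 1" using nz[OF z] by (simp add: Y_def norm_divide)
  qed
  moreover define \<zeta> where "\<zeta> = (y - a) / of_real \<rho>"
  have zeta: "cmod \<zeta> \<le> 1 / 2" using y pos by (simp add: \<zeta>_def norm_divide \<rho>_def[symmetric] field_simps)
  ultimately have "cmod (Y \<zeta>) \<le> cmod \<zeta>" by simp
  then have "cmod (Y \<zeta>) \<le> 1 / 2" using zeta by linarith
  then have "cmod (X \<zeta> - X0) \<le> 1 / 2 * cmod (X \<zeta> + cnj X0)"
    using nz[of \<zeta>] zeta by (simp add: Y_def norm_divide divide_simps)
  moreover have "cmod (X \<zeta> + cnj X0) \<le> cmod (X \<zeta>) + cmod X0" using norm_triangle_ineq[of "X \<zeta>" "cnj X0"] by simp
  moreover have "cmod (X \<zeta>) \<le> cmod X0 + cmod (X \<zeta> - X0)" by (metis norm_triangle_sub)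
  ultimately have "cmod (X \<zeta>) \<le> 3 * cmod X0" by argo
  moreover have "X \<zeta> = P y + of_real \<delta>" using pos by (simp add: X_def \<zeta>_def)
  moreover have "cmod X0 \<le> cmod (P a) + \<delta>" using norm_triangle_ineq[of "P a" "of_real \<delta>"] pos by (simp add: X0_def X_def)
  moreover have "cmod (P y) \<le> cmod (P y + of_real \<delta>) + \<delta>" using norm_triangle_ineq4[of "P y + of_real \<delta>" "of_real \<delta>"] pos by simp
  ultimately show "cmod (P y) \<le> 3 * cmod (P a) + \<epsilon>" by (simp add: \<delta>_def)
qed

text \<open>The bound is uniform near each point, so Weierstrass' theorem applies. The sum of the
  derivatives is what is kept, since only it enters the energies.\<close>

lemma locally_dominated_series_deriv_sums:
  fixes f :: "nat \<Rightarrow> complex \<Rightarrow> complex" and m :: nat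
  assumes f: "\<And>j. f j holomorphic_on unit_disk" and \<epsilon>: "summable \<epsilon>" "\<And>j. 0 \<le> \<epsilon> j"
    and le: "\<And>j z. cmod z < 1 \<Longrightarrow> cmod (f j z) \<le> \<epsilon> j / (1 - cmod z) ^ m"
  obtains F where "F holomorphic_on unit_disk" "\<And>z. cmod z < 1 \<Longrightarrow> (\<lambda>j. deriv (f j) z) sums deriv F z"
proof -
  have "\<exists>d h. 0 < d \<and> summable h \<and> range h \<subseteq> \<real>\<^sub>\<ge>\<^sub>0 \<and>
      (\<forall>\<^sub>F n in sequentially. \<forall>y\<in>ball x d \<inter> unit_disk. cmod (f n y) \<le> cmod (h n))" if x: "x \<in> unit_disk" for x
  proof (intro exI conjI)
    define h where "h = (\<lambda>n. \<epsilon> n / ((1 - cmod x) / 2) ^ m)"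
    let ?d = "(1 - cmod x) / 2" and ?h = "\<lambda>n. complex_of_real (h n)"
    have d: "0 < ?d" using x by simp
    then show "0 < ?d" .
    have h: "0 \<le> h n" for n unfolding h_def using \<epsilon>(2)[of n] d by (intro divide_nonneg_pos zero_less_power)
    show "summable ?h" unfolding summable_complex_of_real h_def by (intro summable_divide \<epsilon>)
    show "range ?h \<subseteq> \<real>\<^sub>\<ge>\<^sub>0" using h by auto
    show "\<forall>\<^sub>F n in sequentially. \<forall>y\<in>ball x ?d \<inter> unit_disk. cmod (f n y) \<le> cmod (?h n)"
    proof (intro always_eventually allI ballI)
      fix n y assume y: "y \<in> ball x ?d \<inter> unit_disk"
      have "cmod y \<le> cmod x + cmod (y - x)" by (metis norm_triangle_sub)
      then have "?d \<le> 1 - cmod y" using y by (simp add: dist_norm norm_minus_commute field_simps)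
      then have "\<epsilon> n / (1 - cmod y) ^ m \<le> \<epsilon> n / ?d ^ m"
        using \<epsilon>(2)[of n] d by (intro divide_left_mono power_mono mult_pos_pos zero_less_power) auto
      then show "cmod (f n y) \<le> cmod (?h n)"
        using le[of y n] y h[of n] unfolding norm_of_real h_def[THEN fun_cong, symmetric] by simp
    qed
  qed
  moreover have "(f n has_field_derivative deriv (f n) x) (at x)" if "x \<in> unit_disk" for n x
    using f that by (intro holomorphic_derivI[of _ unit_disk]) auto
  ultimately obtain g g' where g: "\<And>x. x \<in> unit_disk \<Longrightarrow> (\<lambda>n. deriv (f n) x) sums g' x \<and> (g has_field_derivative g' x) (at x)"
    using series_and_derivative_comparison_complex[OF open_ball[of 0 1], of f "\<lambda>n. deriv (f n)"] by blast
  have "g holomorphic_on unit_disk" unfolding holomorphic_on_open[OF open_ball] using g by blast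
  moreover have "(\<lambda>j. deriv (f j) z) sums deriv g z" if "cmod z < 1" for z
    using g[of z] that by (auto simp: DERIV_imp_deriv)
  ultimately show ?thesis using that by blast
qed

section \<open>Gliding hump construction\<close>

context morrey_params
begin

text \<open>Points are chosen in disjoint annuli, each so far out that its function is small inside
  the annulus and followed by an outer radius beyond which it is small again. A point a meets at
  most one annulus, so at most one index is exceptional.\<close>

lemma gliding_hump_sequence:
  fixes f :: "complex \<Rightarrow> complex \<Rightarrow> complex" and e :: "nat \<Rightarrow> real"
  assumes Z: "\<And>r. r < 1 \<Longrightarrow> \<exists>b\<in>Z. r < cmod b \<and> cmod b < 1" and e: "\<And>n. 0 < e n"
    and circle: "\<And>b \<epsilon>. cmod b < 1 \<Longrightarrow> 0 < \<epsilon> \<Longrightarrow> \<exists>r<1. \<forall>a. r < cmod a \<and> cmod a < 1 \<longrightarrow> energy (f b) a \<le> ennreal \<epsilon>"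
    and compact: "\<And>R \<epsilon>. 0 \<le> R \<Longrightarrow> R < 1 \<Longrightarrow> 0 < \<epsilon> \<Longrightarrow>
      \<exists>r<1. \<forall>a b. cmod a \<le> R \<and> r < cmod b \<and> cmod b < 1 \<longrightarrow> energy (f b) a \<le> ennreal \<epsilon>"
  obtains b where "\<And>n. b n \<in> Z" "\<And>n. cmod (b n) < 1" "\<And>n. 1 - (1 / 2) ^ Suc n < cmod (b n)"
    "\<And>j k. j \<noteq> k \<Longrightarrow> energy (f (b j)) (b k) \<le> ennreal (e j)"
    "\<And>a. cmod a < 1 \<Longrightarrow> \<exists>k. \<forall>j. j \<noteq> k \<longrightarrow> energy (f (b j)) a \<le> ennreal (e j)"
proof -
  \<comment> \<open>R and R' are the radii of the n-th annulus; the function belonging to b is at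
    most e n in energy on both sides of it.\<close>
  define S where "S = (\<lambda>n R R' b. b \<in> Z \<and> R < cmod b \<and> cmod b < R' \<and>
    (\<forall>a. cmod a \<le> R \<longrightarrow> energy (f b) a \<le> ennreal (e n)) \<and> (\<forall>a. R' \<le> cmod a \<and> cmod a < 1 \<longrightarrow> energy (f b) a \<le> ennreal (e n)))"
  have "\<exists>R. \<forall>n. (0 \<le> R n \<and> R n < 1 \<and> 1 - (1 / 2) ^ Suc n \<le> R n) \<and> (\<exists>b. S n (R n) (R (Suc n)) b)"
  proof (rule dependent_nat_choice)
    show "\<exists>R. 0 \<le> R \<and> R < 1 \<and> 1 - (1 / 2) ^ Suc 0 \<le> (R :: real)" by (rule exI[of _ "1 / 2"]) simp
    fix R :: real and n assume R: "0 \<le> R \<and> R < 1 \<and> 1 - (1 / 2) ^ Suc n \<le> R"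
    obtain r where r: "r < 1" "\<And>a b. cmod a \<le> R \<Longrightarrow> r < cmod b \<Longrightarrow> cmod b < 1 \<Longrightarrow> energy (f b) a \<le> ennreal (e n)"
      using compact[of R "e n"] R e by blast
    obtain b where b: "b \<in> Z" "max r R < cmod b" "cmod b < 1" using Z[of "max r R"] r R by auto
    obtain r' where r': "r' < 1" "\<And>a. r' < cmod a \<Longrightarrow> cmod a < 1 \<Longrightarrow> energy (f b) a \<le> ennreal (e n)"
      using circle[OF b(3) e] by blast
    \<comment> \<open>The midpoints put R' strictly beyond |b| and r'. The last entry forces the
      radii to 1 and yields the lower bound for |b n|.\<close>
    define R' where "R' = max ((1 + cmod b) / 2) (max ((1 + r') / 2) (1 - (1 / 2) ^ Suc (Suc n)))"
    have "r' < (1 + r') / 2" "cmod b < (1 + cmod b) / 2" using r' b by auto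
    then have gt: "r' < R'" "cmod b < R'" by (simp_all only: R'_def less_max_iff_disj simp_thms)
    have R'1: "R' < 1" using r' b by (simp add: R'_def)
    have "S n R R' b" unfolding S_def using b r r'(2) gt by auto
    moreover have "0 \<le> R'" using gt(2) norm_ge_zero[of b] by linarith
    moreover have "1 - (1 / 2) ^ Suc (Suc n) \<le> R'" by (simp add: R'_def)
    ultimately show "\<exists>R'. (0 \<le> R' \<and> R' < 1 \<and> 1 - (1 / 2) ^ Suc (Suc n) \<le> R') \<and> (\<exists>b. S n R R' b)" using R'1 by blast
  qed
  then obtain R where R: "\<And>n. 0 \<le> R n" "\<And>n. R n < 1" "\<And>n. 1 - (1 / 2) ^ Suc n \<le> R n" "\<And>n. \<exists>b. S n (R n) (R (Suc n)) b"
    by blast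
  then obtain b where b: "\<And>n. S n (R n) (R (Suc n)) (b n)" by metis
  have "R n \<le> R (Suc n)" for n using b[of n] unfolding S_def by linarith
  then have mono: "R i \<le> R j" if "i \<le> j" for i j using that by (rule lift_Suc_mono_le)
  show ?thesis
  proof (rule that[of b])
    show "b n \<in> Z" for n using b[of n] by (simp add: S_def)
    show b1: "cmod (b n) < 1" for n using b[of n] R(2)[of "Suc n"] unfolding S_def by linarith
    show "1 - (1 / 2) ^ Suc n < cmod (b n)" for n using b[of n] R(3)[of n] unfolding S_def by linarith
    have small: "energy (f (b j)) a \<le> ennreal (e j)" if "cmod a \<le> R j \<or> R (Suc j) \<le> cmod a" "cmod a < 1" for a j
      using b[of j] that unfolding S_def by blast
    show "energy (f (b j)) (b k) \<le> ennreal (e j)" if "j \<noteq> k" for j k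
    proof (rule small)
      show "cmod (b k) < 1" by (rule b1)
      have "R k < cmod (b k)" "cmod (b k) < R (Suc k)" using b[of k] unfolding S_def by blast+
      moreover have "Suc k \<le> j \<or> Suc j \<le> k" using that by auto
      ultimately show "cmod (b k) \<le> R j \<or> R (Suc j) \<le> cmod (b k)" using mono[of "Suc k" j] mono[of "Suc j" k] by force
    qed
    show "\<exists>k. \<forall>j. j \<noteq> k \<longrightarrow> energy (f (b j)) a \<le> ennreal (e j)" if a: "cmod a < 1" for a
    proof -
      obtain N where "(1 / 2 :: real) ^ N < 1 - cmod a" using real_arch_pow_inv[of "1 - cmod a" "1 / 2"] a by auto
      moreover have "(1 / 2 :: real) ^ Suc N \<le> (1 / 2) ^ N" by simp
      ultimately have ex: "cmod a \<le> R N" using R(3)[of N] by linarith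
      define n where "n = (LEAST n. cmod a \<le> R n)"
      have n: "cmod a \<le> R n" unfolding n_def using ex by (rule LeastI)
      \<comment> \<open>Truncated subtraction is safe: for n = 0 every j satisfies n \<le> j, so the
        first case below always applies.\<close>
      have "energy (f (b j)) a \<le> ennreal (e j)" if "j \<noteq> n - 1" for j
      proof (rule small[OF _ a])
        show "cmod a \<le> R j \<or> R (Suc j) \<le> cmod a"
        proof (cases "n \<le> j")
          case True
          then show ?thesis using n mono[of n j] by linarith
        next
          case False
          then have j: "Suc j \<le> n - 1" "n - 1 < n" using that by auto
          then have "R (n - 1) < cmod a" using not_less_Least[of "n - 1" "\<lambda>n. cmod a \<le> R n"] by (simp add: n_def)
          then show ?thesis using mono[OF j(1)] by linarith
        qed
      qed
      then show ?thesis by blast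
    qed
  qed
qed

text \<open>The function is a sum of peaks at points of \<open>Z\<close>. At any given a at most one
  peak has energy not small, and it is bounded by a constant; the others form a convergent series.
  At b k the k-th peak dominates the derivative.\<close>

lemma exists_M_space_peaking:
  assumes Z: "\<And>r. r < 1 \<Longrightarrow> \<exists>b\<in>Z. r < cmod b \<and> cmod b < 1"
  obtains f b where "f \<in> M_space \<alpha> p s" "\<And>k. b k \<in> Z" "\<And>k. cmod (b k) < 1" "\<And>k. 1 - (1 / 2) ^ Suc k < cmod (b k)"
    "\<And>k. 1 / 2 \<le> cmod (deriv f (b k)) * (1 - (cmod (b k))\<^sup>2) powr (1 + \<alpha>)"
proof -
  define m where "m = nat \<lceil>3 + 2 * \<alpha>\<rceil>"
  have m: "3 + 2 * \<alpha> \<le> real m" unfolding m_def by (rule real_nat_ceiling_ge)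
  define pk where "pk = peak (real m - \<alpha>) m"
  have hol_pk: "pk b holomorphic_on unit_disk" if "cmod b < 1" for b
    unfolding pk_def using that by (intro holomorphic_peak) simp
  have "1 + 2 * \<alpha> \<le> real m" using m by simp
  from energy_peak_le[OF this] obtain C
    where C: "0 \<le> C" "\<And>a b. cmod a < 1 \<Longrightarrow> cmod b < 1 \<Longrightarrow> energy (pk b) a \<le> ennreal C"
    unfolding pk_def by blast
  obtain c where c: "0 < c" "\<And>f a. f holomorphic_on unit_disk \<Longrightarrow> cmod a < 1 \<Longrightarrow>
    ennreal (c * (cmod (deriv f a) * (1 - (cmod a)\<^sup>2) powr (1 + \<alpha>)) powr p) \<le> energy f a"
    using norm_deriv_le_energy by blast
  \<comment> \<open>The first entry makes the derivatives of all other peaks at b k add up to at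
    most 1/2, the sum of (1/2)^(j + 2). The second absorbs the constants of
    \<open>energy_sum_le\<close>.\<close>
  define e where "e = (\<lambda>j::nat. min (c * ((1 / 2) ^ (j + 2)) powr p) ((1 / 2) ^ Suc j / 2 powr (p * real (Suc j))))"
  have e: "0 < e n" for n using c(1) by (simp add: e_def)
  obtain b where b: "\<And>n. b n \<in> Z" "\<And>n. cmod (b n) < 1" "\<And>n. 1 - (1 / 2) ^ Suc n < cmod (b n)"
    "\<And>j k. j \<noteq> k \<Longrightarrow> energy (pk (b j)) (b k) \<le> ennreal (e j)"
    "\<And>a. cmod a < 1 \<Longrightarrow> \<exists>k. \<forall>j. j \<noteq> k \<longrightarrow> energy (pk (b j)) a \<le> ennreal (e j)"
  proof (rule gliding_hump_sequence[of Z e pk])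
    show "\<exists>r<1. \<forall>a. r < cmod a \<and> cmod a < 1 \<longrightarrow> energy (pk b) a \<le> ennreal \<epsilon>" if "cmod b < 1" "0 < \<epsilon>" for b \<epsilon>
      using energy_peak_vanishes_at_circle[OF that] unfolding pk_def by metis
    show "\<exists>r<1. \<forall>a b. cmod a \<le> R \<and> r < cmod b \<and> cmod b < 1 \<longrightarrow> energy (pk b) a \<le> ennreal \<epsilon>"
      if "0 \<le> R" "R < 1" "0 < \<epsilon>" for R \<epsilon>
      using energy_peak_vanishes_on_compact[OF m that] unfolding pk_def by metis
  qed (use Z e in blast)+
  have B: "0 < 1 - (cmod (b n))\<^sup>2" "1 - (cmod (b n))\<^sup>2 \<le> (1 / 2) ^ n" for n
  proof -
    show "0 < 1 - (cmod (b n))\<^sup>2" by (rule one_minus_norm_sq_pos[OF b(2)])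
    have "1 - (cmod (b n))\<^sup>2 = (1 - cmod (b n)) * (1 + cmod (b n))" by (simp add: power2_eq_square algebra_simps)
    also have "\<dots> \<le> (1 / 2) ^ Suc n * 2" using b(2)[of n] b(3)[of n] by (intro mult_mono) auto
    finally show "1 - (cmod (b n))\<^sup>2 \<le> (1 / 2) ^ n" by simp
  qed
  have dom: "cmod (pk (b j) z) \<le> (1 / 2) ^ j / (1 - cmod z) ^ m" if z: "cmod z < 1" for j z
  proof -
    have "(1 - (cmod (b j))\<^sup>2) powr (real m - \<alpha>) \<le> (1 - (cmod (b j))\<^sup>2) powr 1"
      using B[of j] m alpha_pos by (intro powr_mono') auto
    also have "\<dots> \<le> (1 / 2) ^ j" using B[of j] by simp
    finally show ?thesis
      using z unfolding pk_def by (intro order_trans[OF norm_peak_le[OF b(2) z]] divide_right_mono) auto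
  qed
  obtain F where F: "F holomorphic_on unit_disk" "\<And>z. cmod z < 1 \<Longrightarrow> (\<lambda>j. deriv (pk (b j)) z) sums deriv F z"
    by (rule locally_dominated_series_deriv_sums[OF hol_pk[OF b(2)] _ _ dom]) (auto intro!: summable_geometric)
  have "energy F a \<le> ennreal (2 powr p * (C + 1))" if a: "cmod a < 1" for a
  proof -
    obtain k where k: "\<And>j. j \<noteq> k \<Longrightarrow> energy (pk (b j)) a \<le> ennreal (e j)" using b(5)[OF a] by blast
    \<comment> \<open>With the exceptional peak removed and the sign reversed, a partial sum becomes
      pk (b k) minus the sum of h, the shape of \<open>morrey_energy_diff_le\<close>.\<close>
    define h where "h = (\<lambda>j z. if j = k then 0 else - 1 * pk (b j) z)"
    have hol_h: "h j holomorphic_on unit_disk" for j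
      unfolding h_def using hol_pk[OF b(2)] by (cases "j = k") (auto intro!: holomorphic_intros)
    have eh: "energy (h j) a \<le> ennreal (e j)" for j
    proof (cases "j = k")
      case True
      then show ?thesis using p_pos by (simp add: h_def morrey_energy_def dirichlet_energy_def)
    next
      case False
      then have "energy (h j) a = energy (\<lambda>z. - 1 * pk (b j) z) a" by (simp add: h_def)
      also have "\<dots> = energy (pk (b j)) a" by (subst morrey_energy_cmult[OF hol_pk[OF b(2)] p_pos a]) simp
      finally show ?thesis using k[OF False] by simp
    qed
    have sum_h: "energy (\<lambda>z. \<Sum>j<N. h j z) a \<le> ennreal 1" for N
    proof -
      have "energy (\<lambda>z. \<Sum>j<N. h j z) a \<le> (\<Sum>j<N. ennreal (2 powr (p * real (Suc j))) * energy (h j) a)"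
        by (rule energy_sum_le[OF hol_h a])
      also have "\<dots> \<le> (\<Sum>j<N. ennreal ((1 / 2) ^ Suc j))"
      proof (rule sum_mono)
        fix j
        have "ennreal (2 powr (p * real (Suc j))) * energy (h j) a \<le> ennreal (2 powr (p * real (Suc j))) * ennreal (e j)"
          by (rule mult_left_mono[OF eh zero_le])
        also have "\<dots> = ennreal (2 powr (p * real (Suc j)) * e j)" using e[of j] by (intro ennreal_mult[symmetric]) auto
        also have "2 powr (p * real (Suc j)) * e j \<le> 2 powr (p * real (Suc j)) * ((1 / 2) ^ Suc j / 2 powr (p * real (Suc j)))"
          by (rule mult_left_mono) (auto simp: e_def)
        also have "\<dots> = (1 / 2) ^ Suc j" by simp
        finally show "ennreal (2 powr (p * real (Suc j))) * energy (h j) a \<le> ennreal ((1 / 2) ^ Suc j)" by (simp add: ennreal_leI)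
      qed
      also have "\<dots> = ennreal (\<Sum>j<N. (1 / 2) ^ Suc j)" by (rule sum_ennreal) simp
      also have "(\<Sum>j<N. (1 / 2 :: real) ^ Suc j) \<le> 1"
      proof -
        have "(\<Sum>j<N. (1 / 2 :: real) ^ Suc j) = 1 - (1 / 2) ^ N" by (induction N) auto
        then show ?thesis by simp
      qed
      finally show ?thesis by (simp add: ennreal_leI)
    qed
    show ?thesis
    proof (rule energy_limit_le[of "\<lambda>N z. \<Sum>j<N. pk (b j) z"])
      show "(\<lambda>z. \<Sum>j<N. pk (b j) z) holomorphic_on unit_disk" for N
        by (intro holomorphic_intros hol_pk b(2))
      show "(\<lambda>N. deriv (\<lambda>z. \<Sum>j<N. pk (b j) z) z) \<longlonglongrightarrow> deriv F z" if z: "cmod z < 1" for z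
      proof -
        have "deriv (\<lambda>z. \<Sum>j<N. pk (b j) z) z = (\<Sum>j<N. deriv (pk (b j)) z)" for N
          using z by (intro DERIV_imp_deriv DERIV_sum holomorphic_derivI[OF hol_pk[OF b(2)]]) auto
        then show ?thesis using F(2)[OF z] by (simp add: sums_def)
      qed
      show "\<forall>\<^sub>F N in sequentially. energy (\<lambda>z. \<Sum>j<N. pk (b j) z) a \<le> ennreal (2 powr p * (C + 1))"
        using eventually_gt_at_top[of k]
      proof eventually_elim
        case (elim N)
        have "(\<Sum>j<N. pk (b j) z) = pk (b k) z - (\<Sum>j<N. h j z)" for z
        proof -
          have "(\<Sum>j<N. h j z) = (\<Sum>j<N. (if j = k then pk (b j) z else 0) - pk (b j) z)"
            by (rule sum.cong) (auto simp: h_def)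
          then show ?thesis using elim by (simp add: sum_subtractf)
        qed
        then have "energy (\<lambda>z. \<Sum>j<N. pk (b j) z) a = energy (\<lambda>z. pk (b k) z - (\<Sum>j<N. h j z)) a" by simp
        also have "\<dots> \<le> ennreal (2 powr p) * (energy (pk (b k)) a + energy (\<lambda>z. \<Sum>j<N. h j z) a)"
          by (rule morrey_energy_diff_le[OF hol_pk[OF b(2)] _ p_pos a]) (intro holomorphic_intros hol_h)
        also have "\<dots> \<le> ennreal (2 powr p) * (ennreal C + ennreal 1)"
          by (rule mult_left_mono[OF add_mono[OF C(2)[OF a b(2)] sum_h] zero_le])
        also have "\<dots> = ennreal (2 powr p * (C + 1))"
          using C(1) by (simp add: ennreal_mult ennreal_plus)
        finally show ?case .
      qed
    qed (use F a in auto)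
  qed
  then have "F \<in> M_space \<alpha> p s"
    unfolding mem_M_space_iff using F(1) C(1) by (intro conjI exI[of _ "2 powr p * (C + 1)"]) auto
  moreover have "1 / 2 \<le> cmod (deriv F (b k)) * (1 - (cmod (b k))\<^sup>2) powr (1 + \<alpha>)" for k
  proof -
    define w where "w = (1 - (cmod (b k))\<^sup>2) powr (1 + \<alpha>)"
    have w: "0 < w" using B[of k] by (simp add: w_def)
    have small: "cmod (deriv (pk (b j)) (b k)) * w \<le> (1 / 2) ^ (j + 2)" if "j \<noteq> k" for j
    proof -
      have "ennreal (c * (cmod (deriv (pk (b j)) (b k)) * w) powr p) \<le> ennreal (e j)"
        unfolding w_def using c(2)[OF hol_pk[OF b(2)] b(2)] b(4)[OF that] order_trans by blast
      then have "c * (cmod (deriv (pk (b j)) (b k)) * w) powr p \<le> e j" using e[of j] by (simp add: ennreal_le_iff)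
      also have "\<dots> \<le> c * ((1 / 2) ^ (j + 2)) powr p" by (simp add: e_def)
      finally have "(cmod (deriv (pk (b j)) (b k)) * w) powr p \<le> ((1 / 2) ^ (j + 2)) powr p" using c(1) by simp
      then show ?thesis using powr_less_mono2[OF p_pos, of "(1 / 2) ^ (j + 2)"] by (meson not_le zero_le_power zero_le_divide_1_iff zero_le_numeral)
    qed
    \<comment> \<open>At its own centre the weighted derivative of the peak equals m * |b k|, and m
      \<ge> 2 and |b k| \<ge> 1/2.\<close>
    have big: "1 \<le> cmod (deriv (pk (b k)) (b k)) * w"
    proof -
      define x where "x = 1 - (cmod (b k))\<^sup>2"
      have x: "0 < x" using B[of k] by (simp add: x_def)
      have "cnj (b k) * b k = of_real ((cmod (b k))\<^sup>2)" by (metis complex_norm_square mult.commute)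
      then have "1 - cnj (b k) * b k = of_real x" by (simp add: x_def)
      then have "cmod (deriv (pk (b k)) (b k)) = real m * cmod (b k) * x powr (real m - \<alpha>) / x ^ Suc m"
        using x by (simp add: pk_def norm_deriv_peak[OF b(2) b(2)] x_def[symmetric])
      also have "\<dots> = real m * cmod (b k) * x powr (- 1 - \<alpha>)"
      proof -
        have "x ^ Suc m = x powr (real m + 1)" using x by (simp add: powr_add powr_realpow)
        then have "x powr (real m - \<alpha>) / x ^ Suc m = x powr ((real m - \<alpha>) - (real m + 1))" by (simp only: powr_diff)
        also have "real m - \<alpha> - (real m + 1) = - 1 - \<alpha>" by simp
        finally show ?thesis by (simp only: times_divide_eq_right[symmetric])
      qed
      finally have "cmod (deriv (pk (b k)) (b k)) * w = real m * cmod (b k) * (x powr (- 1 - \<alpha>) * x powr (1 + \<alpha>))"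
        by (simp add: w_def x_def)
      also have "x powr (- 1 - \<alpha>) * x powr (1 + \<alpha>) = 1" using x by (simp add: powr_add[symmetric])
      finally have "cmod (deriv (pk (b k)) (b k)) * w = real m * cmod (b k)" by simp
      moreover have "(1 / 2 :: real) ^ Suc k \<le> 1 / 2" by (simp add: power_le_one)
      then have "1 / 2 \<le> cmod (b k)" using b(3)[of k] by linarith
      then have "2 * (1 / 2) \<le> real m * cmod (b k)" using m alpha_pos by (intro mult_mono) auto
      ultimately show ?thesis by simp
    qed
    define D where "D = (\<lambda>j. deriv (pk (b j)) (b k) * of_real w)"
    have D: "D sums (deriv F (b k) * of_real w)" unfolding D_def by (rule sums_mult2[OF F(2)[OF b(2)]])
    have "(\<lambda>j. D j - (if j = k then D j else 0)) sums (deriv F (b k) * of_real w - D k)"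
      by (rule sums_diff[OF D sums_single])
    moreover have half: "(\<lambda>j. (1 / 2 :: real) ^ (j + 2)) sums (1 / 2)"
      using sums_mult[OF geometric_sums[of "1 / 2 :: real"], of "1 / 4"] by (simp add: power_add mult.commute)
    moreover have "norm (D j - (if j = k then D j else 0)) \<le> (1 / 2) ^ (j + 2)" for j
      using small[of j] w by (auto simp: D_def norm_mult)
    ultimately have "cmod (deriv F (b k) * of_real w - D k) \<le> 1 / 2"
      using norm_suminf_le[of "\<lambda>j. D j - (if j = k then D j else 0)" "\<lambda>j. (1 / 2) ^ (j + 2)"] by (simp add: sums_iff)
    moreover have "cmod (D k) \<le> cmod (deriv F (b k) * of_real w) + cmod (deriv F (b k) * of_real w - D k)"
      by (metis norm_triangle_sub norm_minus_commute)
    ultimately show ?thesis using big w by (simp add: D_def norm_mult w_def[symmetric])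
  qed
  ultimately show ?thesis using that[of F b] b(1-3) by blast
qed

end

section \<open>Averages at points where the generator is small\<close>

context morrey_semigroup
begin

text \<open>A bound on G at a spreads by Harnack to the ball of radius (1 - |a|)/2. There
  \<open>displacement_le\<close> confines the orbits for short times, f changes little along them,
  and Cauchy's estimate on the ball returns to the derivative at a. The constant K depends on f and
  G but not on T, e or a.\<close>

lemma deriv_orbit_average_diff_le:
  assumes f: "f \<in> M_space \<alpha> p s"
  obtains K r where "0 \<le> K" "r < 1"
    "\<And>T e a. 0 < e \<Longrightarrow> 0 < T \<Longrightarrow> T \<le> e / 112 \<Longrightarrow> r < cmod a \<Longrightarrow> cmod a < 1 \<Longrightarrow> cmod (G a) \<le> (1 - (cmod a)\<^sup>2) / e \<Longrightarrow>
      cmod (deriv (\<lambda>z. of_real (1 / T) * orbit_integral f T z - f z) a) * (1 - (cmod a)\<^sup>2) powr (1 + \<alpha>) \<le> K * (T / e)"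
proof -
  have hol: "f holomorphic_on unit_disk" using f by (simp add: mem_M_space_iff)
  obtain C where C: "0 \<le> C" "\<And>a. cmod a < 1 \<Longrightarrow> cmod (deriv f a) \<le> C * (1 - (cmod a)\<^sup>2) powr (- 1 - \<alpha>)"
    using norm_deriv_M_space_le[OF f] by blast
  obtain b P where bP: "cmod b \<le> 1" "P holomorphic_on unit_disk" "\<And>z. cmod z < 1 \<Longrightarrow> 0 \<le> Re (P z)"
    "\<And>z. cmod z < 1 \<Longrightarrow> P z \<noteq> 0" "\<And>z. cmod z < 1 \<Longrightarrow> G z = (cnj b * z - 1) * (z - b) * P z"
    using Berkson_Porta by blast
  note factor = bP(5)
  \<comment> \<open>For b inside the disk this radius keeps a far enough from b that 1 - |a| \<le>
    |a - b|; for b on the circle that inequality is automatic.\<close>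
  define r where "r = (if cmod b < 1 then (1 + cmod b) / 2 else 0)"
  have r1: "r < 1" by (simp add: r_def)
  have far: "1 - cmod a \<le> cmod (a - b)" if "r < cmod a" for a
    using that bP(1) norm_triangle_ineq2[of a b] norm_triangle_ineq2[of b a] norm_minus_commute[of a b]
    by (auto simp: r_def split: if_splits)
  define K1 where "K1 = 28 * C * (1 / 4) powr (- 1 - \<alpha>)"
  have K1: "0 \<le> K1" using C by (simp add: K1_def)
  define K where "K = 2 * K1 * 2 powr (1 + \<alpha>)"
  show ?thesis
  proof (rule that[of K r])
    show "0 \<le> K" using K1 by (simp add: K_def)
    show "r < 1" by (rule r1)
    fix T e :: real and a :: complex
    assume e: "0 < e" and T: "0 < T" "T \<le> e / 112" and a: "r < cmod a" "cmod a < 1" and Ga: "cmod (G a) \<le> (1 - (cmod a)\<^sup>2) / e"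
    define x where "x = 1 - cmod a"
    have x: "0 < x" using a by (simp add: x_def)
    have x2: "1 - (cmod a)\<^sup>2 \<le> 2 * x"
    proof -
      have "1 - (cmod a)\<^sup>2 = x * (1 + cmod a)" by (simp add: x_def power2_eq_square algebra_simps)
      also have "\<dots> \<le> x * 2" using x a by (intro mult_left_mono) auto
      finally show ?thesis by simp
    qed
    have pos_a: "0 < 1 - (cmod a)\<^sup>2" by (rule one_minus_norm_sq_pos[OF a(2)])
    have ge: "1 - cmod w \<le> 1 - (cmod w)\<^sup>2" if "cmod w < 1" for w
      using that power_le_one[of "cmod w" 1] mult_left_le[of "cmod w" "cmod w"] by (simp add: power2_eq_square)
    have displ: "cmod (\<phi> u y - y) \<le> 28 * (u / e) * x" if y: "y \<in> cball a (x / 2)" and u: "0 \<le> u" "u \<le> T" for y u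
    proof -
      have ya: "cmod (y - a) \<le> x / 2" using y by (simp add: dist_norm norm_minus_commute)
      have ny: "cmod y \<le> cmod a + x / 2" using norm_triangle_sub[of y a] ya by linarith
      then have y1: "cmod y < 1" using x unfolding x_def by argo
      have 1: "cmod (cnj b * y - 1) \<le> 3 / 2 * cmod (cnj b * a - 1)"
      proof -
        have "cmod (cnj b * y - 1) \<le> cmod (cnj b * a - 1) + cmod (cnj b * (y - a))"
          using norm_triangle_ineq[of "cnj b * a - 1" "cnj b * (y - a)"] by (simp add: algebra_simps)
        also have "cmod (cnj b * (y - a)) \<le> 1 * (x / 2)"
          using bP(1) ya by (simp only: norm_mult complex_mod_cnj) (intro mult_mono, auto)
        also have "1 * (x / 2) \<le> cmod (cnj b * a - 1) / 2"
          using norm_one_minus_cnj_mult_ge[OF bP(1), of a] by (simp add: x_def norm_minus_commute)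
        finally show ?thesis by simp
      qed
      have 2: "cmod (y - b) \<le> 3 / 2 * cmod (a - b)"
        using norm_triangle_ineq[of "a - b" "y - a"] ya far[OF a(1)] unfolding x_def by simp
      have 3: "cmod (P y) \<le> 3 * cmod (P a)"
        by (rule norm_le_3_of_Re_nonneg[OF bP(2,3) a(2)]) (use ya in \<open>auto simp: x_def\<close>)
      \<comment> \<open>Passing from a to y enlarges the three Berkson--Porta factors by at most
        3/2, 3/2 and 3. Their product 27/4 is rounded up to 7.\<close>
      have "cmod (G y) = cmod (cnj b * y - 1) * cmod (y - b) * cmod (P y)" by (simp add: factor[OF y1] norm_mult)
      also have "\<dots> \<le> (3 / 2 * cmod (cnj b * a - 1)) * (3 / 2 * cmod (a - b)) * (3 * cmod (P a))"
        by (intro mult_mono 1 2 3) auto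
      also have "\<dots> = 27 / 4 * cmod (G a)" by (simp add: factor[OF a(2)] norm_mult)
      also have "\<dots> \<le> 7 * (2 * x / e)"
        using Ga divide_right_mono[OF x2, of e] e by (intro mult_mono) auto
      finally have Gy: "cmod (G y) \<le> 14 * x / e" by simp
      have "T * cmod (G y) \<le> (e / 112) * (14 * x / e)" using T Gy by (intro mult_mono) (use e in auto)
      also have "\<dots> = (x / 2) / 4" using e by simp
      also have "\<dots> \<le> (1 - (cmod y)\<^sup>2) / 4" using ge[OF y1] ny unfolding x_def by argo
      finally have "cmod (\<phi> u y - y) \<le> 2 * u * cmod (G y)" by (rule displacement_le[OF y1 _ u])
      also have "\<dots> \<le> 2 * u * (14 * x / e)" using u by (intro mult_left_mono Gy) auto
      finally show ?thesis by simp
    qed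
    have diff: "cmod (f (\<phi> u y) - f y) \<le> K1 * (T / e) * x powr (- \<alpha>)" if y: "y \<in> cball a (x / 2)" and u: "u \<in> {0..T}" for y u
    proof -
      \<comment> \<open>One reason for 112: 28/112 = 1/4, so orbits starting in the ball of radius
        x/2 stay in the one of radius 3/4 * x. The other was 14/112 = 1/8, the smallness that
        \<open>displacement_le\<close> asks for.\<close>
      have small: "28 * (T / e) * x \<le> x / 4" using T e x by (simp add: field_simps)
      have uT: "28 * (u / e) * x \<le> 28 * (T / e) * x" using u e x by (intro mult_right_mono mult_left_mono divide_right_mono) auto
      have d: "cmod (\<phi> u y - y) \<le> 28 * (T / e) * x" using displ[OF y, of u] u uT by auto
      have ya: "cmod (y - a) \<le> x / 2" using y by (simp add: dist_norm norm_minus_commute)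
      have S: "y \<in> cball a (3 / 4 * x)" "\<phi> u y \<in> cball a (3 / 4 * x)"
        using ya d small x norm_triangle_ineq[of "\<phi> u y - y" "y - a"] by (auto simp: dist_norm norm_minus_commute[of a])
      have bound: "cmod (deriv f w) \<le> C * (x / 4) powr (- 1 - \<alpha>)" and w1: "cmod w < 1" if w: "w \<in> cball a (3 / 4 * x)" for w
      proof -
        have "cmod w \<le> cmod a + 3 / 4 * x"
          using norm_triangle_sub[of w a] w by (simp add: dist_norm norm_minus_commute)
        then have w4: "x / 4 \<le> 1 - cmod w" unfolding x_def by argo
        then show "cmod w < 1" using x by linarith
        then have "x / 4 \<le> 1 - (cmod w)\<^sup>2" using ge[of w] w4 by linarith
        then have "(1 - (cmod w)\<^sup>2) powr (- 1 - \<alpha>) \<le> (x / 4) powr (- 1 - \<alpha>)"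
          using x alpha_pos by (intro powr_mono2') auto
        then show "cmod (deriv f w) \<le> C * (x / 4) powr (- 1 - \<alpha>)"
          using C(2)[OF \<open>cmod w < 1\<close>] C(1) by (meson mult_left_mono order_trans)
      qed
      have "cmod (f (\<phi> u y) - f y) \<le> C * (x / 4) powr (- 1 - \<alpha>) * cmod (\<phi> u y - y)"
      proof (rule field_differentiable_bound[OF convex_cball _ bound S(2,1)])
        fix w assume "w \<in> cball a (3 / 4 * x)"
        then have "w \<in> unit_disk" using w1 by simp
        then have "(f has_field_derivative deriv f w) (at w)" by (rule holomorphic_derivI[OF hol open_ball])
        then show "(f has_field_derivative deriv f w) (at w within cball a (3 / 4 * x))" by (rule has_field_derivative_at_within)
      qed
      also have "\<dots> \<le> C * (x / 4) powr (- 1 - \<alpha>) * (28 * (T / e) * x)" using C(1) by (intro mult_left_mono d) auto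
      also have "(x / 4) powr (- 1 - \<alpha>) = x powr (- 1 - \<alpha>) * (1 / 4) powr (- 1 - \<alpha>)"
        using powr_mult[of x "1 / 4" "- 1 - \<alpha>"] by simp
      also have "C * (x powr (- 1 - \<alpha>) * (1 / 4) powr (- 1 - \<alpha>)) * (28 * (T / e) * x) = K1 * (T / e) * (x powr (- 1 - \<alpha>) * x powr 1)"
        using x by (simp add: K1_def)
      also have "x powr (- 1 - \<alpha>) * x powr 1 = x powr (- \<alpha>)" by (simp only: powr_add[symmetric]) simp
      finally show ?thesis .
    qed
    define D where "D = (\<lambda>z. of_real (1 / T) * orbit_integral f T z - f z)"
    have "cmod (deriv D a) \<le> K1 * (T / e) * x powr (- \<alpha>) / (x / 2)"
    proof (rule norm_deriv_le_cball)
      show "D holomorphic_on unit_disk" unfolding D_def by (intro holomorphic_intros holomorphic_orbit_integral hol)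
      show sub: "cball a (x / 2) \<subseteq> unit_disk"
      proof
        fix y assume "y \<in> cball a (x / 2)"
        then have "cmod y \<le> cmod a + x / 2"
          using norm_triangle_sub[of y a] by (simp add: dist_norm norm_minus_commute)
        then have "cmod y < 1" using x unfolding x_def by argo
        then show "y \<in> unit_disk" by simp
      qed
      show "0 < x / 2" using x by simp
      fix y assume y: "y \<in> cball a (x / 2)"
      then have y1: "cmod y < 1" using sub by auto
      have "cmod (integral {0..T} (\<lambda>u. f (\<phi> u y) - f y)) \<le> K1 * (T / e) * x powr (- \<alpha>) * (T - 0)"
        using T diff[OF y] by (intro integral_bound continuous_intros continuous_on_orbit hol y1) auto
      then show "cmod (D y) \<le> K1 * (T / e) * x powr (- \<alpha>)"
        unfolding D_def orbit_average_diff[OF hol y1 T(1)] using T(1) by (simp add: norm_mult norm_divide field_simps)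
    qed
    then have "cmod (deriv D a) * (1 - (cmod a)\<^sup>2) powr (1 + \<alpha>) \<le> K1 * (T / e) * x powr (- \<alpha>) / (x / 2) * (2 * x) powr (1 + \<alpha>)"
      using x2 pos_a alpha_pos K1 T e x by (intro mult_mono powr_mono2) auto
    also have "(2 * x) powr (1 + \<alpha>) = 2 powr (1 + \<alpha>) * (x * x powr \<alpha>)" using x by (simp add: powr_mult powr_add)
    also have "K1 * (T / e) * x powr (- \<alpha>) / (x / 2) * (2 powr (1 + \<alpha>) * (x * x powr \<alpha>)) = K * (T / e) * (x powr (- \<alpha>) * x powr \<alpha>)"
      using x by (simp add: K_def)
    also have "x powr (- \<alpha>) * x powr \<alpha> = 1" using x by (simp add: powr_add[symmetric])
    finally show "cmod (deriv (\<lambda>z. of_real (1 / T) * orbit_integral f T z - f z) a) * (1 - (cmod a)\<^sup>2) powr (1 + \<alpha>) \<le> K * (T / e)"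
      by (simp add: D_def)
  qed
qed

lemma not_vanishing_Bloch_conditionE:
  assumes "\<not> vanishing_Bloch_condition G"
  obtains e where "0 < e" "\<And>r. r < 1 \<Longrightarrow> \<exists>z. r < cmod z \<and> cmod z < 1 \<and> cmod (G z) \<le> (1 - (cmod z)\<^sup>2) / e"
proof -
  obtain e where e: "0 < e" "\<And>r. r < 1 \<Longrightarrow> \<exists>z. r < cmod z \<and> cmod z < 1 \<and> \<not> ennreal (1 - (cmod z)\<^sup>2) / ennreal (cmod (G z)) \<le> ennreal e"
    using assms unfolding vanishing_Bloch_condition_def tendsto_ennreal_0_iff eventually_to_unit_circle by blast
  have "cmod (G z) \<le> (1 - (cmod z)\<^sup>2) / e"
    if z: "cmod z < 1" "\<not> ennreal (1 - (cmod z)\<^sup>2) / ennreal (cmod (G z)) \<le> ennreal e" for z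
  proof (cases "G z = 0")
    case False
    have pos: "0 < 1 - (cmod z)\<^sup>2" by (rule one_minus_norm_sq_pos[OF z(1)])
    then have "ennreal (1 - (cmod z)\<^sup>2) / ennreal (cmod (G z)) = ennreal ((1 - (cmod z)\<^sup>2) / cmod (G z))"
      using False by (intro divide_ennreal) auto
    then have "e < (1 - (cmod z)\<^sup>2) / cmod (G z)" using z(2) e(1) by (metis ennreal_leI not_le)
    then show ?thesis using False e(1) by (simp add: field_simps)
  qed (use one_minus_norm_sq_pos[OF z(1)] e(1) in simp)
  then show ?thesis using that[OF e(1)] e(2) by meson
qed

lemma vanishing_Bloch_condition_if_strong_cont_part_subset:
  assumes sub: "strong_cont_part \<phi> (M_space \<alpha> p s) (M_norm \<alpha> p s) \<subseteq> little_m_space \<alpha> p s"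
  shows "vanishing_Bloch_condition G"
proof (rule ccontr)
  assume "\<not> vanishing_Bloch_condition G"
  then obtain e where e: "0 < e" "\<And>r. r < 1 \<Longrightarrow> \<exists>z. r < cmod z \<and> cmod z < 1 \<and> cmod (G z) \<le> (1 - (cmod z)\<^sup>2) / e"
    by (rule not_vanishing_Bloch_conditionE) blast
  define Z where "Z = {z. cmod (G z) \<le> (1 - (cmod z)\<^sup>2) / e}"
  have "\<exists>b\<in>Z. r < cmod b \<and> cmod b < 1" if "r < 1" for r using e(2)[OF that] by (auto simp: Z_def)
  then obtain f b where f: "f \<in> M_space \<alpha> p s" and b: "\<And>k. b k \<in> Z" "\<And>k. cmod (b k) < 1" "\<And>k. 1 - (1 / 2) ^ Suc k < cmod (b k)"
    and big: "\<And>k. 1 / 2 \<le> cmod (deriv f (b k)) * (1 - (cmod (b k))\<^sup>2) powr (1 + \<alpha>)"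
    by (rule exists_M_space_peaking) blast+
  have hol: "f holomorphic_on unit_disk" using f by (simp add: mem_M_space_iff)
  obtain K r where K: "0 \<le> K" "r < 1"
    "\<And>T e a. 0 < e \<Longrightarrow> 0 < T \<Longrightarrow> T \<le> e / 112 \<Longrightarrow> r < cmod a \<Longrightarrow> cmod a < 1 \<Longrightarrow> cmod (G a) \<le> (1 - (cmod a)\<^sup>2) / e \<Longrightarrow>
      cmod (deriv (\<lambda>z. of_real (1 / T) * orbit_integral f T z - f z) a) * (1 - (cmod a)\<^sup>2) powr (1 + \<alpha>) \<le> K * (T / e)"
    using deriv_orbit_average_diff_le[OF f] by blast
  \<comment> \<open>The second entry makes K * (T/e) at most 1/8; the summand 1 covers K =
    0.\<close>
  define T where "T = min (e / 112) (e / (8 * (K + 1)))"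
  have T: "0 < T" using e(1) K(1) by (simp add: T_def)
  have T2: "T \<le> e / 112" unfolding T_def by (rule min.cobounded1)
  have "K * (T / e) \<le> K * (1 / (8 * (K + 1)))"
  proof (rule mult_left_mono[OF _ K(1)])
    have "T / e \<le> e / (8 * (K + 1)) / e" using e(1) by (intro divide_right_mono) (auto simp: T_def)
    then show "T / e \<le> 1 / (8 * (K + 1))" using e(1) by simp
  qed
  also have "\<dots> \<le> 1 / 8" using K(1) by (simp add: field_simps)
  finally have KT: "K * (T / e) \<le> 1 / 8" .
  define g where "g = (\<lambda>z. of_real (1 / T) * orbit_integral f T z)"
  have holg: "g holomorphic_on unit_disk" unfolding g_def by (intro holomorphic_intros holomorphic_orbit_integral hol)
  have "g \<in> little_m_space \<alpha> p s"
    using orbit_average_in_strong_cont_part[OF f T] sub unfolding g_def by blast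
  moreover obtain c where c: "0 < c" "\<And>f a. f holomorphic_on unit_disk \<Longrightarrow> cmod a < 1 \<Longrightarrow>
    ennreal (c * (cmod (deriv f a) * (1 - (cmod a)\<^sup>2) powr (1 + \<alpha>)) powr p) \<le> energy f a"
    using norm_deriv_le_energy by blast
  \<comment> \<open>Energies below this threshold force the weighted derivative of g below 1/8. With
    1/8 for the difference to f, this contradicts the lower bound 1/2.\<close>
  then have "0 < c * (1 / 8) powr p" by simp
  ultimately obtain r' where r': "r' < 1" "\<And>a. r' < cmod a \<Longrightarrow> cmod a < 1 \<Longrightarrow> energy g a \<le> ennreal (c * (1 / 8) powr p)"
    unfolding mem_little_m_space_iff by meson
  obtain k where k: "(1 / 2 :: real) ^ k < 1 - max r r'"
    using real_arch_pow_inv[of "1 - max r r'" "1 / 2"] K(2) r'(1) by auto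
  have "(1 / 2 :: real) ^ Suc k \<le> (1 / 2) ^ k" by simp
  then have bk: "r < cmod (b k)" "r' < cmod (b k)" using b(3)[of k] k by linarith+
  define w where "w = (1 - (cmod (b k))\<^sup>2) powr (1 + \<alpha>)"
  have w: "0 \<le> w" by (simp add: w_def)
  have "cmod (deriv (\<lambda>z. g z - f z) (b k)) * w \<le> 1 / 8"
    using order_trans[OF K(3)[OF e(1) T T2 bk(1) b(2)] KT] b(1)[of k] unfolding Z_def g_def w_def by blast
  moreover have "deriv (\<lambda>z. g z - f z) (b k) = deriv g (b k) - deriv f (b k)"
    using b(2)[of k] by (intro deriv_diff holomorphic_on_imp_differentiable_at[OF holg] holomorphic_on_imp_differentiable_at[OF hol]) auto
  ultimately have "cmod (deriv f (b k) - deriv g (b k)) * w \<le> 1 / 8" by (simp add: norm_minus_commute)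
  moreover have "cmod (deriv g (b k)) * w \<le> 1 / 8"
  proof -
    have "ennreal (c * (cmod (deriv g (b k)) * w) powr p) \<le> ennreal (c * (1 / 8) powr p)"
      unfolding w_def by (rule order_trans[OF c(2)[OF holg b(2)] r'(2)[OF bk(2) b(2)]])
    then have "(cmod (deriv g (b k)) * w) powr p \<le> (1 / 8) powr p" using c(1) by (simp add: ennreal_le_iff)
    then show ?thesis using powr_less_mono2[OF p_pos, of "1 / 8" "cmod (deriv g (b k)) * w"] by force
  qed
  moreover have "cmod (deriv f (b k)) * w \<le> (cmod (deriv g (b k)) + cmod (deriv f (b k) - deriv g (b k))) * w"
    using w by (intro mult_right_mono norm_triangle_sub)
  ultimately show False using big[of k] unfolding w_def[symmetric] by (simp add: distrib_right)
qed

end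

theorem theorem1p4:
  fixes p s \<alpha> :: real
    and \<phi> :: "real \<Rightarrow> complex \<Rightarrow> complex"
    and G :: "complex \<Rightarrow> complex"
  assumes "admissible p s \<alpha>" and "\<alpha> > 0"
    and "holo_semigroup \<phi>" and "nontrivial_semigroup \<phi>"
    and "is_generator \<phi> G"
  shows "strong_cont_part \<phi> (M_space \<alpha> p s) (M_norm \<alpha> p s) = little_m_space \<alpha> p s
    \<longleftrightarrow> vanishing_Bloch_condition G"
proof -
  interpret morrey_semigroup p s \<alpha> \<phi> G by unfold_locales (use assms in auto)
  show ?thesis
    using little_m_space_subset strong_cont_part_subset_little_m_space
      vanishing_Bloch_condition_if_strong_cont_part_subset by blast
qed

end
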